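(* Let $K\subset\mathbb{R}^n$ be a convex body with non-empty interior whose centroid is at the origin. Then its cone-volume measure $V_K$ satisfies the subspace concentration condition.
   Context: A convex body is a compact convex set. The centroid of a convex body $K\subset\mathbb{R}^n$ with non-empty interior is $c(K)=\mathcal{H}_n(K)^{-1}\int_K x\,d\mathcal{H}_n(x)$, where $\mathcal{H}_k$ denotes $k$-dimensional Hausdorff measure. $S^{n-1}$ is the Euclidean unit sphere. $\partial_*K$ is the set of boundary points of $K$ having a unique outer unit normal, and $\nu_K(x)$ denotes that normal at $x\in\partial_*K$. For a convex body $K$ with the origin in its interior, the cone-volume measure $V_K$ is the Borel measure on $S^{n-1}$ given by $V_K(\omega)=\int_{\nu_K^{-1}(\omega)}\frac{\langle x,\nu_K(x)\rangle}{n}\,d\mathcal{H}_{n-1}(x)$ for Borel $\omega\subset S^{n-1}$; its total mass is the volume of $K$. A Borel measure $\mu$ on $S^{n-1}$ satisfies the subspace concentration condition if for every linear subspace $L\subset\mathbb{R}^n$ one has $\mu(L\cap S^{n-1})\le\frac{\dim L}{n}\mu(S^{n-1})$, and equality for some $L$ implies the existence of a linear subspace $\widetilde L$ complementary to $L$ with $\mu(\widetilde L\cap S^{n-1})=\frac{\dim\widetilde L}{n}\mu(S^{n-1})$ (and hence $\operatorname{supp}\mu\subset L\cup\widetilde L$). *)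

theory Defs
  imports "HOL-Analysis.Analysis"
begin

section \<open>Hausdorff measure\<close>

text \<open>The set function \<open>\<alpha>(k) (diam C / 2)^k\<close>, with the usual normalisation in which \<open>\<alpha>(k)\<close> is the
  volume of the \<open>k\<close>-dimensional Euclidean unit ball. The empty set must be treated separately
  because \<open>0 ^ 0 = 1\<close>.\<close>

definition hausdorff_gauge :: "nat \<Rightarrow> 'a::metric_space set \<Rightarrow> ennreal" where
  "hausdorff_gauge k C =
     (if C = {} then 0 else ennreal (unit_ball_vol (real k) * (diameter C / 2) ^ k))"

text \<open>Boundedness is required explicitly since \<open>diameter\<close> is meaningless on unbounded sets.\<close>

definition hausdorff_covers :: "real \<Rightarrow> 'a::metric_space set \<Rightarrow> (nat \<Rightarrow> 'a set) set" where
  "hausdorff_covers \<delta> A =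
     {C. A \<subseteq> (\<Union>i. C i) \<and> (\<forall>i. bounded (C i) \<and> diameter (C i) \<le> \<delta>)}"

definition hausdorff_pre :: "nat \<Rightarrow> real \<Rightarrow> 'a::metric_space set \<Rightarrow> ennreal" where
  "hausdorff_pre k \<delta> A = (INF C \<in> hausdorff_covers \<delta> A. \<Sum>i. hausdorff_gauge k (C i))"

definition hausdorff_outer :: "nat \<Rightarrow> 'a::metric_space set \<Rightarrow> ennreal" where
  "hausdorff_outer k A = (SUP \<delta>\<in>{0<..}. hausdorff_pre k \<delta> A)"

definition hausdorff_measure :: "nat \<Rightarrow> 'a::metric_space measure" where
  "hausdorff_measure k = measure_of UNIV (sets borel) (hausdorff_outer k)"


section \<open>Cone-volume measure\<close>

definition centroid :: "(real^'n) set \<Rightarrow> real^'n" where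
  "centroid K = inverse (measure (hausdorff_measure CARD('n)) K) *\<^sub>R
     (LINT x:K|hausdorff_measure CARD('n). x)"

definition outer_unit_normal :: "'a::euclidean_space set \<Rightarrow> 'a \<Rightarrow> 'a \<Rightarrow> bool" where
  "outer_unit_normal K x u \<longleftrightarrow> norm u = 1 \<and> (\<forall>y\<in>K. (y - x) \<bullet> u \<le> 0)"

definition regular_boundary :: "'a::euclidean_space set \<Rightarrow> 'a set" where
  "regular_boundary K = {x \<in> frontier K. \<exists>!u. outer_unit_normal K x u}"

definition normal_at :: "'a::euclidean_space set \<Rightarrow> 'a \<Rightarrow> 'a" where
  "normal_at K x = (THE u. outer_unit_normal K x u)"

text \<open>When the origin lies in \<open>K\<close>, the integrand is nonnegative, so that \<open>ennreal\<close> does not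
  truncate anything.\<close>

definition cone_volume :: "(real^'n) set \<Rightarrow> (real^'n) set \<Rightarrow> ennreal" where
  "cone_volume K \<omega> =
     (\<integral>\<^sup>+x\<in>{x \<in> regular_boundary K. normal_at K x \<in> \<omega>}.
        ennreal (x \<bullet> normal_at K x / real CARD('n)) \<partial>hausdorff_measure (CARD('n) - 1))"

definition cone_volume_measure :: "(real^'n) set \<Rightarrow> (real^'n) measure" where
  "cone_volume_measure K =
     measure_of (sphere 0 1) (sets (restrict_space borel (sphere 0 1))) (cone_volume K)"


section \<open>Subspace concentration condition\<close>

text \<open>The argument is meant to be a Borel measure on the unit sphere.\<close>

definition subspace_concentration_condition :: "(real^'n) measure \<Rightarrow> bool" where
  "subspace_concentration_condition \<mu> \<longleftrightarrow>
     (\<forall>L. subspace L \<longrightarrow>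
        emeasure \<mu> (L \<inter> sphere 0 1)
          \<le> ennreal (real (dim L) / real CARD('n)) * emeasure \<mu> (sphere 0 1) \<and>
        (emeasure \<mu> (L \<inter> sphere 0 1)
          = ennreal (real (dim L) / real CARD('n)) * emeasure \<mu> (sphere 0 1) \<longrightarrow>
         (\<exists>L'. subspace L' \<and> L \<inter> L' = {0} \<and> L + L' = UNIV \<and>
            emeasure \<mu> (L' \<inter> sphere 0 1)
              = ennreal (real (dim L') / real CARD('n)) * emeasure \<mu> (sphere 0 1))))"


text \<open>For a finite measure, equality for complementary subspaces forces the measure to be
  concentrated on their union; this need not be part of the definition.\<close>

lemma concentrated_on_complementary_subspaces:
  fixes \<mu> :: "(real^'n) measure"
  assumes sets: "sets \<mu> = sets (restrict_space borel (sphere 0 1))"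
    and fin: "emeasure \<mu> (sphere 0 1) \<noteq> \<infinity>"
    and sub: "subspace L" "subspace L'" and compl: "L \<inter> L' = {0}" "L + L' = UNIV"
    and eq: "emeasure \<mu> (L \<inter> sphere 0 1)
        = ennreal (real (dim L) / real CARD('n)) * emeasure \<mu> (sphere 0 1)"
      "emeasure \<mu> (L' \<inter> sphere 0 1)
        = ennreal (real (dim L') / real CARD('n)) * emeasure \<mu> (sphere 0 1)"
  shows "emeasure \<mu> (sphere 0 1 - (L \<union> L')) = 0"
proof -
  let ?S = "sphere 0 1 :: (real^'n) set"
  have meas: "A \<inter> ?S \<in> sets \<mu>" if "closed A" for A
    using borel_closed[OF that] by (auto simp: sets sets_restrict_space_iff)
  have L: "L \<inter> ?S \<in> sets \<mu>" and L': "L' \<inter> ?S \<in> sets \<mu>"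
    using sub by (auto intro: meas closed_subspace)
  have S: "?S \<in> sets \<mu>" using meas[of UNIV] by simp
  have "{x + y |x y. x \<in> L \<and> y \<in> L'} = UNIV"
    unfolding compl(2)[symmetric] set_plus_def by blast
  then have "dim L + dim L' = CARD('n)"
    using dim_sums_Int[OF sub] compl(1) by simp
  then have one: "real (dim L) / real CARD('n) + real (dim L') / real CARD('n) = 1"
    by (simp add: field_simps flip: of_nat_add)
  have "(L \<inter> ?S) \<inter> (L' \<inter> ?S) = (L \<inter> L') \<inter> ?S" by blast
  also have "\<dots> = {}" by (simp add: compl)
  finally have disj: "(L \<inter> ?S) \<inter> (L' \<inter> ?S) = {}" .
  have "emeasure \<mu> ((L \<inter> ?S) \<union> (L' \<inter> ?S)) = emeasure \<mu> (L \<inter> ?S) + emeasure \<mu> (L' \<inter> ?S)"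
    by (rule plus_emeasure[OF L L' disj, symmetric])
  also have "\<dots> = ennreal (real (dim L) / real CARD('n) + real (dim L') / real CARD('n))
      * emeasure \<mu> ?S"
    unfolding eq by (simp only: ennreal_plus divide_nonneg_nonneg of_nat_0_le_iff distrib_right)
  finally have full: "emeasure \<mu> ((L \<inter> ?S) \<union> (L' \<inter> ?S)) = emeasure \<mu> ?S"
    by (simp only: one ennreal_1 mult_1)
  have "?S - (L \<union> L') = ?S - ((L \<inter> ?S) \<union> (L' \<inter> ?S))" by blast
  also have "emeasure \<mu> \<dots> = emeasure \<mu> ?S - emeasure \<mu> ((L \<inter> ?S) \<union> (L' \<inter> ?S))"
    using L L' S fin by (intro emeasure_Diff) (auto simp: full)
  also have "\<dots> = 0" using fin by (simp add: full)
  finally show ?thesis .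
qed


section \<open>The set functions above are measures\<close>

text \<open>\<open>measure_of\<close> yields the zero measure when its set function is not countably additive; the
  following shows that this does not happen here.\<close>

lemma hausdorff_gauge_empty [simp]: "hausdorff_gauge k {} = 0"
  by (simp add: hausdorff_gauge_def)

lemma hausdorff_pre_mono: "A \<subseteq> B \<Longrightarrow> hausdorff_pre k \<delta> A \<le> hausdorff_pre k \<delta> B"
  unfolding hausdorff_pre_def by (rule INF_superset_mono) (auto simp: hausdorff_covers_def)

lemma hausdorff_pre_antimono: "\<delta> \<le> \<epsilon> \<Longrightarrow> hausdorff_pre k \<epsilon> A \<le> hausdorff_pre k \<delta> A"
  unfolding hausdorff_pre_def by (rule INF_superset_mono) (auto simp: hausdorff_covers_def intro: order_trans)

lemma hausdorff_pre_le_outer: "\<delta> > 0 \<Longrightarrow> hausdorff_pre k \<delta> A \<le> hausdorff_outer k A"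
  unfolding hausdorff_outer_def by (rule SUP_upper) simp

lemma hausdorff_outer_mono: "A \<subseteq> B \<Longrightarrow> hausdorff_outer k A \<le> hausdorff_outer k B"
  unfolding hausdorff_outer_def by (rule SUP_mono) (auto intro: hausdorff_pre_mono)

lemma hausdorff_outer_empty [simp]: "hausdorff_outer k {} = 0"
proof -
  have "hausdorff_pre k \<delta> {} = 0" if "\<delta> > 0" for \<delta>
  proof -
    have "hausdorff_pre k \<delta> {} \<le> (\<Sum>i::nat. hausdorff_gauge k ({} :: 'a set))"
      unfolding hausdorff_pre_def
      by (rule INF_lower2[of "\<lambda>_. {}"]) (use that in \<open>auto simp: hausdorff_covers_def\<close>)
    then show ?thesis by simp
  qed
  then show ?thesis
    unfolding hausdorff_outer_def by (intro antisym SUP_least) auto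
qed

lemma hausdorff_pre_UN:
  "hausdorff_pre k \<delta> (\<Union>i. A i) \<le> (\<Sum>n::nat. hausdorff_pre k \<delta> (A n))"
proof (rule ennreal_le_epsilon)
  fix e :: real assume e: "0 < e" and fin: "(\<Sum>n. hausdorff_pre k \<delta> (A n)) < top"
  have "\<exists>C\<in>hausdorff_covers \<delta> (A n). (\<Sum>i. hausdorff_gauge k (C i))
          < hausdorff_pre k \<delta> (A n) + ennreal (e * (1/2)^Suc n)" for n
  proof -
    have "hausdorff_pre k \<delta> (A n) < top"
      using fin by (auto simp: less_top dest!: ennreal_suminf_lessD)
    then have "hausdorff_pre k \<delta> (A n) < hausdorff_pre k \<delta> (A n) + ennreal (e * (1/2)^Suc n)"
      using e by auto
    then show ?thesis
      unfolding hausdorff_pre_def[of k \<delta> "A n"] INF_less_iff by simp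
  qed
  then obtain B where B: "\<And>n. B n \<in> hausdorff_covers \<delta> (A n)"
      and less: "\<And>n. (\<Sum>i. hausdorff_gauge k (B n i))
          < hausdorff_pre k \<delta> (A n) + ennreal (e * (1/2)^Suc n)"
    by metis
  define C where "C = case_prod B \<circ> prod_decode"
  have "(\<Union>n. A n) \<subseteq> (\<Union>i. C i)"
  proof safe
    fix x n assume "x \<in> A n"
    then obtain i where "x \<in> B n i"
      using B[of n] by (auto simp: hausdorff_covers_def)
    then have "x \<in> C (prod_encode (n, i))" by (simp add: C_def)
    then show "x \<in> (\<Union>i. C i)" by blast
  qed
  then have "C \<in> hausdorff_covers \<delta> (\<Union>n. A n)"
    using B by (auto simp: hausdorff_covers_def C_def split_beta)
  then have "hausdorff_pre k \<delta> (\<Union>n. A n) \<le> (\<Sum>i. hausdorff_gauge k (C i))"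
    unfolding hausdorff_pre_def by (rule INF_lower)
  also have "\<dots> = (\<Sum>n. \<Sum>i. hausdorff_gauge k (B n i))"
    unfolding C_def
    using suminf_ennreal_2dimen[of "\<lambda>n. \<Sum>i. hausdorff_gauge k (B n i)"
        "\<lambda>(n, i). hausdorff_gauge k (B n i)"]
    by (simp add: comp_def split_beta)
  also have "\<dots> \<le> (\<Sum>n. hausdorff_pre k \<delta> (A n) + ennreal (e * (1/2)^Suc n))"
    using less by (intro suminf_le) (auto intro: less_imp_le)
  also have "\<dots> = (\<Sum>n. hausdorff_pre k \<delta> (A n)) + (\<Sum>n. ennreal (e * (1/2)^Suc n))"
    by (subst suminf_add[symmetric]) auto
  also have "(\<Sum>n. ennreal (e * (1/2)^Suc n)) = ennreal e"
    using e sums_mult[OF power_half_series, of e]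
    by (intro suminf_ennreal_eq) auto
  finally show "hausdorff_pre k \<delta> (\<Union>i. A i) \<le> (\<Sum>n. hausdorff_pre k \<delta> (A n)) + ennreal e" .
qed

lemma hausdorff_outer_UN:
  "hausdorff_outer k (\<Union>i. A i) \<le> (\<Sum>n::nat. hausdorff_outer k (A n))"
  unfolding hausdorff_outer_def[of k "\<Union>i. A i"]
proof (rule SUP_least)
  fix \<delta> :: real assume "\<delta> \<in> {0<..}"
  then have "(\<Sum>n. hausdorff_pre k \<delta> (A n)) \<le> (\<Sum>n. hausdorff_outer k (A n))"
    by (intro suminf_le) (auto intro: hausdorff_pre_le_outer)
  with hausdorff_pre_UN show "hausdorff_pre k \<delta> (\<Union>i. A i) \<le> (\<Sum>n. hausdorff_outer k (A n))"
    by (rule order_trans)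
qed

lemma hausdorff_outer_Un: "hausdorff_outer k (A \<union> B) \<le> hausdorff_outer k A + hausdorff_outer k B"
proof -
  let ?C = "\<lambda>i::nat. if i = 0 then A else if i = 1 then B else {}"
  have "A \<union> B = ?C 0 \<union> ?C 1" by simp
  also have "\<dots> \<subseteq> (\<Union>i. ?C i)" by (intro Un_least UN_upper UNIV_I)
  finally have "hausdorff_outer k (A \<union> B) \<le> (\<Sum>i. hausdorff_outer k (?C i))"
    by (rule order_trans[OF hausdorff_outer_mono hausdorff_outer_UN])
  also have "\<dots> = hausdorff_outer k A + hausdorff_outer k B"
    by (subst suminf_finite[of "{0, 1}"]) auto
  finally show ?thesis .
qed

lemma hausdorff_outer_separated:
  assumes d: "d > 0" and sep: "\<And>x y. x \<in> A \<Longrightarrow> y \<in> B \<Longrightarrow> d \<le> dist x y"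
  shows "hausdorff_outer k A + hausdorff_outer k B \<le> hausdorff_outer k (A \<union> B)"
proof -
  have pre: "hausdorff_pre k \<delta> A + hausdorff_pre k \<delta> B \<le> hausdorff_pre k \<delta> (A \<union> B)"
    if \<delta>: "0 < \<delta>" "\<delta> < d" for \<delta>
    unfolding hausdorff_pre_def[of k \<delta> "A \<union> B"]
  proof (rule INF_greatest)
    fix C assume C: "C \<in> hausdorff_covers \<delta> (A \<union> B)"
    define CA where "CA i = (if C i \<inter> A \<noteq> {} then C i else {})" for i
    define CB where "CB i = (if C i \<inter> B \<noteq> {} then C i else {})" for i
    have "CA \<in> hausdorff_covers \<delta> A" "CB \<in> hausdorff_covers \<delta> B"
      using C \<delta> by (fastforce simp: hausdorff_covers_def CA_def CB_def)+
    then have "hausdorff_pre k \<delta> A + hausdorff_pre k \<delta> B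
        \<le> (\<Sum>i. hausdorff_gauge k (CA i)) + (\<Sum>i. hausdorff_gauge k (CB i))"
      unfolding hausdorff_pre_def by (intro add_mono INF_lower)
    also have "\<dots> = (\<Sum>i. hausdorff_gauge k (CA i) + hausdorff_gauge k (CB i))"
      by (rule suminf_add) auto
    also have "\<dots> \<le> (\<Sum>i. hausdorff_gauge k (C i))"
    proof (rule suminf_le)
      fix i
      have "C i \<inter> A = {} \<or> C i \<inter> B = {}"
      proof (rule ccontr)
        assume "\<not> ?thesis"
        then obtain x y where "x \<in> A" "x \<in> C i" "y \<in> B" "y \<in> C i" by blast
        then have "d \<le> diameter (C i)"
          using C sep[of x y] diameter_bounded_bound[of "C i" x y]
          by (auto simp: hausdorff_covers_def intro: order_trans)
        moreover have "diameter (C i) \<le> \<delta>" using C by (simp add: hausdorff_covers_def)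
        ultimately show False using \<delta> by linarith
      qed
      then show "hausdorff_gauge k (CA i) + hausdorff_gauge k (CB i) \<le> hausdorff_gauge k (C i)"
        by (auto simp: CA_def CB_def)
    qed auto
    finally show "hausdorff_pre k \<delta> A + hausdorff_pre k \<delta> B \<le> (\<Sum>i. hausdorff_gauge k (C i))" .
  qed
  have "hausdorff_outer k A + hausdorff_outer k B
      = (SUP \<delta>\<in>{0<..}. hausdorff_pre k \<delta> A + hausdorff_pre k \<delta> B)"
    unfolding hausdorff_outer_def
  proof (rule SUP_add_directed_ennreal[symmetric])
    fix \<delta> \<epsilon> :: real assume "\<delta> \<in> {0<..}" "\<epsilon> \<in> {0<..}"
    then show "\<exists>\<eta>\<in>{0<..}. hausdorff_pre k \<delta> A + hausdorff_pre k \<epsilon> B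
        \<le> hausdorff_pre k \<eta> A + hausdorff_pre k \<eta> B"
      by (intro bexI[of _ "min \<delta> \<epsilon>"] add_mono hausdorff_pre_antimono) auto
  qed
  also have "\<dots> \<le> hausdorff_outer k (A \<union> B)"
  proof (rule SUP_least)
    fix \<delta> :: real assume "\<delta> \<in> {0<..}"
    then have "hausdorff_pre k \<delta> A + hausdorff_pre k \<delta> B
        \<le> hausdorff_pre k (min \<delta> (d/2)) A + hausdorff_pre k (min \<delta> (d/2)) B"
      by (intro add_mono hausdorff_pre_antimono) auto
    also have "\<dots> \<le> hausdorff_pre k (min \<delta> (d/2)) (A \<union> B)"
      using d \<open>\<delta> \<in> {0<..}\<close> by (intro pre) auto
    also have "\<dots> \<le> hausdorff_outer k (A \<union> B)"
      using d \<open>\<delta> \<in> {0<..}\<close> by (intro hausdorff_pre_le_outer) auto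
    finally show "hausdorff_pre k \<delta> A + hausdorff_pre k \<delta> B \<le> hausdorff_outer k (A \<union> B)" .
  qed
  finally show ?thesis .
qed

lemma hausdorff_outer_closed_split:
  fixes F :: "'a::metric_space set"
  assumes F: "closed F"
  shows "hausdorff_outer k (T \<inter> F) + hausdorff_outer k (T - F) \<le> hausdorff_outer k T"
proof (cases "F = {} \<or> hausdorff_outer k T = \<infinity>")
  case True
  then show ?thesis by auto
next
  case False
  then have ne: "F \<noteq> {}" and fin: "hausdorff_outer k T < top" by (auto simp: less_top)
  let ?H = "hausdorff_outer k"
  define g where "g x = infdist x F" for x
  have g_lip: "g x \<le> g y + dist x y" for x y
    unfolding g_def by (rule infdist_triangle)
  have g_pos: "g x > 0 \<longleftrightarrow> x \<notin> F" for x
    using in_closed_iff_infdist_zero[OF F ne] infdist_nonneg[of x F] by (auto simp: g_def less_le)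
  define E where "E m = {x \<in> T. g x \<ge> 1 / real (Suc m)}" for m :: nat
  define R where "R m = E (Suc m) - E m" for m
  have E_mono: "E m \<subseteq> E n" if "m \<le> n" for m n
  proof
    fix x assume "x \<in> E m"
    moreover have "1 / real (Suc n) \<le> 1 / real (Suc m)"
      using that by (intro divide_left_mono) auto
    ultimately show "x \<in> E n" by (auto simp: E_def)
  qed
  have E_le: "?H (E m) \<le> ?H T" for m
    by (rule hausdorff_outer_mono) (auto simp: E_def)
  have sepF: "?H (T \<inter> F) + ?H (E m) \<le> ?H T" for m
  proof -
    have "?H (T \<inter> F) + ?H (E m) \<le> ?H (T \<inter> F \<union> E m)"
    proof (rule hausdorff_outer_separated)
      fix x y assume "x \<in> T \<inter> F" "y \<in> E m"
      then show "1 / real (Suc m) \<le> dist x y"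
        using g_lip[of y x] g_pos[of x] by (auto simp: E_def dist_commute)
    qed auto
    also have "\<dots> \<le> ?H T"
      by (rule hausdorff_outer_mono) (auto simp: E_def)
    finally show ?thesis .
  qed
  have alt: "(\<Sum>j<N. ?H (R (2 * j + 1 + c))) \<le> ?H (E (2 * N + c))" for N c
  proof (induction N)
    case 0
    then show ?case by simp
  next
    case (Suc N)
    let ?m = "2 * N + c"
    have gap: "1 / real (Suc ?m) - 1 / real (Suc (Suc ?m)) > 0"
      using divide_strict_left_mono[of "real (Suc ?m)" "real (Suc (Suc ?m))" 1] by simp
    have "(\<Sum>j<Suc N. ?H (R (2 * j + 1 + c))) \<le> ?H (E ?m) + ?H (R (Suc ?m))"
      using Suc.IH by (simp add: add_right_mono)
    also have "\<dots> \<le> ?H (E ?m \<union> R (Suc ?m))"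
    proof (rule hausdorff_outer_separated[OF gap])
      fix x y assume "x \<in> E ?m" "y \<in> R (Suc ?m)"
      then show "1 / real (Suc ?m) - 1 / real (Suc (Suc ?m)) \<le> dist x y"
        using g_lip[of x y] by (auto simp: E_def R_def)
    qed
    also have "\<dots> \<le> ?H (E (2 * Suc N + c))"
      using E_mono[of ?m "2 * Suc N + c"] by (intro hausdorff_outer_mono) (auto simp: R_def)
    finally show ?case .
  qed
  define a where "a m = ?H (R (Suc m))" for m
  have split_sum: "(\<Sum>m<2 * N. a m) = (\<Sum>j<N. a (2 * j)) + (\<Sum>j<N. a (2 * j + 1))" for N
    by (induction N) (auto simp: algebra_simps)
  have sum1: "(\<Sum>j<N. a (2 * j)) \<le> ?H T" for N
    using order_trans[OF alt[of 0 N] E_le] by (simp add: a_def)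
  have sum2: "(\<Sum>j<N. a (2 * j + 1)) \<le> ?H T" for N
    using order_trans[OF alt[of 1 N] E_le] by (simp add: a_def)
  have even_le: "(\<Sum>m<2 * N. a m) \<le> ?H T + ?H T" for N
    unfolding split_sum by (intro add_mono sum1 sum2)
  have "(\<Sum>m<N. a m) \<le> ?H T + ?H T" for N
    by (rule order_trans[OF sum_mono2 even_le[of N]]) auto
  then have "suminf a \<le> ?H T + ?H T"
    by (intro suminf_le_const) auto
  also have "\<dots> < top" using fin by simp
  finally have S: "suminf a < top" .
  have part: "?H (T \<inter> F) + ?H (T - F) + (\<Sum>m<N. a m) \<le> ?H T + suminf a" for N
  proof -
    have "T - F \<subseteq> E (Suc N) \<union> (\<Union>j. R (Suc (j + N)))"
    proof
      fix x assume x: "x \<in> T - F"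
      then obtain n where n: "inverse (real (Suc n)) < g x"
        using g_pos[of x] reals_Archimedean by blast
      have ex: "\<exists>n. x \<in> E n"
        using x n by (intro exI[of _ n]) (auto simp: E_def inverse_eq_divide)
      define m where "m = (LEAST n. x \<in> E n)"
      have m: "x \<in> E m" unfolding m_def using ex by (rule LeastI_ex)
      show "x \<in> E (Suc N) \<union> (\<Union>j. R (Suc (j + N)))"
      proof (cases "m \<le> Suc N")
        case True
        then show ?thesis using m E_mono[of m "Suc N"] by auto
      next
        case False
        then obtain j where j: "m = Suc (Suc (j + N))"
          using less_imp_Suc_add[of "Suc N" m] by (auto simp: add.commute)
        have "x \<notin> E (Suc (j + N))"
          using not_less_Least[of "Suc (j + N)" "\<lambda>n. x \<in> E n"] j by (simp add: m_def)
        then have "x \<in> R (Suc (j + N))" using m j by (simp add: R_def)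
        then show ?thesis by blast
      qed
    qed
    then have "?H (T - F) \<le> ?H (E (Suc N)) + ?H (\<Union>j. R (Suc (j + N)))"
      by (rule order_trans[OF hausdorff_outer_mono hausdorff_outer_Un])
    also have "\<dots> \<le> ?H (E (Suc N)) + (\<Sum>j. a (j + N))"
      unfolding a_def by (intro add_left_mono hausdorff_outer_UN)
    finally have "?H (T \<inter> F) + ?H (T - F) + (\<Sum>m<N. a m)
        \<le> ?H (T \<inter> F) + (?H (E (Suc N)) + (\<Sum>j. a (j + N))) + (\<Sum>m<N. a m)"
      by (intro add_mono order_refl)
    also have "\<dots> = (?H (T \<inter> F) + ?H (E (Suc N))) + ((\<Sum>j. a (j + N)) + (\<Sum>m<N. a m))"
      by (simp add: ac_simps)
    also have "(\<Sum>j. a (j + N)) + (\<Sum>m<N. a m) = suminf a"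
      by (rule suminf_offset[symmetric]) auto
    also note add_right_mono[OF sepF[of "Suc N"]]
    finally show ?thesis .
  qed
  have "(\<lambda>N. ?H (T \<inter> F) + ?H (T - F) + (\<Sum>m<N. a m))
      \<longlonglongrightarrow> ?H (T \<inter> F) + ?H (T - F) + suminf a"
    by (intro tendsto_add tendsto_const summable_LIMSEQ) auto
  then have "?H (T \<inter> F) + ?H (T - F) + suminf a \<le> ?H T + suminf a"
    by (rule LIMSEQ_le_const2) (use part in blast)
  then show ?thesis
    using S ennreal_add_left_cancel_le[of "suminf a"] by (auto simp: add.commute[of _ "suminf a"])
qed

lemma measure_space_hausdorff:
  "measure_space UNIV (sets borel) (hausdorff_outer k :: 'a::metric_space set \<Rightarrow> ennreal)"
proof -
  let ?L = "lambda_system UNIV (Pow UNIV) (hausdorff_outer k :: 'a set \<Rightarrow> ennreal)"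
  interpret P: sigma_algebra "UNIV :: 'a set" "Pow UNIV" by (rule sigma_algebra_Pow)
  have "outer_measure_space (Pow UNIV) (hausdorff_outer k :: 'a set \<Rightarrow> ennreal)"
    by (auto simp: outer_measure_space_def positive_def increasing_def countably_subadditive_def
        intro: hausdorff_outer_mono hausdorff_outer_UN)
  then have L: "measure_space UNIV ?L (hausdorff_outer k)"
    by (rule P.caratheodory_lemma)
  then interpret L: sigma_algebra UNIV ?L by (simp add: measure_space_def)
  have "F \<in> ?L" if "closed F" for F :: "'a set"
  proof -
    have "hausdorff_outer k (T \<inter> F) + hausdorff_outer k (T - F) = hausdorff_outer k T" for T
      using hausdorff_outer_closed_split[OF that, of k T]
        hausdorff_outer_Un[of k "T \<inter> F" "T - F"]
      by (auto simp: Int_Diff_Un intro: antisym)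
    then show ?thesis unfolding P.lambda_system_eq by blast
  qed
  then have "sigma_sets UNIV (Collect closed) \<subseteq> ?L"
    by (intro L.sigma_sets_subset) auto
  moreover have "sets (borel :: 'a measure) = sigma_sets UNIV (Collect closed)"
    by (subst borel_eq_closed) (rule sets_measure_of, simp)
  ultimately have sub: "sets borel \<subseteq> ?L"
    by (simp only:)
  have alg: "sigma_algebra UNIV (sets (borel :: 'a measure))"
    using sets.sigma_algebra_axioms[of "borel :: 'a measure"] by simp
  show ?thesis
    by (rule measure_down[OF L alg sub])
qed

lemma sets_hausdorff_measure [simp, measurable_cong]: "sets (hausdorff_measure k) = sets borel"
  unfolding hausdorff_measure_def using sets.sets_measure_of_eq[of borel] by simp

lemma space_hausdorff_measure [simp]: "space (hausdorff_measure k) = UNIV"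
  using sets_eq_imp_space_eq[OF sets_hausdorff_measure] by simp

lemma emeasure_hausdorff_measure:
  fixes A :: "'a::metric_space set"
  assumes "A \<in> sets borel"
  shows "emeasure (hausdorff_measure k) A = hausdorff_outer k A"
  unfolding hausdorff_measure_def
proof (rule emeasure_measure_of_sigma)
  show "positive (sets borel) (hausdorff_outer k :: 'a set \<Rightarrow> ennreal)"
    "countably_additive (sets borel) (hausdorff_outer k :: 'a set \<Rightarrow> ennreal)"
    using measure_space_hausdorff[of k] unfolding measure_space_def by blast+
  show "sigma_algebra UNIV (sets (borel :: 'a measure))"
    using measure_space_hausdorff unfolding measure_space_def by blast
qed (rule assms)

lemma closed_outer_unit_normal: "closed {(x, u). outer_unit_normal K x u}"
proof -
  have "{(x, u). outer_unit_normal K x u} =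
      {p. norm (snd p) = 1} \<inter> (\<Inter>y\<in>K. {p. (y - fst p) \<bullet> snd p \<le> 0})"
    by (auto simp: outer_unit_normal_def)
  also have "closed \<dots>"
    by (intro closed_Int closed_INT ballI closed_Collect_eq closed_Collect_le continuous_intros)
  finally show ?thesis .
qed

lemma normal_at_eq:
  assumes "x \<in> regular_boundary K"
  shows "outer_unit_normal K x u \<longleftrightarrow> normal_at K x = u"
proof -
  have ex: "\<exists>!u. outer_unit_normal K x u" using assms by (simp add: regular_boundary_def)
  from theI'[OF this] have "outer_unit_normal K x (normal_at K x)" by (simp add: normal_at_def)
  with ex show ?thesis by blast
qed

lemma compact_normal_pairs:
  fixes K :: "'a::euclidean_space set"
  assumes K: "compact K" and C: "closed C"
  shows "compact {x \<in> frontier K. \<exists>u\<in>C. outer_unit_normal K x u}"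
proof -
  have "compact ((frontier K \<times> sphere 0 1) \<inter> ({(x, u). outer_unit_normal K x u} \<inter> UNIV \<times> C))"
    by (intro compact_Int_closed compact_Times compact_frontier[OF K] compact_sphere closed_Int
        closed_outer_unit_normal closed_Times closed_UNIV C)
  then have "compact (fst ` ((frontier K \<times> sphere 0 1) \<inter>
      ({(x, u). outer_unit_normal K x u} \<inter> UNIV \<times> C)))"
    by (intro compact_continuous_image continuous_intros)
  also have "fst ` ((frontier K \<times> sphere 0 1) \<inter> ({(x, u). outer_unit_normal K x u} \<inter> UNIV \<times> C))
      = {x \<in> frontier K. \<exists>u\<in>C. outer_unit_normal K x u}"
    by (force simp: outer_unit_normal_def image_iff)
  finally show ?thesis .
qed

lemma regular_boundary_borel:
  fixes K :: "'a::euclidean_space set"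
  assumes K: "compact K"
  shows "regular_boundary K \<in> sets borel"
proof -
  let ?N = "{(x, u). outer_unit_normal K x u}"
  define D where "D m = {x \<in> frontier K. \<exists>u v. outer_unit_normal K x u \<and>
      outer_unit_normal K x v \<and> dist u v \<ge> inverse (real (Suc m))}" for m :: nat
  have D: "compact (D m)" for m
  proof -
    let ?Q = "{p :: 'a \<times> 'a \<times> 'a. (fst p, fst (snd p)) \<in> ?N} \<inter> {p. (fst p, snd (snd p)) \<in> ?N}
        \<inter> {p. inverse (real (Suc m)) \<le> dist (fst (snd p)) (snd (snd p))}"
    have "closed ((\<lambda>p :: 'a \<times> 'a \<times> 'a. (fst p, fst (snd p))) -` ?N)"
         "closed ((\<lambda>p :: 'a \<times> 'a \<times> 'a. (fst p, snd (snd p))) -` ?N)"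
      by (intro closed_vimage closed_outer_unit_normal continuous_intros)+
    then have "closed ?Q"
      by (intro closed_Int closed_Collect_le continuous_intros) (simp_all add: vimage_def)
    then have "compact ((frontier K \<times> sphere 0 1 \<times> sphere 0 1) \<inter> ?Q)"
      by (intro compact_Int_closed compact_Times compact_frontier[OF K] compact_sphere)
    then have "compact (fst ` ((frontier K \<times> sphere 0 1 \<times> sphere 0 1) \<inter> ?Q))"
      by (intro compact_continuous_image continuous_intros)
    also have "fst ` ((frontier K \<times> sphere 0 1 \<times> sphere 0 1) \<inter> ?Q) = D m"
    proof (intro equalityI subsetI)
      fix x assume "x \<in> D m"
      then obtain u v where "x \<in> frontier K" "outer_unit_normal K x u" "outer_unit_normal K x v"
          "inverse (real (Suc m)) \<le> dist u v"
        by (auto simp: D_def)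
      then have "(x, u, v) \<in> (frontier K \<times> sphere 0 1 \<times> sphere 0 1) \<inter> ?Q"
        by (auto simp: outer_unit_normal_def)
      then show "x \<in> fst ` ((frontier K \<times> sphere 0 1 \<times> sphere 0 1) \<inter> ?Q)"
        by (rule rev_image_eqI) simp
    qed (auto simp: D_def)
    finally show ?thesis .
  qed
  have "regular_boundary K =
      {x \<in> frontier K. \<exists>u\<in>UNIV. outer_unit_normal K x u} - (\<Union>m. D m)" (is "_ = ?R")
  proof (intro equalityI subsetI)
    fix x assume "x \<in> regular_boundary K"
    then show "x \<in> ?R" by (force simp: regular_boundary_def D_def)
  next
    fix x assume x: "x \<in> ?R"
    then obtain u where u: "x \<in> frontier K" "outer_unit_normal K x u" by blast
    have "v = u" if v: "outer_unit_normal K x v" for v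
    proof (rule ccontr)
      assume "v \<noteq> u"
      then obtain m where "inverse (real (Suc m)) < dist u v"
        using reals_Archimedean[of "dist u v"] by auto
      then have "x \<in> D m" using u v by (force simp: D_def)
      with x show False by blast
    qed
    with u show "x \<in> regular_boundary K" by (auto simp: regular_boundary_def)
  qed
  moreover have "{x \<in> frontier K. \<exists>u\<in>UNIV. outer_unit_normal K x u} \<in> sets borel"
    by (intro borel_compact compact_normal_pairs[OF K] closed_UNIV)
  moreover have "(\<Union>m. D m) \<in> sets borel"
    using D by (intro sets.countable_UN) (auto intro: borel_compact)
  ultimately show ?thesis by simp
qed

lemma normal_at_measurable:
  fixes K :: "'a::euclidean_space set"
  assumes K: "compact K"
  shows "(\<lambda>x. if x \<in> regular_boundary K then normal_at K x else 0) \<in> borel_measurable borel"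
    (is "?f \<in> _")
proof -
  have "?f \<in> measurable borel (sigma UNIV (Collect closed))"
  proof (rule measurable_measure_of)
    fix C :: "'a set" assume "C \<in> Collect closed"
    then have [measurable]: "{x \<in> frontier K. \<exists>u\<in>C. outer_unit_normal K x u} \<in> sets borel"
      by (intro borel_compact compact_normal_pairs[OF K]) auto
    have reg: "(\<exists>u\<in>C. outer_unit_normal K x u) \<longleftrightarrow> normal_at K x \<in> C" "x \<in> frontier K"
      if "x \<in> regular_boundary K" for x
      using normal_at_eq[OF that] that by (auto simp: regular_boundary_def)
    have "?f -` C = (regular_boundary K \<inter> {x \<in> frontier K. \<exists>u\<in>C. outer_unit_normal K x u})
        \<union> (if 0 \<in> C then - regular_boundary K else {})"
      by (rule set_eqI) (simp add: reg cong: conj_cong)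
    then show "?f -` C \<inter> space borel \<in> sets borel"
      using regular_boundary_borel[OF K] by auto
  qed auto
  then show ?thesis by (subst borel_eq_closed)
qed

lemma sets_cone_volume_measure [simp]:
  fixes K :: "(real^'n) set"
  shows "sets (cone_volume_measure K) = sets (restrict_space borel (sphere 0 1))"
  unfolding cone_volume_measure_def
  using sets.sets_measure_of_eq[of "restrict_space borel (sphere 0 1 :: (real^'n) set)"]
  by (simp add: space_restrict_space)

lemma emeasure_cone_volume_measure:
  fixes K :: "(real^'n) set"
  assumes K: "compact K" and \<omega>: "\<omega> \<in> sets borel" "\<omega> \<subseteq> sphere 0 1"
  shows "emeasure (cone_volume_measure K) \<omega> = cone_volume K \<omega>"
proof -
  let ?B = "restrict_space borel (sphere 0 1 :: (real^'n) set)"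
  let ?H = "hausdorff_measure (CARD('n) - 1) :: (real^'n) measure"
  let ?f = "\<lambda>x. if x \<in> regular_boundary K then normal_at K x else 0"
  let ?M = "density ?H (\<lambda>x. indicator (regular_boundary K) x * ennreal (x \<bullet> ?f x / real CARD('n)))"
  note [measurable] = normal_at_measurable[OF K] regular_boundary_borel[OF K]
  have eq: "cone_volume K A = emeasure (distr ?M borel ?f) A"
    if [measurable]: "A \<in> sets borel" for A
  proof -
    have "emeasure (distr ?M borel ?f) A = emeasure ?M (?f -` A)"
      by (subst emeasure_distr) (auto simp: measurable_density_eq1 space_density)
    also have "?f -` A \<in> sets ?H"
      using measurable_sets[OF normal_at_measurable[OF K] that] by simp
    then have "emeasure ?M (?f -` A) = (\<integral>\<^sup>+x. indicator (regular_boundary K) x *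
        ennreal (x \<bullet> ?f x / real CARD('n)) * indicator (?f -` A) x \<partial>?H)"
      by (subst emeasure_density) auto
    also have "\<dots> = cone_volume K A"
      unfolding cone_volume_def by (intro nn_integral_cong) (auto split: split_indicator)
    finally show ?thesis by simp
  qed
  have sub: "A \<in> sets borel" if "A \<in> sets ?B" for A
    using that by (auto simp: sets_restrict_space)
  show ?thesis
    unfolding cone_volume_measure_def
  proof (rule emeasure_measure_of_sigma)
    show "sigma_algebra (sphere 0 1) (sets ?B)"
      using sets.sigma_algebra_axioms[of ?B] by (simp add: space_restrict_space)
    show "positive (sets ?B) (cone_volume K)"
      by (simp add: positive_def cone_volume_def)
    show "countably_additive (sets ?B) (cone_volume K)"
      unfolding countably_additive_def
    proof safe
      fix A :: "nat \<Rightarrow> (real^'n) set"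
      assume A: "range A \<subseteq> sets ?B" "disjoint_family A"
      then have A': "A i \<in> sets borel" for i using sub by blast
      have "(\<Sum>i. cone_volume K (A i)) = (\<Sum>i. emeasure (distr ?M borel ?f) (A i))"
        using eq[OF A'] by simp
      also have "\<dots> = emeasure (distr ?M borel ?f) (\<Union>i. A i)"
        using A A' by (intro suminf_emeasure) auto
      also have "\<dots> = cone_volume K (\<Union>i. A i)"
        using A' by (intro eq[symmetric]) auto
      finally show "(\<Sum>i. cone_volume K (A i)) = cone_volume K (\<Union>i. A i)" .
    qed
    show "\<omega> \<in> sets ?B"
      using \<omega> by (simp add: sets_restrict_space_iff)
  qed
qed

end

theory Submission
  imports Defs "HOL-Probability.Probability"
begin

text \<open>Up to a constant, the cone-volume of a set of normals is the Lebesgue measure of the part of \<open>K\<close>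
  seen from the origin through the corresponding boundary points: near a regular boundary point a thin
  shell \<open>K - (1 - \<delta>) K\<close> is almost isometric to a slanted slab over the tangent hyperplane, so the two
  measures have bounded ratio arbitrarily close to the same constant.

  Let \<open>L\<close> have dimension \<open>d\<close> and let \<open>P\<close> be the orthogonal projection onto \<open>L\<close>. By Brunn-Minkowski the
  volume \<open>F x\<close> of the section of \<open>K\<close> over \<open>x \<in> P K\<close> has a concave \<open>(n - d)\<close>-th root. The supergradient
  inequality for this root at the origin, integrated over \<open>K\<close>, loses its linear term because the
  centroid vanishes, and gives \<open>vol (K \<inter> P\<^sup>-\<^sup>1 (r P K)) \<ge> r ^ d vol K\<close> for \<open>0 < r < 1\<close>. This part of \<open>K\<close> misses the
  outer shell \<open>C - r C\<close> of the cone \<open>C\<close> over the boundary points with normals in \<open>L\<close>, hence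
  \<open>(1 - r ^ n) vol C \<le> (1 - r ^ d) vol K\<close>, and \<open>r \<rightarrow> 1\<close> yields the inequality.

  Equality forces \<open>F\<close> to be constant. Then, in every direction, the quantiles of the sections are
  affine in \<open>x\<close> with a slope independent of the level, so that the sections are translates of one
  another by a linear map \<open>T\<close>. A normal at a boundary point over the relative interior of \<open>P K\<close> is
  orthogonal to the graph of \<open>T\<close>, all other normals lie in \<open>L\<close>, and \<open>L'\<close> is the orthogonal
  complement of the graph.\<close>

section \<open>Lebesgue measure and orthogonal projections\<close>

text \<open>The subspace concentration condition is homogeneous in the measure, and the centroid
  does not change when volume is rescaled. Hausdorff measure is therefore identified up to a factor
  only: in full dimension with Lebesgue measure, on hyperplanes through the product with length.
  Both factors come from the uniqueness of translation invariant measures. The second one has to be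
  the same for all hyperplanes, since the normals vary along the boundary; rotation invariance
  provides this. It is only shown to be nonnegative: if it vanishes, the cone-volume measure is zero
  and the condition is trivial.

  The equality case must survive the division by \<open>1 - r\<close> before \<open>r\<close> tends
  to 1. For this reason the section inequality carries an excess term of first order in
  \<open>1 - r\<close>, whose coefficient \<open>e\<close> vanishes only if all sections have the
  same volume.\<close>

lemma translation_invariant_eq_lborel:
  fixes M :: "'a::euclidean_space measure"
  assumes sets_M: "sets M = sets borel"
    and inv: "\<And>c. distr M borel ((+) c) = M"
    and fin: "\<And>r. emeasure M (cball 0 r) < \<infinity>"
    and A: "A \<in> sets borel"
  shows "emeasure M A = emeasure M (cbox (- One) 0) * emeasure lborel A"
proof -
  have [measurable_cong]: "sets M = sets borel" by (fact sets_M)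
  have space_M: "space M = UNIV" using sets_eq_imp_space_eq[OF sets_M] by simp
  have "sigma_finite_measure M"
  proof
    show "\<exists>A. countable A \<and> A \<subseteq> sets M \<and> \<Union>A = space M \<and> (\<forall>a\<in>A. emeasure M a \<noteq> \<infinity>)"
    proof (intro exI conjI)
      show "\<Union>(range (\<lambda>n. cball 0 (real n))) = space M"
        using real_arch_simple by (auto simp: space_M)
    qed (use fin in \<open>auto simp: sets_M less_top\<close>)
  qed
  then interpret pair_sigma_finite lborel M
    by (simp add: pair_sigma_finite_def lborel.sigma_finite_measure_axioms)
  have shiftM: "(\<integral>\<^sup>+x. g x \<partial>M) = (\<integral>\<^sup>+x. g (c + x) \<partial>M)" if "g \<in> borel_measurable borel" for g c
    by (subst inv[of c, symmetric], subst nn_integral_distr) (use that in auto)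
  have shiftL: "(\<integral>\<^sup>+x. g x \<partial>lborel) = (\<integral>\<^sup>+x. g (c + x) \<partial>lborel)"
    if "g \<in> borel_measurable borel" for g and c :: 'a
    by (subst lborel_distr_plus[of c, symmetric], subst nn_integral_distr) (use that in auto)
  \<comment> \<open>The unit cube has Lebesgue measure 1 and serves as a weight. Translating in
    \<open>M\<close>, then in Lebesgue measure, then again in \<open>M\<close>, with Fubini in
    between, moves the integration over \<open>A\<close> from \<open>M\<close> to
    \<open>lborel\<close>; what remains as a factor is the \<open>M\<close>-measure of the reflected
    cube.\<close>
  define B where "B = cbox (0::'a) One"
  have [measurable]: "B \<in> sets borel" "A \<in> sets borel" using A by (auto simp: B_def)
  have "emeasure lborel B = 1" by (simp add: B_def)
  then have "emeasure M A = (\<integral>\<^sup>+y. indicator B y * (\<integral>\<^sup>+x. indicator A x \<partial>M) \<partial>lborel)"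
    by (simp add: nn_integral_multc)
  also have "\<dots> = (\<integral>\<^sup>+y. (\<integral>\<^sup>+x. indicator B y * indicator A (y + x) \<partial>M) \<partial>lborel)"
    by (intro nn_integral_cong, subst shiftM) (simp_all add: nn_integral_cmult)
  also have "\<dots> = (\<integral>\<^sup>+x. (\<integral>\<^sup>+y. indicator B y * indicator A (y + x) \<partial>lborel) \<partial>M)"
    by (rule Fubini'[symmetric]) simp
  also have "\<dots> = (\<integral>\<^sup>+x. (\<integral>\<^sup>+y. indicator B (y - x) * indicator A y \<partial>lborel) \<partial>M)"
    proof (rule nn_integral_cong)
    fix x
    show "(\<integral>\<^sup>+y. indicator B y * indicator A (y + x) \<partial>lborel) =
        (\<integral>\<^sup>+y. indicator B (y - x) * indicator A y \<partial>lborel)"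
      using shiftL[of "\<lambda>y. indicator B (y - x) * indicator A y" x] by (simp add: add.commute)
  qed
  also have "\<dots> = (\<integral>\<^sup>+y. (\<integral>\<^sup>+x. indicator B (y - x) * indicator A y \<partial>M) \<partial>lborel)"
    by (rule Fubini') simp
  also have "\<dots> = (\<integral>\<^sup>+y. emeasure M (cbox (- One) 0) * indicator A y \<partial>lborel)"
  proof (intro nn_integral_cong)
    fix y
    have "(\<integral>\<^sup>+x. indicator B (y - x) * indicator A y \<partial>M) = (\<integral>\<^sup>+x. indicator B (y - x) \<partial>M) * indicator A y"
      by (intro nn_integral_multc) simp
    also have "(\<integral>\<^sup>+x. indicator B (y - x) \<partial>M) = (\<integral>\<^sup>+x. indicator B (- x) \<partial>M)"
      by (subst shiftM[of _ y]) simp_all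
    also have "\<dots> = (\<integral>\<^sup>+x. indicator (cbox (- One) 0) x \<partial>M)"
      by (intro nn_integral_cong) (auto simp: B_def mem_box indicator_def inner_simps)
    finally show "(\<integral>\<^sup>+x. indicator B (y - x) * indicator A y \<partial>M) =
        emeasure M (cbox (- One) 0) * indicator A y" by simp
  qed
  also have "\<dots> = emeasure M (cbox (- One) 0) * emeasure lborel A"
    by (simp add: nn_integral_cmult)
  finally show ?thesis .
qed

text \<open>The image measure is again translation invariant, hence a multiple of Lebesgue measure;
  the factor is 1 because the unit ball is its own preimage.\<close>

lemma distr_lborel_orthogonal_transformation:
  fixes f :: "'a::euclidean_space \<Rightarrow> 'a"
  assumes f: "orthogonal_transformation f"
  shows "distr lborel borel f = lborel"
proof -
  have lin: "linear f" and nrm: "norm (f x) = norm x" for x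
    using f by (auto simp: orthogonal_transformation)
  have bij: "bij f" by (rule orthogonal_transformation_bij[OF f])
  have [measurable]: "f \<in> borel_measurable borel"
    by (intro borel_measurable_continuous_onI linear_continuous_on linear_conv_bounded_linear[THEN iffD1] lin)
  let ?M = "distr lborel borel f"
  have vim: "f -` cball 0 r = cball 0 r" for r
    by (auto simp: nrm)
  have eq: "emeasure ?M A = emeasure ?M (cbox (- One) 0) * emeasure lborel A"
    if "A \<in> sets borel" for A
  proof (rule translation_invariant_eq_lborel[OF _ _ _ that])
    fix c
    obtain d where d: "f d = c" using bij by (metis bij_pointE)
    have "distr ?M borel ((+) c) = distr lborel borel ((+) c \<circ> f)"
      by (rule distr_distr) simp_all
    also have "(+) c \<circ> f = f \<circ> (+) d"
      using lin d by (auto simp: linear_add)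
    also have "distr lborel borel (f \<circ> (+) d) = distr (distr lborel borel ((+) d)) borel f"
      by (rule distr_distr[symmetric]) simp_all
    finally show "distr ?M borel ((+) c) = ?M" by (simp add: lborel_distr_plus)
  qed (simp_all add: emeasure_distr vim emeasure_lborel_cball_finite[simplified])
  let ?k = "emeasure ?M (cbox (- One) 0)"
  have "emeasure lborel (cball (0::'a) 1) = ?k * emeasure lborel (cball (0::'a) 1)"
    using eq[of "cball 0 1"] by (simp add: emeasure_distr vim)
  moreover have "emeasure lborel (cball (0::'a) 1) \<noteq> 0" "emeasure lborel (cball (0::'a) 1) \<noteq> \<infinity>"
    using emeasure_lborel_cball_finite[of "0::'a" 1] by (simp_all add: emeasure_cball less_top less_imp_neq[OF unit_ball_vol_pos, THEN not_sym])
  ultimately have "?k = 1"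
    using ennreal_mult_divide_eq[of "emeasure lborel (cball (0::'a) 1)" ?k]
      ennreal_mult_divide_eq[of "emeasure lborel (cball (0::'a) 1)" 1] by simp
  show ?thesis
    by (rule measure_eqI) (use eq \<open>?k = 1\<close> in auto)
qed

lemma nn_integral_lborel_orthogonal_transformation:
  fixes f :: "'a::euclidean_space \<Rightarrow> 'a"
  assumes f: "orthogonal_transformation f" and g: "g \<in> borel_measurable borel"
  shows "(\<integral>\<^sup>+x. g (f x) \<partial>lborel) = (\<integral>\<^sup>+x. g x \<partial>lborel)"
proof -
  have "f \<in> borel_measurable borel"
    using f by (intro borel_measurable_continuous_onI linear_continuous_on
        linear_conv_bounded_linear[THEN iffD1]) (auto simp: orthogonal_transformation)
  then have "(\<integral>\<^sup>+x. g x \<partial>distr lborel borel f) = (\<integral>\<^sup>+x. g (f x) \<partial>lborel)"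
    by (intro nn_integral_distr) (use g in auto)
  then show ?thesis by (simp add: distr_lborel_orthogonal_transformation[OF f])
qed

lemma orthogonal_transformation_swap_unit:
  fixes a b :: "'a::euclidean_space"
  assumes "norm a = 1" "norm b = 1"
  obtains f where "orthogonal_transformation f" "f a = b" "f b = a"
proof -
  let ?w = "a - b"
  \<comment> \<open>The reflection in the hyperplane orthogonal to \<open>a - b\<close>. If
    \<open>a = b\<close>, the vector \<open>?w\<close> is 0 and the formula gives the
    identity.\<close>
  let ?f = "\<lambda>x. x - (2 * (x \<bullet> ?w) / (?w \<bullet> ?w)) *\<^sub>R ?w"
  have ww: "?w \<bullet> ?w = 2 - 2 * (a \<bullet> b)"
    using assms by (simp add: inner_diff inner_commute norm_eq_1 algebra_simps)
  have aw: "a \<bullet> ?w = 1 - a \<bullet> b" "b \<bullet> ?w = - (1 - a \<bullet> b)"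
    using assms by (simp_all add: inner_diff_right norm_eq_1 inner_commute)
  have half: "2 * (1 - a \<bullet> b) / (?w \<bullet> ?w) = 1" if "a \<noteq> b"
  proof -
    have "?w \<bullet> ?w \<noteq> 0" using that by simp
    moreover have "2 * (1 - a \<bullet> b) = ?w \<bullet> ?w" by (simp only: ww right_diff_distrib mult_1_right)
    ultimately show ?thesis by (metis divide_self)
  qed
  have half': "2 * - (1 - a \<bullet> b) / (?w \<bullet> ?w) = - 1" if "a \<noteq> b"
    using half[OF that] by (metis minus_divide_left mult_minus_right)
  have f_a: "?f a = b"
    unfolding aw
  proof (cases "a = b")
    case False
    show "a - (2 * (1 - a \<bullet> b) / (?w \<bullet> ?w)) *\<^sub>R ?w = b"
      unfolding half[OF False] by simp
  qed simp
  have f_b: "?f b = a"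
    unfolding aw
  proof (cases "a = b")
    case False
    show "b - (2 * - (1 - a \<bullet> b) / (?w \<bullet> ?w)) *\<^sub>R ?w = a"
      unfolding half'[OF False] by simp
  qed simp
  have "linear ?f"
    by (rule linearI) (simp_all add: inner_add_left distrib_left add_divide_distrib scaleR_add_left scaleR_diff_right mult.left_commute)
  moreover have "norm (?f x) = norm x" for x
  proof -
    have "(x - k *\<^sub>R w) \<bullet> (x - k *\<^sub>R w) = x \<bullet> x - 2 * k * (x \<bullet> w) + k\<^sup>2 * (w \<bullet> w)" for k w
      by (simp add: inner_diff_left inner_diff_right inner_commute power2_eq_square algebra_simps)
    then have "?f x \<bullet> ?f x = x \<bullet> x - 2 * (2 * (x \<bullet> ?w) / (?w \<bullet> ?w)) * (x \<bullet> ?w)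
        + (2 * (x \<bullet> ?w) / (?w \<bullet> ?w))\<^sup>2 * (?w \<bullet> ?w)" .
    also have "\<dots> = x \<bullet> x"
    proof (cases "?w \<bullet> ?w = 0")
      case False
      then have "(2 * (x \<bullet> ?w) / (?w \<bullet> ?w))\<^sup>2 * (?w \<bullet> ?w) = 2 * (2 * (x \<bullet> ?w) / (?w \<bullet> ?w)) * (x \<bullet> ?w)"
        by (simp only: power2_eq_square) (simp del: inner_eq_zero_iff)
      then show ?thesis by linarith
    qed simp
    finally show ?thesis by (simp add: norm_eq_sqrt_inner)
  qed
  ultimately have "orthogonal_transformation ?f"
    by (simp add: orthogonal_transformation)
  then show ?thesis using f_a f_b by (rule that)
qed

text \<open>Along a basis vector this is the affine substitution rule; a reflection exchanging
  \<open>b\<close> with a basis vector transports it to \<open>b\<close>.\<close>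

lemma nn_integral_lborel_scale_direction:
  fixes b :: "'a::euclidean_space"
  assumes r: "r > 0" and b: "norm b = 1" and g: "g \<in> borel_measurable borel"
  shows "(\<integral>\<^sup>+x. g x \<partial>lborel) = ennreal r * (\<integral>\<^sup>+x. g (x + ((r - 1) * (x \<bullet> b)) *\<^sub>R b) \<partial>lborel)"
proof -
  obtain e :: 'a where e: "e \<in> Basis" using nonempty_Basis by blast
  obtain f where f: "orthogonal_transformation f" "f b = e" "f e = b"
    using orthogonal_transformation_swap_unit[OF b norm_Basis[OF e]] .
  have lin: "linear f" and inn: "f x \<bullet> f y = x \<bullet> y" for x y
    using f by (auto simp: orthogonal_transformation_def)
  have [measurable]: "f \<in> borel_measurable borel" "g \<in> borel_measurable borel"
    using g by (auto intro: borel_measurable_continuous_onI linear_continuous_on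
        linear_conv_bounded_linear[THEN iffD1] lin)
  let ?c = "\<lambda>j. if j = e then r else 1"
  let ?T = "\<lambda>x. 0 + (\<Sum>j\<in>Basis. (?c j * (x \<bullet> j)) *\<^sub>R j)"
  have T: "?T x = x + ((r - 1) * (x \<bullet> e)) *\<^sub>R e" for x
  proof -
    have "?T x = (\<Sum>j\<in>Basis. (x \<bullet> j) *\<^sub>R j + (if j = e then ((r - 1) * (x \<bullet> e)) *\<^sub>R e else 0))"
      by (auto intro!: sum.cong simp: algebra_simps)
    also have "\<dots> = x + ((r - 1) * (x \<bullet> e)) *\<^sub>R e"
      using e by (simp add: sum.distrib euclidean_representation)
    finally show ?thesis .
  qed
  have prod: "(\<Prod>j\<in>Basis. \<bar>?c j\<bar>) = r"
    using e r by (subst prod.remove[of _ e]) (auto intro: prod.neutral)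
  have "lborel = density (distr lborel borel ?T) (\<lambda>_. ennreal (\<Prod>j\<in>Basis. \<bar>?c j\<bar>))"
    using lborel_affine_euclidean[of ?c "0::'a"] r by simp
  then have D: "lborel = density (distr lborel borel ?T) (\<lambda>_. ennreal r)"
    by (simp only: prod)
  have scale: "(\<integral>\<^sup>+x. h x \<partial>lborel) = ennreal r * (\<integral>\<^sup>+x. h (x + ((r - 1) * (x \<bullet> e)) *\<^sub>R e) \<partial>lborel)"
    if [measurable]: "h \<in> borel_measurable borel" for h
    unfolding T[symmetric]
    by (subst D, subst nn_integral_density, simp, simp, subst nn_integral_cmult, simp,
        subst nn_integral_distr) simp_all
  have "(\<integral>\<^sup>+x. g x \<partial>lborel) = (\<integral>\<^sup>+x. g (f x) \<partial>lborel)"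
    by (rule nn_integral_lborel_orthogonal_transformation[OF f(1) g, symmetric])
  also have "\<dots> = ennreal r * (\<integral>\<^sup>+x. g (f (x + ((r - 1) * (x \<bullet> e)) *\<^sub>R e)) \<partial>lborel)"
    by (rule scale) simp
  also have "\<dots> = ennreal r * (\<integral>\<^sup>+x. g (f x + ((r - 1) * (f x \<bullet> b)) *\<^sub>R b) \<partial>lborel)"
    using f inn[of _ e] by (simp add: linear_add[OF lin] linear_scale[OF lin])
  also have "\<dots> = ennreal r * (\<integral>\<^sup>+x. g (x + ((r - 1) * (x \<bullet> b)) *\<^sub>R b) \<partial>lborel)"
    by (subst nn_integral_lborel_orthogonal_transformation[OF f(1),
        where g = "\<lambda>x. g (x + ((r - 1) * (x \<bullet> b)) *\<^sub>R b)"]) simp_all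
  finally show ?thesis .
qed

lemma nn_integral_lborel_scale_orthonormal:
  fixes B :: "'a::euclidean_space set"
  assumes "finite B" "pairwise orthogonal B" "\<And>b. b \<in> B \<Longrightarrow> norm b = 1"
    and r: "r > 0" and g: "g \<in> borel_measurable borel"
  shows "(\<integral>\<^sup>+x. g x \<partial>lborel) =
    ennreal (r ^ card B) * (\<integral>\<^sup>+x. g (x + (\<Sum>b\<in>B. ((r - 1) * (x \<bullet> b)) *\<^sub>R b)) \<partial>lborel)"
  using assms(1-3) g
proof (induction B arbitrary: g rule: finite_induct)
  case empty
  then show ?case by simp
next
  case (insert b B)
  note [measurable] = insert.prems(3)
  have orth: "b' \<bullet> b = 0" if "b' \<in> B" for b'
    using insert that by (auto simp: pairwise_def orthogonal_def inner_commute)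
  have nb: "norm b = 1" using insert.prems by simp
  have "(\<integral>\<^sup>+x. g x \<partial>lborel) = ennreal r * (\<integral>\<^sup>+x. g (x + ((r - 1) * (x \<bullet> b)) *\<^sub>R b) \<partial>lborel)"
    by (rule nn_integral_lborel_scale_direction[OF r nb insert.prems(3)])
  also have "(\<integral>\<^sup>+x. g (x + ((r - 1) * (x \<bullet> b)) *\<^sub>R b) \<partial>lborel) =
      ennreal (r ^ card B) * (\<integral>\<^sup>+x. g ((x + (\<Sum>b\<in>B. ((r - 1) * (x \<bullet> b)) *\<^sub>R b)) +
        ((r - 1) * ((x + (\<Sum>b\<in>B. ((r - 1) * (x \<bullet> b)) *\<^sub>R b)) \<bullet> b)) *\<^sub>R b) \<partial>lborel)"
    by (rule insert.IH[of "\<lambda>x. g (x + ((r - 1) * (x \<bullet> b)) *\<^sub>R b)"])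
      (use insert.prems in \<open>auto simp: pairwise_insert\<close>)
  also have "\<dots> = ennreal (r ^ card B) *
      (\<integral>\<^sup>+x. g (x + (\<Sum>b\<in>insert b B. ((r - 1) * (x \<bullet> b)) *\<^sub>R b)) \<partial>lborel)"
    using insert.hyps by (simp add: inner_add_left inner_sum_left orth add.commute add.left_commute)
  finally show ?case
    using insert.hyps r by (simp add: ennreal_mult mult.assoc)
qed

text \<open>A subspace is encoded by the projection onto it. The subspace and its orthogonal
  complement then become the ranges of the total linear maps \<open>P\<close> and
  \<open>\<lambda>x. x - P x\<close>, and everything can be integrated over the whole space.\<close>

locale orthogonal_projection =
  fixes P :: "'a::euclidean_space \<Rightarrow> 'a"
  assumes linear_P: "linear P"
    and idem: "P (P x) = P x"
    and selfadj: "P x \<bullet> y = x \<bullet> P y"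
begin

lemma P_add: "P (x + y) = P x + P y" and P_diff: "P (x - y) = P x - P y"
  and P_scale: "P (r *\<^sub>R x) = r *\<^sub>R P x" and P_zero [simp]: "P 0 = 0"
  and P_minus: "P (- x) = - P x"
  using linear_P by (simp_all add: linear_add linear_diff linear_scale linear_0 linear_neg)

lemmas P_simps = P_add P_diff P_scale P_minus idem

lemma P_orthogonal: "P x \<bullet> (y - P y) = 0"
  by (simp add: inner_diff_right selfadj idem)

lemma continuous_on_P [continuous_intros]:
  "continuous_on S f \<Longrightarrow> continuous_on S (\<lambda>x. P (f x))"
  using linear_P linear_continuous_on[of P UNIV] continuous_on_compose2[of UNIV P S f]
  by (auto simp: linear_conv_bounded_linear)

lemma measurable_P [measurable]: "P \<in> borel_measurable borel"
  by (intro borel_measurable_continuous_onI continuous_intros)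

lemma norm_P: "(norm x)\<^sup>2 = (norm (P x))\<^sup>2 + (norm (x - P x))\<^sup>2"
proof -
  have "x \<bullet> x = (P x + (x - P x)) \<bullet> (P x + (x - P x))" by simp
  also have "\<dots> = P x \<bullet> P x + (x - P x) \<bullet> (x - P x)"
    using P_orthogonal[of x x] by (simp only: inner_add_left inner_add_right inner_commute[of "x - P x" "P x"])
  finally show ?thesis by (simp only: power2_norm_eq_inner)
qed

lemma norm_P_le: "norm (P x) \<le> norm x" and norm_compl_le: "norm (x - P x) \<le> norm x"
  using norm_P[of x] by (auto intro: power2_le_imp_le)

lemma compl_projection: "orthogonal_projection (\<lambda>x. x - P x)"
  proof (rule orthogonal_projection.intro)
  show "linear (\<lambda>x. x - P x)"
    by (rule linearI) (simp_all add: P_add P_scale scaleR_diff_right)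
qed (simp_all add: P_simps inner_diff_left inner_diff_right selfadj)

lemma subspace_range: "subspace (range P)"
  by (rule linear_subspace_image[OF linear_P subspace_UNIV])

lemma range_sums_range_compl: "{x + y |x y. x \<in> range P \<and> y \<in> range (\<lambda>x. x - P x)} = UNIV"
proof (intro equalityI subsetI UNIV_I)
  fix x
  have "x = P x + (x - P x)" by simp
  then show "x \<in> {x + y |x y. x \<in> range P \<and> y \<in> range (\<lambda>x. x - P x)}" by blast
qed

lemma range_Int_range_compl: "range P \<inter> range (\<lambda>x. x - P x) = {0}"
proof -
  have "x = 0" if x: "x \<in> range P" "x \<in> range (\<lambda>x. x - P x)" for x
  proof -
    obtain y where "x = P y" using x(1) by auto
    moreover obtain z where "x = z - P z" using x(2) by auto
    ultimately show ?thesis by (metis P_orthogonal inner_eq_zero_iff)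
  qed
  then show ?thesis by (auto intro: rev_image_eqI[of 0])
qed

lemma range_plus_range_compl: "range P + range (\<lambda>x. x - P x) = UNIV"
proof -
  have "range P + range (\<lambda>x. x - P x) = {x + y |x y. x \<in> range P \<and> y \<in> range (\<lambda>x. x - P x)}"
    by (auto simp only: set_plus_def)
  then show ?thesis by (simp only: range_sums_range_compl)
qed

lemma dim_range: "dim (range P) + dim (range (\<lambda>x. x - P x)) = DIM('a)"
proof -
  interpret Q: orthogonal_projection "\<lambda>x. x - P x" by (rule compl_projection)
  show ?thesis
    using dim_sums_Int[OF subspace_range Q.subspace_range]
    unfolding range_sums_range_compl range_Int_range_compl by simp
qed

text \<open>The linear map scaling the range by \<open>r\<close> and fixing the kernel has
  determinant \<open>r ^ dim (range P)\<close>. For \<open>P\<close> it shrinks the projection of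
  the body, for the complementary projection it rescales sections.\<close>

lemma nn_integral_scale:
  assumes r: "r > 0" and g: "g \<in> borel_measurable borel"
  shows "(\<integral>\<^sup>+x. g x \<partial>lborel) =
    ennreal (r ^ dim (range P)) * (\<integral>\<^sup>+x. g (r *\<^sub>R P x + (x - P x)) \<partial>lborel)"
proof -
  obtain B where B: "B \<subseteq> range P" "pairwise orthogonal B" "\<And>x. x \<in> B \<Longrightarrow> norm x = 1"
     "independent B" "card B = dim (range P)" "span B = range P"
    by (rule orthonormal_basis_subspace[OF subspace_range]) auto
  have fin: "finite B" using B(4) by (rule independent_imp_finite)
  have "(\<Sum>b\<in>B. (x \<bullet> b) *\<^sub>R b) = P x" for x
  proof -
    have "P x = (\<Sum>b\<in>B. (P x \<bullet> b) *\<^sub>R b)"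
    proof -
      obtain a where a: "P x = (\<Sum>b\<in>B. a b *\<^sub>R b)"
        using B(6) span_finite[OF fin] by (metis (no_types, lifting) imageE rangeI)
      have "P x \<bullet> b = a b" if "b \<in> B" for b
      proof -
        have "P x \<bullet> b = (\<Sum>c\<in>B. if c = b then a b else 0)"
          unfolding a inner_sum_left
          using B(2,3) that by (intro sum.cong) (auto simp: pairwise_def orthogonal_def norm_eq_1)
        then show ?thesis using that fin by simp
      qed
      then show ?thesis unfolding a by (intro sum.cong) auto
    qed
    also have "\<dots> = (\<Sum>b\<in>B. (x \<bullet> b) *\<^sub>R b)"
    proof (intro sum.cong refl)
      fix b assume "b \<in> B"
      then have "P b = b" using B(1) idem by auto
      then show "(P x \<bullet> b) *\<^sub>R b = (x \<bullet> b) *\<^sub>R b" by (simp add: selfadj)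
    qed
    finally show ?thesis ..
  qed
  then have "(\<Sum>b\<in>B. ((r - 1) * (x \<bullet> b)) *\<^sub>R b) = (r - 1) *\<^sub>R P x" for x
    by (simp only: scaleR_sum_right[symmetric] scaleR_scaleR[symmetric])
  then have "x + (\<Sum>b\<in>B. ((r - 1) * (x \<bullet> b)) *\<^sub>R b) = r *\<^sub>R P x + (x - P x)" for x
    by (simp add: algebra_simps)
  then show ?thesis
    using nn_integral_lborel_scale_orthonormal[OF fin B(2,3) r g] B(5) by (simp only:)
qed

end

lemma orthogonal_projection_exists:
  fixes L :: "'a::euclidean_space set"
  assumes L: "subspace L"
  obtains P where "orthogonal_projection P" "range P = L"
proof -
  obtain B where B: "B \<subseteq> L" "pairwise orthogonal B" "\<And>x. x \<in> B \<Longrightarrow> norm x = 1"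
     "independent B" "span B = L"
    by (rule orthonormal_basis_subspace[OF L]) auto
  have fin: "finite B" using B(4) by (rule independent_imp_finite)
  define P where "P x = (\<Sum>b\<in>B. (x \<bullet> b) *\<^sub>R b)" for x
  have lin: "linear P"
    unfolding P_def by (rule linearI) (simp_all add: inner_add_left algebra_simps sum.distrib scaleR_sum_right)
  have Pb: "P b = b" if "b \<in> B" for b
  proof -
    have "P b = (\<Sum>c\<in>B. if c = b then b else 0)"
      unfolding P_def using B(2,3) that
      by (intro sum.cong) (auto simp: pairwise_def orthogonal_def norm_eq_1)
    then show ?thesis using that fin by simp
  qed
  have PL: "P x = x" if "x \<in> L" for x
    using that B(5) linear_eq_on[OF lin linear_id, of x B] Pb by auto
  have mem: "P x \<in> L" for x
    unfolding P_def B(5)[symmetric] by (intro span_sum span_scale span_base)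
  have "orthogonal_projection P"
  proof (rule orthogonal_projection.intro)
    show "P x \<bullet> y = x \<bullet> P y" for x y
      by (simp add: P_def inner_sum_left inner_sum_right inner_commute mult.commute)
  qed (auto simp: lin PL mem)
  moreover have "range P = L"
    using PL mem by (metis image_subset_iff rangeI subsetI subset_antisym)
  ultimately show ?thesis by (rule that)
qed

section \<open>Hausdorff measure of hyperplane sections\<close>

lemma bounded_pairwise:
  assumes "\<And>x y. x \<in> S \<Longrightarrow> y \<in> S \<Longrightarrow> dist x y \<le> e"
  shows "bounded S"
proof (cases "S = {}")
  case False
  then obtain x where "x \<in> S" by blast
  then show ?thesis unfolding bounded_def using assms by blast
qed simp

lemma ennreal_le_mult_INF:
  assumes r: "r > 0" and le: "\<And>x. x \<in> S \<Longrightarrow> a \<le> ennreal r * f x"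
  shows "a \<le> ennreal r * (INF x\<in>S. f x)"
proof -
  have nz: "ennreal r \<noteq> 0" "ennreal r \<noteq> top" using r by auto
  have "a / ennreal r \<le> (INF x\<in>S. f x)"
    using le r by (intro INF_greatest divide_le_posI_ennreal) (auto simp: mult.commute)
  then have "ennreal r * (a / ennreal r) \<le> ennreal r * (INF x\<in>S. f x)"
    by (rule mult_left_mono) simp
  moreover have "ennreal r * (a / ennreal r) = a"
    using nz by (simp add: ennreal_times_divide mult.commute[of "ennreal r"] ennreal_mult_divide_eq)
  ultimately show ?thesis by simp
qed

lemma hausdorff_outer_lipschitz_image:
  fixes f :: "'a::metric_space \<Rightarrow> 'b::real_normed_vector"
  assumes L: "L > 0" and lip: "\<And>x y. x \<in> A \<Longrightarrow> y \<in> A \<Longrightarrow> dist (f x) (f y) \<le> L * dist x y"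
  shows "hausdorff_outer k (f ` A) \<le> ennreal (L ^ k) * hausdorff_outer k A"
proof -
  have "hausdorff_pre k \<delta> (f ` A) \<le> ennreal (L ^ k) * hausdorff_outer k A" if \<delta>: "\<delta> > 0" for \<delta>
  proof -
    have "hausdorff_pre k \<delta> (f ` A) \<le> ennreal (L ^ k) * (\<Sum>i. hausdorff_gauge k (C i))"
      if C: "C \<in> hausdorff_covers (\<delta> / L) A" for C
    proof -
      \<comment> \<open>\<open>f\<close> is controlled on \<open>A\<close> only, so each covering
        set is first cut down to \<open>A\<close>; mesh \<open>\<delta> / L\<close> makes the images
        fine enough.\<close>
      let ?D = "\<lambda>i. f ` (C i \<inter> A)"
      have bC: "bounded (C i)" and dC: "diameter (C i) \<le> \<delta> / L" for i
        using C by (auto simp: hausdorff_covers_def)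
      have diam: "bounded (?D i) \<and> diameter (?D i) \<le> L * diameter (C i)" for i
      proof -
        have *: "norm (x - y) \<le> L * diameter (C i)" if xy: "x \<in> ?D i" "y \<in> ?D i" for x y
        proof -
          obtain a b where ab: "a \<in> C i" "a \<in> A" "b \<in> C i" "b \<in> A" "x = f a" "y = f b"
            using xy by blast
          have "dist (f a) (f b) \<le> L * dist a b" using lip ab by blast
          also have "\<dots> \<le> L * diameter (C i)"
            using diameter_bounded_bound[OF bC[of i]] ab L by (intro mult_left_mono) auto
          finally show ?thesis using ab by (simp add: dist_norm)
        qed
        have "bounded (?D i)"
          using * by (intro bounded_pairwise) (auto simp: dist_norm)
        moreover have "diameter (?D i) \<le> L * diameter (C i)"
          using L diameter_ge_0[OF bC[of i]] * by (intro diameter_le) auto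
        ultimately show ?thesis by simp
      qed
      have "L * diameter (C i) \<le> \<delta>" for i
        using dC[of i] L by (simp add: pos_le_divide_eq mult.commute)
      then have "?D \<in> hausdorff_covers \<delta> (f ` A)"
        unfolding hausdorff_covers_def
      proof (intro CollectI conjI allI)
        show "f ` A \<subseteq> (\<Union>i. ?D i)"
          using C by (fastforce simp: hausdorff_covers_def)
        show "bounded (?D i)" for i using diam by blast
        show "diameter (?D i) \<le> \<delta>" for i
          using diam[of i] \<open>\<And>i. L * diameter (C i) \<le> \<delta>\<close>[of i] by linarith
      qed
      then have "hausdorff_pre k \<delta> (f ` A) \<le> (\<Sum>i. hausdorff_gauge k (?D i))"
        unfolding hausdorff_pre_def by (rule INF_lower)
      also have "\<dots> \<le> (\<Sum>i. ennreal (L ^ k) * hausdorff_gauge k (C i))"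
      proof (rule suminf_le)
        fix i
        have "unit_ball_vol (real k) * (diameter (?D i) / 2) ^ k
            \<le> L ^ k * (unit_ball_vol (real k) * (diameter (C i) / 2) ^ k)"
        proof -
          have "(diameter (?D i) / 2) ^ k \<le> (L * (diameter (C i) / 2)) ^ k"
            using diam[of i] diameter_ge_0[of "?D i"] by (intro power_mono) auto
          then have "unit_ball_vol (real k) * (diameter (?D i) / 2) ^ k
              \<le> unit_ball_vol (real k) * (L * (diameter (C i) / 2)) ^ k"
            by (intro mult_left_mono) auto
          then show ?thesis by (simp only: power_mult_distrib mult.assoc mult.left_commute)
        qed
        then show "hausdorff_gauge k (?D i) \<le> ennreal (L ^ k) * hausdorff_gauge k (C i)"
          using L diameter_ge_0[OF bC[of i]]
          by (auto simp: hausdorff_gauge_def ennreal_mult[symmetric] intro!: ennreal_leI)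
      qed auto
      also have "\<dots> = ennreal (L ^ k) * (\<Sum>i. hausdorff_gauge k (C i))"
        by (rule ennreal_suminf_cmult)
      finally show ?thesis .
    qed
    then have "hausdorff_pre k \<delta> (f ` A) \<le> ennreal (L ^ k) * hausdorff_pre k (\<delta> / L) A"
      unfolding hausdorff_pre_def[of k "\<delta> / L"] using L
      by (intro ennreal_le_mult_INF) auto
    also have "\<dots> \<le> ennreal (L ^ k) * hausdorff_outer k A"
      using \<delta> L by (intro mult_left_mono hausdorff_pre_le_outer) auto
    finally show ?thesis .
  qed
  then show ?thesis
    unfolding hausdorff_outer_def[of k "f ` A"] by (intro SUP_least) simp
qed

lemma hausdorff_outer_isometry_image:
  fixes f :: "'a::real_normed_vector \<Rightarrow> 'b::real_normed_vector"
  assumes iso: "\<And>x y. x \<in> A \<Longrightarrow> y \<in> A \<Longrightarrow> dist (f x) (f y) = dist x y"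
  shows "hausdorff_outer k (f ` A) = hausdorff_outer k A"
proof (rule antisym)
  show "hausdorff_outer k (f ` A) \<le> hausdorff_outer k A"
    using hausdorff_outer_lipschitz_image[of 1 A f k] iso by simp
  have inj: "inj_on f A" using iso by (auto intro!: inj_onI) (metis dist_eq_0_iff)
  have "dist (inv_into A f x) (inv_into A f y) \<le> 1 * dist x y" if "x \<in> f ` A" "y \<in> f ` A" for x y
    using that iso inj by auto
  then have "hausdorff_outer k (inv_into A f ` f ` A) \<le> ennreal (1 ^ k) * hausdorff_outer k (f ` A)"
    by (intro hausdorff_outer_lipschitz_image) auto
  then show "hausdorff_outer k A \<le> hausdorff_outer k (f ` A)"
    using inj by (simp add: inv_into_image_cancel)
qed

lemma hausdorff_outer_translation:
  fixes A :: "'a::real_normed_vector set"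
  shows "hausdorff_outer k ((+) c ` A) = hausdorff_outer k A"
  by (rule hausdorff_outer_isometry_image) (simp add: dist_norm)

text \<open>A set of diameter \<open>d\<close> lies in a ball of radius \<open>d\<close>, whereas
  the gauge counts a ball of radius \<open>d / 2\<close>; this costs the factor
  \<open>2 ^ DIM('a)\<close>. The crude bound is enough to see that Hausdorff measure is not zero.
  For a non-Borel set the left-hand side is 0 by convention.\<close>

lemma lborel_le_hausdorff_outer:
  fixes A :: "'a::euclidean_space set"
  shows "emeasure lborel A \<le> ennreal (2 ^ DIM('a)) * hausdorff_outer DIM('a) A"
proof (cases "A \<in> sets borel")
  case True
  let ?n = "DIM('a)"
  have "emeasure lborel A \<le> ennreal (2 ^ ?n) * (\<Sum>i. hausdorff_gauge ?n (C i))"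
    if C: "C \<in> hausdorff_covers 1 A" for C
  proof -
    define x where "x i = (SOME y. y \<in> C i)" for i
    define B where "B i = (if C i = {} then {} else cball (x i) (diameter (C i)))" for i
    have bC: "bounded (C i)" for i using C by (auto simp: hausdorff_covers_def)
    have "C i \<subseteq> B i" for i
    proof (cases "C i = {}")
      case False
      then have "x i \<in> C i" unfolding x_def by (simp add: some_in_eq)
      then show ?thesis using False diameter_bounded_bound[OF bC] by (auto simp: B_def)
    qed simp
    then have "A \<subseteq> (\<Union>i. B i)" using C by (fastforce simp: hausdorff_covers_def)
    then have "emeasure lborel A \<le> emeasure lborel (\<Union>i. B i)"
      by (intro emeasure_mono) (auto simp: B_def)
    also have "\<dots> \<le> (\<Sum>i. emeasure lborel (B i))"
      by (rule emeasure_subadditive_countably) (auto simp: B_def)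
    also have "\<dots> = (\<Sum>i. ennreal (2 ^ ?n) * hausdorff_gauge ?n (C i))"
      using diameter_ge_0[OF bC]
      by (intro suminf_cong)
        (auto simp: B_def hausdorff_gauge_def emeasure_cball ennreal_mult[symmetric] power_divide)
    also have "\<dots> = ennreal (2 ^ ?n) * (\<Sum>i. hausdorff_gauge ?n (C i))"
      by (rule ennreal_suminf_cmult)
    finally show ?thesis .
  qed
  then have "emeasure lborel A \<le> ennreal (2 ^ ?n) * hausdorff_pre ?n 1 A"
    unfolding hausdorff_pre_def by (intro ennreal_le_mult_INF) auto
  also have "\<dots> \<le> ennreal (2 ^ ?n) * hausdorff_outer ?n A"
    by (intro mult_left_mono hausdorff_pre_le_outer) auto
  finally show ?thesis .
qed (simp add: emeasure_notin_sets)

lemma hausdorff_pre_finite_cover: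
  assumes fin: "finite I" and cov: "A \<subseteq> (\<Union>i\<in>I. C i)" and \<delta>: "\<delta> \<ge> 0"
    and C: "\<And>i. i \<in> I \<Longrightarrow> bounded (C i) \<and> diameter (C i) \<le> \<delta>"
  shows "hausdorff_pre k \<delta> A \<le> (\<Sum>i\<in>I. hausdorff_gauge k (C i))"
proof -
  obtain e where e: "bij_betw e {..<card I} I"
    using fin by (metis atLeast0LessThan ex_bij_betw_nat_finite)
  define D where "D j = (if j < card I then C (e j) else {})" for j
  have "D \<in> hausdorff_covers \<delta> A"
    unfolding hausdorff_covers_def
  proof (intro CollectI conjI allI)
    show "A \<subseteq> (\<Union>j. D j)"
    proof
      fix x assume "x \<in> A"
      then obtain i where "i \<in> I" "x \<in> C i" using cov by blast
      moreover then obtain j where "j < card I" "e j = i"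
        using e by (metis bij_betw_imp_surj_on imageE lessThan_iff)
      ultimately show "x \<in> (\<Union>j. D j)" by (auto simp: D_def intro!: exI[of _ j])
    qed
    show "bounded (D j)" "diameter (D j) \<le> \<delta>" for j
      using C[of "e j"] e \<delta> by (auto simp: D_def bij_betw_def)
  qed
  then have "hausdorff_pre k \<delta> A \<le> (\<Sum>j. hausdorff_gauge k (D j))"
    unfolding hausdorff_pre_def by (rule INF_lower)
  also have "\<dots> = (\<Sum>j<card I. hausdorff_gauge k (D j))"
    by (rule suminf_finite) (auto simp: D_def)
  also have "\<dots> = (\<Sum>j<card I. hausdorff_gauge k (C (e j)))"
    by (rule sum.cong) (auto simp: D_def)
  also have "\<dots> = (\<Sum>i\<in>I. hausdorff_gauge k (C i))"
    by (rule sum.reindex_bij_betw[OF e])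
  finally show ?thesis .
qed

text \<open>Cutting each of the \<open>k\<close> edges into \<open>N\<close> pieces gives
  \<open>N ^ k\<close> cells of diameter at most \<open>k / N\<close>. The powers of
  \<open>N\<close> cancel in the gauge sum, which leaves a bound independent of the mesh.\<close>

lemma hausdorff_outer_unit_cube_finite:
  fixes D :: "'a::euclidean_space set"
  assumes D: "D \<subseteq> Basis"
  shows "hausdorff_outer (card D) {x. \<forall>b\<in>Basis. if b \<in> D then 0 \<le> x \<bullet> b \<and> x \<bullet> b \<le> 1 else x \<bullet> b = 0} < \<infinity>"
    (is "hausdorff_outer ?k ?Q < \<infinity>")
proof -
  have finD: "finite D" by (rule finite_subset[OF D finite_Basis])
  define c where "c = unit_ball_vol (real ?k) * (real ?k / 2) ^ ?k"
  have "hausdorff_pre ?k \<delta> ?Q \<le> ennreal c" if \<delta>: "\<delta> > 0" for \<delta>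
  proof -
    obtain N :: nat where N: "N > 0" "real ?k / real N \<le> \<delta>"
    proof -
      obtain m :: nat where "real ?k / \<delta> < real m" using reals_Archimedean2 by blast
      then have "real ?k < \<delta> * real m" using \<delta> by (simp add: pos_divide_less_eq mult.commute)
      also have "\<dots> \<le> \<delta> * real (Suc m)" using \<delta> by (intro mult_left_mono) auto
      finally have "real ?k / real (Suc m) \<le> \<delta>" by (simp add: pos_divide_le_eq del: of_nat_Suc)
      then show ?thesis by (intro that[of "Suc m"]) simp_all
    qed
    define I where "I = PiE D (\<lambda>_. {..<N})"
    define C where "C i = {x \<in> ?Q. \<forall>b\<in>D. real (i b) / real N \<le> x \<bullet> b \<and> x \<bullet> b \<le> (real (i b) + 1) / real N}"
      for i :: "'a \<Rightarrow> nat"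
    have finI: "finite I" unfolding I_def using finD by (intro finite_PiE) auto
    have cardI: "card I = N ^ ?k" unfolding I_def using finD by (simp add: card_PiE)
    have close: "norm (x - y) \<le> real ?k / real N" if "x \<in> C i" "y \<in> C i" for x y i
    proof -
      have "norm (x - y) \<le> (\<Sum>b\<in>Basis. \<bar>(x - y) \<bullet> b\<bar>)" by (rule norm_le_l1)
      also have "\<dots> = (\<Sum>b\<in>D. \<bar>(x - y) \<bullet> b\<bar>)"
        using that D by (intro sum.mono_neutral_right) (auto simp: C_def inner_diff_left)
      also have "\<dots> \<le> (\<Sum>b\<in>D. 1 / real N)"
        using that by (intro sum_mono) (force simp: C_def inner_diff_left abs_le_iff add_divide_distrib)
      finally show ?thesis by simp
    qed
    have bC: "bounded (C i)" for i
      using close by (intro bounded_pairwise) (auto simp: dist_norm)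
    have dC: "diameter (C i) \<le> real ?k / real N" for i
      using close by (intro diameter_le) auto
    have cov: "?Q \<subseteq> (\<Union>i\<in>I. C i)"
    proof
      fix x assume x: "x \<in> ?Q"
      \<comment> \<open>The minimum assigns the coordinate value 1 to the last cell; the floor alone
        would give the index \<open>N\<close>.\<close>
      define i where "i = (\<lambda>b\<in>D. min (nat \<lfloor>x \<bullet> b * real N\<rfloor>) (N - 1))"
      have "i \<in> I" using N by (auto simp: I_def i_def)
      moreover have "x \<in> C i"
      proof -
        have "real (i b) / real N \<le> x \<bullet> b \<and> x \<bullet> b \<le> (real (i b) + 1) / real N" if b: "b \<in> D" for b
        proof -
          have xb: "0 \<le> x \<bullet> b" "x \<bullet> b \<le> 1" using x b D by (auto split: if_splits)
          let ?m = "nat \<lfloor>x \<bullet> b * real N\<rfloor>"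
          have m: "real ?m \<le> x \<bullet> b * real N" "x \<bullet> b * real N \<le> real ?m + 1"
          proof -
            have "0 \<le> x \<bullet> b * real N" using xb by simp
            then have "real ?m = of_int \<lfloor>x \<bullet> b * real N\<rfloor>" by simp
            then show "real ?m \<le> x \<bullet> b * real N" "x \<bullet> b * real N \<le> real ?m + 1" by linarith+
          qed
          have xN: "x \<bullet> b * real N \<le> real N" using xb N by (simp add: mult_left_le_one_le)
          have "real (i b) \<le> x \<bullet> b * real N" using m b by (simp add: i_def min_def)
          moreover have "x \<bullet> b * real N \<le> real (i b) + 1"
            using m xN b N by (auto simp: i_def min_def)
          ultimately show ?thesis using N by (simp add: pos_divide_le_eq pos_le_divide_eq)
        qed
        then show ?thesis using x by (auto simp: C_def)
      qed
      ultimately show "x \<in> (\<Union>i\<in>I. C i)" by blast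
    qed
    have "hausdorff_pre ?k \<delta> ?Q \<le> (\<Sum>i\<in>I. hausdorff_gauge ?k (C i))"
      using dC N \<delta> bC by (intro hausdorff_pre_finite_cover finI cov) (auto intro: order_trans)
    also have "\<dots> \<le> (\<Sum>i\<in>I. ennreal (unit_ball_vol (real ?k) * (real ?k / real N / 2) ^ ?k))"
    proof (rule sum_mono)
      fix i
      have "(diameter (C i) / 2) ^ ?k \<le> (real ?k / real N / 2) ^ ?k"
        using dC[of i] diameter_ge_0[OF bC[of i]] by (intro power_mono) auto
      then show "hausdorff_gauge ?k (C i) \<le> ennreal (unit_ball_vol (real ?k) * (real ?k / real N / 2) ^ ?k)"
        by (auto simp: hausdorff_gauge_def intro!: ennreal_leI mult_left_mono)
    qed
    also have "\<dots> = ennreal (real (N ^ ?k) * (unit_ball_vol (real ?k) * (real ?k / real N / 2) ^ ?k))"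
      by (subst ennreal_mult) (auto simp: cardI ennreal_of_nat_eq_real_of_nat)
    also have "real (N ^ ?k) * (unit_ball_vol (real ?k) * (real ?k / real N / 2) ^ ?k) = c"
      using N by (simp add: c_def power_divide)
    finally show ?thesis .
  qed
  then have "hausdorff_outer ?k ?Q \<le> ennreal c"
    unfolding hausdorff_outer_def by (intro SUP_least) simp
  then show ?thesis by (simp add: order_le_less_trans less_top)
qed

lemma hausdorff_outer_coordinate_flat_finite:
  fixes D :: "'a::euclidean_space set"
  assumes D: "D \<subseteq> Basis" and A: "bounded A" and flat: "\<And>x b. x \<in> A \<Longrightarrow> b \<in> Basis - D \<Longrightarrow> x \<bullet> b = 0"
  shows "hausdorff_outer (card D) A < \<infinity>"
proof -
  let ?Q = "{x. \<forall>b\<in>Basis. if b \<in> D then 0 \<le> x \<bullet> b \<and> x \<bullet> b \<le> 1 else x \<bullet> b = 0}"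
  obtain R where R: "R > 0" "\<And>x. x \<in> A \<Longrightarrow> norm x \<le> R"
    using A bounded_pos by blast
  have finD: "finite D" by (rule finite_subset[OF D finite_Basis])
  \<comment> \<open>Maps the unit cube of the flat onto the cube with coordinates between
    \<open>-R\<close> and \<open>R\<close>, with Lipschitz constant \<open>2 * R\<close>.\<close>
  define f where "f x = (2 * R) *\<^sub>R x - R *\<^sub>R (\<Sum>b\<in>D. b)" for x
  have "A \<subseteq> f ` ?Q"
  proof
    fix x assume x: "x \<in> A"
    define y where "y = (1 / (2 * R)) *\<^sub>R (x + R *\<^sub>R (\<Sum>b\<in>D. b))"
    have "x = f y" using R by (simp add: f_def y_def)
    moreover have "y \<in> ?Q"
    proof (intro CollectI ballI)
      fix b :: 'a assume b: "b \<in> Basis"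
      have s: "(\<Sum>c\<in>D. c) \<bullet> b = (if b \<in> D then 1 else 0)"
      proof -
        have "(\<Sum>c\<in>D. c) \<bullet> b = (\<Sum>c\<in>D. if c = b then 1 else 0)"
          unfolding inner_sum_left using D b by (intro sum.cong) (auto simp: inner_Basis)
        then show ?thesis using finD by simp
      qed
      have "\<bar>x \<bullet> b\<bar> \<le> R" using Basis_le_norm[OF b, of x] R(2)[OF x] by linarith
      then show "if b \<in> D then 0 \<le> y \<bullet> b \<and> y \<bullet> b \<le> 1 else y \<bullet> b = 0"
      proof -
        have yb: "y \<bullet> b = (x \<bullet> b + R * (if b \<in> D then 1 else 0)) / (2 * R)"
          by (simp add: y_def inner_add_left s)
        show ?thesis
        proof (cases "b \<in> D")
          case True
          then show ?thesis using \<open>\<bar>x \<bullet> b\<bar> \<le> R\<close> R(1) by (simp add: yb abs_le_iff)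
        next
          case False
          then show ?thesis using flat[OF x, of b] b by (simp add: yb)
        qed
      qed
    qed
    ultimately show "x \<in> f ` ?Q" by blast
  qed
  then have "hausdorff_outer (card D) A \<le> hausdorff_outer (card D) (f ` ?Q)"
    by (rule hausdorff_outer_mono)
  also have "\<dots> \<le> ennreal ((2 * R) ^ card D) * hausdorff_outer (card D) ?Q"
    using R by (intro hausdorff_outer_lipschitz_image)
      (auto simp: f_def dist_norm simp flip: scaleR_diff_right)
  also have "\<dots> < \<infinity>"
    using hausdorff_outer_unit_cube_finite[OF D] by (simp add: ennreal_mult_less_top)
  finally show ?thesis .
qed

lemma translation_vimage_eq: "(+) c -` A = (+) (- c) ` (A :: 'a::ab_group_add set)"
proof (intro equalityI subsetI)
  fix x assume "x \<in> (+) c -` A"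
  then show "x \<in> (+) (- c) ` A" by (intro image_eqI[of _ _ "c + x"]) simp_all
qed auto

text \<open>Translation invariance leaves an unknown factor, which is finite because cubes have
  finite Hausdorff measure and positive by the covering bound. Its later uses, Lipschitz images and
  the centroid, are homogeneous in the measure.\<close>

lemma hausdorff_measure_eq_lborel:
  obtains c where "0 < c" and
    "hausdorff_measure DIM('a) = density lborel (\<lambda>x::'a::euclidean_space. ennreal c)"
proof -
  let ?H = "hausdorff_measure DIM('a) :: 'a measure"
  let ?k = "emeasure ?H (cbox (- One) 0)"
  have eq: "emeasure ?H A = ?k * emeasure lborel A" if "A \<in> sets borel" for A
  proof (rule translation_invariant_eq_lborel[OF _ _ _ that])
    show "distr ?H borel ((+) c) = ?H" for c
    proof (rule measure_eqI)
      fix A assume "A \<in> sets (distr ?H borel ((+) c))"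
      then have A: "A \<in> sets borel" by simp
      then have A': "(+) c -` A \<in> sets borel"
        using measurable_sets_borel[of "(+) c" borel A] by simp
      have "emeasure (distr ?H borel ((+) c)) A = hausdorff_outer DIM('a) ((+) c -` A)"
        using A A' by (simp add: emeasure_distr emeasure_hausdorff_measure)
      also have "\<dots> = hausdorff_outer DIM('a) A"
        unfolding translation_vimage_eq by (rule hausdorff_outer_translation)
      finally show "emeasure (distr ?H borel ((+) c)) A = emeasure ?H A"
        using A by (simp add: emeasure_hausdorff_measure)
    qed simp
    show "emeasure ?H (cball 0 r) < \<infinity>" for r
      using hausdorff_outer_coordinate_flat_finite[of "Basis :: 'a set" "cball 0 r"]
      by (simp add: emeasure_hausdorff_measure)
  qed simp
  have "emeasure lborel (cbox (- One) (0::'a)) \<le> ennreal (2 ^ DIM('a)) * ?k"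
    using lborel_le_hausdorff_outer[of "cbox (- One) (0::'a)"] by (simp add: emeasure_hausdorff_measure)
  moreover have "emeasure lborel (cbox (- One) (0::'a)) = 1" by simp
  ultimately have "?k \<noteq> 0" by (auto simp del: emeasure_lborel_cbox)
  moreover have fin: "?k \<noteq> \<infinity>"
    using hausdorff_outer_coordinate_flat_finite[of "Basis :: 'a set" "cbox (- One) 0"]
    by (simp add: emeasure_hausdorff_measure bounded_cbox less_top)
  ultimately have k: "ennreal (enn2real ?k) = ?k" "enn2real ?k > 0"
    by (auto simp: less_top enn2real_positive_iff zero_less_iff_neq_zero)
  show ?thesis
  proof (rule that[OF k(2)])
    show "?H = density lborel (\<lambda>x. ennreal (enn2real ?k))"
      unfolding k(1)
    proof (rule measure_eqI)
      fix A assume "A \<in> sets ?H"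
      then have A: "A \<in> sets borel" by simp
      then show "emeasure ?H A = emeasure (density lborel (\<lambda>x. ?k)) A"
        unfolding eq[OF A] by (subst emeasure_density_const) simp_all
    qed simp
  qed
qed

lemma hausdorff_outer_orthogonal_transformation:
  fixes f :: "'a::euclidean_space \<Rightarrow> 'a"
  assumes "orthogonal_transformation f"
  shows "hausdorff_outer k (f ` A) = hausdorff_outer k A"
  using assms by (intro hausdorff_outer_isometry_image) (simp add: orthogonal_transformation_isometry)

lemma hausdorff_outer_hyperplane_finite:
  fixes A :: "'a::euclidean_space set"
  assumes u: "norm u = 1" and A: "bounded A" "\<And>x. x \<in> A \<Longrightarrow> x \<bullet> u = 0"
  shows "hausdorff_outer (DIM('a) - 1) A < \<infinity>"
proof -
  obtain e :: 'a where e: "e \<in> Basis" using nonempty_Basis by blast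
  obtain f where f: "orthogonal_transformation f" "f u = e"
    using orthogonal_transformation_swap_unit[OF u norm_Basis[OF e]] by metis
  have "hausdorff_outer (card (Basis - {e})) (f ` A) < \<infinity>"
  proof (rule hausdorff_outer_coordinate_flat_finite)
    show "bounded (f ` A)"
      using A f by (auto simp: bounded_iff orthogonal_transformation)
    show "x \<bullet> b = 0" if xb: "x \<in> f ` A" "b \<in> Basis - (Basis - {e})" for x b
    proof -
      have "b = e" using xb by auto
      moreover obtain a where "a \<in> A" "x = f a" using xb by auto
      ultimately show ?thesis using A f by (metis orthogonal_transformation_def)
    qed
  qed auto
  then show ?thesis
    using e f by (simp add: hausdorff_outer_orthogonal_transformation)
qed

section \<open>Hyperplane measure times length\<close>

lemma compact_slab:
  fixes B :: "'a::euclidean_space set"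
  assumes "compact B"
  shows "compact {p + s *\<^sub>R w |p s. p \<in> B \<and> s \<in> {0..1}}"
proof -
  have "{p + s *\<^sub>R w |p s. p \<in> B \<and> s \<in> {0..1}} = (\<lambda>x. fst x + snd x *\<^sub>R w) ` (B \<times> {0..1::real})"
    by (auto simp: image_def Bex_def)
  moreover have "compact ((\<lambda>x. fst x + snd x *\<^sub>R w) ` (B \<times> {0..1::real}))"
    using assms by (intro compact_continuous_image compact_Times continuous_intros) auto
  ultimately show ?thesis by simp
qed

text \<open>The link between measure in dimension \<open>DIM('a) - 1\<close> and volume: this
  product of hyperplane measure and length is translation invariant on the whole space, hence a
  multiple of Lebesgue measure.\<close>

definition hyperplane_product :: "'a::euclidean_space \<Rightarrow> 'a measure" where
  "hyperplane_product u = distr (density (hausdorff_measure (DIM('a) - 1)) (indicator {p. p \<bullet> u = 0})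
     \<Otimes>\<^sub>M lborel) borel (\<lambda>(p, s). p + s *\<^sub>R u)"

context
  fixes u :: "'a::euclidean_space"
  assumes u: "norm u = 1"
begin

private abbreviation (input) "hyp \<equiv> {p. p \<bullet> u = 0}"
private abbreviation (input) "Hu \<equiv> density (hausdorff_measure (DIM('a) - 1)) (indicator hyp)"

private lemma closed_hyp: "closed hyp"
  by (rule closed_Collect_eq) (auto intro!: continuous_intros)

private lemma emeasure_Hu:
  assumes "A \<in> sets borel"
  shows "emeasure Hu A = hausdorff_outer (DIM('a) - 1) (hyp \<inter> A)"
proof -
  have h: "hyp \<in> sets borel" using closed_hyp by (rule borel_closed)
  have "emeasure Hu A = (\<integral>\<^sup>+x. indicator hyp x * indicator A x \<partial>hausdorff_measure (DIM('a) - 1))"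
    using assms h by (intro emeasure_density) simp_all
  also have "\<dots> = (\<integral>\<^sup>+x. indicator (hyp \<inter> A) x \<partial>hausdorff_measure (DIM('a) - 1))"
    by (simp only: indicator_inter_arith)
  also have "\<dots> = hausdorff_outer (DIM('a) - 1) (hyp \<inter> A)"
    using assms h by (simp add: emeasure_hausdorff_measure)
  finally show ?thesis .
qed

private lemma pair_sigma_finite_Hu: "pair_sigma_finite Hu (lborel :: real measure)"
proof -
  have "sigma_finite_measure Hu"
  proof
    show "\<exists>A. countable A \<and> A \<subseteq> sets Hu \<and> \<Union>A = space Hu \<and> (\<forall>a\<in>A. emeasure Hu a \<noteq> \<infinity>)"
    proof (intro exI conjI)
      show "\<Union>(range (\<lambda>n. cball 0 (real n))) = space Hu"
        using real_arch_simple by (auto simp: space_density)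
      have "emeasure Hu (cball 0 (real n)) < \<infinity>" for n
        by (subst emeasure_Hu, simp, rule hausdorff_outer_hyperplane_finite[OF u]) (auto intro: bounded_Int)
      then show "\<forall>a\<in>range (\<lambda>n. cball 0 (real n)). emeasure Hu a \<noteq> \<infinity>" by (auto simp: less_top)
    qed auto
  qed
  then show ?thesis by (simp add: pair_sigma_finite_def lborel.sigma_finite_measure_axioms)
qed

private lemma slice_borel:
  assumes "A \<in> sets borel"
  shows "{(p, s). p + s *\<^sub>R u \<in> A} \<in> sets (Hu \<Otimes>\<^sub>M (lborel :: real measure))"
proof -
  have "(\<lambda>(p, s). p + s *\<^sub>R u) \<in> measurable (borel \<Otimes>\<^sub>M (borel :: real measure)) borel"
    by (simp add: split_beta)
  then have "(\<lambda>(p, s). p + s *\<^sub>R u) -` A \<inter> space (borel \<Otimes>\<^sub>M (borel :: real measure))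
      \<in> sets (borel \<Otimes>\<^sub>M (borel :: real measure))"
    using assms by (rule measurable_sets)
  also have "sets (borel \<Otimes>\<^sub>M (borel :: real measure)) = sets (Hu \<Otimes>\<^sub>M (lborel :: real measure))"
    by (intro sets_pair_measure_cong) simp_all
  also have "(\<lambda>(p, s). p + s *\<^sub>R u) -` A \<inter> space (borel \<Otimes>\<^sub>M (borel :: real measure))
      = {(p, s). p + s *\<^sub>R u \<in> A}"
    by (auto simp: space_pair_measure)
  finally show ?thesis .
qed

private lemma slice_section_borel: "A \<in> sets borel \<Longrightarrow> {p. p + s *\<^sub>R u \<in> A} \<in> sets borel"
  using measurable_sets_borel[of "\<lambda>p. p + s *\<^sub>R u" borel A] by (simp add: vimage_def)

private lemma slice_measurable:
  assumes A: "A \<in> sets borel"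
  shows "(\<lambda>s. hausdorff_outer (DIM('a) - 1) (hyp \<inter> {p. p + s *\<^sub>R u \<in> A})) \<in> borel_measurable borel"
proof -
  interpret pair_sigma_finite Hu "lborel :: real measure" by (rule pair_sigma_finite_Hu)
  have "(\<lambda>s. emeasure Hu ((\<lambda>p. (p, s)) -` {(p, s). p + s *\<^sub>R u \<in> A})) \<in> borel_measurable lborel"
    by (rule measurable_emeasure_Pair2[OF slice_borel[OF A]])
  also have "(\<lambda>s. emeasure Hu ((\<lambda>p. (p, s)) -` {(p, s). p + s *\<^sub>R u \<in> A})) =
      (\<lambda>s. hausdorff_outer (DIM('a) - 1) (hyp \<inter> {p. p + s *\<^sub>R u \<in> A}))"
    using emeasure_Hu[OF slice_section_borel[OF A]] by (simp add: vimage_def del: One_nat_def)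
  finally show ?thesis by simp
qed

private lemma emeasure_hyperplane_product:
  assumes A: "A \<in> sets borel"
  shows "emeasure (hyperplane_product u) A =
    (\<integral>\<^sup>+s. hausdorff_outer (DIM('a) - 1) (hyp \<inter> {p. p + s *\<^sub>R u \<in> A}) \<partial>lborel)"
proof -
  interpret pair_sigma_finite Hu "lborel :: real measure" by (rule pair_sigma_finite_Hu)
  have m: "(\<lambda>(p, s). p + s *\<^sub>R u) \<in> measurable (Hu \<Otimes>\<^sub>M (lborel :: real measure)) borel"
  proof (rule measurableI)
    fix B :: "'a set" assume "B \<in> sets borel"
    from slice_borel[OF this]
    show "(\<lambda>(p, s). p + s *\<^sub>R u) -` B \<inter> space (Hu \<Otimes>\<^sub>M (lborel :: real measure)) \<in> sets (Hu \<Otimes>\<^sub>M lborel)"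
      by (simp add: vimage_def space_pair_measure space_density case_prod_beta')
  qed simp
  have "emeasure (hyperplane_product u) A = emeasure (Hu \<Otimes>\<^sub>M lborel) {(p, s). p + s *\<^sub>R u \<in> A}"
    unfolding hyperplane_product_def
    by (subst emeasure_distr[OF m A])
      (simp add: vimage_def space_pair_measure space_density case_prod_beta')
  also have "\<dots> = (\<integral>\<^sup>+s. emeasure Hu ((\<lambda>p. (p, s)) -` {(p, s). p + s *\<^sub>R u \<in> A}) \<partial>lborel)"
    by (rule emeasure_pair_measure_alt2[OF slice_borel[OF A]])
  also have "\<dots> = (\<integral>\<^sup>+s. hausdorff_outer (DIM('a) - 1) (hyp \<inter> {p. p + s *\<^sub>R u \<in> A}) \<partial>lborel)"
    using emeasure_Hu[OF slice_section_borel[OF A]] by (simp add: vimage_def del: One_nat_def)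
  finally show ?thesis .
qed

private lemma hyperplane_product_cball_finite: "emeasure (hyperplane_product u) (cball 0 r) < \<infinity>"
proof -
  have "emeasure (hyperplane_product u) (cball 0 r) \<le>
      (\<integral>\<^sup>+s. hausdorff_outer (DIM('a) - 1) (hyp \<inter> cball 0 r) * indicator {-r..r} s \<partial>lborel)"
    unfolding emeasure_hyperplane_product[OF borel_closed[OF closed_cball]]
  proof (rule nn_integral_mono)
    fix s :: real
    have "p \<in> cball 0 r \<and> \<bar>s\<bar> \<le> r" if "p \<bullet> u = 0" "p + s *\<^sub>R u \<in> cball 0 r" for p
    proof -
      have "(norm (p + s *\<^sub>R u))\<^sup>2 = (norm p)\<^sup>2 + s\<^sup>2"
        using that u by (simp add: power2_norm_eq_inner inner_add_left inner_add_right norm_eq_1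
            inner_commute[of u p] power2_eq_square[of s])
      moreover have "norm (p + s *\<^sub>R u) \<le> r" using that by simp
      moreover from this have "(norm (p + s *\<^sub>R u))\<^sup>2 \<le> r\<^sup>2" "0 \<le> r"
        by (auto intro: power_mono order_trans[OF norm_ge_zero])
      ultimately have "(norm p)\<^sup>2 \<le> r\<^sup>2" "\<bar>s\<bar>\<^sup>2 \<le> r\<^sup>2" "0 \<le> r"
        using zero_le_power2[of s] zero_le_power2[of "norm p"] by (simp_all only: power2_abs)
      then show ?thesis by (auto intro: power2_le_imp_le)
    qed
    then have "hyp \<inter> {p. p + s *\<^sub>R u \<in> cball 0 r} \<subseteq> (if s \<in> {-r..r} then hyp \<inter> cball 0 r else {})"
      by (auto simp: abs_le_iff)
    then show "hausdorff_outer (DIM('a) - 1) (hyp \<inter> {p. p + s *\<^sub>R u \<in> cball 0 r}) \<le>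
        hausdorff_outer (DIM('a) - 1) (hyp \<inter> cball 0 r) * indicator {-r..r} s"
      using hausdorff_outer_mono[of _ "if s \<in> {-r..r} then hyp \<inter> cball 0 r else {}" "DIM('a) - 1"]
      by (auto split: if_splits simp: indicator_def)
  qed
  also have "\<dots> = hausdorff_outer (DIM('a) - 1) (hyp \<inter> cball 0 r) * emeasure lborel {-r..r}"
    by (simp add: nn_integral_cmult)
  also have "\<dots> < \<infinity>"
  proof -
    have "hausdorff_outer (DIM('a) - 1) (hyp \<inter> cball 0 r) < \<infinity>"
      by (rule hausdorff_outer_hyperplane_finite[OF u]) (auto intro: bounded_Int)
    moreover have "emeasure lborel {-r..r} < \<infinity>"
      using emeasure_lborel_Icc_eq[of "-r" r] by simp
    ultimately show ?thesis by (simp add: ennreal_mult_less_top)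
  qed
  finally show ?thesis .
qed

private lemma hyperplane_product_translation: "distr (hyperplane_product u) borel ((+) c) = hyperplane_product u"
proof (rule measure_eqI)
  fix A assume "A \<in> sets (distr (hyperplane_product u) borel ((+) c))"
  then have A: "A \<in> sets borel" by simp
  then have A': "(+) c -` A \<in> sets borel"
    using measurable_sets_borel[of "(+) c" borel A] by simp
  let ?g = "\<lambda>s. hausdorff_outer (DIM('a) - 1) (hyp \<inter> {p. p + s *\<^sub>R u \<in> A})"
  \<comment> \<open>\<open>c\<close> is split into its part along \<open>u\<close>, which shifts the
    height \<open>s\<close> of the slices, and a part \<open>d\<close> in the hyperplane, which
    translates each slice within itself.\<close>
  define t where "t = c \<bullet> u"
  define d where "d = c - t *\<^sub>R u"
  have d: "d \<bullet> u = 0" using u by (simp add: d_def t_def inner_diff_left norm_eq_1)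
  have "emeasure (distr (hyperplane_product u) borel ((+) c)) A = emeasure (hyperplane_product u) ((+) c -` A)"
    using A by (subst emeasure_distr) (simp_all add: hyperplane_product_def)
  also have "\<dots> = (\<integral>\<^sup>+s. ?g (t + s) \<partial>lborel)"
    unfolding emeasure_hyperplane_product[OF A']
  proof (intro nn_integral_cong)
    fix s :: real
    have "c + (p + s *\<^sub>R u) = d + (p + (t + s) *\<^sub>R u)" for p
      by (simp add: d_def algebra_simps)
    then have "hyp \<inter> {p. p + s *\<^sub>R u \<in> (+) c -` A} = hyp \<inter> {p. d + (p + (t + s) *\<^sub>R u) \<in> A}"
      by (simp only: vimage_eq mem_Collect_eq)
    also have "\<dots> = (+) d -` (hyp \<inter> {p. p + (t + s) *\<^sub>R u \<in> A})"
      using d by (auto simp: inner_add_left add.assoc)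
    also have "hausdorff_outer (DIM('a) - 1) \<dots> = ?g (t + s)"
      unfolding translation_vimage_eq by (rule hausdorff_outer_translation)
    finally show "hausdorff_outer (DIM('a) - 1) (hyp \<inter> {p. p + s *\<^sub>R u \<in> (+) c -` A}) = ?g (t + s)" .
  qed
  also have "\<dots> = (\<integral>\<^sup>+s. ?g s \<partial>distr lborel borel ((+) t))"
    by (rule nn_integral_distr[symmetric]) (use slice_measurable[OF A] in simp_all)
  also have "\<dots> = emeasure (hyperplane_product u) A"
    by (simp only: lborel_distr_plus emeasure_hyperplane_product[OF A])
  finally show "emeasure (distr (hyperplane_product u) borel ((+) c)) A = emeasure (hyperplane_product u) A" .
qed (simp add: hyperplane_product_def)

private lemma hyperplane_product_eq:
  assumes "A \<in> sets borel"
  shows "emeasure (hyperplane_product u) A =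
    emeasure (hyperplane_product u) (cbox (- One) 0) * emeasure lborel A"
  using hyperplane_product_translation hyperplane_product_cball_finite assms
  by (rule translation_invariant_eq_lborel[rotated]) (simp add: hyperplane_product_def)

text \<open>At a height \<open>s\<close> between 0 and \<open>w \<bullet> u\<close> the slice of the
  slanted slab is a translate of \<open>B\<close>; all other slices are empty.\<close>

private lemma hyperplane_product_slab:
  assumes B: "compact B" "\<And>p. p \<in> B \<Longrightarrow> p \<bullet> u = 0" and w: "0 < w \<bullet> u"
  shows "emeasure (hyperplane_product u) {p + s *\<^sub>R w |p s. p \<in> B \<and> s \<in> {0..1}} =
    hausdorff_outer (DIM('a) - 1) B * ennreal (w \<bullet> u)"
proof -
  let ?S = "{p + s *\<^sub>R w |p s. p \<in> B \<and> s \<in> {0..1}}"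
  let ?h = "w \<bullet> u"
  have S: "?S \<in> sets borel"
    by (intro borel_compact compact_slab B)
  have uu: "u \<bullet> u = 1" using u by (simp add: norm_eq_1)
  have sl: "hyp \<inter> {p. p + s *\<^sub>R u \<in> ?S} =
      (if s \<in> {0..?h} then (+) ((s / ?h) *\<^sub>R w - s *\<^sub>R u) ` B else {})" for s
  proof (intro equalityI subsetI)
    fix q assume q: "q \<in> hyp \<inter> {p. p + s *\<^sub>R u \<in> ?S}"
    then obtain p t where p: "p \<in> B" "0 \<le> t" "t \<le> 1" "q + s *\<^sub>R u = p + t *\<^sub>R w" "q \<bullet> u = 0"
      by auto
    have "(q + s *\<^sub>R u) \<bullet> u = s" "(p + t *\<^sub>R w) \<bullet> u = t * ?h"
      using p(1,5) B by (simp_all add: inner_add_left uu)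
    then have s: "s = t * ?h" unfolding p(4) by simp
    then have "s \<in> {0..?h}" "t = s / ?h" using p w by (auto simp: mult_le_cancel_right1)
    moreover have "q = ((s / ?h) *\<^sub>R w - s *\<^sub>R u) + p"
      using p(4) \<open>t = s / ?h\<close> by (simp add: algebra_simps)
    ultimately show "q \<in> (if s \<in> {0..?h} then (+) ((s / ?h) *\<^sub>R w - s *\<^sub>R u) ` B else {})"
      using p by auto
  next
    fix q assume q: "q \<in> (if s \<in> {0..?h} then (+) ((s / ?h) *\<^sub>R w - s *\<^sub>R u) ` B else {})"
    then have s: "s \<in> {0..?h}" by (auto split: if_splits)
    with q obtain p where p: "p \<in> B" "q = ((s / ?h) *\<^sub>R w - s *\<^sub>R u) + p" by auto
    have "q \<bullet> u = 0" using p B w by (simp add: inner_add_left inner_diff_left uu)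
    moreover have "q + s *\<^sub>R u = p + (s / ?h) *\<^sub>R w" using p by simp
    moreover have "s / ?h \<in> {0..1}" using s w by auto
    ultimately show "q \<in> hyp \<inter> {p. p + s *\<^sub>R u \<in> ?S}" using p by blast
  qed
  have "emeasure (hyperplane_product u) ?S =
      (\<integral>\<^sup>+s. hausdorff_outer (DIM('a) - 1) B * indicator {0..?h} s \<partial>lborel)"
    unfolding emeasure_hyperplane_product[OF S] sl
    by (intro nn_integral_cong) (simp add: hausdorff_outer_translation)
  also have "\<dots> = hausdorff_outer (DIM('a) - 1) B * ennreal ?h"
    using w by (simp add: nn_integral_cmult)
  finally show ?thesis .
qed

text \<open>The unit ball is invariant under rotations, so its mass is the same for the directions
  \<open>u\<close> and \<open>f u\<close>. This makes the factor of
  \<open>hyperplane_product\<close> independent of the direction.\<close>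

private lemma hyperplane_product_rotate:
  fixes f :: "'a \<Rightarrow> 'a"
  assumes f: "orthogonal_transformation f"
  shows "emeasure (hyperplane_product u) (cball 0 1) =
    (\<integral>\<^sup>+s. hausdorff_outer (DIM('a) - 1) ({p. p \<bullet> f u = 0} \<inter> {p. p + s *\<^sub>R f u \<in> cball 0 1}) \<partial>lborel)"
proof -
  have lin: "linear f" and inn: "f x \<bullet> f y = x \<bullet> y" and nrm: "norm (f x) = norm x" for x y
    using f orthogonal_transformation[of f] by (auto simp: orthogonal_transformation_def)
  have "{p. p \<bullet> f u = 0} \<inter> {p. p + s *\<^sub>R f u \<in> cball 0 1} = f ` (hyp \<inter> {p. p + s *\<^sub>R u \<in> cball 0 1})" for s
  proof (intro equalityI subsetI)
    fix q assume q: "q \<in> {p. p \<bullet> f u = 0} \<inter> {p. p + s *\<^sub>R f u \<in> cball 0 1}"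
    obtain p where p: "q = f p" using bij_is_surj[OF orthogonal_transformation_bij[OF f]] by auto
    have "norm (f (p + s *\<^sub>R u)) \<le> 1" using q unfolding p by (simp add: linear_add[OF lin] linear_scale[OF lin])
    then show "q \<in> f ` (hyp \<inter> {p. p + s *\<^sub>R u \<in> cball 0 1})"
      using q unfolding p by (auto simp: inn nrm)
  next
    fix q assume "q \<in> f ` (hyp \<inter> {p. p + s *\<^sub>R u \<in> cball 0 1})"
    then obtain p where p: "q = f p" "p \<bullet> u = 0" "norm (p + s *\<^sub>R u) \<le> 1" by auto
    have "norm (f (p + s *\<^sub>R u)) \<le> 1" using p nrm by simp
    then show "q \<in> {p. p \<bullet> f u = 0} \<inter> {p. p + s *\<^sub>R f u \<in> cball 0 1}"
      using p by (simp add: inn linear_add[OF lin] linear_scale[OF lin])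
  qed
  then show ?thesis
    by (simp only: hausdorff_outer_orthogonal_transformation[OF f]
        emeasure_hyperplane_product[OF borel_closed[OF closed_cball]])
qed

lemmas hyperplane_product_facts = emeasure_hyperplane_product hyperplane_product_cball_finite
  hyperplane_product_eq hyperplane_product_slab hyperplane_product_rotate

end

text \<open>The order of the quantifiers matters: \<open>c\<close> is fixed before \<open>u\<close>,
  so that one constant serves the tangent hyperplanes at all boundary points.\<close>

lemma hausdorff_hyperplane_slab:
  obtains c :: real where "0 \<le> c" and
    "\<And>u w (B :: 'a::euclidean_space set). norm u = 1 \<Longrightarrow> 0 < w \<bullet> u \<Longrightarrow> compact B \<Longrightarrow>
      (\<And>p. p \<in> B \<Longrightarrow> p \<bullet> u = 0) \<Longrightarrow>
      hausdorff_outer (DIM('a) - 1) B * ennreal (w \<bullet> u) =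
      ennreal c * emeasure lborel {p + s *\<^sub>R w |p s. p \<in> B \<and> s \<in> {0..1}}"
proof -
  obtain e :: 'a where e: "e \<in> Basis" using nonempty_Basis by blast
  have ne: "norm e = 1" using e by simp
  let ?k = "\<lambda>u::'a. emeasure (hyperplane_product u) (cbox (- One) 0)"
  have fin: "?k e < \<infinity>"
  proof -
    obtain r where "\<And>x. x \<in> cbox (- One) (0::'a) \<Longrightarrow> norm x \<le> r"
      using bounded_cbox[of "- One" "0::'a"] unfolding bounded_iff by blast
    then have "cbox (- One) (0::'a) \<subseteq> cball 0 r" by (simp add: subset_iff)
    then have "?k e \<le> emeasure (hyperplane_product e) (cball 0 r)"
      by (intro emeasure_mono) (auto simp: hyperplane_product_def)
    also have "\<dots> < \<infinity>" by (rule hyperplane_product_facts(2)[OF ne])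
    finally show ?thesis .
  qed
  \<comment> \<open>Both product measures give the unit ball the same mass, and they are multiples
    of the same Lebesgue measure.\<close>
  have same: "?k u = ?k e" if u: "norm u = 1" for u
  proof -
    obtain f where f: "orthogonal_transformation f" "f u = e"
      using orthogonal_transformation_swap_unit[OF u ne] by metis
    have "emeasure (hyperplane_product u) (cball 0 1) = emeasure (hyperplane_product e) (cball 0 1)"
      unfolding hyperplane_product_facts(5)[OF u f(1)] f(2)
      by (rule hyperplane_product_facts(1)[OF ne, symmetric]) simp
    then have "?k u * emeasure lborel (cball (0::'a) 1) = ?k e * emeasure lborel (cball (0::'a) 1)"
      using hyperplane_product_facts(3)[OF u, of "cball 0 1"] hyperplane_product_facts(3)[OF ne, of "cball 0 1"]
      by simp
    moreover have "emeasure lborel (cball (0::'a) 1) \<noteq> 0" "emeasure lborel (cball (0::'a) 1) \<noteq> \<infinity>"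
      using emeasure_lborel_cball_finite[of "0::'a" 1]
      by (simp_all add: emeasure_cball less_top less_imp_neq[OF unit_ball_vol_pos, THEN not_sym])
    ultimately show ?thesis
      by (metis ennreal_mult_divide_eq infinity_ennreal_def)
  qed
  show ?thesis
  proof (rule that[of "enn2real (?k e)"])
    fix u w :: 'a and B :: "'a set"
    assume u: "norm u = 1" and w: "0 < w \<bullet> u" and B: "compact B" "\<And>p. p \<in> B \<Longrightarrow> p \<bullet> u = 0"
    have S: "{p + s *\<^sub>R w |p s. p \<in> B \<and> s \<in> {0..1}} \<in> sets borel"
      by (intro borel_compact compact_slab B)
    show "hausdorff_outer (DIM('a) - 1) B * ennreal (w \<bullet> u) =
      ennreal (enn2real (?k e)) * emeasure lborel {p + s *\<^sub>R w |p s. p \<in> B \<and> s \<in> {0..1}}"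
      using hyperplane_product_facts(4)[OF u B w] hyperplane_product_facts(3)[OF u S] same[OF u] fin
      by (simp add: less_top)
  qed simp
qed

section \<open>Gauge and radial projection of a convex body\<close>

lemma emeasure_lborel_vimage_scaleR:
  fixes A :: "'a::euclidean_space set"
  assumes s: "s > 0" and A: "A \<in> sets borel"
  shows "emeasure lborel {z. z /\<^sub>R s \<in> A} = ennreal (s ^ DIM('a)) * emeasure lborel A"
proof -
  let ?D = "distr lborel borel (\<lambda>x::'a. 0 + inverse s *\<^sub>R x)"
  have "emeasure lborel A = emeasure (density ?D (\<lambda>_. ennreal (\<bar>inverse s\<bar> ^ DIM('a)))) A"
    using lborel_affine[of "inverse s" "0::'a"] s by (metis inverse_zero_imp_zero less_irrefl)
  also have "\<dots> = ennreal (\<bar>inverse s\<bar> ^ DIM('a)) * emeasure ?D A"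
    using A by (subst emeasure_density_const) simp_all
  also have "emeasure ?D A = emeasure lborel {z. z /\<^sub>R s \<in> A}"
    using A by (subst emeasure_distr) (simp_all add: vimage_def)
  finally have "ennreal (s ^ DIM('a)) * emeasure lborel A =
      ennreal (s ^ DIM('a)) * (ennreal (inverse s ^ DIM('a)) * emeasure lborel {z. z /\<^sub>R s \<in> A})"
    using s by simp
  also have "\<dots> = ennreal (s ^ DIM('a) * inverse s ^ DIM('a)) * emeasure lborel {z. z /\<^sub>R s \<in> A}"
    using s by (subst ennreal_mult) (simp_all add: mult.assoc)
  also have "s ^ DIM('a) * inverse s ^ DIM('a) = 1"
    using s by (simp add: power_mult_distrib[symmetric])
  finally show ?thesis by simp
qed

lemma integrable_continuous_bounded_support:
  fixes f :: "'a::euclidean_space \<Rightarrow> real"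
  assumes f: "continuous_on UNIV f" and supp: "\<And>x. norm x > R \<Longrightarrow> f x = 0"
  shows "integrable lborel f"
proof -
  have "integrable lborel (\<lambda>x. indicator (cball 0 R) x *\<^sub>R f x)"
    using f by (intro borel_integrable_compact continuous_on_subset[OF f]) auto
  also have "(\<lambda>x. indicator (cball 0 R) x *\<^sub>R f x) = f"
  proof
    fix x
    show "indicator (cball 0 R) x *\<^sub>R f x = f x"
      using supp[of x] by (cases "norm x \<le> R") simp_all
  qed
  finally show ?thesis .
qed

locale convex_body =
  fixes K :: "'a::euclidean_space set"
  assumes compact_K: "compact K" and convex_K: "convex K" and zero_interior: "0 \<in> interior K"
begin

definition polar :: "'a set" where
  "polar = {p. \<forall>x\<in>K. p \<bullet> x \<le> 1}"

text \<open>The Minkowski functional of \<open>K\<close>, written as the support function of the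
  polar body. In this form the points of the polar body where the supremum is attained are the
  rescaled outer normals.\<close>

definition gauge_fun :: "'a \<Rightarrow> real" where
  "gauge_fun z = Sup ((\<lambda>p. p \<bullet> z) ` polar)"

lemma ball_in_K: obtains r where "r > 0" "cball 0 r \<subseteq> K"
  using zero_interior by (auto simp: mem_interior_cball)

lemma K_bounded: obtains R where "R > 0" "\<And>x. x \<in> K \<Longrightarrow> norm x \<le> R"
  using compact_imp_bounded[OF compact_K] unfolding bounded_pos by blast

lemma zero_in_polar: "0 \<in> polar"
  by (simp add: polar_def)

lemma polar_bound: obtains C where "C > 0" "\<And>p. p \<in> polar \<Longrightarrow> norm p \<le> C"
proof -
  obtain r where r: "r > 0" "cball 0 r \<subseteq> K" by (rule ball_in_K)
  have "norm p \<le> 1 / r" if p: "p \<in> polar" for p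
  proof (cases "p = 0")
    case False
    have "norm ((r / norm p) *\<^sub>R p) = r" using False r by simp
    then have "(r / norm p) *\<^sub>R p \<in> K" using r by auto
    then have "p \<bullet> ((r / norm p) *\<^sub>R p) \<le> 1" using p unfolding polar_def by blast
    moreover have "p \<bullet> ((r / norm p) *\<^sub>R p) = r * norm p"
      using False by (simp add: dot_square_norm power2_eq_square)
    ultimately show ?thesis using r by (simp add: pos_le_divide_eq mult.commute)
  qed (use r in simp)
  then show ?thesis using r by (intro that[of "1 / r"]) auto
qed

lemma compact_polar: "compact polar"
proof -
  have "polar = (\<Inter>x\<in>K. {p. p \<bullet> x \<le> 1})" by (auto simp: polar_def)
  then have "closed polar"
    by (simp only:) (intro closed_INT ballI closed_Collect_le continuous_intros)
  moreover have "bounded polar" using polar_bound unfolding bounded_iff by metis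
  ultimately show ?thesis by (simp add: compact_eq_bounded_closed)
qed

lemma gauge_attained: obtains p where "p \<in> polar" "gauge_fun z = p \<bullet> z"
proof -
  have "\<exists>p\<in>polar. \<forall>q\<in>polar. q \<bullet> z \<le> p \<bullet> z"
    using zero_in_polar by (intro continuous_attains_sup compact_polar) (auto intro!: continuous_intros)
  then obtain q where q: "q \<in> polar" "\<And>p. p \<in> polar \<Longrightarrow> p \<bullet> z \<le> q \<bullet> z" by blast
  have "gauge_fun z = q \<bullet> z"
    unfolding gauge_fun_def using q by (intro cSup_eq_maximum) auto
  then show ?thesis using q that by metis
qed

lemma gauge_ge: "p \<in> polar \<Longrightarrow> p \<bullet> z \<le> gauge_fun z"
  unfolding gauge_fun_def
proof (rule cSUP_upper)
  have "compact ((\<lambda>p. p \<bullet> z) ` polar)"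
    by (intro compact_continuous_image compact_polar continuous_intros)
  then show "bdd_above ((\<lambda>p. p \<bullet> z) ` polar)"
    by (intro bounded_imp_bdd_above compact_imp_bounded)
qed

lemma gauge_scale:
  assumes "t \<ge> 0" shows "gauge_fun (t *\<^sub>R z) = t * gauge_fun z"
proof (rule antisym)
  obtain p where "p \<in> polar" "gauge_fun (t *\<^sub>R z) = p \<bullet> (t *\<^sub>R z)" by (rule gauge_attained)
  then show "gauge_fun (t *\<^sub>R z) \<le> t * gauge_fun z"
    using gauge_ge[of p z] assms by (simp add: mult_left_mono)
  obtain p where "p \<in> polar" "gauge_fun z = p \<bullet> z" by (rule gauge_attained)
  then show "t * gauge_fun z \<le> gauge_fun (t *\<^sub>R z)"
    using gauge_ge[of p "t *\<^sub>R z"] by simp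
qed

lemma gauge_zero [simp]: "gauge_fun 0 = 0"
  using gauge_scale[of 0 0] by simp

lemma gauge_lipschitz: obtains C where "C > 0" "\<And>x y. \<bar>gauge_fun x - gauge_fun y\<bar> \<le> C * norm (x - y)"
proof -
  obtain C where C: "C > 0" "\<And>p. p \<in> polar \<Longrightarrow> norm p \<le> C" by (rule polar_bound) auto
  have "gauge_fun x - gauge_fun y \<le> C * norm (x - y)" for x y
  proof -
    obtain p where p: "p \<in> polar" "gauge_fun x = p \<bullet> x" by (rule gauge_attained)
    have "gauge_fun x - gauge_fun y \<le> p \<bullet> (x - y)"
      using gauge_ge[OF p(1), of y] p(2) by (simp add: inner_diff_right)
    also have "\<dots> \<le> norm p * norm (x - y)" by (rule norm_cauchy_schwarz)
    also have "\<dots> \<le> C * norm (x - y)" using C p by (intro mult_right_mono) auto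
    finally show ?thesis .
  qed
  from this[of x y for x y] this[of y x for x y] show ?thesis
    using C(1) that[of C] by (metis abs_le_iff minus_diff_eq norm_minus_commute)
qed

lemma continuous_on_gauge [continuous_intros]:
  assumes "continuous_on S f" shows "continuous_on S (\<lambda>x. gauge_fun (f x))"
proof -
  obtain C where C: "C > 0" "\<And>x y. \<bar>gauge_fun x - gauge_fun y\<bar> \<le> C * norm (x - y)"
    by (rule gauge_lipschitz) auto
  have "continuous_on UNIV gauge_fun"
    unfolding continuous_on_iff
  proof (intro ballI allI impI)
    fix x :: 'a and e :: real assume e: "0 < e"
    show "\<exists>d>0. \<forall>x'\<in>UNIV. dist x' x < d \<longrightarrow> dist (gauge_fun x') (gauge_fun x) < e"
    proof (intro exI conjI ballI impI)
      fix y assume "dist y x < e / C"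
      then have "C * norm (y - x) < e" using C by (simp add: dist_norm pos_less_divide_eq mult.commute)
      then show "dist (gauge_fun y) (gauge_fun x) < e"
        using C(2)[of y x] by (simp add: dist_real_def)
    qed (use e C in simp)
  qed
  then show ?thesis using assms by (rule continuous_on_compose2) auto
qed

lemma gauge_measurable [measurable]: "gauge_fun \<in> borel_measurable borel"
  by (intro borel_measurable_continuous_onI continuous_intros)

lemma gauge_pos: assumes "z \<noteq> 0" shows "gauge_fun z > 0"
proof -
  obtain R where R: "R > 0" "\<And>x. x \<in> K \<Longrightarrow> norm x \<le> R" by (rule K_bounded) auto
  let ?p = "(1 / (R * norm z)) *\<^sub>R z"
  have "?p \<in> polar"
    unfolding polar_def
  proof (intro CollectI ballI)
    fix x assume x: "x \<in> K"
    have "?p \<bullet> x \<le> norm ?p * norm x" by (rule norm_cauchy_schwarz)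
    also have "\<dots> \<le> norm ?p * R" using R x by (intro mult_left_mono) auto
    also have "\<dots> = 1" using R assms by simp
    finally show "?p \<bullet> x \<le> 1" .
  qed
  moreover have "?p \<bullet> z > 0" using R assms by simp
  ultimately show ?thesis using gauge_ge[of ?p z] by linarith
qed

text \<open>The bipolar theorem. A point outside \<open>K\<close> is cut off by a hyperplane that
  also misses 0, so its functional can be normalised to a point of the polar body with value above
  1.\<close>

lemma mem_K_iff: "z \<in> K \<longleftrightarrow> gauge_fun z \<le> 1"
proof
  assume "z \<in> K"
  moreover obtain p where "p \<in> polar" "gauge_fun z = p \<bullet> z" by (rule gauge_attained)
  ultimately show "gauge_fun z \<le> 1" by (simp add: polar_def)
next
  assume le: "gauge_fun z \<le> 1"
  show "z \<in> K"
  proof (rule ccontr)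
    assume "z \<notin> K"
    then obtain a b where ab: "a \<bullet> z < b" "\<And>x. x \<in> K \<Longrightarrow> b < a \<bullet> x"
      using separating_hyperplane_closed_point[OF convex_K compact_imp_closed[OF compact_K]] by metis
    have "0 \<in> K" using zero_interior interior_subset by blast
    then have b: "b < 0" using ab(2)[of 0] by simp
    let ?p = "(1 / b) *\<^sub>R a"
    have "?p \<bullet> x \<le> 1" if "x \<in> K" for x
      using ab(2)[OF that] b by (simp add: divide_le_eq)
    then have "?p \<in> polar" by (auto simp: polar_def)
    moreover have "?p \<bullet> z > 1" using ab(1) b by (simp add: less_divide_eq)
    ultimately show False using gauge_ge[of ?p z] le by linarith
  qed
qed

lemma mem_interior_iff: "z \<in> interior K \<longleftrightarrow> gauge_fun z < 1"
proof
  assume z: "z \<in> interior K"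
  show "gauge_fun z < 1"
  proof (cases "z = 0")
    case False
    obtain e where e: "e > 0" "cball z e \<subseteq> K" using z by (auto simp: mem_interior_cball)
    let ?t = "1 + e / norm z"
    have "?t *\<^sub>R z \<in> cball z e" using False e by (simp add: dist_norm algebra_simps)
    then have "gauge_fun (?t *\<^sub>R z) \<le> 1" using e mem_K_iff by blast
    then have "?t * gauge_fun z \<le> 1" using e False by (simp add: gauge_scale)
    moreover have "1 * gauge_fun z < ?t * gauge_fun z"
      using e False gauge_pos[OF False] by (intro mult_strict_right_mono) auto
    ultimately show ?thesis by linarith
  qed simp
next
  assume "gauge_fun z < 1"
  moreover have "open {z. gauge_fun z < 1}" by (intro open_Collect_less continuous_intros)
  moreover have "{z. gauge_fun z < 1} \<subseteq> K" by (auto simp: mem_K_iff)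
  ultimately show "z \<in> interior K" by (intro interiorI[of "{z. gauge_fun z < 1}"]) auto
qed

lemma mem_frontier_iff: "z \<in> frontier K \<longleftrightarrow> gauge_fun z = 1"
proof -
  have "frontier K = K - interior K"
    using compact_imp_closed[OF compact_K] by (simp add: frontier_def)
  then show ?thesis by (auto simp: mem_K_iff mem_interior_iff)
qed

section \<open>Outer normals as points of the polar body\<close>

lemma outer_unit_normal_inner_pos:
  assumes "outer_unit_normal K x u"
  shows "x \<bullet> u > 0"
proof -
  obtain r where r: "r > 0" "cball 0 r \<subseteq> K" by (rule ball_in_K)
  have u: "norm u = 1" "\<And>y. y \<in> K \<Longrightarrow> (y - x) \<bullet> u \<le> 0"
    using assms by (auto simp: outer_unit_normal_def)
  have "r *\<^sub>R u \<in> K" using r u by auto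
  then have "(r *\<^sub>R u) \<bullet> u \<le> x \<bullet> u" using u(2)[of "r *\<^sub>R u"] by (simp add: inner_diff_left)
  moreover have "(r *\<^sub>R u) \<bullet> u = r" using u(1) by (simp add: norm_eq_1)
  ultimately show ?thesis using r by simp
qed

text \<open>Together with \<open>polar_outer_unit_normal\<close>: up to length, the outer normals at
  a boundary point \<open>x\<close> are the points \<open>p\<close> of the polar body with
  \<open>p \<bullet> x = 1\<close>. Uniqueness of the normal thus becomes uniqueness of a
  maximiser.\<close>

lemma outer_unit_normal_polar:
  assumes "outer_unit_normal K x u"
  shows "(1 / (x \<bullet> u)) *\<^sub>R u \<in> polar"
proof -
  have "u \<bullet> y \<le> x \<bullet> u" if "y \<in> K" for y
    using assms that by (auto simp: outer_unit_normal_def inner_diff_left inner_commute[of u])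
  then show ?thesis
    using outer_unit_normal_inner_pos[OF assms] by (auto simp: polar_def)
qed

lemma polar_outer_unit_normal:
  assumes p: "p \<in> polar" "p \<bullet> x = 1"
  shows "outer_unit_normal K x ((1 / norm p) *\<^sub>R p)"
proof -
  have "p \<noteq> 0" using p by auto
  moreover have "(y - x) \<bullet> p \<le> 0" if "y \<in> K" for y
    using p that by (simp add: polar_def inner_diff_right inner_commute[of _ p])
  ultimately show ?thesis
    by (auto simp: outer_unit_normal_def divide_le_0_iff)
qed

lemma regular_boundaryI:
  assumes x: "gauge_fun x = 1"
    and uniq: "\<And>p q. p \<in> polar \<Longrightarrow> q \<in> polar \<Longrightarrow> p \<bullet> x = 1 \<Longrightarrow> q \<bullet> x = 1 \<Longrightarrow> p = q"
  shows "x \<in> regular_boundary K"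
proof -
  obtain p where p: "p \<in> polar" "gauge_fun x = p \<bullet> x" by (rule gauge_attained)
  have "outer_unit_normal K x ((1 / norm p) *\<^sub>R p)"
    using p x by (intro polar_outer_unit_normal) auto
  moreover have "u = v" if uv: "outer_unit_normal K x u" "outer_unit_normal K x v" for u v
  proof -
    have pos: "x \<bullet> u > 0" "x \<bullet> v > 0" using uv outer_unit_normal_inner_pos by auto
    have "(1 / (x \<bullet> u)) *\<^sub>R u = (1 / (x \<bullet> v)) *\<^sub>R v"
      using uv pos by (intro uniq outer_unit_normal_polar) (simp_all add: inner_commute)
    moreover have "norm u = 1" "norm v = 1" using uv by (auto simp: outer_unit_normal_def)
    ultimately have "1 / (x \<bullet> u) = 1 / (x \<bullet> v)"
      using pos by (metis abs_of_pos divide_pos_pos mult.right_neutral norm_scaleR zero_less_one)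
    with \<open>(1 / (x \<bullet> u)) *\<^sub>R u = (1 / (x \<bullet> v)) *\<^sub>R v\<close> show ?thesis using pos by simp
  qed
  ultimately show ?thesis
    using x by (auto simp: regular_boundary_def mem_frontier_iff)
qed

text \<open>Two maximisers with different values on \<open>b\<close> produce a kink of the gauge at
  \<open>z\<close>, so that the symmetric second difference in direction \<open>b\<close> is at
  least of first order in \<open>s\<close>. Integrated against a Lipschitz cutoff this difference is
  of second order in \<open>s\<close>. Hence kinks can occur on a null set only.\<close>

lemma AE_gauge_directional:
  assumes b: "norm b = 1"
  shows "AE z in lborel. \<forall>p\<in>polar. \<forall>q\<in>polar. p \<bullet> z = gauge_fun z \<longrightarrow> q \<bullet> z = gauge_fun z \<longrightarrow> p \<bullet> b \<le> q \<bullet> b"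
proof -
  obtain C where C: "C > 0" "\<And>x y. \<bar>gauge_fun x - gauge_fun y\<bar> \<le> C * norm (x - y)"
    by (rule gauge_lipschitz) auto
  define D where "D s z = gauge_fun (z + s *\<^sub>R b) + gauge_fun (z - s *\<^sub>R b) - 2 * gauge_fun z" for s z
  have D_ge: "s * (p \<bullet> b - q \<bullet> b) \<le> D s z"
    if "p \<in> polar" "q \<in> polar" "p \<bullet> z = gauge_fun z" "q \<bullet> z = gauge_fun z" "s \<ge> 0" for p q z s
    using gauge_ge[OF that(1), of "z + s *\<^sub>R b"] gauge_ge[OF that(2), of "z - s *\<^sub>R b"] that(3,4)
    by (simp add: D_def inner_add_right inner_diff_right algebra_simps)
  have D_nonneg: "0 \<le> D s z" if "s \<ge> 0" for s z
  proof -
    obtain p where p: "p \<in> polar" "gauge_fun z = p \<bullet> z" by (rule gauge_attained)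
    show ?thesis using D_ge[OF p(1) p(1) p(2)[symmetric] p(2)[symmetric] that] by simp
  qed
  have "AE z in lborel. norm z < R \<longrightarrow> (\<forall>p\<in>polar. \<forall>q\<in>polar. p \<bullet> z = gauge_fun z \<longrightarrow> q \<bullet> z = gauge_fun z \<longrightarrow> p \<bullet> b \<le> q \<bullet> b)"
    for R :: real
  proof -
    \<comment> \<open>A Lipschitz cutoff that is positive exactly on the open ball of radius
      \<open>R\<close>.\<close>
    define \<psi> where "\<psi> z = max 0 (R - norm z)" for z :: 'a
    have \<psi>_cont [continuous_intros]: "continuous_on S (\<lambda>x. \<psi> (f x))" if "continuous_on S f" for S :: "'a set" and f
      unfolding \<psi>_def using that by (intro continuous_intros)
    have \<psi>_lip: "\<bar>\<psi> x - \<psi> y\<bar> \<le> norm (x - y)" for x y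
      unfolding \<psi>_def using norm_triangle_ineq3[of x y] by linarith
    have [measurable]: "\<psi> \<in> borel_measurable borel"
      by (intro borel_measurable_continuous_onI continuous_intros)
    define V where "V = measure lborel (cball (0::'a) (R + 1))"
    have bound: "(\<integral>\<^sup>+z. ennreal (\<psi> z * (D s z / s)) \<partial>lborel) \<le> ennreal (C * s * V)" if s: "0 < s" "s \<le> 1" for s
    proof -
      let ?d = "\<lambda>z. gauge_fun (z + s *\<^sub>R b) - gauge_fun z"
      have out: "\<psi> z = 0" "\<psi> (z + s *\<^sub>R b) = 0" if "norm z > R + 1" for z
      proof -
        have "norm z \<le> norm (z + s *\<^sub>R b) + norm (s *\<^sub>R b)"
          using norm_triangle_ineq4[of "z + s *\<^sub>R b" "s *\<^sub>R b"] by simp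
        then show "\<psi> z = 0" "\<psi> (z + s *\<^sub>R b) = 0" using that s b by (auto simp: \<psi>_def max_def)
      qed
      have i1: "integrable lborel (\<lambda>z. \<psi> z * ?d z)" and i2: "integrable lborel (\<lambda>z. \<psi> (z + s *\<^sub>R b) * ?d z)"
        and i3: "integrable lborel (\<lambda>z. \<psi> z * ?d (z - s *\<^sub>R b))" and i4: "integrable lborel (\<lambda>z. \<psi> z * D s z)"
        using out unfolding D_def
        by (auto intro!: integrable_continuous_bounded_support[of _ "R + 1"] continuous_intros)
      \<comment> \<open>Summation by parts: translating one of the two first differences moves the
        outer difference onto \<open>\<psi>\<close>. Both \<open>\<psi>\<close> and the gauge are
        Lipschitz, so each factor contributes one power of \<open>s\<close>.\<close>
      have "(\<integral>z. \<psi> z * D s z \<partial>lborel) = (\<integral>z. \<psi> z * ?d z \<partial>lborel) - (\<integral>z. \<psi> z * ?d (z - s *\<^sub>R b) \<partial>lborel)"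
        by (subst Bochner_Integration.integral_diff[OF i1 i3, symmetric])
          (simp add: D_def algebra_simps)
      also have "(\<integral>z. \<psi> z * ?d (z - s *\<^sub>R b) \<partial>lborel) =
          (\<integral>z. \<psi> z * ?d (z - s *\<^sub>R b) \<partial>distr lborel borel ((+) (s *\<^sub>R b)))"
        by (simp only: lborel_distr_plus)
      also have "\<dots> = (\<integral>z. \<psi> (z + s *\<^sub>R b) * ?d z \<partial>lborel)"
        by (subst integral_distr) (simp_all add: add.commute)
      also have "(\<integral>z. \<psi> z * ?d z \<partial>lborel) - (\<integral>z. \<psi> (z + s *\<^sub>R b) * ?d z \<partial>lborel) =
          (\<integral>z. (\<psi> z - \<psi> (z + s *\<^sub>R b)) * ?d z \<partial>lborel)"
        by (subst Bochner_Integration.integral_diff[OF i1 i2, symmetric]) (simp add: left_diff_distrib)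
      also have "\<dots> \<le> (\<integral>z. C * s * s * indicator (cball (0::'a) (R + 1)) z \<partial>lborel)"
      proof (rule integral_mono)
        show "integrable lborel (\<lambda>z. (\<psi> z - \<psi> (z + s *\<^sub>R b)) * ?d z)"
          using Bochner_Integration.integrable_diff[OF i1 i2] by (simp add: left_diff_distrib)
        show "integrable lborel (\<lambda>z::'a. C * s * s * indicator (cball 0 (R + 1)) z)"
          by (intro integrable_mult_right integrable_real_indicator) (simp_all add: emeasure_lborel_cball_finite[simplified])
        fix z
        show "(\<psi> z - \<psi> (z + s *\<^sub>R b)) * ?d z \<le> C * s * s * indicator (cball 0 (R + 1)) z"
        proof (cases "norm z > R + 1")
          case True
          then show ?thesis using out by simp
        next
          case False
          have "\<bar>\<psi> z - \<psi> (z + s *\<^sub>R b)\<bar> \<le> s" "\<bar>?d z\<bar> \<le> C * s"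
            using \<psi>_lip[of z "z + s *\<^sub>R b"] C(2)[of "z + s *\<^sub>R b" z] s b by simp_all
          then have "\<bar>(\<psi> z - \<psi> (z + s *\<^sub>R b)) * ?d z\<bar> \<le> s * (C * s)"
            unfolding abs_mult by (intro mult_mono) auto
          then show ?thesis using False by (simp add: mult_ac abs_le_iff)
        qed
      qed
      also have "\<dots> = C * s * s * V" by (simp add: V_def)
      finally have le: "(\<integral>z. \<psi> z * D s z \<partial>lborel) \<le> C * s * s * V" .
      have "(\<integral>\<^sup>+z. ennreal (\<psi> z * (D s z / s)) \<partial>lborel) = ennreal (\<integral>z. \<psi> z * (D s z / s) \<partial>lborel)"
        using D_nonneg s i4 by (intro nn_integral_eq_integral) (auto simp: \<psi>_def)
      also have "(\<integral>z. \<psi> z * (D s z / s) \<partial>lborel) = (\<integral>z. \<psi> z * D s z \<partial>lborel) / s"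
        by simp
      also have "\<dots> \<le> C * s * V"
        using le s by (simp add: pos_divide_le_eq mult_ac)
      finally show ?thesis using ennreal_leI by simp
    qed
    let ?s = "\<lambda>k::nat. inverse (real (Suc k))"
    let ?g = "\<lambda>k z. ennreal (\<psi> z * (D (?s k) z / ?s k))"
    \<comment> \<open>Fatou's lemma: the integrals tend to 0, so the lower limit of the difference
      quotients is 0 almost everywhere.\<close>
    have "(\<integral>\<^sup>+z. liminf (\<lambda>k. ?g k z) \<partial>lborel) \<le> liminf (\<lambda>k. \<integral>\<^sup>+z. ?g k z \<partial>lborel)"
      by (rule nn_integral_liminf) (simp add: D_def)
    also have "\<dots> \<le> liminf (\<lambda>k. ennreal (C * ?s k * V))"
    proof (intro Liminf_mono always_eventually allI)
      fix k
      have "inverse (real (Suc k)) \<le> 1" by (simp add: inverse_le_1_iff)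
      then show "(\<integral>\<^sup>+z. ?g k z \<partial>lborel) \<le> ennreal (C * ?s k * V)"
        by (intro bound) simp_all
    qed
    also have "\<dots> = 0"
    proof -
      have "(\<lambda>k. C * ?s k * V) \<longlonglongrightarrow> C * 0 * V"
        by (intro tendsto_mult tendsto_const LIMSEQ_inverse_real_of_nat)
      then have "(\<lambda>k. ennreal (C * ?s k * V)) \<longlonglongrightarrow> ennreal (C * 0 * V)"
        by (rule tendsto_ennrealI)
      then show ?thesis by (simp add: lim_imp_Liminf)
    qed
    finally have "(\<integral>\<^sup>+z. liminf (\<lambda>k. ?g k z) \<partial>lborel) = 0" by simp
    then have "AE z in lborel. liminf (\<lambda>k. ?g k z) = 0"
      by (subst (asm) nn_integral_0_iff_AE) (simp_all add: D_def)
    then show ?thesis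
    proof eventually_elim
      case (elim z)
      show ?case
      proof (intro impI ballI)
        fix p q assume R: "norm z < R" and pq: "p \<in> polar" "q \<in> polar" "p \<bullet> z = gauge_fun z" "q \<bullet> z = gauge_fun z"
        have \<psi>: "\<psi> z > 0" using R by (simp add: \<psi>_def)
        have "ennreal (\<psi> z * (p \<bullet> b - q \<bullet> b)) \<le> ?g k z" for k
          using D_ge[OF pq, of "?s k"] \<psi>
          by (intro ennreal_leI mult_left_mono) (simp_all add: pos_le_divide_eq mult.commute del: of_nat_Suc)
        then have "ennreal (\<psi> z * (p \<bullet> b - q \<bullet> b)) \<le> liminf (\<lambda>k. ?g k z)"
          by (intro Liminf_bounded always_eventually) simp
        then have "\<psi> z * (p \<bullet> b - q \<bullet> b) \<le> 0" using elim by (simp add: ennreal_eq_0_iff)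
        then show "p \<bullet> b \<le> q \<bullet> b" using \<psi> by (simp add: mult_le_0_iff)
      qed
    qed
  qed
  then have "AE z in lborel. \<forall>R::nat. norm z < real R \<longrightarrow> (\<forall>p\<in>polar. \<forall>q\<in>polar. p \<bullet> z = gauge_fun z \<longrightarrow> q \<bullet> z = gauge_fun z \<longrightarrow> p \<bullet> b \<le> q \<bullet> b)"
    by (intro AE_all_countable[THEN iffD2] allI)
  then show ?thesis
  proof eventually_elim
    case (elim z)
    obtain R :: nat where "norm z < real R" using reals_Archimedean2 by blast
    with elim show ?case by blast
  qed
qed

section \<open>Radial projection and cones over boundary sets\<close>

definition radial :: "'a \<Rightarrow> 'a" where
  "radial z = z /\<^sub>R gauge_fun z"

lemma radial_measurable [measurable]: "radial \<in> borel_measurable borel"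
  unfolding radial_def by measurable

lemma radial_scale: "t > 0 \<Longrightarrow> radial (t *\<^sub>R z) = radial z"
  by (simp add: radial_def gauge_scale)

lemma gauge_radial: "z \<noteq> 0 \<Longrightarrow> gauge_fun (radial z) = 1"
  using gauge_pos[of z] by (simp add: radial_def gauge_scale)

lemma gauge_scaleR_radial: "gauge_fun z *\<^sub>R radial z = z"
  using gauge_pos[of z] by (cases "z = 0") (simp_all add: radial_def)

lemma radial_frontier: "gauge_fun x = 1 \<Longrightarrow> radial x = x"
  by (simp add: radial_def)

lemma AE_radial_regular: "AE z in lborel. radial z \<in> regular_boundary K"
proof -
  have "AE z in lborel. \<forall>b\<in>Basis. \<forall>p\<in>polar. \<forall>q\<in>polar.
      p \<bullet> z = gauge_fun z \<longrightarrow> q \<bullet> z = gauge_fun z \<longrightarrow> p \<bullet> b \<le> q \<bullet> b"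
    by (rule AE_finite_allI[OF finite_Basis]) (rule AE_gauge_directional[OF norm_Basis])
  moreover have "AE z in lborel. z \<noteq> (0::'a)" by (rule AE_lborel_singleton)
  ultimately show ?thesis
  proof eventually_elim
    case (elim z)
    have pos: "gauge_fun z > 0" by (rule gauge_pos) (rule elim(2))
    show ?case
    proof (rule regular_boundaryI)
      show "gauge_fun (radial z) = 1" using elim(2) by (rule gauge_radial)
      fix p q assume pq: "p \<in> polar" "q \<in> polar" "p \<bullet> radial z = 1" "q \<bullet> radial z = 1"
      then have *: "p \<bullet> z = gauge_fun z" "q \<bullet> z = gauge_fun z"
        using pos by (simp_all add: radial_def field_simps)
      show "p = q"
      proof (rule euclidean_eqI)
        fix b :: 'a assume b: "b \<in> Basis"
        show "p \<bullet> b = q \<bullet> b"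
          \<comment> \<open>Exchanging \<open>p\<close> and \<open>q\<close> turns the one-sided
            inequality into equality in each coordinate.\<close>
          using elim(1)[rule_format, OF b pq(1,2) *] elim(1)[rule_format, OF b pq(2,1) *(2,1)] by simp
      qed
    qed
  qed
qed

text \<open>For \<open>A\<close> in the frontier this is the union of the segments from the origin
  to \<open>A\<close>, without the apex, since \<open>radial 0 = 0\<close>.\<close>

definition cone :: "'a set \<Rightarrow> 'a set" where
  "cone A = K \<inter> radial -` A"

lemma cone_borel: "A \<in> sets borel \<Longrightarrow> cone A \<in> sets borel"
  unfolding cone_def using measurable_sets_borel[OF radial_measurable, of A]
  by (simp add: borel_compact compact_K sets.Int)

lemma emeasure_K_finite: "emeasure lborel K < \<infinity>"
  by (rule emeasure_compact_finite[OF compact_K])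

lemma emeasure_cone_regular: "emeasure lborel (cone (regular_boundary K)) = emeasure lborel K"
proof (rule emeasure_eq_AE)
  show "AE x in lborel. (x \<in> cone (regular_boundary K)) = (x \<in> K)"
    using AE_radial_regular by eventually_elim (auto simp: cone_def)
  show "cone (regular_boundary K) \<in> sets lborel"
    using cone_borel[OF regular_boundary_borel[OF compact_K]] by simp
  show "K \<in> sets lborel" using compact_K by (simp add: borel_compact)
qed

lemma emeasure_shell:
  assumes A: "A \<in> sets borel" and s: "0 < s" "s \<le> 1"
  shows "emeasure lborel {z. s < gauge_fun z \<and> gauge_fun z \<le> 1 \<and> radial z \<in> A} =
    ennreal (1 - s ^ DIM('a)) * emeasure lborel (cone A)"
proof -
  let ?B = "{z. z /\<^sub>R s \<in> cone A}"
  have B: "?B = {z. gauge_fun z \<le> s \<and> radial z \<in> A}"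
    using s by (auto simp: cone_def mem_K_iff gauge_scale radial_scale field_simps)
  have cA: "cone A \<in> sets borel" by (rule cone_borel[OF A])
  have mB: "?B \<in> sets borel"
    using measurable_sets_borel[of "\<lambda>z. z /\<^sub>R s" borel "cone A"] cA by (simp add: vimage_def)
  have eB: "emeasure lborel ?B = ennreal (s ^ DIM('a)) * emeasure lborel (cone A)"
    by (rule emeasure_lborel_vimage_scaleR[OF s(1) cA])
  have fin: "emeasure lborel (cone A) < \<infinity>"
    using emeasure_K_finite emeasure_mono[of "cone A" K lborel] compact_K
    by (auto simp: cone_def borel_compact intro: order_le_less_trans)
  have sub: "?B \<subseteq> cone A" unfolding B using s by (auto simp: cone_def mem_K_iff)
  have "{z. s < gauge_fun z \<and> gauge_fun z \<le> 1 \<and> radial z \<in> A} = cone A - ?B"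
    unfolding B by (auto simp: cone_def mem_K_iff)
  also have "emeasure lborel \<dots> = emeasure lborel (cone A) - emeasure lborel ?B"
    using cA mB sub fin eB by (intro emeasure_Diff) (auto simp: ennreal_mult_less_top less_top[symmetric] ennreal_mult_eq_top_iff)
  also have "\<dots> = ennreal (1 - s ^ DIM('a)) * emeasure lborel (cone A)"
  proof -
    obtain m where m: "0 \<le> m" "emeasure lborel (cone A) = ennreal m"
      using fin by (cases "emeasure lborel (cone A)") auto
    have "m - s ^ DIM('a) * m = (1 - s ^ DIM('a)) * m" by (simp add: left_diff_distrib)
    moreover have "s ^ DIM('a) \<le> 1" using s by (simp add: power_le_one)
    ultimately show ?thesis
      unfolding eB m(2) using m(1) s by (simp add: ennreal_mult[symmetric] ennreal_minus)
  qed
  finally show ?thesis .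
qed

end

section \<open>Cone-volume and Lebesgue measure of cones\<close>

text \<open>The hypothesis makes \<open>a i\<close> a well-defined function of \<open>b i\<close>,
  and this function is Lipschitz with constant \<open>L\<close>. Parametrising both sets by
  \<open>I\<close> allows a chart to be read in either direction.\<close>

lemma hausdorff_outer_lipschitz_param:
  fixes a b :: "'i \<Rightarrow> 'a::real_normed_vector"
  assumes L: "L > 0" and lip: "\<And>i j. i \<in> I \<Longrightarrow> j \<in> I \<Longrightarrow> norm (a i - a j) \<le> L * norm (b i - b j)"
  shows "hausdorff_outer k (a ` I) \<le> ennreal (L ^ k) * hausdorff_outer k (b ` I)"
proof -
  let ?f = "a \<circ> inv_into I b"
  have f: "?f (b i) = a i" if i: "i \<in> I" for i
  proof -
    have "inv_into I b (b i) \<in> I" "b (inv_into I b (b i)) = b i"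
      using i by (auto intro: inv_into_into f_inv_into_f)
    then have "norm (a (inv_into I b (b i)) - a i) \<le> L * 0"
      using lip[OF _ i] by (metis diff_self norm_zero)
    then show ?thesis by simp
  qed
  have "a ` I = ?f ` b ` I"
    unfolding image_image using f by (intro image_cong) auto
  also have "hausdorff_outer k \<dots> \<le> ennreal (L ^ k) * hausdorff_outer k (b ` I)"
  proof (rule hausdorff_outer_lipschitz_image[OF L])
    fix x y assume "x \<in> b ` I" "y \<in> b ` I"
    then obtain i j where "i \<in> I" "j \<in> I" "x = b i" "y = b j" by blast
    then show "dist (?f x) (?f y) \<le> L * dist x y"
      using f lip by (simp only: dist_norm)
  qed
  finally show ?thesis .
qed

text \<open>The Lipschitz bound for Hausdorff measure of full dimension carries over, since the
  factor to Lebesgue measure appears on both sides and cancels.\<close>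

lemma emeasure_lborel_lipschitz_param:
  fixes a b :: "'i \<Rightarrow> 'a::euclidean_space"
  assumes L: "L > 0" and lip: "\<And>i j. i \<in> I \<Longrightarrow> j \<in> I \<Longrightarrow> norm (a i - a j) \<le> L * norm (b i - b j)"
    and borel: "a ` I \<in> sets borel" "b ` I \<in> sets borel"
  shows "emeasure lborel (a ` I) \<le> ennreal (L ^ DIM('a)) * emeasure lborel (b ` I)"
proof -
  obtain c where c: "0 < c" "hausdorff_measure DIM('a) = density lborel (\<lambda>x::'a. ennreal c)"
    by (rule hausdorff_measure_eq_lborel)
  have eq: "hausdorff_outer DIM('a) A = ennreal c * emeasure lborel A" if "A \<in> sets borel" for A :: "'a set"
    using that by (simp add: emeasure_hausdorff_measure[symmetric] c emeasure_density_const)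
  have "hausdorff_outer DIM('a) (a ` I) \<le> ennreal (L ^ DIM('a)) * hausdorff_outer DIM('a) (b ` I)"
    by (rule hausdorff_outer_lipschitz_param[OF L lip])
  then have "ennreal c * emeasure lborel (a ` I) \<le> ennreal (L ^ DIM('a)) * (ennreal c * emeasure lborel (b ` I))"
    by (simp only: eq borel)
  then have "ennreal c * emeasure lborel (a ` I) \<le> ennreal c * (ennreal (L ^ DIM('a)) * emeasure lborel (b ` I))"
    by (simp only: mult.left_commute)
  then show ?thesis using c(1)
    by (subst (asm) ennreal_mult_le_mult_iff) auto
qed

context convex_body
begin

text \<open>The boundary points having some normal far from the one at \<open>x0\<close> form a
  compact set. It misses \<open>x0\<close>, where the normal is unique, so its complement is the
  neighbourhood sought.\<close>

lemma normal_at_continuous: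
  assumes x: "x0 \<in> regular_boundary K" and e: "e > 0"
  obtains U where "open U" "x0 \<in> U"
    "\<And>x. x \<in> U \<Longrightarrow> x \<in> regular_boundary K \<Longrightarrow> norm (normal_at K x - normal_at K x0) < e"
proof
  let ?C = "{u. e \<le> norm (u - normal_at K x0)}"
  let ?N = "{x \<in> frontier K. \<exists>u\<in>?C. outer_unit_normal K x u}"
  have "closed ?C" by (intro closed_Collect_le continuous_intros)
  then have "compact ?N" by (rule compact_normal_pairs[OF compact_K])
  then show "open (- ?N)" by (simp add: compact_imp_closed open_Compl)
  show "x0 \<in> - ?N" using normal_at_eq[OF x] e by auto
  fix x assume "x \<in> - ?N" "x \<in> regular_boundary K"
  then show "norm (normal_at K x - normal_at K x0) < e"
    using normal_at_eq[of x K] by (auto simp: regular_boundary_def not_le)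
qed

lemma outer_unit_normal_at:
  assumes "x \<in> regular_boundary K" shows "outer_unit_normal K x (normal_at K x)"
  using normal_at_eq[OF assms] by blast

definition cone_measure :: "'a measure" where
  "cone_measure = distr (density lborel (indicator K)) borel radial"

text \<open>The cone-volume measure before passing to normals. It lives on boundary points, where it
  can be compared set by set with \<open>cone_measure\<close>; the two turn out to be proportional
  on the regular boundary.\<close>

definition boundary_measure :: "'a measure" where
  "boundary_measure = density (hausdorff_measure (DIM('a) - 1))
     (\<lambda>x. indicator (regular_boundary K) x * ennreal (x \<bullet> normal_at K x / real DIM('a)))"

lemma sets_cone_measure [simp, measurable_cong]: "sets cone_measure = sets borel"
  and sets_boundary_measure [simp, measurable_cong]: "sets boundary_measure = sets borel"
  and space_cone_measure [simp]: "space cone_measure = UNIV"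
  and space_boundary_measure [simp]: "space boundary_measure = UNIV"
  by (simp_all add: cone_measure_def boundary_measure_def space_density)

lemma emeasure_cone_measure:
  assumes "A \<in> sets borel"
  shows "emeasure cone_measure A = emeasure lborel (cone A)"
proof -
  have K: "K \<in> sets borel" using compact_K by (simp add: borel_compact)
  have A: "radial -` A \<in> sets borel" using measurable_sets_borel[OF radial_measurable assms] by simp
  have "emeasure cone_measure A = emeasure (density lborel (indicator K)) (radial -` A)"
    using assms unfolding cone_measure_def by (subst emeasure_distr) (simp_all add: space_density)
  also have "\<dots> = (\<integral>\<^sup>+x. indicator K x * indicator (radial -` A) x \<partial>lborel)"
    using K A by (intro emeasure_density) simp_all
  also have "\<dots> = (\<integral>\<^sup>+x. indicator (cone A) x \<partial>lborel)"
    by (simp only: indicator_inter_arith cone_def)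
  also have "\<dots> = emeasure lborel (cone A)"
    using cone_borel[OF assms] by simp
  finally show ?thesis .
qed

lemma emeasure_cone_measure_finite: "emeasure cone_measure A < \<infinity>"
proof -
  have "emeasure cone_measure A \<le> emeasure cone_measure UNIV"
    by (rule emeasure_mono) simp_all
  also have "\<dots> = emeasure lborel K"
    by (subst emeasure_cone_measure) (simp_all add: cone_def)
  also have "\<dots> < \<infinity>" by (rule emeasure_K_finite)
  finally show ?thesis .
qed

lemma boundary_density_measurable:
  "(\<lambda>x. indicator (regular_boundary K) x * ennreal (x \<bullet> normal_at K x / real DIM('a))) \<in> borel_measurable borel"
proof -
  note [measurable] = normal_at_measurable[OF compact_K] regular_boundary_borel[OF compact_K]
  have "(\<lambda>x. indicator (regular_boundary K) x *
      ennreal (x \<bullet> (if x \<in> regular_boundary K then normal_at K x else 0) / real DIM('a))) \<in> borel_measurable borel"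
    by measurable
  also have "(\<lambda>x. indicator (regular_boundary K) x *
      ennreal (x \<bullet> (if x \<in> regular_boundary K then normal_at K x else 0) / real DIM('a))) =
      (\<lambda>x. indicator (regular_boundary K) x * ennreal (x \<bullet> normal_at K x / real DIM('a)))"
    by (auto simp: indicator_def)
  finally show ?thesis .
qed

lemma emeasure_boundary_measure:
  assumes "A \<in> sets borel" "A \<subseteq> regular_boundary K"
  shows "emeasure boundary_measure A =
    (\<integral>\<^sup>+x. ennreal (x \<bullet> normal_at K x / real DIM('a)) * indicator A x \<partial>hausdorff_measure (DIM('a) - 1))"
proof -
  have "emeasure boundary_measure A = (\<integral>\<^sup>+x. indicator (regular_boundary K) x *
      ennreal (x \<bullet> normal_at K x / real DIM('a)) * indicator A x \<partial>hausdorff_measure (DIM('a) - 1))"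
    unfolding boundary_measure_def using boundary_density_measurable assms
    by (intro emeasure_density) (simp_all cong: measurable_cong_sets)
  also have "\<dots> = (\<integral>\<^sup>+x. ennreal (x \<bullet> normal_at K x / real DIM('a)) * indicator A x \<partial>hausdorff_measure (DIM('a) - 1))"
    using assms(2) by (intro nn_integral_cong) (auto simp: indicator_def)
  finally show ?thesis .
qed

lemma emeasure_boundary_measure_bounds:
  assumes A: "A \<in> sets borel" "A \<subseteq> regular_boundary K"
    and bounds: "\<And>x. x \<in> A \<Longrightarrow> l \<le> x \<bullet> normal_at K x \<and> x \<bullet> normal_at K x \<le> m" and l: "0 \<le> l" "0 \<le> m"
  shows "ennreal (l / real DIM('a)) * hausdorff_outer (DIM('a) - 1) A \<le> emeasure boundary_measure A"
    and "emeasure boundary_measure A \<le> ennreal (m / real DIM('a)) * hausdorff_outer (DIM('a) - 1) A"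
proof -
  let ?H = "hausdorff_measure (DIM('a) - 1) :: 'a measure"
  have c: "(\<integral>\<^sup>+x. ennreal r * indicator A x \<partial>?H) = ennreal r * hausdorff_outer (DIM('a) - 1) A" for r
    using A by (subst nn_integral_cmult) (simp_all add: emeasure_hausdorff_measure)
  show "ennreal (l / real DIM('a)) * hausdorff_outer (DIM('a) - 1) A \<le> emeasure boundary_measure A"
    unfolding c[symmetric] emeasure_boundary_measure[OF A]
    using bounds by (intro nn_integral_mono) (auto simp: indicator_def intro!: ennreal_leI divide_right_mono)
  show "emeasure boundary_measure A \<le> ennreal (m / real DIM('a)) * hausdorff_outer (DIM('a) - 1) A"
    unfolding c[symmetric] emeasure_boundary_measure[OF A]
    using bounds by (intro nn_integral_mono) (auto simp: indicator_def intro!: ennreal_leI divide_right_mono)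
qed

end

text \<open>\<open>A\<close> joins two points of the shell, \<open>B\<close> the corresponding
  points of the slab over the tangent hyperplane with edge \<open>\<eta> *\<^sub>R x0\<close>. Their
  difference has three terms, all small compared with \<open>norm B\<close>: the normal component of
  \<open>x - y\<close>, the contraction of \<open>x - y\<close> by at most \<open>\<eta>\<close>,
  and the displacement of \<open>y\<close> from \<open>x0\<close>.\<close>

lemma shell_slab_near_isometry:
  fixes x y u x0 :: "'a::real_inner" and s t \<eta> \<theta> h :: real
  assumes u: "norm u = 1" and h: "h = x0 \<bullet> u" "h > 0" and \<eta>: "0 < \<eta>" "\<eta> \<le> 1/2"
    and \<theta>: "\<eta> * (4 * (1 + norm x0 / h) + 1 / h) \<le> \<theta>"
    and y: "norm (y - x0) \<le> \<eta>" and flat: "\<bar>(x - y) \<bullet> u\<bar> \<le> \<eta> * norm (x - y)" and s: "0 \<le> s" "s \<le> 1"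
  defines "A \<equiv> (1 - \<eta> + \<eta> * s) *\<^sub>R x - (1 - \<eta> + \<eta> * t) *\<^sub>R y"
    and "B \<equiv> (x - (x \<bullet> u) *\<^sub>R u + s *\<^sub>R (\<eta> *\<^sub>R x0)) - (y - (y \<bullet> u) *\<^sub>R u + t *\<^sub>R (\<eta> *\<^sub>R x0))"
  shows "norm (A - B) \<le> \<theta> * norm B"
proof -
  define p where "p = (x - (x \<bullet> u) *\<^sub>R u) - (y - (y \<bullet> u) *\<^sub>R u)"
  have uu: "u \<bullet> u = 1" using u by (simp add: norm_eq_1)
  have pu: "p \<bullet> u = 0" by (simp add: p_def inner_diff_left uu)
  have xy: "x - y = p + ((x - y) \<bullet> u) *\<^sub>R u" by (simp add: p_def inner_diff_left scaleR_diff_left)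
  have B: "B = p + ((s - t) * \<eta>) *\<^sub>R x0" by (simp add: B_def p_def algebra_simps)
  have Bu: "B \<bullet> u = (s - t) * \<eta> * h" by (simp add: B inner_add_left pu h)
  \<comment> \<open>The normal component of \<open>B\<close> comes from \<open>x0\<close> alone, so
    \<open>norm B\<close> controls the difference of the two heights.\<close>
  have "\<bar>B \<bullet> u\<bar> \<le> norm B" using Cauchy_Schwarz_ineq2[of B u] u by simp
  then have st: "\<eta> * \<bar>s - t\<bar> \<le> norm B / h"
    unfolding Bu using h(2) \<eta> by (simp add: abs_mult pos_le_divide_eq mult_ac)
  have "norm p \<le> norm B + \<eta> * \<bar>s - t\<bar> * norm x0"
  proof -
    have "p = B - ((s - t) * \<eta>) *\<^sub>R x0" by (simp add: B)
    then have "norm p \<le> norm B + norm (((s - t) * \<eta>) *\<^sub>R x0)" by (metis norm_triangle_ineq4)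
    then show ?thesis using \<eta> by (simp add: abs_mult mult_ac)
  qed
  also have "\<dots> \<le> norm B + norm B / h * norm x0"
    using st by (intro add_left_mono mult_right_mono) auto
  finally have p: "norm p \<le> norm B * (1 + norm x0 / h)" by (simp add: algebra_simps)
  have "norm (x - y) \<le> norm p + \<bar>(x - y) \<bullet> u\<bar>"
    using norm_triangle_ineq[of p "((x - y) \<bullet> u) *\<^sub>R u"] xy u by simp
  also have "\<dots> \<le> norm p + 1/2 * norm (x - y)"
    using flat \<eta>(2) mult_right_mono[OF \<eta>(2), of "norm (x - y)"] by simp
  finally have nxy: "norm (x - y) \<le> 2 * norm p" by simp
  have "A - B = ((x - y) \<bullet> u) *\<^sub>R u + (- \<eta> + \<eta> * s) *\<^sub>R (x - y) + (\<eta> * (s - t)) *\<^sub>R (y - x0)"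
  proof -
    have "A - B = (x - y) - p + (- \<eta> + \<eta> * s) *\<^sub>R (x - y) + (\<eta> * (s - t)) *\<^sub>R (y - x0)"
      by (simp add: A_def B algebra_simps)
    also have "(x - y) - p = ((x - y) \<bullet> u) *\<^sub>R u" using xy by (metis add_diff_cancel_left')
    finally show ?thesis .
  qed
  then have "norm (A - B) \<le> norm (((x - y) \<bullet> u) *\<^sub>R u) + norm ((- \<eta> + \<eta> * s) *\<^sub>R (x - y)) + norm ((\<eta> * (s - t)) *\<^sub>R (y - x0))"
    by (metis norm_triangle_le norm_triangle_ineq add_right_mono)
  also have "\<dots> \<le> \<eta> * norm (x - y) + \<eta> * norm (x - y) + \<eta> * \<bar>s - t\<bar> * \<eta>"
  proof (intro add_mono)
    show "norm (((x - y) \<bullet> u) *\<^sub>R u) \<le> \<eta> * norm (x - y)" using flat u by simp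
    have "- \<eta> + \<eta> * s = - (\<eta> * (1 - s))" by (simp add: algebra_simps)
    then have "\<bar>- \<eta> + \<eta> * s\<bar> = \<eta> * (1 - s)" using \<eta> s by simp
    also have "\<dots> \<le> \<eta>" using \<eta> s by (simp add: mult_left_le)
    finally show "norm ((- \<eta> + \<eta> * s) *\<^sub>R (x - y)) \<le> \<eta> * norm (x - y)" by (simp add: mult_right_mono)
    show "norm ((\<eta> * (s - t)) *\<^sub>R (y - x0)) \<le> \<eta> * \<bar>s - t\<bar> * \<eta>"
      using y \<eta> by (simp add: abs_mult mult_left_mono)
  qed
  \<comment> \<open>The bound required of \<open>\<theta>\<close> originates here: the first two
    terms use \<open>norm (x - y) \<le> 2 * norm p\<close>, the third uses the estimate of the
    heights.\<close>
  also have "\<dots> \<le> \<eta> * (2 * (norm B * (1 + norm x0 / h))) + \<eta> * (2 * (norm B * (1 + norm x0 / h))) + norm B / h * \<eta>"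
    using nxy p st \<eta> by (intro add_mono mult_left_mono mult_right_mono) auto
  also have "\<dots> = \<eta> * (4 * (1 + norm x0 / h) + 1 / h) * norm B" by (simp add: algebra_simps)
  also have "\<dots> \<le> \<theta> * norm B" using \<theta> by (intro mult_right_mono) auto
  finally show ?thesis .
qed

text \<open>The choice of \<open>\<theta>\<close> gives \<open>1 - \<theta> = 1 / L\<close> exactly,
  and \<open>1 + \<theta> \<le> L\<close> because \<open>L + 1 / L \<ge> 2\<close>. Thus the same
  factor \<open>L\<close> works in both directions.\<close>

lemma norm_near_isometry:
  fixes A B :: "'a::real_normed_vector"
  assumes "norm (A - B) \<le> \<theta> * norm B" and L: "L > 1" "\<theta> = 1 - 1 / L"
  shows "norm A \<le> L * norm B" "norm B \<le> L * norm A"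
proof -
  have \<theta>: "1 + \<theta> \<le> L"
  proof -
    have "0 \<le> (L - 1)\<^sup>2 / L" using L by simp
    also have "(L - 1)\<^sup>2 / L = L - 2 + 1 / L" using L by (simp add: power2_eq_square field_simps)
    finally show ?thesis using L(2) by simp
  qed
  have "norm A \<le> norm B + norm (A - B)" using norm_triangle_ineq[of B "A - B"] by simp
  also have "\<dots> \<le> (1 + \<theta>) * norm B" using assms(1) by (simp add: distrib_right)
  also have "\<dots> \<le> L * norm B" using \<theta> by (intro mult_right_mono) auto
  finally show "norm A \<le> L * norm B" .
  have "norm B \<le> norm A + norm (A - B)" using norm_triangle_ineq4[of A "A - B"] by simp
  then have "(1 - \<theta>) * norm B \<le> norm A" using assms(1) by (simp add: left_diff_distrib)
  then have "(1 / L) * norm B \<le> norm A" by (simp add: L(2))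
  then show "norm B \<le> L * norm A" using L by (simp add: pos_divide_le_eq mult.commute)
qed

context convex_body
begin

text \<open>Near a regular boundary point the shell between \<open>(1 - \<delta>) K\<close> and \<open>K\<close> is almost isometric to
  a slanted slab over the tangent hyperplane.\<close>

lemma local_chart:
  assumes x0: "x0 \<in> regular_boundary K" and L: "L > 1"
  defines "u \<equiv> normal_at K x0"
  defines "h \<equiv> x0 \<bullet> u"
  obtains U \<delta> where "open U" "x0 \<in> U" "0 < \<delta>" "real DIM('a) * \<delta> \<le> 1 - 1 / L" "\<delta> * L < 1"
    "\<And>x. x \<in> U \<inter> regular_boundary K \<Longrightarrow> h / L \<le> x \<bullet> normal_at K x \<and> x \<bullet> normal_at K x \<le> h * L"
    "\<And>x y. x \<in> U \<inter> regular_boundary K \<Longrightarrow> y \<in> U \<inter> regular_boundary K \<Longrightarrow>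
      norm (x - y) \<le> L * norm ((x - (x \<bullet> u) *\<^sub>R u) - (y - (y \<bullet> u) *\<^sub>R u))"
    "\<And>x y s t. x \<in> U \<inter> regular_boundary K \<Longrightarrow> y \<in> U \<inter> regular_boundary K \<Longrightarrow>
      0 \<le> s \<Longrightarrow> s \<le> 1 \<Longrightarrow>
      norm ((1 - \<delta> + \<delta> * s) *\<^sub>R x - (1 - \<delta> + \<delta> * t) *\<^sub>R y) \<le>
        L * norm ((x - (x \<bullet> u) *\<^sub>R u + s *\<^sub>R (\<delta> *\<^sub>R x0)) - (y - (y \<bullet> u) *\<^sub>R u + t *\<^sub>R (\<delta> *\<^sub>R x0))) \<and>
      norm ((x - (x \<bullet> u) *\<^sub>R u + s *\<^sub>R (\<delta> *\<^sub>R x0)) - (y - (y \<bullet> u) *\<^sub>R u + t *\<^sub>R (\<delta> *\<^sub>R x0))) \<le>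
        L * norm ((1 - \<delta> + \<delta> * s) *\<^sub>R x - (1 - \<delta> + \<delta> * t) *\<^sub>R y)"
proof -
  have nu: "outer_unit_normal K x0 u" unfolding u_def by (rule outer_unit_normal_at[OF x0])
  then have u: "norm u = 1" by (simp add: outer_unit_normal_def)
  then have uu: "u \<bullet> u = 1" by (simp add: norm_eq_1)
  have h: "h > 0" unfolding h_def by (rule outer_unit_normal_inner_pos[OF nu])
  define \<theta> where "\<theta> = 1 - 1 / L"
  have \<theta>: "0 < \<theta>" "\<theta> < 1" using L by (auto simp: \<theta>_def)
  have \<theta>L: "1 - \<theta> = 1 / L" by (simp add: \<theta>_def)
  define M where "M = 4 * (1 + norm x0 / h) + 1 / h"
  have M: "M > 0" using h by (auto simp: M_def intro!: add_pos_nonneg)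
  \<comment> \<open>One bound for each use: \<open>1/2\<close> and \<open>\<theta> / M\<close> for
    the near isometry, \<open>\<theta> / real DIM('a)\<close> for the Bernoulli estimate of shell
    volumes, \<open>1 / (2 * L)\<close> for \<open>\<delta> * L < 1\<close>, and the last one for
    the values \<open>x \<bullet> normal_at K x\<close>.\<close>
  define \<eta> where "\<eta> = Min {1/2, \<theta> / M, \<theta> / real DIM('a), 1 / (2 * L), h * \<theta> / (norm x0 + 2)}"
  have le: "\<eta> \<le> 1/2" "\<eta> \<le> \<theta> / M" "\<eta> \<le> \<theta> / real DIM('a)" "\<eta> \<le> 1 / (2 * L)" "\<eta> \<le> h * \<theta> / (norm x0 + 2)"
    unfolding \<eta>_def by (rule Min_le, simp, simp)+
  have n2: "norm x0 + 2 > 0" by (rule add_nonneg_pos) auto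
  have "0 < \<eta>" unfolding \<eta>_def using h \<theta> M L n2 by (subst Min_gr_iff) auto
  have \<eta>M: "\<eta> * M \<le> \<theta>" using le(2) M by (simp add: pos_le_divide_eq)
  have \<eta>n: "real DIM('a) * \<eta> \<le> \<theta>" using le(3) by (simp add: pos_le_divide_eq mult.commute)
  have \<eta>L: "\<eta> * L < 1" using le(4) L \<open>0 < \<eta>\<close> by (simp add: pos_le_divide_eq)
  have \<eta>h: "\<eta> * (norm x0 + 2) \<le> h * \<theta>" using le(5) n2 by (simp add: pos_le_divide_eq)
  have "1 * \<eta> \<le> real DIM('a) * \<eta>" using \<open>0 < \<eta>\<close> DIM_positive[where 'a='a] by (intro mult_right_mono) auto
  then have \<eta>\<theta>: "\<eta> \<le> \<theta>" using \<eta>n by simp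
  obtain V where V: "open V" "x0 \<in> V"
    "\<And>x. x \<in> V \<Longrightarrow> x \<in> regular_boundary K \<Longrightarrow> norm (normal_at K x - u) < \<eta>"
    using normal_at_continuous[OF x0 \<open>0 < \<eta>\<close>] unfolding u_def by blast
  define U where "U = V \<inter> ball x0 \<eta>"
  have close: "norm (x - x0) < \<eta>" "norm (normal_at K x - u) < \<eta>" "outer_unit_normal K x (normal_at K x)" "x \<in> K"
    if "x \<in> U \<inter> regular_boundary K" for x
    using that V(3)[of x] outer_unit_normal_at[of x] frontier_subset_compact[OF compact_K]
    by (auto simp: U_def dist_norm norm_minus_commute regular_boundary_def)
  have flat: "\<bar>(x - y) \<bullet> u\<bar> \<le> \<eta> * norm (x - y)"
    if xy: "x \<in> U \<inter> regular_boundary K" "y \<in> U \<inter> regular_boundary K" for x y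
  proof -
    \<comment> \<open>The normal at \<open>a\<close> supports \<open>K\<close>, which contains
      \<open>b\<close>, and it is within \<open>\<eta>\<close> of \<open>u\<close>. Exchanging the
      two points bounds the other sign.\<close>
    have *: "(b - a) \<bullet> u \<le> \<eta> * norm (b - a)"
      if ab: "a \<in> U \<inter> regular_boundary K" "b \<in> U \<inter> regular_boundary K" for a b
    proof -
      have "(b - a) \<bullet> normal_at K a \<le> 0"
        using close(3)[OF ab(1)] close(4)[OF ab(2)] by (simp add: outer_unit_normal_def)
      then have "(b - a) \<bullet> u \<le> (b - a) \<bullet> (u - normal_at K a)" by (simp add: inner_diff_right)
      also have "\<dots> \<le> norm (b - a) * norm (u - normal_at K a)" by (rule norm_cauchy_schwarz)
      also have "\<dots> \<le> norm (b - a) * \<eta>"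
        using close(2)[OF ab(1)] by (intro mult_left_mono) (auto simp: norm_minus_commute)
      finally show ?thesis by (simp add: mult.commute)
    qed
    have "(y - x) \<bullet> u = - ((x - y) \<bullet> u)" by (simp add: inner_diff_left)
    then show ?thesis using *[OF xy] *[OF xy(2,1)] by (simp add: abs_le_iff norm_minus_commute)
  qed
  show ?thesis
  proof (rule that[of U \<eta>])
    show "open U" "x0 \<in> U" using V \<open>0 < \<eta>\<close> by (auto simp: U_def)
    show "0 < \<eta>" "real DIM('a) * \<eta> \<le> 1 - 1 / L" "\<eta> * L < 1"
      using \<open>0 < \<eta>\<close> \<eta>n \<eta>L by (auto simp: \<theta>_def)
  next
    fix x assume x: "x \<in> U \<inter> regular_boundary K"
    have "x \<bullet> normal_at K x - h = x \<bullet> (normal_at K x - u) + (x - x0) \<bullet> u"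
      by (simp add: h_def inner_diff_left inner_diff_right)
    then have "\<bar>x \<bullet> normal_at K x - h\<bar> \<le> norm x * norm (normal_at K x - u) + norm (x - x0) * norm u"
      using Cauchy_Schwarz_ineq2[of x "normal_at K x - u"] Cauchy_Schwarz_ineq2[of "x - x0" u] by linarith
    also have "\<dots> \<le> (norm x0 + 1) * \<eta> + \<eta> * 1"
    proof (intro add_mono mult_mono)
      have "norm x \<le> norm x0 + norm (x - x0)" using norm_triangle_sub by blast
      then show "norm x \<le> norm x0 + 1" using close(1)[OF x] le(1) by linarith
    qed (use close[OF x] u \<open>0 < \<eta>\<close> in auto)
    also have "\<dots> = \<eta> * (norm x0 + 2)" by (simp add: algebra_simps)
    also note \<eta>h
    finally have *: "\<bar>x \<bullet> normal_at K x - h\<bar> \<le> h * \<theta>" .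
    then have "h * (1 - \<theta>) \<le> x \<bullet> normal_at K x" "x \<bullet> normal_at K x \<le> h * (1 + \<theta>)"
      by (auto simp: abs_le_iff algebra_simps)
    moreover have "1 + \<theta> \<le> L"
    proof -
      have "0 \<le> (L - 1)\<^sup>2 / L" using L by simp
      also have "(L - 1)\<^sup>2 / L = L - 2 + 1 / L" using L by (simp add: power2_eq_square field_simps)
      finally show ?thesis by (simp add: \<theta>_def)
    qed
    then have "h * (1 + \<theta>) \<le> h * L" using h by (intro mult_left_mono) auto
    ultimately show "h / L \<le> x \<bullet> normal_at K x \<and> x \<bullet> normal_at K x \<le> h * L" by (simp add: \<theta>L)
  next
    fix x y assume xy: "x \<in> U \<inter> regular_boundary K" "y \<in> U \<inter> regular_boundary K"
    let ?p = "(x - (x \<bullet> u) *\<^sub>R u) - (y - (y \<bullet> u) *\<^sub>R u)"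
    have "norm (?p - (x - y)) = \<bar>(x - y) \<bullet> u\<bar>"
    proof -
      have "?p - (x - y) = - (((x - y) \<bullet> u) *\<^sub>R u)" by (simp add: inner_diff_left algebra_simps)
      then show ?thesis using u by simp
    qed
    also have "\<dots> \<le> \<theta> * norm (x - y)"
      using flat[OF xy] mult_right_mono[OF \<eta>\<theta> norm_ge_zero, of "x - y"] by linarith
    finally show "norm (x - y) \<le> L * norm ?p"
      using norm_near_isometry(2)[of ?p "x - y", OF _ L \<theta>_def] by simp
  next
    fix x y :: 'a and s t :: real
    assume xy: "x \<in> U \<inter> regular_boundary K" "y \<in> U \<inter> regular_boundary K" and s: "0 \<le> s" "s \<le> 1"
    let ?A = "(1 - \<eta> + \<eta> * s) *\<^sub>R x - (1 - \<eta> + \<eta> * t) *\<^sub>R y"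
    let ?B = "(x - (x \<bullet> u) *\<^sub>R u + s *\<^sub>R (\<eta> *\<^sub>R x0)) - (y - (y \<bullet> u) *\<^sub>R u + t *\<^sub>R (\<eta> *\<^sub>R x0))"
    have "norm (?A - ?B) \<le> \<theta> * norm ?B"
      using close(1)[OF xy(2)] \<eta>M unfolding M_def
      by (intro shell_slab_near_isometry[OF u h_def[THEN meta_eq_to_obj_eq] h \<open>0 < \<eta>\<close> le(1) _ _ flat[OF xy] s]) auto
    then show "norm ?A \<le> L * norm ?B \<and> norm ?B \<le> L * norm ?A"
      using norm_near_isometry[OF _ L \<theta>_def] by blast
  qed
qed

text \<open>The exponents are not optimised; only their independence of \<open>L\<close> matters.\<close>

lemma local_comparison_compact:
  assumes slab: "\<forall>u w B. norm u = 1 \<and> 0 < w \<bullet> u \<and> compact B \<and> (\<forall>p\<in>B. p \<bullet> u = 0) \<longrightarrow>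
      hausdorff_outer (DIM('a) - 1) B * ennreal (w \<bullet> u) =
      ennreal c * emeasure lborel {p + s *\<^sub>R w |p s. p \<in> (B :: 'a set) \<and> s \<in> {0..1}}"
    and c: "0 \<le> c" and x0: "x0 \<in> regular_boundary K" and L: "L > 1"
  obtains U where "open U" "x0 \<in> U" "emeasure boundary_measure (U \<inter> regular_boundary K) < \<infinity>"
    "\<And>C. compact C \<Longrightarrow> C \<subseteq> U \<inter> regular_boundary K \<Longrightarrow>
      emeasure boundary_measure C \<le> ennreal (L ^ (2 * DIM('a) + 2) * c) * emeasure cone_measure C \<and>
      ennreal c * emeasure cone_measure C \<le> ennreal (L ^ (2 * DIM('a) + 2)) * emeasure boundary_measure C"
proof -
  let ?n = "DIM('a)" and ?R = "regular_boundary K"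
  define u where "u = normal_at K x0"
  define h where "h = x0 \<bullet> u"
  have nu: "outer_unit_normal K x0 u" unfolding u_def by (rule outer_unit_normal_at[OF x0])
  then have u: "norm u = 1" by (simp add: outer_unit_normal_def)
  then have uu: "u \<bullet> u = 1" by (simp add: norm_eq_1)
  have h: "h > 0" unfolding h_def by (rule outer_unit_normal_inner_pos[OF nu])
  obtain U \<delta> where U: "open U" "x0 \<in> U" and \<delta>: "0 < \<delta>" "real ?n * \<delta> \<le> 1 - 1 / L" "\<delta> * L < 1"
    and hb: "\<And>x. x \<in> U \<inter> ?R \<Longrightarrow> h / L \<le> x \<bullet> normal_at K x \<and> x \<bullet> normal_at K x \<le> h * L"
    and proj: "\<And>x y. x \<in> U \<inter> ?R \<Longrightarrow> y \<in> U \<inter> ?R \<Longrightarrow>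
      norm (x - y) \<le> L * norm ((x - (x \<bullet> u) *\<^sub>R u) - (y - (y \<bullet> u) *\<^sub>R u))"
    and chart: "\<And>x y s t. x \<in> U \<inter> ?R \<Longrightarrow> y \<in> U \<inter> ?R \<Longrightarrow> 0 \<le> s \<Longrightarrow> s \<le> 1 \<Longrightarrow>
      norm ((1 - \<delta> + \<delta> * s) *\<^sub>R x - (1 - \<delta> + \<delta> * t) *\<^sub>R y) \<le>
        L * norm ((x - (x \<bullet> u) *\<^sub>R u + s *\<^sub>R (\<delta> *\<^sub>R x0)) - (y - (y \<bullet> u) *\<^sub>R u + t *\<^sub>R (\<delta> *\<^sub>R x0))) \<and>
      norm ((x - (x \<bullet> u) *\<^sub>R u + s *\<^sub>R (\<delta> *\<^sub>R x0)) - (y - (y \<bullet> u) *\<^sub>R u + t *\<^sub>R (\<delta> *\<^sub>R x0))) \<le>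
        L * norm ((1 - \<delta> + \<delta> * s) *\<^sub>R x - (1 - \<delta> + \<delta> * t) *\<^sub>R y)"
    using local_chart[OF x0 L] unfolding u_def h_def by metis
  define \<pi> where "\<pi> x = x - (x \<bullet> u) *\<^sub>R u" for x
  have \<pi>u: "\<pi> x \<bullet> u = 0" for x by (simp add: \<pi>_def inner_diff_left uu)
  have \<pi>_diff: "\<pi> x - \<pi> y = \<pi> (x - y)" for x y
    by (simp add: \<pi>_def inner_diff_left algebra_simps)
  have \<pi>_le: "norm (\<pi> x) \<le> norm x" for x
  proof -
    have "x \<bullet> x = \<pi> x \<bullet> \<pi> x + (x \<bullet> u)\<^sup>2"
      by (simp add: \<pi>_def inner_diff_left inner_diff_right uu power2_eq_square inner_commute)
    then have "(norm (\<pi> x))\<^sup>2 \<le> (norm x)\<^sup>2" by (simp add: power2_norm_eq_inner)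
    then show ?thesis by (rule power2_le_imp_le) simp
  qed
  have RU: "U \<inter> ?R \<in> sets borel" using U(1) regular_boundary_borel[OF compact_K] by simp
  have H_le: "hausdorff_outer (?n - 1) A \<le> ennreal (L ^ (?n - 1)) * hausdorff_outer (?n - 1) (\<pi> ` A)"
    if "A \<subseteq> U \<inter> ?R" for A
    using hausdorff_outer_lipschitz_param[of L A id \<pi> "?n - 1"] proj L that by (auto simp: \<pi>_def)
  have H_ge: "hausdorff_outer (?n - 1) (\<pi> ` A) \<le> hausdorff_outer (?n - 1) A" for A
    using hausdorff_outer_lipschitz_image[of 1 A \<pi> "?n - 1"] by (simp add: dist_norm \<pi>_diff \<pi>_le del: One_nat_def)
  have H_fin: "hausdorff_outer (?n - 1) A < \<infinity>" if A: "A \<subseteq> U \<inter> ?R" for A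
  proof -
    have "A \<subseteq> K" using A frontier_subset_compact[OF compact_K] by (auto simp: regular_boundary_def)
    then have "bounded A" using compact_imp_bounded[OF compact_K] bounded_subset by blast
    then have "bounded (\<pi> ` A)" using \<pi>_le unfolding bounded_iff by (metis imageE order_trans)
    then have "hausdorff_outer (?n - 1) (\<pi> ` A) < \<infinity>"
      using \<pi>u by (intro hausdorff_outer_hyperplane_finite[OF u]) auto
    then have "ennreal (L ^ (?n - 1)) * hausdorff_outer (?n - 1) (\<pi> ` A) < \<infinity>"
      by (simp add: ennreal_mult_less_top)
    with H_le[OF A] show ?thesis by (rule order_le_less_trans)
  qed
  have hL: "0 \<le> h / L" "0 \<le> h * L" using h L by auto
  show ?thesis
  proof (rule that[OF U])
    have "emeasure boundary_measure (U \<inter> ?R) \<le> ennreal (h * L / ?n) * hausdorff_outer (?n - 1) (U \<inter> ?R)"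
      by (rule emeasure_boundary_measure_bounds(2)[OF RU _ hb hL]) auto
    also have "\<dots> < \<infinity>" using H_fin[OF order_refl] by (simp add: ennreal_mult_less_top)
    finally show "emeasure boundary_measure (U \<inter> ?R) < \<infinity>" .
  next
    fix C assume C: "compact C" "C \<subseteq> U \<inter> ?R"
    have bC: "C \<in> sets borel" using C(1) by (rule borel_compact)
    have front: "gauge_fun x = 1" if "x \<in> C" for x
      using C(2) that by (auto simp: regular_boundary_def mem_frontier_iff)
    define I where "I = C \<times> {0..1::real}"
    \<comment> \<open>\<open>a\<close> parametrises the shell over \<open>C\<close> between the
      gauge levels \<open>1 - \<delta>\<close> and 1; \<open>b\<close> parametrises the slab over
      the projection of \<open>C\<close> to the tangent hyperplane, slanted along
      \<open>\<delta> *\<^sub>R x0\<close>.\<close>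
    define a where "a = (\<lambda>(x::'a, s). (1 - \<delta> + \<delta> * s) *\<^sub>R x)"
    define b where "b = (\<lambda>(x::'a, s). \<pi> x + s *\<^sub>R (\<delta> *\<^sub>R x0))"
    have cI: "compact I" unfolding I_def using C(1) by (intro compact_Times) auto
    have ca: "compact (a ` I)" and cb: "compact (b ` I)"
      unfolding a_def b_def \<pi>_def split_beta
      by (intro compact_continuous_image cI continuous_intros)+
    have ab: "norm (a i - a j) \<le> L * norm (b i - b j)" "norm (b i - b j) \<le> L * norm (a i - a j)"
      if ij: "i \<in> I" "j \<in> I" for i j
    proof -
      obtain x s y t where "i = (x, s)" "j = (y, t)" "x \<in> U \<inter> ?R" "y \<in> U \<inter> ?R" "0 \<le> s" "s \<le> 1"
        using ij C(2) by (cases i, cases j) (auto simp: I_def)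
      then show "norm (a i - a j) \<le> L * norm (b i - b j)" "norm (b i - b j) \<le> L * norm (a i - a j)"
        using chart[of x y s t] by (auto simp: a_def b_def \<pi>_def)
    qed
    have meas_ab: "emeasure lborel (a ` I) \<le> ennreal (L ^ ?n) * emeasure lborel (b ` I)"
      using L ab ca cb by (intro emeasure_lborel_lipschitz_param) (auto intro: borel_compact)
    have meas_ba: "emeasure lborel (b ` I) \<le> ennreal (L ^ ?n) * emeasure lborel (a ` I)"
      using L ab ca cb by (intro emeasure_lborel_lipschitz_param) (auto intro: borel_compact)
    have \<pi>C: "compact (\<pi> ` C)"
      unfolding \<pi>_def by (intro compact_continuous_image C(1) continuous_intros)
    have bI: "b ` I = {p + s *\<^sub>R (\<delta> *\<^sub>R x0) |p s. p \<in> \<pi> ` C \<and> s \<in> {0..1}}"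
    proof (intro equalityI subsetI)
      fix z assume "z \<in> b ` I"
      then show "z \<in> {p + s *\<^sub>R (\<delta> *\<^sub>R x0) |p s. p \<in> \<pi> ` C \<and> s \<in> {0..1}}"
        by (force simp: b_def I_def)
    next
      fix z assume "z \<in> {p + s *\<^sub>R (\<delta> *\<^sub>R x0) |p s. p \<in> \<pi> ` C \<and> s \<in> {0..1}}"
      then obtain x s where "x \<in> C" "s \<in> {0..1}" "z = \<pi> x + s *\<^sub>R (\<delta> *\<^sub>R x0)" by blast
      then show "z \<in> b ` I" by (intro image_eqI[of _ _ "(x, s)"]) (auto simp: b_def I_def)
    qed
    have slabC: "hausdorff_outer (?n - 1) (\<pi> ` C) * ennreal (\<delta> * h) = ennreal c * emeasure lborel (b ` I)"
      unfolding bI using slab[rule_format, of u "\<delta> *\<^sub>R x0" "\<pi> ` C"] u \<pi>C \<delta> h \<pi>u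
      by (auto simp: h_def simp del: One_nat_def)
    have shell_upper: "emeasure lborel (a ` I) \<le> ennreal (real ?n * \<delta> * L) * emeasure cone_measure C"
    proof -
      \<comment> \<open>Lowering the level from \<open>1 - \<delta>\<close> to
        \<open>1 - \<delta> * L\<close> brings the face \<open>t = 0\<close> under the strict
        inequality of the shell; the price is one factor \<open>L\<close>.\<close>
      define s where "s = 1 - \<delta> * L"
      have s: "0 < s" "s \<le> 1" using \<delta> L by (auto simp: s_def)
      have "a ` I \<subseteq> {z. s < gauge_fun z \<and> gauge_fun z \<le> 1 \<and> radial z \<in> C}"
      proof
        fix z assume "z \<in> a ` I"
        then obtain x t where xt: "x \<in> C" "0 \<le> t" "t \<le> 1" "z = (1 - \<delta> + \<delta> * t) *\<^sub>R x"
          by (auto simp: a_def I_def)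
        let ?q = "1 - \<delta> + \<delta> * t"
        have "\<delta> * 1 < \<delta> * L" using \<delta> L by (intro mult_strict_left_mono) auto
        moreover have "0 \<le> \<delta> * t" "\<delta> * t \<le> \<delta> * 1" using \<delta> xt by (auto intro!: mult_left_mono)
        ultimately have q: "s < ?q" "?q \<le> 1" "0 < ?q" using s by (auto simp: s_def)
        then show "z \<in> {z. s < gauge_fun z \<and> gauge_fun z \<le> 1 \<and> radial z \<in> C}"
          using front[OF xt(1)] xt by (simp add: gauge_scale radial_scale radial_frontier)
      qed
      moreover have "{z. s < gauge_fun z \<and> gauge_fun z \<le> 1 \<and> radial z \<in> C} \<in> sets borel"
        using bC by measurable
      ultimately have "emeasure lborel (a ` I) \<le> emeasure lborel {z. s < gauge_fun z \<and> gauge_fun z \<le> 1 \<and> radial z \<in> C}"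
        by (intro emeasure_mono) auto
      also have "\<dots> = ennreal (1 - s ^ ?n) * emeasure cone_measure C"
        by (simp add: emeasure_shell[OF bC s] emeasure_cone_measure[OF bC])
      also have "\<dots> \<le> ennreal (real ?n * \<delta> * L) * emeasure cone_measure C"
      proof (intro mult_right_mono ennreal_leI)
        have "1 + real ?n * (- (\<delta> * L)) \<le> (1 + - (\<delta> * L)) ^ ?n"
          using \<delta> by (intro Bernoulli_inequality) auto
        then show "1 - s ^ ?n \<le> real ?n * \<delta> * L" by (simp add: s_def mult.assoc)
      qed simp
      finally show ?thesis .
    qed
    have shell_lower: "ennreal (real ?n * \<delta> / L) * emeasure cone_measure C \<le> emeasure lborel (a ` I)"
    proof -
      define s where "s = 1 - \<delta>"
      have "\<delta> * 1 < \<delta> * L" using \<delta> L by (intro mult_strict_left_mono) auto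
      then have s: "0 < s" "s \<le> 1" using \<delta>(1,3) unfolding s_def by linarith+
      have "{z. s < gauge_fun z \<and> gauge_fun z \<le> 1 \<and> radial z \<in> C} \<subseteq> a ` I"
      proof
        fix z assume z: "z \<in> {z. s < gauge_fun z \<and> gauge_fun z \<le> 1 \<and> radial z \<in> C}"
        let ?t = "(gauge_fun z - s) / \<delta>"
        have "z = a (radial z, ?t)"
          using \<delta> gauge_scaleR_radial[of z] by (simp add: a_def s_def)
        moreover have "(radial z, ?t) \<in> I" using z \<delta> by (auto simp: I_def s_def pos_divide_le_eq)
        ultimately show "z \<in> a ` I" by blast
      qed
      then have "emeasure lborel {z. s < gauge_fun z \<and> gauge_fun z \<le> 1 \<and> radial z \<in> C} \<le> emeasure lborel (a ` I)"
        using ca by (intro emeasure_mono) (auto intro: borel_compact)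
      then have *: "ennreal (1 - s ^ ?n) * emeasure cone_measure C \<le> emeasure lborel (a ` I)"
        by (simp add: emeasure_shell[OF bC s] emeasure_cone_measure[OF bC])
      have "real ?n * \<delta> / L \<le> 1 - s ^ ?n"
      proof -
        \<comment> \<open>Since \<open>real ?n * \<delta> \<le> 1 - 1 / L\<close>, Bernoulli bounds
          every power \<open>s ^ i\<close> with \<open>i < ?n\<close> from below by
          \<open>1 / L\<close>.\<close>
        have "1 + real ?n * (- \<delta>) \<le> (1 + - \<delta>) ^ ?n"
          using s by (intro Bernoulli_inequality) (auto simp: s_def)
        then have sn: "1 / L \<le> s ^ ?n" using \<delta>(2) by (simp add: s_def)
        have "real ?n * (1 / L) = (\<Sum>i<?n. 1 / L)" by simp
        also have "\<dots> \<le> (\<Sum>i<?n. s ^ i)"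
          using s by (intro sum_mono order_trans[OF sn] power_decreasing) auto
        finally have "\<delta> * (real ?n * (1 / L)) \<le> \<delta> * (\<Sum>i<?n. s ^ i)"
          using \<delta> by (intro mult_left_mono) auto
        also have "\<delta> * (\<Sum>i<?n. s ^ i) = 1 - s ^ ?n"
          using one_diff_power_eq[of s ?n] by (simp add: s_def)
        finally show ?thesis by (simp add: mult_ac)
      qed
      then have "ennreal (real ?n * \<delta> / L) * emeasure cone_measure C \<le> ennreal (1 - s ^ ?n) * emeasure cone_measure C"
        by (intro mult_right_mono ennreal_leI) auto
      with * show ?thesis by (rule order_trans[rotated])
    qed
    \<comment> \<open>All measures involved are finite, so the chains of inequalities can be carried
      out in the reals.\<close>
    define \<tau> where "\<tau> = enn2real (emeasure boundary_measure C)"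
    define \<sigma> where "\<sigma> = enn2real (emeasure cone_measure C)"
    define H where "H = enn2real (hausdorff_outer (?n - 1) C)"
    define G where "G = enn2real (hausdorff_outer (?n - 1) (\<pi> ` C))"
    define la where "la = enn2real (emeasure lborel (a ` I))"
    define lb where "lb = enn2real (emeasure lborel (b ` I))"
    have nonneg: "0 \<le> \<tau>" "0 \<le> \<sigma>" "0 \<le> H" "0 \<le> G" "0 \<le> la" "0 \<le> lb"
      by (simp_all add: \<tau>_def \<sigma>_def H_def G_def la_def lb_def)
    have Hf: "hausdorff_outer (?n - 1) C < \<infinity>" by (rule H_fin[OF C(2)])
    have Gf: "hausdorff_outer (?n - 1) (\<pi> ` C) < \<infinity>" using H_ge Hf by (rule order_le_less_trans)
    have "emeasure boundary_measure C \<le> ennreal (h * L / ?n) * hausdorff_outer (?n - 1) C"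
      by (rule emeasure_boundary_measure_bounds(2)[OF bC _ hb hL]) (use C(2) in auto)
    also have "\<dots> < \<infinity>" using Hf by (simp add: ennreal_mult_less_top)
    finally have \<tau>f: "emeasure boundary_measure C < \<infinity>" .
    have e: "emeasure boundary_measure C = ennreal \<tau>" "emeasure cone_measure C = ennreal \<sigma>"
      "hausdorff_outer (?n - 1) C = ennreal H" "hausdorff_outer (?n - 1) (\<pi> ` C) = ennreal G"
      "emeasure lborel (a ` I) = ennreal la" "emeasure lborel (b ` I) = ennreal lb"
      using \<tau>f emeasure_cone_measure_finite[of C] Hf Gf emeasure_compact_finite[OF ca] emeasure_compact_finite[OF cb]
      by (simp_all add: \<tau>_def \<sigma>_def H_def G_def la_def lb_def del: One_nat_def)
    have n: "real ?n > 0" by simp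
    have 1: "\<tau> \<le> h * L / ?n * H"
    proof -
      have "ennreal \<tau> \<le> ennreal (h * L / ?n) * ennreal H"
        unfolding e[symmetric] by (rule emeasure_boundary_measure_bounds(2)[OF bC _ hb hL]) (use C(2) in auto)
      then show ?thesis using hL n nonneg by (simp add: ennreal_mult[symmetric])
    qed
    have 2: "h / L / ?n * H \<le> \<tau>"
    proof -
      have "ennreal (h / L / ?n * H) = ennreal (h / L / ?n) * ennreal H"
        using h L nonneg by (intro ennreal_mult divide_nonneg_nonneg) auto
      also have "\<dots> \<le> ennreal \<tau>"
        unfolding e[symmetric] by (rule emeasure_boundary_measure_bounds(1)[OF bC _ hb hL]) (use C(2) in auto)
      finally show ?thesis using nonneg by simp
    qed
    have 3: "H \<le> L ^ (?n - 1) * G"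
      using H_le[OF C(2)] L nonneg unfolding e by (simp add: ennreal_mult[symmetric])
    have 4: "G \<le> H" using H_ge[of C] nonneg unfolding e by simp
    have 5: "G * (\<delta> * h) = c * lb"
      using slabC nonneg c \<delta> h unfolding e by (simp add: ennreal_mult[symmetric])
    have 6: "la \<le> L ^ ?n * lb" "lb \<le> L ^ ?n * la"
      using meas_ab meas_ba L nonneg unfolding e by (simp_all add: ennreal_mult[symmetric])
    have 7: "la \<le> ?n * \<delta> * L * \<sigma>" "?n * \<delta> / L * \<sigma> \<le> la"
      using shell_upper shell_lower L nonneg \<delta> unfolding e by (simp_all add: ennreal_mult[symmetric])
    have Ln: "L * L ^ (?n - 1) = L ^ ?n" using DIM_positive[where 'a='a] by (simp add: power_eq_if)
    have nd: "real ?n * \<delta> > 0" using \<delta> n by simp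
    \<comment> \<open>The chain runs from boundary measure over the Hausdorff measure of
      \<open>C\<close>, that of its projection, slab volume and shell volume to cone measure. The
      losses \<open>L\<close>, \<open>L ^ (?n - 1)\<close>, \<open>L ^ ?n\<close> and
      \<open>L\<close> multiply to \<open>L ^ (2 * ?n + 1)\<close>.\<close>
    have "?n * \<delta> * \<tau> \<le> ?n * \<delta> * (h * L / ?n * (L ^ (?n - 1) * G))"
      using 1 3 hL n \<delta> by (intro mult_left_mono order_trans[OF 1]) auto
    also have "\<dots> = L ^ ?n * (G * (\<delta> * h))" using n by (simp add: Ln[symmetric])
    also have "\<dots> = L ^ ?n * (c * lb)" by (simp only: 5)
    also have "\<dots> \<le> L ^ ?n * (c * (L ^ ?n * (?n * \<delta> * L * \<sigma>)))"
      using 6(2) 7(1) c L by (intro mult_left_mono order_trans[OF 6(2)]) auto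
    also have "\<dots> = ?n * \<delta> * (L ^ (2 * ?n + 1) * c * \<sigma>)"
    proof -
      have "L ^ (2 * ?n + 1) = L ^ ?n * L ^ ?n * L" by (metis mult_2 power_add power_one_right)
      then show ?thesis by (simp only: mult_ac)
    qed
    finally have "\<tau> \<le> L ^ (2 * ?n + 1) * c * \<sigma>"
      using nd by (simp only: mult_le_cancel_left_pos)
    also have "\<dots> \<le> L ^ (2 * ?n + 2) * c * \<sigma>"
      using L c nonneg by (intro mult_right_mono power_increasing) auto
    finally have A: "\<tau> \<le> L ^ (2 * ?n + 2) * c * \<sigma>" .
    \<comment> \<open>The same chain backwards. The projection does not increase Hausdorff measure,
      so only \<open>L ^ (?n + 2)\<close> is lost.\<close>
    have "?n * \<delta> * (c * \<sigma>) = c * L * (?n * \<delta> / L * \<sigma>)" using L by simp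
    also have "\<dots> \<le> c * L * (L ^ ?n * lb)"
      using 7(2) 6(1) c L by (intro mult_left_mono order_trans[OF 7(2)]) auto
    also have "\<dots> = L ^ (?n + 1) * (c * lb)" by (simp add: mult_ac)
    also have "\<dots> = L ^ (?n + 1) * (G * (\<delta> * h))" by (simp only: 5)
    also have "\<dots> \<le> L ^ (?n + 1) * (H * (\<delta> * h))"
      using 4 L \<delta> h by (intro mult_left_mono mult_right_mono) auto
    also have "\<dots> = ?n * \<delta> * (L ^ (?n + 2) * (h / L / ?n * H))"
      using L n by (simp add: field_simps)
    also have "\<dots> \<le> ?n * \<delta> * (L ^ (?n + 2) * \<tau>)"
      using 2 nd L by (intro mult_left_mono) auto
    finally have "c * \<sigma> \<le> L ^ (?n + 2) * \<tau>"
      using nd by (simp only: mult_le_cancel_left_pos)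
    also have "\<dots> \<le> L ^ (2 * ?n + 2) * \<tau>"
      using L nonneg by (intro mult_right_mono power_increasing) auto
    finally have B: "c * \<sigma> \<le> L ^ (2 * ?n + 2) * \<tau>" .
    show "emeasure boundary_measure C \<le> ennreal (L ^ (2 * ?n + 2) * c) * emeasure cone_measure C \<and>
      ennreal c * emeasure cone_measure C \<le> ennreal (L ^ (2 * ?n + 2)) * emeasure boundary_measure C"
      unfolding e using A B L c nonneg by (simp add: ennreal_mult[symmetric] ennreal_leI)
  qed
qed

end

text \<open>\<open>M\<close> may be infinite, so inner regularity is applied to its restriction to
  \<open>A\<close>, which is finite.\<close>

lemma emeasure_eq_SUP_compact:
  fixes M :: "'a::euclidean_space measure"
  assumes sets [measurable_cong]: "sets M = sets borel" and A: "A \<in> sets borel" "emeasure M A < \<infinity>"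
  shows "emeasure M A = (SUP C\<in>{C. C \<subseteq> A \<and> compact C}. emeasure M C)"
proof -
  let ?M = "density M (indicator A)"
  have M: "emeasure ?M B = emeasure M (A \<inter> B)" if "B \<in> sets borel" for B
  proof -
    have "emeasure ?M B = (\<integral>\<^sup>+x. indicator A x * indicator B x \<partial>M)"
      using that A by (intro emeasure_density) (simp_all add: sets)
    also have "\<dots> = (\<integral>\<^sup>+x. indicator (A \<inter> B) x \<partial>M)" by (simp only: indicator_inter_arith)
    also have "\<dots> = emeasure M (A \<inter> B)" using that A by (simp add: sets)
    finally show ?thesis .
  qed
  have sp: "space M = UNIV" using sets_eq_imp_space_eq[OF sets] by simp
  have "emeasure ?M (space ?M) \<noteq> \<infinity>"
    using M[of UNIV] A(2) by (simp add: space_density sp less_top)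
  then have "emeasure ?M A = (SUP C\<in>{C. C \<subseteq> A \<and> compact C}. emeasure ?M C)"
    using A(1) by (intro inner_regular) (simp_all add: sets)
  also have "\<dots> = (SUP C\<in>{C. C \<subseteq> A \<and> compact C}. emeasure M C)"
    by (intro SUP_cong) (auto simp: M borel_compact intro!: arg_cong[where f="emeasure M"])
  finally show ?thesis using A by (simp add: M)
qed

lemma compact_le_imp_borel_le:
  fixes M N :: "'a::euclidean_space measure"
  assumes sets: "sets M = sets borel" "sets N = sets borel"
    and W: "W \<in> sets borel" "emeasure M W < \<infinity>"
    and le: "\<And>C. compact C \<Longrightarrow> C \<subseteq> W \<Longrightarrow> r * emeasure M C \<le> s * emeasure N C"
    and A: "A \<in> sets borel" "A \<subseteq> W"
  shows "r * emeasure M A \<le> s * emeasure N A"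
proof -
  have "emeasure M A \<le> emeasure M W" using A W by (intro emeasure_mono) (auto simp: sets)
  then have "emeasure M A = (SUP C\<in>{C. C \<subseteq> A \<and> compact C}. emeasure M C)"
    using A W sets by (intro emeasure_eq_SUP_compact) (auto intro: order_le_less_trans)
  then have "r * emeasure M A = (SUP C\<in>{C. C \<subseteq> A \<and> compact C}. r * emeasure M C)"
    by (simp add: SUP_mult_left_ennreal)
  also have "\<dots> \<le> s * emeasure N A"
  proof (rule SUP_least)
    fix C assume C: "C \<in> {C. C \<subseteq> A \<and> compact C}"
    then have "r * emeasure M C \<le> s * emeasure N C" using A by (intro le) auto
    also have "\<dots> \<le> s * emeasure N A"
      using C A by (intro mult_left_mono emeasure_mono) (auto simp: sets)
    finally show "r * emeasure M C \<le> s * emeasure N A" .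
  qed
  finally show ?thesis .
qed

text \<open>By Lindelof countably many of the good neighbourhoods cover \<open>W\<close>. Cutting
  \<open>A\<close> along the disjointed cover and summing preserves the constants \<open>r\<close>
  and \<open>s\<close>.\<close>

lemma local_le_imp_le:
  fixes M N :: "'a::euclidean_space measure"
  assumes sets: "sets M = sets borel" "sets N = sets borel"
    and loc: "\<And>x. x \<in> W \<Longrightarrow> \<exists>U. open U \<and> x \<in> U \<and>
      (\<forall>A\<in>sets borel. A \<subseteq> U \<inter> W \<longrightarrow> r * emeasure M A \<le> s * emeasure N A)"
    and A: "A \<in> sets borel" "A \<subseteq> W"
  shows "r * emeasure M A \<le> s * emeasure N A"
proof -
  let ?F = "{U. open U \<and> (\<forall>A\<in>sets borel. A \<subseteq> U \<inter> W \<longrightarrow> r * emeasure M A \<le> s * emeasure N A)}"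
  obtain F where F: "F \<subseteq> ?F" "countable F" "\<Union>F = \<Union>?F"
    using Lindelof[of ?F] by auto
  have W: "W \<subseteq> \<Union>F" unfolding F(3) using loc by blast
  show ?thesis
  proof (cases "F = {}")
    case True
    then show ?thesis using W A by auto
  next
    case False
    define e where "e = from_nat_into F"
    have e: "e i \<in> ?F" "open (e i)" for i
      using from_nat_into[OF False, of i] F(1) by (auto simp: e_def)
    have cov: "\<Union>F = (\<Union>i. e i)"
      unfolding e_def using range_from_nat_into[OF False F(2)] by simp
    define B where "B i = A \<inter> disjointed e i" for i
    have "range e \<subseteq> sets borel" using e(2) by (auto intro: borel_open)
    then have "disjointed e i \<in> sets borel" for i
      using sets.range_disjointed_sets[of e borel] by blast
    then have B: "B i \<in> sets borel" for i
      unfolding B_def using A by (intro sets.Int)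
    have disj: "disjoint_family B"
      unfolding B_def using disjoint_family_disjointed[of e] by (auto simp: disjoint_family_on_def)
    have AB: "A = (\<Union>i. B i)"
      using A W unfolding B_def Int_UN_distrib[symmetric] UN_disjointed_eq cov by blast
    have "r * emeasure M (B i) \<le> s * emeasure N (B i)" for i
      using e(1)[of i] B[of i] A disjointed_subset[of e i] by (auto simp: B_def)
    then have "(\<Sum>i. r * emeasure M (B i)) \<le> (\<Sum>i. s * emeasure N (B i))"
      by (intro suminf_le) auto
    then show ?thesis
      using B disj unfolding AB by (simp add: ennreal_suminf_cmult suminf_emeasure sets image_subset_iff)
  qed
qed

context convex_body
begin

text \<open>The local two-sided comparison extends to all Borel sets with an error factor
  \<open>L ^ (2 * DIM('a) + 2)\<close>, and \<open>L\<close> may tend to 1 because the exponent does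
  not depend on it.\<close>

lemma boundary_measure_eq_cone_measure:
  assumes slab: "\<forall>u w B. norm u = 1 \<and> 0 < w \<bullet> u \<and> compact B \<and> (\<forall>p\<in>B. p \<bullet> u = 0) \<longrightarrow>
      hausdorff_outer (DIM('a) - 1) B * ennreal (w \<bullet> u) =
      ennreal c * emeasure lborel {p + s *\<^sub>R w |p s. p \<in> (B :: 'a set) \<and> s \<in> {0..1}}"
    and c: "0 \<le> c" and A: "A \<in> sets borel" "A \<subseteq> regular_boundary K"
  shows "emeasure boundary_measure A = ennreal c * emeasure cone_measure A"
proof -
  let ?n = "2 * DIM('a) + 2" and ?R = "regular_boundary K"
  have R: "?R \<in> sets borel" by (rule regular_boundary_borel[OF compact_K])
  have both: "emeasure boundary_measure A \<le> ennreal (L ^ ?n * c) * emeasure cone_measure A"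
    "ennreal c * emeasure cone_measure A \<le> ennreal (L ^ ?n) * emeasure boundary_measure A" if L: "L > 1" for L
  proof -
    have loc: "\<exists>U. open U \<and> x \<in> U \<and>
        (\<forall>A\<in>sets borel. A \<subseteq> U \<inter> ?R \<longrightarrow> 1 * emeasure boundary_measure A \<le> ennreal (L ^ ?n * c) * emeasure cone_measure A) \<and>
        (\<forall>A\<in>sets borel. A \<subseteq> U \<inter> ?R \<longrightarrow> ennreal c * emeasure cone_measure A \<le> ennreal (L ^ ?n) * emeasure boundary_measure A)"
      if x: "x \<in> ?R" for x
    proof -
      obtain U where U: "open U" "x \<in> U" "emeasure boundary_measure (U \<inter> ?R) < \<infinity>"
        "\<And>C. compact C \<Longrightarrow> C \<subseteq> U \<inter> ?R \<Longrightarrow>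
          emeasure boundary_measure C \<le> ennreal (L ^ ?n * c) * emeasure cone_measure C \<and>
          ennreal c * emeasure cone_measure C \<le> ennreal (L ^ ?n) * emeasure boundary_measure C"
        using local_comparison_compact[OF slab c x L] by metis
      have UR: "U \<inter> ?R \<in> sets borel" using U(1) R by simp
      have "1 * emeasure boundary_measure A \<le> ennreal (L ^ ?n * c) * emeasure cone_measure A"
        if "A \<in> sets borel" "A \<subseteq> U \<inter> ?R" for A
        by (rule compact_le_imp_borel_le[OF _ _ UR U(3) _ that]) (use U(4) in auto)
      moreover have "ennreal c * emeasure cone_measure A \<le> ennreal (L ^ ?n) * emeasure boundary_measure A"
        if "A \<in> sets borel" "A \<subseteq> U \<inter> ?R" for A
        by (rule compact_le_imp_borel_le[OF _ _ UR emeasure_cone_measure_finite _ that]) (use U(4) in auto)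
      ultimately show ?thesis using U(1,2) by blast
    qed
    have "1 * emeasure boundary_measure A \<le> ennreal (L ^ ?n * c) * emeasure cone_measure A"
    proof (rule local_le_imp_le[OF _ _ _ A])
      fix x assume "x \<in> ?R"
      from loc[OF this] show "\<exists>U. open U \<and> x \<in> U \<and> (\<forall>A\<in>sets borel. A \<subseteq> U \<inter> ?R \<longrightarrow>
          1 * emeasure boundary_measure A \<le> ennreal (L ^ ?n * c) * emeasure cone_measure A)" by blast
    qed simp_all
    then show "emeasure boundary_measure A \<le> ennreal (L ^ ?n * c) * emeasure cone_measure A" by simp
    show "ennreal c * emeasure cone_measure A \<le> ennreal (L ^ ?n) * emeasure boundary_measure A"
    proof (rule local_le_imp_le[OF _ _ _ A])
      fix x assume "x \<in> ?R"
      from loc[OF this] show "\<exists>U. open U \<and> x \<in> U \<and> (\<forall>A\<in>sets borel. A \<subseteq> U \<inter> ?R \<longrightarrow>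
          ennreal c * emeasure cone_measure A \<le> ennreal (L ^ ?n) * emeasure boundary_measure A)" by blast
    qed simp_all
  qed
  obtain \<sigma> where \<sigma>: "0 \<le> \<sigma>" "emeasure cone_measure A = ennreal \<sigma>"
    using emeasure_cone_measure_finite[of A] by (cases "emeasure cone_measure A") auto
  \<comment> \<open>The comparison with \<open>L = 2\<close> gives finiteness of the boundary
    measure, so the limit can be taken in the reals.\<close>
  have "ennreal (2 ^ ?n * c) * emeasure cone_measure A < \<infinity>"
    by (simp add: \<sigma> ennreal_mult_less_top)
  then have "emeasure boundary_measure A < \<infinity>"
    using both(1)[of 2] by (simp add: order_le_less_trans)
  then obtain \<tau> where \<tau>: "0 \<le> \<tau>" "emeasure boundary_measure A = ennreal \<tau>"
    by (cases "emeasure boundary_measure A") auto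
  define L where "L j = 1 + inverse (real (Suc j))" for j
  have L: "L j > 1" for j by (simp add: L_def)
  have lim: "(\<lambda>j. L j ^ ?n * x) \<longlonglongrightarrow> 1 ^ ?n * x" for x
    unfolding L_def using LIMSEQ_inverse_real_of_nat
    by (intro tendsto_mult tendsto_power tendsto_const) (metis LIMSEQ_inverse_real_of_nat_add)
  have 1: "\<tau> \<le> L j ^ ?n * (c * \<sigma>)" for j
  proof -
    have "0 \<le> L j ^ ?n * c" using L[of j] c by simp
    then have "ennreal \<tau> \<le> ennreal (L j ^ ?n * c * \<sigma>)"
      using both(1)[OF L, of j] \<sigma>(1) unfolding \<sigma>(2) \<tau>(2) by (simp only: ennreal_mult)
    moreover have "0 \<le> L j ^ ?n * c * \<sigma>" using L[of j] c \<sigma> by simp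
    ultimately show ?thesis by (simp add: mult.assoc)
  qed
  have 2: "c * \<sigma> \<le> L j ^ ?n * \<tau>" for j
  proof -
    have "0 \<le> L j ^ ?n" using L[of j] by simp
    then have "ennreal (c * \<sigma>) \<le> ennreal (L j ^ ?n * \<tau>)"
      using both(2)[OF L, of j] c \<sigma>(1) \<tau>(1) unfolding \<sigma>(2) \<tau>(2) by (simp only: ennreal_mult)
    moreover have "0 \<le> L j ^ ?n * \<tau>" using L[of j] \<tau> by simp
    ultimately show ?thesis by simp
  qed
  have "\<tau> \<le> 1 ^ ?n * (c * \<sigma>)"
    by (rule LIMSEQ_le_const[OF lim]) (use 1 in blast)
  moreover have "c * \<sigma> \<le> 1 ^ ?n * \<tau>"
    by (rule LIMSEQ_le_const[OF lim]) (use 2 in blast)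
  ultimately have "\<tau> = c * \<sigma>" by simp
  then show ?thesis using c \<sigma>(1) by (simp only: \<sigma>(2) \<tau>(2) ennreal_mult)
qed

lemma normal_preimage_borel:
  assumes \<omega>: "\<omega> \<in> sets borel"
  shows "{x \<in> regular_boundary K. normal_at K x \<in> \<omega>} \<in> sets borel"
proof -
  let ?f = "\<lambda>x. if x \<in> regular_boundary K then normal_at K x else 0"
  have "?f -` \<omega> \<in> sets borel"
    using measurable_sets_borel[OF normal_at_measurable[OF compact_K] \<omega>] by simp
  then have "regular_boundary K \<inter> ?f -` \<omega> \<in> sets borel"
    using regular_boundary_borel[OF compact_K] by simp
  also have "regular_boundary K \<inter> ?f -` \<omega> = {x \<in> regular_boundary K. normal_at K x \<in> \<omega>}" by auto
  finally show ?thesis .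
qed

end

lemma cone_volume_eq_emeasure_cone:
  obtains c :: real where "0 \<le> c" and
    "\<And>K \<omega>. convex_body K \<Longrightarrow> \<omega> \<in> sets borel \<Longrightarrow>
      cone_volume (K :: (real^'n) set) \<omega> =
      ennreal c * emeasure lborel (convex_body.cone K {x \<in> regular_boundary K. normal_at K x \<in> \<omega>})"
proof -
  obtain c :: real where c: "0 \<le> c" and
    slab: "\<And>u w (B :: (real^'n) set). norm u = 1 \<Longrightarrow> 0 < w \<bullet> u \<Longrightarrow> compact B \<Longrightarrow>
      (\<And>p. p \<in> B \<Longrightarrow> p \<bullet> u = 0) \<Longrightarrow>
      hausdorff_outer (DIM(real^'n) - 1) B * ennreal (w \<bullet> u) =
      ennreal c * emeasure lborel {p + s *\<^sub>R w |p s. p \<in> B \<and> s \<in> {0..1}}"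
    using hausdorff_hyperplane_slab[where 'a="real^'n"] by blast
  show ?thesis
  proof (rule that[OF c])
    fix K \<omega> :: "(real^'n) set"
    assume "convex_body K" and \<omega>: "\<omega> \<in> sets borel"
    then interpret convex_body K by simp
    let ?A = "{x \<in> regular_boundary K. normal_at K x \<in> \<omega>}"
    have A: "?A \<in> sets borel" by (rule normal_preimage_borel[OF \<omega>])
    have "cone_volume K \<omega> = emeasure boundary_measure ?A"
      unfolding cone_volume_def using emeasure_boundary_measure[OF A] by (simp add: mult.commute del: One_nat_def)
    also have "\<dots> = ennreal c * emeasure cone_measure ?A"
      by (rule boundary_measure_eq_cone_measure[OF _ c A]) (use slab in auto)
    also have "emeasure cone_measure ?A = emeasure lborel (cone ?A)"
      by (rule emeasure_cone_measure[OF A])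
    finally show "cone_volume K \<omega> = ennreal c * emeasure lborel (cone ?A)" .
  qed
qed

section \<open>The Brunn-Minkowski inequality\<close>

lemma brunn_minkowski_real:
  fixes X Y Z :: "real set"
  assumes X: "X \<in> sets borel" "X \<noteq> {}" "emeasure lborel X < \<infinity>"
    and Y: "Y \<in> sets borel" "Y \<noteq> {}" "emeasure lborel Y < \<infinity>"
    and Z: "Z \<in> sets borel" "\<And>x y. x \<in> X \<Longrightarrow> y \<in> Y \<Longrightarrow> x + y \<in> Z"
  shows "emeasure lborel X + emeasure lborel Y \<le> emeasure lborel Z"
proof -
  have trans: "emeasure lborel ((+) c ` A) = emeasure lborel A" if "A \<in> sets borel" for c :: real and A
  proof -
    have "emeasure lborel A = emeasure (distr lborel borel ((+) (- c))) A" by (simp add: lborel_distr_plus)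
    also have "\<dots> = emeasure lborel ((+) (- c) -` A)" using that by (subst emeasure_distr) simp_all
    also have "(+) (- c) -` A = (+) c ` A" by (simp add: translation_vimage_eq)
    finally show ?thesis by simp
  qed
  have compact_case: "emeasure lborel C + emeasure lborel D \<le> emeasure lborel Z"
    if C: "compact C" "C \<subseteq> X" "C \<noteq> {}" and D: "compact D" "D \<subseteq> Y" "D \<noteq> {}" for C D
  proof -
    obtain a where a: "a \<in> C" "\<And>x. x \<in> C \<Longrightarrow> x \<le> a" using compact_attains_sup[OF C(1,3)] by blast
    obtain b where b: "b \<in> D" "\<And>x. x \<in> D \<Longrightarrow> b \<le> x" using compact_attains_inf[OF D(1,3)] by blast
    have bC: "(+) b ` C \<in> sets borel" and aD: "(+) a ` D \<in> sets borel"
      using C(1) D(1) by (auto intro: borel_compact compact_translation)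
    \<comment> \<open>The translates of \<open>C\<close> by the minimum \<open>b\<close> of
      \<open>D\<close> and of \<open>D\<close> by the maximum \<open>a\<close> of \<open>C\<close>
      both lie in \<open>Z\<close> and meet at most in the point \<open>a + b\<close>.\<close>
    have "emeasure lborel C + emeasure lborel D = emeasure lborel ((+) b ` C) + emeasure lborel ((+) a ` D - {a + b})"
      using C(1) D(1) aD by (simp add: trans borel_compact emeasure_Diff_null_set finite_imp_null_set_lborel)
    also have "\<dots> = emeasure lborel ((+) b ` C \<union> ((+) a ` D - {a + b}))"
      using bC aD a(2) b(2) by (intro plus_emeasure) (auto, fastforce)
    also have "\<dots> \<le> emeasure lborel Z"
    proof (rule emeasure_mono)
      show "(+) b ` C \<union> ((+) a ` D - {a + b}) \<subseteq> Z"
        using Z(2) a(1) b(1) C(2) D(2) by (auto simp: add.commute[of b])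
    qed (use Z in simp)
    finally show ?thesis .
  qed
  obtain x0 y0 where xy: "x0 \<in> X" "y0 \<in> Y" using X Y by blast
  have 1: "emeasure lborel C + emeasure lborel D \<le> emeasure lborel Z"
    if C: "compact C" "C \<subseteq> X" and D: "compact D" "D \<subseteq> Y" for C D
  proof -
    \<comment> \<open>The approximating compact sets may be empty; adding one point of
      \<open>X\<close> and one of \<open>Y\<close> makes the compact case applicable.\<close>
    have "emeasure lborel C + emeasure lborel D \<le> emeasure lborel (insert x0 C) + emeasure lborel (insert y0 D)"
      using C D by (intro add_mono emeasure_mono) (auto intro: borel_compact)
    also have "\<dots> \<le> emeasure lborel Z"
      using C D xy by (intro compact_case) auto
    finally show ?thesis .
  qed
  have SX: "emeasure lborel X = (SUP C\<in>{C. C \<subseteq> X \<and> compact C}. emeasure lborel C)"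
    and SY: "emeasure lborel Y = (SUP C\<in>{C. C \<subseteq> Y \<and> compact C}. emeasure lborel C)"
    using X Y by (auto intro!: emeasure_eq_SUP_compact)
  have neX: "{C. C \<subseteq> X \<and> compact C} \<noteq> {}" and neY: "{C. C \<subseteq> Y \<and> compact C} \<noteq> {}"
    using compact_empty by blast+
  have "emeasure lborel C + emeasure lborel Y \<le> emeasure lborel Z" if "compact C" "C \<subseteq> X" for C
  proof -
    have "emeasure lborel C + emeasure lborel Y =
        (SUP D\<in>{D. D \<subseteq> Y \<and> compact D}. emeasure lborel C + emeasure lborel D)"
      unfolding SY using neY by (rule ennreal_SUP_add_right)
    also have "\<dots> \<le> emeasure lborel Z" using 1[OF that] by (intro SUP_least) auto
    finally show ?thesis .
  qed
  moreover have "emeasure lborel X + emeasure lborel Y =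
      (SUP C\<in>{C. C \<subseteq> X \<and> compact C}. emeasure lborel C + emeasure lborel Y)"
    unfolding SX using neX by (rule ennreal_SUP_add_left[symmetric])
  ultimately show ?thesis by (auto intro!: SUP_least)
qed

text \<open>The layer cake formula with levels in units of \<open>H\<close>, so that functions of
  different heights can be compared at a common parameter \<open>s\<close> in the unit interval.
  Levels above \<open>H\<close> are cut off by the minimum.\<close>

lemma layer_cake_truncated:
  fixes h :: "real \<Rightarrow> real"
  assumes [measurable]: "h \<in> borel_measurable borel" and nonneg: "\<And>x. 0 \<le> h x" and H: "H > 0"
  shows "ennreal H * (\<integral>\<^sup>+s. indicator {0<..<1} s * emeasure lborel {x. s * H < h x} \<partial>lborel)
      = (\<integral>\<^sup>+x. ennreal (min H (h x)) \<partial>lborel)"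
proof -
  have "(\<integral>\<^sup>+s. indicator {0<..<1} s * emeasure lborel {x. s * H < h x} \<partial>lborel)
     = (\<integral>\<^sup>+s. (\<integral>\<^sup>+x. indicator {0<..<1} s * indicator {x. s * H < h x} x \<partial>lborel) \<partial>lborel)"
    by (intro nn_integral_cong) (simp add: nn_integral_cmult)
  also have "\<dots> = (\<integral>\<^sup>+x. (\<integral>\<^sup>+s. indicator {0<..<1} s * indicator {x. s * H < h x} x \<partial>lborel) \<partial>lborel)"
    by (rule lborel_pair.Fubini') (simp add: indicator_def[abs_def] split_beta)
  also have "\<dots> = (\<integral>\<^sup>+x. ennreal (min 1 (h x / H)) \<partial>lborel)"
  proof (intro nn_integral_cong)
    fix x
    have "(\<integral>\<^sup>+s. indicator {0<..<1} s * indicator {x. s * H < h x} x \<partial>lborel)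
        = (\<integral>\<^sup>+s. indicator {0<..<min 1 (h x / H)} s \<partial>lborel)"
      using H by (intro nn_integral_cong) (auto simp: indicator_def pos_less_divide_eq)
    also have "\<dots> = ennreal (min 1 (h x / H))"
      using nonneg[of x] H by simp
    finally show "(\<integral>\<^sup>+s. indicator {0<..<1} s * indicator {x. s * H < h x} x \<partial>lborel) = ennreal (min 1 (h x / H))" .
  qed
  also have "ennreal H * \<dots> = (\<integral>\<^sup>+x. ennreal H * ennreal (min 1 (h x / H)) \<partial>lborel)"
    by (rule nn_integral_cmult[symmetric]) simp
  also have "\<dots> = (\<integral>\<^sup>+x. ennreal (min H (h x)) \<partial>lborel)"
    using H nonneg by (intro nn_integral_cong) (auto simp: ennreal_mult[symmetric] min_def field_simps)
  finally show ?thesis .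
qed

text \<open>The levels of \<open>f\<close> and \<open>g\<close> are measured in units of their
  suprema, so that for \<open>0 < s < 1\<close> both level sets are nonempty, as the one-dimensional
  Brunn-Minkowski inequality requires. Integration over \<open>s\<close> yields an arithmetic mean,
  which Young's inequality bounds below by the geometric mean.\<close>

lemma prekopa_leindler_real:
  fixes f g h :: "real \<Rightarrow> real"
  assumes [measurable]: "f \<in> borel_measurable borel" "g \<in> borel_measurable borel" "h \<in> borel_measurable borel"
    and nonneg: "\<And>x. 0 \<le> f x" "\<And>x. 0 \<le> g x" "\<And>x. 0 \<le> h x"
    and bounded: "\<And>x. f x \<le> B" "\<And>x. g x \<le> B"
    and t: "0 < t" "t < 1"
    and le: "\<And>x y. f x powr (1 - t) * g y powr t \<le> h ((1 - t) * x + t * y)"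
    and fi: "(\<integral>\<^sup>+x. ennreal (f x) \<partial>lborel) = ennreal a" "0 \<le> a"
    and gi: "(\<integral>\<^sup>+x. ennreal (g x) \<partial>lborel) = ennreal b" "0 \<le> b"
    and hi: "(\<integral>\<^sup>+x. ennreal (h x) \<partial>lborel) = ennreal c" "0 \<le> c"
  shows "a powr (1 - t) * b powr t \<le> c"
proof (cases "a = 0 \<or> b = 0")
  case True
  then show ?thesis using hi t by auto
next
  case False
  then have ab: "a > 0" "b > 0" using fi gi by auto
  define F where "F = (SUP x. f x)"
  define G where "G = (SUP x. g x)"
  have bdd: "bdd_above (range f)" "bdd_above (range g)" using bounded by (auto intro!: bdd_aboveI2)
  have fF: "f x \<le> F" and gG: "g x \<le> G" for x
    using bdd by (auto simp: F_def G_def intro: cSUP_upper)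
  have F: "F > 0"
  proof (rule ccontr)
    assume "\<not> F > 0"
    then have "f x = 0" for x using fF[of x] nonneg(1)[of x] by linarith
    then show False using fi ab by simp
  qed
  have G: "G > 0"
  proof (rule ccontr)
    assume "\<not> G > 0"
    then have "g x = 0" for x using gG[of x] nonneg(2)[of x] by linarith
    then show False using gi ab by simp
  qed
  \<comment> \<open>The hypothesis at arguments where \<open>f\<close> exceeds \<open>s * F\<close>
    and \<open>g\<close> exceeds \<open>s * G\<close> puts \<open>h\<close> above
    \<open>s * H\<close>, since the exponents add up to 1.\<close>
  define H where "H = F powr (1 - t) * G powr t"
  have H: "H > 0" using F G by (simp add: H_def)
  have fin: "emeasure lborel {x. s < k x} < \<infinity>"
    if [measurable]: "k \<in> borel_measurable borel" and k: "(\<integral>\<^sup>+x. ennreal (k x) \<partial>lborel) = ennreal r" and s: "s > 0" for k r s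
  proof -
    have "ennreal s * emeasure lborel {x. s < k x} = (\<integral>\<^sup>+x. ennreal s * indicator {x. s < k x} x \<partial>lborel)"
      by (simp add: nn_integral_cmult)
    also have "\<dots> \<le> (\<integral>\<^sup>+x. ennreal (k x) \<partial>lborel)"
      by (intro nn_integral_mono) (auto simp: indicator_def intro: ennreal_leI)
    also have "\<dots> < \<infinity>" by (simp add: k)
    finally show ?thesis using s by (auto simp: ennreal_mult_less_top)
  qed
  let ?lf = "\<lambda>s. emeasure lborel {x. s * F < f x}" and ?lg = "\<lambda>s. emeasure lborel {x. s * G < g x}"
    and ?lh = "\<lambda>s. emeasure lborel {x. s * H < h x}"
  have level: "ennreal (1 - t) * ?lf s + ennreal t * ?lg s \<le> ?lh s" if s: "0 < s" "s < 1" for s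
  proof -
    have scale: "ennreal r * emeasure lborel A = emeasure lborel {z. z / r \<in> A} \<and> {z. z / r \<in> A} \<in> sets borel"
      if "r > 0" "A \<in> sets borel" for r and A :: "real set"
      using emeasure_lborel_vimage_scaleR[OF that] that measurable_sets_borel[of "\<lambda>z. z / r" borel A]
      by (simp add: vimage_def divide_inverse mult.commute)
    let ?X = "{z. z / (1 - t) \<in> {x. s * F < f x}}" and ?Y = "{z. z / t \<in> {x. s * G < g x}}"
    have mf: "{x. s * F < f x} \<in> sets borel" and mg: "{x. s * G < g x} \<in> sets borel" by measurable
    have "s * F < F" "s * G < G" using s F G by simp_all
    then obtain x1 y1 where ne: "s * F < f x1" "s * G < g y1"
      using less_cSUP_iff[OF _ bdd(1)] less_cSUP_iff[OF _ bdd(2)] by (auto simp: F_def G_def)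
    have "emeasure lborel ?X + emeasure lborel ?Y \<le> ?lh s"
    proof (rule brunn_minkowski_real)
      show "?X \<in> sets borel" "?Y \<in> sets borel" using scale[OF _ mf, of "1 - t"] scale[OF _ mg, of t] t by auto
      have "(1 - t) * x1 \<in> ?X" "t * y1 \<in> ?Y" using ne t by simp_all
      then show "?X \<noteq> {}" "?Y \<noteq> {}" by blast+
      have "emeasure lborel ?X = ennreal (1 - t) * emeasure lborel {x. s * F < f x}"
        "emeasure lborel ?Y = ennreal t * emeasure lborel {x. s * G < g x}"
        using scale[OF _ mf, of "1 - t"] scale[OF _ mg, of t] t by simp_all
      then show "emeasure lborel ?X < \<infinity>" "emeasure lborel ?Y < \<infinity>"
        using fin[OF _ fi(1), of "s * F"] fin[OF _ gi(1), of "s * G"] s F G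
        by (auto simp: ennreal_mult_less_top)
      show "{x. s * H < h x} \<in> sets borel" by measurable
      fix x y assume x: "x \<in> ?X" and y: "y \<in> ?Y"
      have "s * H = (s powr (1 - t) * s powr t) * (F powr (1 - t) * G powr t)"
        using s by (simp add: H_def powr_add[symmetric])
      also have "\<dots> = (s * F) powr (1 - t) * (s * G) powr t"
        using s F G by (simp add: powr_mult mult_ac)
      also have "\<dots> < f (x / (1 - t)) powr (1 - t) * g (y / t) powr t"
      proof -
        have pos: "0 < s * F" "0 < s * G" using s F G by simp_all
        have "(s * F) powr (1 - t) < f (x / (1 - t)) powr (1 - t)" "(s * G) powr t < g (y / t) powr t"
          using x y t pos by (auto intro!: powr_less_mono2)
        then show ?thesis using pos by (intro mult_strict_mono) auto
      qed
      also have "\<dots> \<le> h ((1 - t) * (x / (1 - t)) + t * (y / t))" by (rule le)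
      also have "(1 - t) * (x / (1 - t)) + t * (y / t) = x + y" using t by simp
      finally show "x + y \<in> {x. s * H < h x}" by simp
    qed
    then show ?thesis using scale[OF _ mf, of "1 - t"] scale[OF _ mg, of t] t by simp
  qed
  have [measurable]: "?lf \<in> borel_measurable borel" "?lg \<in> borel_measurable borel"
  proof -
    have m: "(\<lambda>s. emeasure lborel (Pair s -` {(s, x). s * k < q x})) \<in> borel_measurable lborel"
      if [measurable]: "q \<in> borel_measurable borel" for q :: "real \<Rightarrow> real" and k :: real
    proof (rule lborel.measurable_emeasure_Pair)
      have "{x \<in> space (borel \<Otimes>\<^sub>M borel). fst x * k < q (snd x)} \<in> sets (borel \<Otimes>\<^sub>M (borel :: real measure))"
        by measurable
      then show "{(s, x). s * k < q x} \<in> sets (lborel \<Otimes>\<^sub>M (lborel :: real measure))"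
        by (simp add: space_pair_measure case_prod_beta' cong: sets_pair_measure_cong)
    qed
    show "?lf \<in> borel_measurable borel" "?lg \<in> borel_measurable borel"
      using m[of f F] m[of g G] by (simp_all add: vimage_def)
  qed
  define If where "If = (\<integral>\<^sup>+s. indicator {0<..<1} s * ?lf s \<partial>lborel)"
  define Ig where "Ig = (\<integral>\<^sup>+s. indicator {0<..<1} s * ?lg s \<partial>lborel)"
  define Ih where "Ih = (\<integral>\<^sup>+s. indicator {0<..<1} s * ?lh s \<partial>lborel)"
  have "ennreal F * If = (\<integral>\<^sup>+x. ennreal (min F (f x)) \<partial>lborel)"
    unfolding If_def using nonneg F by (intro layer_cake_truncated) simp_all
  then have If: "ennreal F * If = ennreal a" using fF by (simp add: min_absorb2 fi)
  have "ennreal G * Ig = (\<integral>\<^sup>+x. ennreal (min G (g x)) \<partial>lborel)"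
    unfolding Ig_def using nonneg G by (intro layer_cake_truncated) simp_all
  then have Ig: "ennreal G * Ig = ennreal b" using gG by (simp add: min_absorb2 gi)
  have "ennreal H * Ih = (\<integral>\<^sup>+x. ennreal (min H (h x)) \<partial>lborel)"
    unfolding Ih_def using nonneg H by (intro layer_cake_truncated) simp_all
  also have "\<dots> \<le> (\<integral>\<^sup>+x. ennreal (h x) \<partial>lborel)" by (intro nn_integral_mono ennreal_leI) simp
  finally have Ih: "ennreal H * Ih \<le> ennreal c" by (simp add: hi)
  have sum: "ennreal (1 - t) * If + ennreal t * Ig \<le> Ih"
  proof -
    have "ennreal (1 - t) * If + ennreal t * Ig =
        (\<integral>\<^sup>+s. ennreal (1 - t) * (indicator {0<..<1} s * ?lf s) + ennreal t * (indicator {0<..<1} s * ?lg s) \<partial>lborel)"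
      unfolding If_def Ig_def by (simp add: nn_integral_add nn_integral_cmult)
    also have "\<dots> \<le> Ih"
      unfolding Ih_def using level by (intro nn_integral_mono) (auto simp: indicator_def)
    finally show ?thesis .
  qed
  have If': "If = ennreal (a / F)"
  proof -
    have "ennreal F * If = ennreal F * ennreal (a / F)" using If F fi by (simp add: ennreal_mult[symmetric])
    then show ?thesis using F by (subst (asm) ennreal_mult_cancel_left) auto
  qed
  have Ig': "Ig = ennreal (b / G)"
  proof -
    have "ennreal G * Ig = ennreal G * ennreal (b / G)" using Ig G gi by (simp add: ennreal_mult[symmetric])
    then show ?thesis using G by (subst (asm) ennreal_mult_cancel_left) auto
  qed
  have "ennreal (H * ((1 - t) * (a / F) + t * (b / G))) = ennreal H * (ennreal (1 - t) * If + ennreal t * Ig)"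
  proof -
    have nn: "0 \<le> (1 - t) * (a / F)" "0 \<le> t * (b / G)" using F G fi gi t by auto
    have "ennreal ((1 - t) * (a / F)) = ennreal (1 - t) * If"
      unfolding If' by (rule ennreal_mult) (use F fi t in auto)
    moreover have "ennreal (t * (b / G)) = ennreal t * Ig"
      unfolding Ig' by (rule ennreal_mult) (use G gi t in auto)
    moreover have "ennreal (H * ((1 - t) * (a / F) + t * (b / G))) =
        ennreal H * (ennreal ((1 - t) * (a / F)) + ennreal (t * (b / G)))"
      using nn H by (subst ennreal_mult) (auto simp: ennreal_plus)
    ultimately show ?thesis by simp
  qed
  also have "\<dots> \<le> ennreal H * Ih" using sum by (rule mult_left_mono) simp
  also note Ih
  finally have c: "H * ((1 - t) * (a / F) + t * (b / G)) \<le> c" using hi by simp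
  have "a powr (1 - t) * b powr t = H * ((a / F) powr (1 - t) * (b / G) powr t)"
    using F G ab by (simp add: H_def powr_divide)
  also have "\<dots> \<le> H * ((1 - t) * (a / F) + t * (b / G))"
    using H F G ab t by (intro mult_left_mono Youngs_inequality_0) auto
  finally show ?thesis using c by simp
qed

text \<open>The multiplicative form contains no dimension and so passes through an induction on the
  coordinates: by the induction hypothesis the section measures, as functions of the new coordinate,
  satisfy the hypothesis of \<open>prekopa_leindler_real\<close>. The box keeps them finite and
  bounded.\<close>

lemma brunn_minkowski_PiM:
  fixes A B C :: "('i \<Rightarrow> real) set"
  defines "N \<equiv> \<lambda>D. PiM D (\<lambda>_::'i. lborel :: real measure)"
  assumes D: "finite D" and t: "0 < t" "t < 1"
    and sets: "A \<in> sets (N D)" "B \<in> sets (N D)" "C \<in> sets (N D)"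
    and box: "A \<subseteq> PiE D (\<lambda>_. {-R..R})" "B \<subseteq> PiE D (\<lambda>_. {-R..R})" "C \<subseteq> PiE D (\<lambda>_. {-R..R})"
    and comb: "\<And>a b. a \<in> A \<Longrightarrow> b \<in> B \<Longrightarrow> (\<lambda>i\<in>D. (1 - t) * a i + t * b i) \<in> C"
  shows "measure (N D) A powr (1 - t) * measure (N D) B powr t \<le> measure (N D) C"
  using D sets box comb
proof (induction D arbitrary: A B C rule: finite_induct)
  case empty
  show ?case
  proof (cases "A = {} \<or> B = {}")
    case False
    have "A \<subseteq> {\<lambda>_. undefined}" "B \<subseteq> {\<lambda>_. undefined}" "C \<subseteq> {\<lambda>_. undefined}"
      using empty.prems(4-6) by auto
    moreover have "C \<noteq> {}" using False empty.prems(7) by blast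
    ultimately have "A = {\<lambda>_. undefined}" "B = {\<lambda>_. undefined}" "C = {\<lambda>_. undefined}"
      using False by auto
    then show ?thesis by (simp add: N_def PiM_empty measure_def)
  qed (use t in auto)
next
  case (insert i D)
  interpret product_sigma_finite "\<lambda>_::'i. lborel :: real measure" ..
  interpret D: sigma_finite_measure "N D" unfolding N_def by (rule sigma_finite[OF insert.hyps(1)])
  define S where "S X y = {x \<in> space (N D). x(i := y) \<in> X}" for X y
  have spN: "space (N E) = PiE E (\<lambda>_. UNIV)" for E by (simp add: N_def space_PiM)
  have upd: "(\<lambda>(f, y). f(i := y)) \<in> measurable (N D \<Otimes>\<^sub>M lborel) (N (insert i D))"
    unfolding N_def by (rule measurable_add_dim)
  have pairset: "{(y, x). x \<in> space (N D) \<and> x(i := y) \<in> X} \<in> sets (lborel \<Otimes>\<^sub>M N D)" if X: "X \<in> sets (N (insert i D))" for X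
  proof -
    have "(\<lambda>(f, y). f(i := y)) \<circ> (\<lambda>p. (snd p, fst p)) \<in> measurable (lborel \<Otimes>\<^sub>M N D) (N (insert i D))"
      by (rule measurable_comp[OF _ upd]) simp
    also have "(\<lambda>(f, y). f(i := y)) \<circ> (\<lambda>p. (snd p, fst p)) = (\<lambda>p :: real \<times> ('i \<Rightarrow> real). (snd p)(i := fst p))"
      by auto
    finally have "(\<lambda>p :: real \<times> ('i \<Rightarrow> real). (snd p)(i := fst p)) \<in> measurable (lborel \<Otimes>\<^sub>M N D) (N (insert i D))" .
    from measurable_sets[OF this X]
    have "(\<lambda>p :: real \<times> ('i \<Rightarrow> real). (snd p)(i := fst p)) -` X \<inter> space (lborel \<Otimes>\<^sub>M N D)
        \<in> sets (lborel \<Otimes>\<^sub>M N D)" .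
    also have "(\<lambda>p :: real \<times> ('i \<Rightarrow> real). (snd p)(i := fst p)) -` X \<inter> space (lborel \<Otimes>\<^sub>M N D) =
        {(y, x). x \<in> space (N D) \<and> x(i := y) \<in> X}"
      by (auto simp: space_pair_measure)
    finally show ?thesis .
  qed
  have Sset: "S X y \<in> sets (N D)" if X: "X \<in> sets (N (insert i D))" for X y
    using sets_Pair1[OF pairset[OF X], of y] by (simp add: S_def vimage_def)
  have Smeas: "(\<lambda>y. emeasure (N D) (S X y)) \<in> borel_measurable borel" if X: "X \<in> sets (N (insert i D))" for X
    using D.measurable_emeasure_Pair[OF pairset[OF X]] by (simp add: S_def vimage_def)
  have emeasure_S: "emeasure (N (insert i D)) X = (\<integral>\<^sup>+y. emeasure (N D) (S X y) \<partial>lborel)"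
    if X: "X \<in> sets (N (insert i D))" for X
  proof -
    have "emeasure (N (insert i D)) X = (\<integral>\<^sup>+x. indicator X x \<partial>N (insert i D))" using X by simp
    also have "\<dots> = (\<integral>\<^sup>+y. (\<integral>\<^sup>+x. indicator X (x(i := y)) \<partial>N D) \<partial>lborel)"
      unfolding N_def using insert.hyps X by (intro product_nn_integral_insert_rev) (auto simp: N_def)
    also have "\<dots> = (\<integral>\<^sup>+y. (\<integral>\<^sup>+x. indicator (S X y) x \<partial>N D) \<partial>lborel)"
      by (intro nn_integral_cong) (auto simp: S_def indicator_def)
    also have "\<dots> = (\<integral>\<^sup>+y. emeasure (N D) (S X y) \<partial>lborel)"
      using Sset[OF X] by simp
    finally show ?thesis .
  qed
  have Sbox: "S X y \<subseteq> PiE D (\<lambda>_. {-R..R})" "S X y \<noteq> {} \<Longrightarrow> y \<in> {-R..R}"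
    if X: "X \<subseteq> PiE (insert i D) (\<lambda>_. {-R..R})" for X y
  proof
    fix x assume x: "x \<in> S X y"
    then have *: "x(i := y) \<in> PiE (insert i D) (\<lambda>_. {-R..R})" "x \<in> PiE D (\<lambda>_. UNIV)"
      using X by (auto simp: S_def spN)
    show "x \<in> PiE D (\<lambda>_. {-R..R})"
    proof (rule PiE_I)
      fix j assume j: "j \<in> D"
      then have "(x(i := y)) j \<in> {-R..R}" using * by (metis PiE_mem insertI2)
      then show "x j \<in> {-R..R}" using j insert.hyps(2) by (auto split: if_splits)
    qed (use * in \<open>auto simp: PiE_def extensional_def\<close>)
  next
    assume "S X y \<noteq> {}"
    then obtain x where "x(i := y) \<in> X" by (auto simp: S_def)
    then have "(x(i := y)) i \<in> {-R..R}" using X by (metis PiE_mem insertI1 subsetD)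
    then show "y \<in> {-R..R}" by simp
  qed
  define V where "V = emeasure (N D) (PiE D (\<lambda>_. {-R..R}))"
  have Vbox: "PiE D (\<lambda>_. {-R..R}) \<in> sets (N D)"
    unfolding N_def using insert.hyps(1) by (intro sets_PiM_I_finite) auto
  have V: "V < \<infinity>"
  proof -
    have "V = (\<Prod>j\<in>D. emeasure lborel {-R..R})"
      unfolding V_def N_def using insert.hyps(1) by (intro emeasure_PiM) auto
    also have "\<dots> = ennreal (\<Prod>j\<in>D. max 0 (2 * R))"
      using emeasure_lborel_Icc_eq[of "-R" R] by (subst prod_ennreal[symmetric]) (auto simp: max_def)
    also have "\<dots> < \<infinity>" by simp
    finally show ?thesis .
  qed
  have Sle: "emeasure (N D) (S X y) \<le> V" if "X \<subseteq> PiE (insert i D) (\<lambda>_. {-R..R})" for X y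
    unfolding V_def by (intro emeasure_mono Sbox(1)[OF that] Vbox)
  have Seq: "emeasure (N D) (S X y) = ennreal (measure (N D) (S X y))" if "X \<subseteq> PiE (insert i D) (\<lambda>_. {-R..R})" for X y
    using Sle[OF that, of y] V by (intro emeasure_eq_ennreal_measure) (auto simp: less_top[symmetric] top_unique)
  have total: "(\<integral>\<^sup>+y. ennreal (measure (N D) (S X y)) \<partial>lborel) = ennreal (measure (N (insert i D)) X)"
    if X: "X \<in> sets (N (insert i D))" "X \<subseteq> PiE (insert i D) (\<lambda>_. {-R..R})" for X
  proof -
    have "emeasure (N (insert i D)) X = (\<integral>\<^sup>+y. emeasure (N D) (S X y) \<partial>lborel)" by (rule emeasure_S[OF X(1)])
    also have "\<dots> \<le> (\<integral>\<^sup>+y. V * indicator {-R..R} y \<partial>lborel)"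
    proof (rule nn_integral_mono)
      fix y
      show "emeasure (N D) (S X y) \<le> V * indicator {-R..R} y"
        using Sle[OF X(2), of y] Sbox(2)[OF X(2), of y] by (cases "S X y = {}") auto
    qed
    also have "\<dots> = V * emeasure lborel {-R..R}" by (simp add: nn_integral_cmult)
    also have "\<dots> < \<infinity>" using V emeasure_lborel_Icc_eq[of "-R" R] by (simp add: ennreal_mult_less_top)
    finally have "emeasure (N (insert i D)) X < \<infinity>" .
    then have "ennreal (measure (N (insert i D)) X) = emeasure (N (insert i D)) X"
      by (intro emeasure_eq_ennreal_measure[symmetric]) auto
    then show ?thesis using Seq[OF X(2)] emeasure_S[OF X(1)] by simp
  qed
  have meas: "(\<lambda>y. measure (N D) (S X y)) \<in> borel_measurable borel" if "X \<in> sets (N (insert i D))" for X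
    using Smeas[OF that] unfolding measure_def by simp
  show ?case
  proof (rule prekopa_leindler_real)
    show "(\<lambda>y. measure (N D) (S A y)) \<in> borel_measurable borel"
      "(\<lambda>y. measure (N D) (S B y)) \<in> borel_measurable borel"
      "(\<lambda>y. measure (N D) (S C y)) \<in> borel_measurable borel"
      using insert.prems by (auto intro: meas)
    show "measure (N D) (S A y) \<le> enn2real V" "measure (N D) (S B y) \<le> enn2real V" for y
      using Sle[OF insert.prems(4), of y] Sle[OF insert.prems(5), of y] V
      unfolding measure_def by (auto intro: enn2real_mono)
    show "measure (N D) (S A x) powr (1 - t) * measure (N D) (S B y) powr t
        \<le> measure (N D) (S C ((1 - t) * x + t * y))" for x y
    proof (rule insert.IH)
      show "S A x \<in> sets (N D)" "S B y \<in> sets (N D)" "S C ((1 - t) * x + t * y) \<in> sets (N D)"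
        using insert.prems by (auto intro: Sset)
      show "S A x \<subseteq> PiE D (\<lambda>_. {-R..R})" "S B y \<subseteq> PiE D (\<lambda>_. {-R..R})"
        "S C ((1 - t) * x + t * y) \<subseteq> PiE D (\<lambda>_. {-R..R})"
        using insert.prems by (auto intro!: Sbox(1) simp del: PiE_iff)
      fix a b assume ab: "a \<in> S A x" "b \<in> S B y"
      then have "a(i := x) \<in> A" "b(i := y) \<in> B" by (auto simp: S_def simp del: fun_upd_apply)
      then have "(\<lambda>j\<in>insert i D. (1 - t) * (a(i := x)) j + t * (b(i := y)) j) \<in> C"
        by (rule insert.prems(7))
      also have "(\<lambda>j\<in>insert i D. (1 - t) * (a(i := x)) j + t * (b(i := y)) j) =
          (\<lambda>j\<in>D. (1 - t) * a j + t * b j)(i := (1 - t) * x + t * y)"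
        using insert.hyps(2) by (auto simp: fun_eq_iff)
      finally show "(\<lambda>j\<in>D. (1 - t) * a j + t * b j) \<in> S C ((1 - t) * x + t * y)"
        by (simp add: S_def spN del: fun_upd_apply)
    qed
  qed (use t insert.prems total in auto)
qed

lemma brunn_minkowski:
  fixes A B C :: "'a::euclidean_space set"
  assumes t: "0 < t" "t < 1" and sets: "A \<in> sets borel" "B \<in> sets borel" "C \<in> sets borel"
    and bounded: "bounded A" "bounded B" "bounded C"
    and comb: "\<And>a b. a \<in> A \<Longrightarrow> b \<in> B \<Longrightarrow> (1 - t) *\<^sub>R a + t *\<^sub>R b \<in> C"
  shows "measure lborel A powr (1 - t) * measure lborel B powr t \<le> measure lborel C"
proof -
  let ?N = "PiM Basis (\<lambda>_::'a. lborel :: real measure)"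
  define T where "T f = (\<Sum>b\<in>Basis. f b *\<^sub>R b)" for f :: "'a \<Rightarrow> real"
  have [measurable]: "T \<in> measurable ?N borel" unfolding T_def by measurable
  define S where "S X = T -` X \<inter> space ?N" for X
  have coord: "T f \<bullet> b = f b" if "b \<in> Basis" for f b
  proof -
    have "T f \<bullet> b = (\<Sum>c\<in>Basis. if c = b then f b else 0)"
      unfolding T_def inner_sum_left using that by (intro sum.cong) (auto simp: inner_Basis)
    then show ?thesis using that by simp
  qed
  have mS: "measure lborel X = measure ?N (S X)" if "X \<in> sets borel" for X
    unfolding measure_def S_def using that
    by (subst lborel_eq) (simp add: T_def[symmetric] emeasure_distr)
  have sS: "S X \<in> sets ?N" if "X \<in> sets borel" for X
    unfolding S_def using that by measurable
  have "bounded (A \<union> B \<union> C)" using bounded by simp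
  then obtain R where R: "\<And>x. x \<in> A \<union> B \<union> C \<Longrightarrow> norm x \<le> R" unfolding bounded_iff by blast
  have box: "S X \<subseteq> PiE Basis (\<lambda>_. {-R..R})" if "X \<subseteq> A \<union> B \<union> C" for X
  proof
    fix f assume f: "f \<in> S X"
    have "\<bar>f b\<bar> \<le> R" if "b \<in> Basis" for b
      using Basis_le_norm[OF that, of "T f"] R[of "T f"] f \<open>X \<subseteq> A \<union> B \<union> C\<close> coord[OF that, of f]
      by (auto simp: S_def)
    then show "f \<in> PiE Basis (\<lambda>_. {-R..R})"
      using f by (auto simp: S_def space_PiM PiE_iff abs_le_iff minus_le_iff)
  qed
  have "measure ?N (S A) powr (1 - t) * measure ?N (S B) powr t \<le> measure ?N (S C)"
  proof (rule brunn_minkowski_PiM[OF finite_Basis t])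
    show "S A \<in> sets ?N" "S B \<in> sets ?N" "S C \<in> sets ?N" using sets by (auto intro: sS)
    show "S A \<subseteq> PiE Basis (\<lambda>_. {-R..R})" "S B \<subseteq> PiE Basis (\<lambda>_. {-R..R})" "S C \<subseteq> PiE Basis (\<lambda>_. {-R..R})"
      by (intro box; blast)+
    fix a b assume ab: "a \<in> S A" "b \<in> S B"
    have "T (\<lambda>i\<in>Basis. (1 - t) * a i + t * b i) = (1 - t) *\<^sub>R T a + t *\<^sub>R T b"
      by (rule euclidean_eqI) (simp add: coord inner_add_left)
    then show "(\<lambda>i\<in>Basis. (1 - t) * a i + t * b i) \<in> S C"
      using comb[of "T a" "T b"] ab by (simp add: S_def space_PiM)
  qed
  then show ?thesis using sets by (simp only: mS)
qed

section \<open>Sections parallel to a kernel\<close>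

lemma emeasure_lborel_open_pos:
  fixes S :: "'a::euclidean_space set"
  assumes "open S" "S \<noteq> {}"
  shows "emeasure lborel S > 0"
proof -
  obtain x where "x \<in> S" using assms by blast
  then obtain e where e: "e > 0" "ball x e \<subseteq> S" using assms(1) open_contains_ball by blast
  have "0 < emeasure lborel (ball x e)"
    using e(1) by (simp add: emeasure_ball)
  also have "\<dots> \<le> emeasure lborel S" using e assms by (intro emeasure_mono) auto
  finally show ?thesis .
qed

text \<open>The strict hypograph, moved so that the graph point over \<open>x0\<close> becomes the
  origin, is convex and misses the origin. A separating hyperplane is the graph of the supergradient
  once it is known not to be vertical.\<close>

lemma supergradient_exists:
  fixes f :: "'a::euclidean_space \<Rightarrow> real"
  assumes U: "open U" "convex U"
    and conc: "\<And>x y t. x \<in> U \<Longrightarrow> y \<in> U \<Longrightarrow> 0 < t \<Longrightarrow> t < 1 \<Longrightarrow> (1 - t) * f x + t * f y \<le> f ((1 - t) *\<^sub>R x + t *\<^sub>R y)"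
    and x0: "x0 \<in> U"
  obtains v where "\<And>x. x \<in> U \<Longrightarrow> f x \<le> f x0 + v \<bullet> (x - x0)"
proof -
  define S where "S = {p :: 'a \<times> real. x0 + fst p \<in> U \<and> f x0 + snd p < f (x0 + fst p)}"
  have "convex S"
    unfolding convex_alt
  proof (intro ballI allI impI)
    fix p q :: "'a \<times> real" and t :: real assume p: "p \<in> S" and q: "q \<in> S" and t: "0 \<le> t \<and> t \<le> 1"
    show "(1 - t) *\<^sub>R p + t *\<^sub>R q \<in> S"
    proof (cases "t = 0 \<or> t = 1")
      case False
      then have t': "0 < t" "t < 1" using t by auto
      have eq: "x0 + ((1 - t) *\<^sub>R fst p + t *\<^sub>R fst q) = (1 - t) *\<^sub>R (x0 + fst p) + t *\<^sub>R (x0 + fst q)"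
        by (simp add: algebra_simps)
      have "x0 + ((1 - t) *\<^sub>R fst p + t *\<^sub>R fst q) \<in> U"
        unfolding eq using U(2) p q t by (auto simp: S_def convex_alt)
      moreover have "f x0 + ((1 - t) * snd p + t * snd q) = (1 - t) * (f x0 + snd p) + t * (f x0 + snd q)"
        by (simp add: algebra_simps)
      moreover have "(1 - t) * (f x0 + snd p) + t * (f x0 + snd q) < (1 - t) * f (x0 + fst p) + t * f (x0 + fst q)"
        using p q t' by (intro add_strict_mono mult_strict_left_mono) (auto simp: S_def)
      moreover have "(1 - t) * f (x0 + fst p) + t * f (x0 + fst q) \<le> f (x0 + ((1 - t) *\<^sub>R fst p + t *\<^sub>R fst q))"
        unfolding eq using p q t' by (intro conc) (auto simp: S_def)
      ultimately show ?thesis by (simp add: S_def)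
    qed (use p q in auto)
  qed
  moreover have "0 \<notin> S" by (simp add: S_def)
  ultimately obtain a :: "'a \<times> real" where a: "a \<noteq> 0" "\<And>p. p \<in> S \<Longrightarrow> 0 \<le> a \<bullet> p"
    using separating_hyperplane_set_0[of S] by blast
  obtain p q where pq: "a = (p, q)" by (cases a)
  have sep: "0 \<le> p \<bullet> (x - x0) + q * s" if "x \<in> U" "f x0 + s < f x" for x s
    using a(2)[of "(x - x0, s)"] that by (simp add: S_def pq)
  \<comment> \<open>A vertical hyperplane would support the open set \<open>U\<close> at its
    interior point \<open>x0\<close>.\<close>
  have "q < 0"
  proof (rule ccontr)
    assume q: "\<not> q < 0"
    have "q = 0" using sep[OF x0, of "-1"] q by simp
    then have "p \<noteq> 0" using a(1) pq by (auto simp: zero_prod_def)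
    obtain e where e: "e > 0" "ball x0 e \<subseteq> U" using U(1) x0 open_contains_ball by blast
    let ?x = "x0 - (e / (2 * norm p)) *\<^sub>R p"
    have "?x \<in> U" using e \<open>p \<noteq> 0\<close> by (intro e(2)[THEN subsetD]) (simp add: dist_norm)
    then have "0 \<le> p \<bullet> (?x - x0)" using sep[of ?x "f ?x - f x0 - 1"] \<open>q = 0\<close> by simp
    moreover have "p \<bullet> (?x - x0) = - (e / (2 * norm p) * (p \<bullet> p))" by simp
    moreover have "e / (2 * norm p) * (p \<bullet> p) > 0" using e \<open>p \<noteq> 0\<close> by (intro mult_pos_pos) auto
    ultimately show False by linarith
  qed
  show ?thesis
  proof (rule that[of "(1 / - q) *\<^sub>R p"])
    fix x assume x: "x \<in> U"
    show "f x \<le> f x0 + ((1 / - q) *\<^sub>R p) \<bullet> (x - x0)"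
    proof (rule field_le_epsilon)
      fix e :: real assume e: "e > 0"
      have "0 \<le> p \<bullet> (x - x0) + q * (f x - f x0 - e)" using sep[OF x, of "f x - f x0 - e"] e by simp
      then have "- q * (f x - f x0 - e) \<le> p \<bullet> (x - x0)" by simp
      then have "f x - f x0 - e \<le> p \<bullet> (x - x0) / - q"
        using \<open>q < 0\<close> by (subst pos_le_divide_eq) (auto simp: mult.commute)
      then show "f x \<le> f x0 + ((1 / - q) *\<^sub>R p) \<bullet> (x - x0) + e" by simp
    qed
  qed
qed

text \<open>The tangent of the convex \<open>m\<close>-th power at \<open>b\<close>, obtained from
  Bernoulli's inequality.\<close>

lemma power_diff_ge:
  fixes a b :: real
  assumes "0 \<le> a" "0 < b" "1 \<le> m"
  shows "real m * b ^ (m - 1) * (a - b) \<le> a ^ m - b ^ m"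
proof -
  have "1 + real m * (a / b - 1) \<le> (1 + (a / b - 1)) ^ m"
    using assms by (intro Bernoulli_inequality) simp
  then have "b ^ m * (1 + real m * (a / b - 1)) \<le> b ^ m * (a / b) ^ m"
    using assms by (intro mult_left_mono) auto
  also have "b ^ m * (a / b) ^ m = a ^ m" using assms by (simp add: power_divide)
  finally have "b ^ m + real m * (b ^ m * (a / b - 1)) \<le> a ^ m" by (simp add: algebra_simps)
  moreover have "b ^ m * (a / b - 1) = b ^ (m - 1) * (a - b)"
  proof -
    have "b ^ m = b ^ (m - 1) * b" using assms(3) by (cases m) simp_all
    then show ?thesis using assms by (simp add: field_simps)
  qed
  ultimately show ?thesis by (simp add: mult_ac)
qed

context orthogonal_projection
begin

text \<open>A constant multiple of the Lebesgue measure on the kernel of \<open>P\<close>, realised without a measure on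
  a subspace by thickening with the unit ball of the range of \<open>P\<close>.\<close>

definition sec_set :: "'a set \<Rightarrow> 'a set" where
  "sec_set A = {z. norm (P z) < 1 \<and> z - P z \<in> A}"

definition sec :: "'a set \<Rightarrow> real" where
  "sec A = measure lborel (sec_set A)"

lemma sec_set_borel [measurable]: "A \<in> sets borel \<Longrightarrow> sec_set A \<in> sets borel"
proof -
  assume A: "A \<in> sets borel"
  have "open {z. norm (P z) < 1}" by (intro open_Collect_less continuous_intros)
  moreover have "(\<lambda>z. z - P z) -` A \<in> sets borel"
    using measurable_sets_borel[of "\<lambda>z. z - P z" borel A] A by simp
  moreover have "sec_set A = {z. norm (P z) < 1} \<inter> (\<lambda>z. z - P z) -` A" by (auto simp: sec_set_def)
  ultimately show ?thesis by (auto intro: borel_open)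
qed

lemma sec_set_bounded: "bounded A \<Longrightarrow> bounded (sec_set A)"
proof -
  assume "bounded A"
  then obtain R where R: "\<And>x. x \<in> A \<Longrightarrow> norm x \<le> R" unfolding bounded_iff by blast
  have "norm z \<le> 1 + R" if "z \<in> sec_set A" for z
  proof -
    have "norm z \<le> norm (P z) + norm (z - P z)" using norm_triangle_ineq[of "P z" "z - P z"] by simp
    then show ?thesis using that R[of "z - P z"] by (simp add: sec_set_def)
  qed
  then show ?thesis unfolding bounded_iff by blast
qed

lemma emeasure_sec_set:
  assumes "A \<in> sets borel" "bounded A"
  shows "emeasure lborel (sec_set A) = ennreal (sec A)"
proof -
  have "emeasure lborel (sec_set A) < \<infinity>"
    using sec_set_bounded[OF assms(2)] emeasure_bounded_finite by auto
  then show ?thesis unfolding sec_def by (intro emeasure_eq_ennreal_measure) auto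
qed

lemma sec_nonneg: "0 \<le> sec A" by (simp add: sec_def)

lemma sec_mono:
  assumes "A \<subseteq> B" "A \<in> sets borel" "B \<in> sets borel" "bounded B"
  shows "sec A \<le> sec B"
proof -
  have "bounded A" using assms bounded_subset by blast
  moreover have "emeasure lborel (sec_set A) \<le> emeasure lborel (sec_set B)"
    using assms by (intro emeasure_mono) (auto simp: sec_set_def intro: sec_set_borel)
  ultimately show ?thesis using assms by (simp add: emeasure_sec_set sec_nonneg)
qed

lemma sec_scale:
  assumes s: "s > 0" and A: "A \<in> sets borel"
  shows "sec {w. w /\<^sub>R s \<in> A} = s ^ dim (range (\<lambda>x. x - P x)) * sec A"
proof -
  interpret Q: orthogonal_projection "\<lambda>x. x - P x" by (rule compl_projection)
  have B: "{w. w /\<^sub>R s \<in> A} \<in> sets borel"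
    using measurable_sets_borel[of "\<lambda>w. w /\<^sub>R s" borel A] A by (simp add: vimage_def)
  have "emeasure lborel (sec_set {w. w /\<^sub>R s \<in> A}) = (\<integral>\<^sup>+x. indicator (sec_set {w. w /\<^sub>R s \<in> A}) x \<partial>lborel)"
    using B by simp
  also have "\<dots> = ennreal (s ^ dim (range (\<lambda>x. x - P x))) *
      (\<integral>\<^sup>+x. indicator (sec_set {w. w /\<^sub>R s \<in> A}) (s *\<^sub>R (x - P x) + (x - (x - P x))) \<partial>lborel)"
    using B s by (intro Q.nn_integral_scale) simp_all
  also have "(\<integral>\<^sup>+x. indicator (sec_set {w. w /\<^sub>R s \<in> A}) (s *\<^sub>R (x - P x) + (x - (x - P x))) \<partial>lborel)
      = (\<integral>\<^sup>+x. indicator (sec_set A) x \<partial>lborel)"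
    using s by (intro nn_integral_cong) (simp add: indicator_def sec_set_def P_simps)
  also have "\<dots> = emeasure lborel (sec_set A)" using A by simp
  finally show ?thesis
    using s unfolding sec_def measure_def by (simp add: enn2real_mult)
qed

lemma sec_brunn_minkowski:
  assumes t: "0 < t" "t < 1" and sets: "A \<in> sets borel" "B \<in> sets borel" "C \<in> sets borel"
    and bounded: "bounded A" "bounded B" "bounded C"
    and comb: "\<And>a b. a \<in> A \<Longrightarrow> b \<in> B \<Longrightarrow> P a = 0 \<Longrightarrow> P b = 0 \<Longrightarrow> (1 - t) *\<^sub>R a + t *\<^sub>R b \<in> C"
  shows "sec A powr (1 - t) * sec B powr t \<le> sec C"
  unfolding sec_def
proof (rule brunn_minkowski[OF t])
  fix a b assume ab: "a \<in> sec_set A" "b \<in> sec_set B"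
  have "norm (P ((1 - t) *\<^sub>R a + t *\<^sub>R b)) \<le> (1 - t) * norm (P a) + t * norm (P b)"
    unfolding P_simps using norm_triangle_ineq[of "(1 - t) *\<^sub>R P a" "t *\<^sub>R P b"] t by simp
  also have "\<dots> < (1 - t) * 1 + t * 1"
    using ab t by (intro add_strict_mono mult_strict_left_mono) (auto simp: sec_set_def)
  finally have "norm (P ((1 - t) *\<^sub>R a + t *\<^sub>R b)) < 1" by simp
  moreover have "(1 - t) *\<^sub>R (a - P a) + t *\<^sub>R (b - P b) \<in> C"
    using ab by (intro comb) (auto simp: sec_set_def P_simps)
  moreover have "(1 - t) *\<^sub>R (a - P a) + t *\<^sub>R (b - P b) = ((1 - t) *\<^sub>R a + t *\<^sub>R b) - P ((1 - t) *\<^sub>R a + t *\<^sub>R b)"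
    by (simp add: P_simps algebra_simps)
  ultimately show "(1 - t) *\<^sub>R a + t *\<^sub>R b \<in> sec_set C" by (simp add: sec_set_def)
qed (use sets bounded in \<open>auto intro: sec_set_bounded\<close>)

text \<open>Passage from the multiplicative to the additive form: \<open>A\<close> and
  \<open>B\<close> are rescaled to have \<open>sec\<close> equal to 1, and the weight is adjusted to
  compensate for the different scales. Scaling by \<open>r\<close> multiplies \<open>sec\<close> by
  \<open>r ^ m\<close>, whence the root of order \<open>m\<close>.\<close>

lemma sec_root_concave:
  defines "m \<equiv> dim (range (\<lambda>x. x - P x))"
  assumes m: "1 \<le> m" and t: "0 < t" "t < 1" and sets: "A \<in> sets borel" "B \<in> sets borel" "C \<in> sets borel"
    and bounded: "bounded A" "bounded B" "bounded C" and pos: "sec A > 0" "sec B > 0"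
    and comb: "\<And>a b. a \<in> A \<Longrightarrow> b \<in> B \<Longrightarrow> P a = 0 \<Longrightarrow> P b = 0 \<Longrightarrow> (1 - t) *\<^sub>R a + t *\<^sub>R b \<in> C"
  shows "(1 - t) * root m (sec A) + t * root m (sec B) \<le> root m (sec C)"
proof -
  define a where "a = root m (sec A)"
  define b where "b = root m (sec B)"
  have ab: "a > 0" "b > 0" and pw: "a ^ m = sec A" "b ^ m = sec B"
    using m pos by (auto simp: a_def b_def)
  define s where "s = (1 - t) * a + t * b"
  have s: "s > 0" unfolding s_def using ab t by (intro add_pos_pos) auto
  \<comment> \<open>With this weight \<open>(1 - t) *\<^sub>R (a *\<^sub>R w) + t *\<^sub>R (b
    *\<^sub>R w')\<close> equals \<open>s\<close> times the combination of \<open>w\<close> and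
    \<open>w'\<close> with weight \<open>\<theta>\<close>.\<close>
  define \<theta> where "\<theta> = t * b / s"
  have \<theta>: "0 < \<theta>" "\<theta> < 1" using ab t s by (auto simp: \<theta>_def s_def)
  have s\<theta>: "s * (1 - \<theta>) = (1 - t) * a" "s * \<theta> = t * b" using s by (auto simp: \<theta>_def s_def right_diff_distrib)
  let ?S = "\<lambda>r (X :: 'a set). {w. w /\<^sub>R r \<in> X}"
  have Sb: "?S r X \<in> sets borel" if "X \<in> sets borel" for r and X :: "'a set"
    using measurable_sets_borel[of "\<lambda>w. w /\<^sub>R r" borel X] that by (simp add: vimage_def)
  have Sbd: "bounded (?S r X)" if r: "r > 0" and X: "bounded X" for r and X :: "'a set"
  proof -
    obtain R where R: "\<And>x. x \<in> X \<Longrightarrow> norm x \<le> R" using X unfolding bounded_iff by blast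
    have "norm w \<le> r * R" if "w \<in> ?S r X" for w
      using R[of "w /\<^sub>R r"] that r by (simp add: field_simps)
    then show ?thesis unfolding bounded_iff by blast
  qed
  have one: "sec (?S (1 / a) A) = 1" "sec (?S (1 / b) B) = 1"
    using sec_scale[of "1 / a" A] sec_scale[of "1 / b" B] ab sets pw[symmetric] pos unfolding m_def[symmetric]
    by (simp_all add: power_divide)
  have "sec (?S (1 / a) A) powr (1 - \<theta>) * sec (?S (1 / b) B) powr \<theta> \<le> sec (?S (1 / s) C)"
  proof (rule sec_brunn_minkowski[OF \<theta>])
    fix w w' assume w: "w \<in> ?S (1 / a) A" "w' \<in> ?S (1 / b) B" "P w = 0" "P w' = 0"
    have "(1 - t) *\<^sub>R (a *\<^sub>R w) + t *\<^sub>R (b *\<^sub>R w') \<in> C"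
      using w by (intro comb) (auto simp: P_simps)
    also have "(1 - t) *\<^sub>R (a *\<^sub>R w) + t *\<^sub>R (b *\<^sub>R w') = s *\<^sub>R ((1 - \<theta>) *\<^sub>R w + \<theta> *\<^sub>R w')"
      by (simp add: scaleR_add_right s\<theta>)
    finally show "(1 - \<theta>) *\<^sub>R w + \<theta> *\<^sub>R w' \<in> ?S (1 / s) C" by simp
  qed (use sets bounded ab s Sb[of A "1 / a"] Sb[of B "1 / b"] Sb[of C "1 / s"]
      Sbd[of "1 / a" A] Sbd[of "1 / b" B] Sbd[of "1 / s" C] in simp_all)
  then have "1 \<le> (1 / s) ^ m * sec C"
    using sec_scale[of "1 / s" C] s sets(3) one unfolding m_def[symmetric] by simp
  then have "s ^ m \<le> sec C" using s by (simp add: power_divide pos_le_divide_eq)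
  then have "root m (s ^ m) \<le> root m (sec C)" using m by simp
  moreover have "root m (s ^ m) = s" using s m by (intro real_root_power_cancel) auto
  ultimately show ?thesis by (simp only: s_def a_def b_def)
qed

text \<open>The normalising factor of the Fubini formula: the volume of the product of the unit
  balls of range and kernel, over which the auxiliary variables run.\<close>

definition kap :: real where
  "kap = measure lborel {z. norm (P z) < 1 \<and> norm (z - P z) < 1}"

lemma kap_pos: "0 < kap" and emeasure_kap: "emeasure lborel {z. norm (P z) < 1 \<and> norm (z - P z) < 1} = ennreal kap"
proof -
  let ?S = "{z. norm (P z) < 1 \<and> norm (z - P z) < 1}"
  have "?S = sec_set (ball 0 1)" by (auto simp: sec_set_def)
  then have "emeasure lborel ?S = ennreal (sec (ball 0 1))" "sec (ball 0 1) = kap"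
    by (simp_all add: emeasure_sec_set kap_def sec_def)
  then show e: "emeasure lborel ?S = ennreal kap" by simp
  have "open ?S" by (intro open_Collect_conj open_Collect_less continuous_intros)
  moreover have "0 \<in> ?S" by simp
  ultimately have "emeasure lborel ?S > 0" using emeasure_lborel_open_pos[of ?S] by blast
  then show "0 < kap" unfolding e by simp
qed

lemma orthogonal_transformation_swap:
  "orthogonal_transformation (\<lambda>p::'a \<times> 'a. (P (fst p) + (snd p - P (snd p)), P (snd p) + (fst p - P (fst p))))"
  unfolding orthogonal_transformation
proof (intro conjI allI)
  show "linear (\<lambda>p::'a \<times> 'a. (P (fst p) + (snd p - P (snd p)), P (snd p) + (fst p - P (fst p))))"
    by (rule linearI) (simp_all add: P_simps algebra_simps)
  fix p :: "'a \<times> 'a"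
  have pyth: "(norm (P x + (y - P y)))\<^sup>2 = (norm (P x))\<^sup>2 + (norm (y - P y))\<^sup>2" for x y
    using norm_P[of "P x + (y - P y)"] by (simp add: P_simps)
  have "(norm (P (fst p) + (snd p - P (snd p)), P (snd p) + (fst p - P (fst p))))\<^sup>2 = (norm p)\<^sup>2"
    using norm_P[of "fst p"] norm_P[of "snd p"] by (cases p) (simp add: norm_Pair pyth)
  then show "norm (P (fst p) + (snd p - P (snd p)), P (snd p) + (fst p - P (fst p))) = norm p"
    by (rule power2_eq_imp_eq) auto
qed

text \<open>Fubini in the decomposition into range and kernel of \<open>P\<close>: swapping the kernel components of a
  pair of points is an isometry.\<close>

lemma nn_integral_sections:
  assumes S: "S \<in> sets borel" and \<phi>: "\<phi> \<in> borel_measurable borel"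
  shows "(\<integral>\<^sup>+x. \<phi> (P x) * indicator {x. norm (x - P x) < 1} x * emeasure lborel (sec_set {w. P x + w \<in> S}) \<partial>lborel)
    = ennreal kap * (\<integral>\<^sup>+x. \<phi> (P x) * indicator S x \<partial>lborel)"
proof -
  note [measurable] = S \<phi>
  let ?T = "\<lambda>p::'a \<times> 'a. (P (fst p) + (snd p - P (snd p)), P (snd p) + (fst p - P (fst p)))"
  let ?G = "\<lambda>p::'a \<times> 'a. \<phi> (P (fst p)) * indicator S (fst p) *
      indicator {z. norm (P z) < 1 \<and> norm (z - P z) < 1} (snd p)"
  have [measurable]: "{w. P x + w \<in> S} \<in> sets borel" for x
    using measurable_sets_borel[of "\<lambda>w. P x + w" borel S] by (simp add: vimage_def)
  have G: "?G \<in> borel_measurable borel"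
    unfolding borel_prod[symmetric] by measurable
  have "(\<integral>\<^sup>+x. \<phi> (P x) * indicator {x. norm (x - P x) < 1} x * emeasure lborel (sec_set {w. P x + w \<in> S}) \<partial>lborel)
      = (\<integral>\<^sup>+x. (\<integral>\<^sup>+z. \<phi> (P x) * indicator {x. norm (x - P x) < 1} x * indicator (sec_set {w. P x + w \<in> S}) z \<partial>lborel) \<partial>lborel)"
    by (intro nn_integral_cong) (simp add: nn_integral_cmult)
  \<comment> \<open>After the swap the first component \<open>P x + (z - P z)\<close> is tested for
    membership in \<open>S\<close> and the second for membership in a fixed set of volume
    \<open>kap\<close>, so that the double integral will split.\<close>
  also have "\<dots> = (\<integral>\<^sup>+x. (\<integral>\<^sup>+z. ?G (?T (x, z)) \<partial>lborel) \<partial>lborel)"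
    by (intro nn_integral_cong) (auto simp: P_simps sec_set_def indicator_def)
  also have "\<dots> = (\<integral>\<^sup>+p. ?G (?T p) \<partial>(lborel \<Otimes>\<^sub>M lborel))"
    by (rule lborel.nn_integral_fst) measurable
  also have "\<dots> = (\<integral>\<^sup>+p. ?G p \<partial>(lborel \<Otimes>\<^sub>M lborel))"
    unfolding lborel_prod by (rule nn_integral_lborel_orthogonal_transformation[OF orthogonal_transformation_swap G])
  also have "\<dots> = (\<integral>\<^sup>+x. (\<integral>\<^sup>+z. ?G (x, z) \<partial>lborel) \<partial>lborel)"
    by (rule lborel.nn_integral_fst[symmetric]) measurable
  also have "\<dots> = (\<integral>\<^sup>+x. ennreal kap * (\<phi> (P x) * indicator S x) \<partial>lborel)"
    by (intro nn_integral_cong) (simp add: nn_integral_cmult emeasure_kap mult.commute)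
  also have "\<dots> = ennreal kap * (\<integral>\<^sup>+x. \<phi> (P x) * indicator S x \<partial>lborel)"
    by (rule nn_integral_cmult) measurable
  finally show ?thesis .
qed

end

section \<open>Sections of a centred body\<close>

lemma integrable_indicator_bounded:
  fixes f :: "'a::euclidean_space \<Rightarrow> real"
  assumes "W \<in> sets borel" "bounded W" "f \<in> borel_measurable borel" "\<And>x. x \<in> W \<Longrightarrow> \<bar>f x\<bar> \<le> B"
  shows "integrable lborel (\<lambda>x. indicator W x * f x)"
proof -
  have "emeasure lborel W < \<infinity>" using emeasure_bounded_finite[OF assms(2)] by simp
  then have "integrable lborel (\<lambda>x. indicator W x *\<^sub>R f x)"
    using assms by (intro integrableI_bounded_set_indicator[where B=B]) auto
  then show ?thesis by simp
qed

lemma continuous_integral_zero: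
  fixes f :: "'a::euclidean_space \<Rightarrow> real"
  assumes W: "open W" and cont: "continuous_on W f" and nonneg: "\<And>x. x \<in> W \<Longrightarrow> 0 \<le> f x"
    and int: "integrable lborel (\<lambda>x. indicator W x * f x)" and zero: "(\<integral>x. indicator W x * f x \<partial>lborel) = 0"
    and x: "x \<in> W"
  shows "f x = 0"
proof -
  have nn: "0 \<le> indicator W x * f x" for x using nonneg by (simp add: indicator_def)
  have AE: "AE x in lborel. indicator W x * f x = 0"
    using integral_nonneg_eq_0_iff_AE[OF int] nn zero by simp
  have "open (W \<inter> f -` (- {0}))"
    by (rule continuous_open_preimage[OF cont W]) (simp add: open_Compl)
  moreover have "emeasure lborel (W \<inter> f -` (- {0})) = 0"
  proof -
    have "emeasure lborel {x \<in> space lborel. indicator W x * f x \<noteq> 0} = 0"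
      using AE by (intro emeasure_eq_0_AE) simp
    also have "{x \<in> space lborel. indicator W x * f x \<noteq> 0} = W \<inter> f -` (- {0})" by (auto simp: indicator_def)
    finally show ?thesis .
  qed
  ultimately have "W \<inter> f -` (- {0}) = {}" using emeasure_lborel_open_pos[of "W \<inter> f -` (- {0})"] by auto
  then show ?thesis using x by auto
qed

text \<open>\<open>D\<close> will be the interior of the body. Openness gives every nonempty section
  positive volume and makes \<open>U\<close> open, so that concave functions on \<open>U\<close> are
  continuous and have supergradients.\<close>

locale projected_body = orthogonal_projection P for P :: "'a::euclidean_space \<Rightarrow> 'a" +
  fixes D :: "'a set"
  assumes open_D: "open D" and convex_D: "convex D" and bounded_D: "bounded D" and zero_D: "0 \<in> D"
    and centred: "\<And>v. (\<integral>x. indicator D x * (v \<bullet> x) \<partial>lborel) = 0"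
    and dim_ker: "1 \<le> dim (range (\<lambda>x. x - P x))"
begin

abbreviation (input) "m \<equiv> dim (range (\<lambda>x. x - P x))"

text \<open>The cylinder over the projection of \<open>D\<close>. Functions of \<open>P x\<close>
  are studied on this open set of the whole space rather than on the projection itself.\<close>

definition U :: "'a set" where "U = {x. \<exists>y\<in>D. P y = P x}"

text \<open>A full translate of \<open>D\<close>. Only its points in the kernel of \<open>P\<close>
  matter, since \<open>sec\<close> sees no others; they form the section over
  \<open>P x\<close>.\<close>

definition slice :: "'a \<Rightarrow> 'a set" where "slice x = {w. P x + w \<in> D}"

definition F :: "'a \<Rightarrow> real" where "F x = sec (slice x)"

definition G :: "'a \<Rightarrow> real" where "G x = root m (F x)"

lemma D_borel [measurable]: "D \<in> sets borel" using open_D by (rule borel_open)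

lemma open_slice: "open (slice x)"
proof -
  have "open ((\<lambda>w. P x + w) -` D)" by (intro open_vimage open_D continuous_intros)
  then show ?thesis by (simp add: slice_def vimage_def)
qed

lemma slice_borel [measurable]: "slice x \<in> sets borel"
  using open_slice by (rule borel_open)

lemma bounded_slice: "bounded (slice x)"
proof -
  have "slice x = (+) (- P x) ` D"
    unfolding slice_def using translation_vimage_eq[of "P x" D] by (simp add: vimage_def)
  then show ?thesis using bounded_translation[OF bounded_D, of "- P x"] by metis
qed

lemma slice_P: "P x = P y \<Longrightarrow> slice x = slice y" by (simp add: slice_def)

lemma F_P: "P x = P y \<Longrightarrow> F x = F y" using slice_P[of x y] by (simp add: F_def)

lemma G_P: "P x = P y \<Longrightarrow> G x = G y" using F_P[of x y] by (simp add: G_def)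

lemma U_P: "P x = P y \<Longrightarrow> x \<in> U \<longleftrightarrow> y \<in> U" by (simp add: U_def)

lemma UI: "y \<in> D \<Longrightarrow> P y = P x \<Longrightarrow> x \<in> U"
  unfolding U_def mem_Collect_eq by (rule bexI)

lemma UE: assumes "x \<in> U" obtains y where "y \<in> D" "P y = P x"
  using assms unfolding U_def mem_Collect_eq by (elim bexE) (rule that)

lemma D_subset_U: "D \<subseteq> U" by (rule subsetI) (rule UI[OF _ refl])

lemma U_alt: "U = (\<Union>w\<in>{w. P w = 0}. (\<lambda>x. x + w) -` D)"
proof (intro equalityI subsetI)
  fix x assume "x \<in> U"
  then obtain y where "y \<in> D" "P y = P x" by (rule UE)
  then have "P (y - x) = 0" "x + (y - x) \<in> D" by (simp_all add: P_simps)
  then show "x \<in> (\<Union>w\<in>{w. P w = 0}. (\<lambda>x. x + w) -` D)" by blast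
next
  fix x assume "x \<in> (\<Union>w\<in>{w. P w = 0}. (\<lambda>x. x + w) -` D)"
  then obtain w where "P w = 0" "x + w \<in> D" by auto
  then have "P (x + w) = P x" by (simp add: P_simps)
  with \<open>x + w \<in> D\<close> show "x \<in> U" by (rule UI)
qed

lemma open_U: "open U"
  unfolding U_alt by (intro open_UN ballI open_vimage open_D continuous_intros)

lemma convex_comb_D: "x \<in> D \<Longrightarrow> y \<in> D \<Longrightarrow> 0 \<le> t \<Longrightarrow> t \<le> 1 \<Longrightarrow> (1 - t) *\<^sub>R x + t *\<^sub>R y \<in> D"
  using convex_D by (simp add: convex_alt)

lemma convex_U: "convex U"
  unfolding convex_alt
proof (intro ballI allI impI)
  fix x y and t :: real assume xy: "x \<in> U" "y \<in> U" and t: "0 \<le> t \<and> t \<le> 1"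
  from xy(1) obtain a where a: "a \<in> D" "P a = P x" by (rule UE)
  from xy(2) obtain b where b: "b \<in> D" "P b = P y" by (rule UE)
  note ab = a b
  then have "(1 - t) *\<^sub>R a + t *\<^sub>R b \<in> D" using t by (intro convex_comb_D) auto
  moreover have "P ((1 - t) *\<^sub>R a + t *\<^sub>R b) = P ((1 - t) *\<^sub>R x + t *\<^sub>R y)" using ab by (simp add: P_simps)
  ultimately show "(1 - t) *\<^sub>R x + t *\<^sub>R y \<in> U" by (rule UI)
qed

lemma zero_U: "0 \<in> U" using zero_D D_subset_U by blast

lemma F_pos: assumes "x \<in> U" shows "0 < F x"
proof -
  obtain y where y: "y \<in> D" "P y = P x" using assms by (rule UE)
  have "sec_set (slice x) = {z. norm (P z) < 1} \<inter> (\<lambda>z. z - P z) -` slice x" by (auto simp: sec_set_def)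
  moreover have "open ((\<lambda>z. z - P z) -` slice x)" by (intro open_vimage open_slice continuous_intros)
  moreover have "open {z. norm (P z) < 1}" by (intro open_Collect_less continuous_intros)
  ultimately have "open (sec_set (slice x))" by auto
  moreover have "y - P y \<in> sec_set (slice x)" using y by (simp add: sec_set_def P_simps slice_def)
  ultimately have "0 < emeasure lborel (sec_set (slice x))" using emeasure_lborel_open_pos by blast
  then show ?thesis by (simp add: F_def emeasure_sec_set bounded_slice)
qed

lemma F_zero: assumes "x \<notin> U" shows "F x = 0"
proof -
  have "sec_set (slice x) = {}"
  proof (rule ccontr)
    assume "sec_set (slice x) \<noteq> {}"
    then obtain z where "P x + (z - P z) \<in> D" by (auto simp: sec_set_def slice_def)
    moreover have "P (P x + (z - P z)) = P x" by (simp add: P_simps)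
    ultimately have "x \<in> U" by (rule UI)
    then show False using assms by simp
  qed
  then show ?thesis by (simp add: F_def sec_def)
qed

lemma F_nonneg: "0 \<le> F x" by (simp add: F_def sec_nonneg)

lemma F_bounded: obtains B where "\<And>x. F x \<le> B"
proof -
  obtain R where R: "\<And>x. x \<in> D \<Longrightarrow> norm x \<le> R" using bounded_D unfolding bounded_iff by blast
  have "F x \<le> sec (cball 0 R)" for x
  proof -
    have "sec_set (slice x) \<subseteq> sec_set (cball 0 R)"
    proof
      fix z assume "z \<in> sec_set (slice x)"
      then have z: "norm (P z) < 1" "P x + (z - P z) \<in> D" by (auto simp: sec_set_def slice_def)
      have "norm ((P x + (z - P z)) - P (P x + (z - P z))) \<le> R"
        using norm_compl_le R[OF z(2)] order_trans by blast
      then show "z \<in> sec_set (cball 0 R)" using z(1) by (simp add: sec_set_def P_simps)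
    qed
    then have "emeasure lborel (sec_set (slice x)) \<le> emeasure lborel (sec_set (cball 0 R))"
      by (intro emeasure_mono) auto
    then show ?thesis by (simp add: F_def emeasure_sec_set bounded_slice sec_nonneg)
  qed
  then show ?thesis by (rule that)
qed

lemma F_measurable [measurable]: "F \<in> borel_measurable borel"
proof -
  have "(\<lambda>x. \<integral>\<^sup>+z. indicator {z. norm (P z) < 1} z * indicator D (P x + (z - P z)) \<partial>lborel) \<in> borel_measurable borel"
    by measurable
  also have "(\<lambda>x. \<integral>\<^sup>+z. indicator {z. norm (P z) < 1} z * indicator D (P x + (z - P z)) \<partial>lborel)
      = (\<lambda>x. \<integral>\<^sup>+z. indicator (sec_set (slice x)) z \<partial>lborel)"
    by (intro ext nn_integral_cong) (auto simp: sec_set_def slice_def indicator_def)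
  also have "\<dots> = (\<lambda>x. ennreal (F x))"
    by (simp add: F_def emeasure_sec_set bounded_slice)
  finally have "(\<lambda>x. enn2real (ennreal (F x))) \<in> borel_measurable borel" by measurable
  then show ?thesis by (simp add: F_nonneg)
qed

lemma G_measurable [measurable]: "G \<in> borel_measurable borel"
  unfolding G_def by measurable

lemma G_pow: "G x ^ m = F x"
  unfolding G_def using dim_ker F_nonneg by simp

lemma G_pos: "x \<in> U \<Longrightarrow> 0 < G x"
  unfolding G_def using dim_ker F_pos by simp

lemma G_nonneg: "0 \<le> G x"
  unfolding G_def using dim_ker F_nonneg by simp

lemma G_concave:
  assumes "x \<in> U" "y \<in> U" "0 < t" "t < 1"
  shows "(1 - t) * G x + t * G y \<le> G ((1 - t) *\<^sub>R x + t *\<^sub>R y)"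
  unfolding G_def F_def
proof (rule sec_root_concave[OF dim_ker assms(3,4)])
  fix a b assume "a \<in> slice x" "b \<in> slice y"
  then have "(1 - t) *\<^sub>R (P x + a) + t *\<^sub>R (P y + b) \<in> D"
    using assms by (intro convex_comb_D) (auto simp: slice_def)
  then show "(1 - t) *\<^sub>R a + t *\<^sub>R b \<in> slice ((1 - t) *\<^sub>R x + t *\<^sub>R y)"
    by (simp add: slice_def P_simps algebra_simps)
qed (use F_pos assms in \<open>auto simp: F_def bounded_slice\<close>)

lemma continuous_on_G: "continuous_on U G"
proof -
  have "convex_on U (\<lambda>x. - G x)"
  proof (rule convex_onI[OF _ convex_U])
    fix t :: real and x y assume "0 < t" "t < 1" "x \<in> U" "y \<in> U"
    then show "- G ((1 - t) *\<^sub>R x + t *\<^sub>R y) \<le> (1 - t) * - G x + t * - G y"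
      using G_concave[of x y t] by simp
  qed
  then have "continuous_on U (\<lambda>x. - G x)" by (rule convex_on_continuous[OF open_U])
  then show ?thesis using continuous_on_minus[of U "\<lambda>x. - G x"] by simp
qed

text \<open>A bounded window of \<open>U\<close>: for a function of \<open>P x\<close>, integration
  over \<open>W\<close> weights all fibres equally.\<close>

definition W :: "'a set" where "W = U \<inter> {x. norm (x - P x) < 1}"

lemma open_W: "open W"
  unfolding W_def by (intro open_Int open_U open_Collect_less continuous_intros)

lemma W_borel [measurable]: "W \<in> sets borel" using open_W by (rule borel_open)

lemma bounded_W: "bounded W"
proof -
  obtain R where R: "\<And>x. x \<in> D \<Longrightarrow> norm x \<le> R" using bounded_D unfolding bounded_iff by blast
  have "norm x \<le> R + 1" if "x \<in> W" for x
  proof -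
    have "x \<in> U" using that by (simp add: W_def)
    then obtain y where "y \<in> D" "P y = P x" by (rule UE)
    then have "norm (P x) \<le> R" using norm_P_le[of y] R[of y] by simp
    moreover have "norm x \<le> norm (P x) + norm (x - P x)" using norm_triangle_ineq[of "P x" "x - P x"] by simp
    ultimately show ?thesis using that by (simp add: W_def)
  qed
  then show ?thesis unfolding bounded_iff by blast
qed

lemma nn_integral_F:
  assumes \<phi>: "\<phi> \<in> borel_measurable borel"
  shows "(\<integral>\<^sup>+x. \<phi> (P x) * indicator {x. norm (x - P x) < 1} x * ennreal (F x) \<partial>lborel)
    = ennreal kap * (\<integral>\<^sup>+x. \<phi> (P x) * indicator D x \<partial>lborel)"
  using nn_integral_sections[OF D_borel \<phi>]
  by (simp add: F_def emeasure_sec_set bounded_slice flip: slice_def)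

lemma integral_F:
  assumes \<psi>: "\<psi> \<in> borel_measurable borel" and nonneg: "\<And>x. x \<in> D \<Longrightarrow> 0 \<le> \<psi> (P x)"
  shows "(\<integral>x. indicator W x * (\<psi> (P x) * F x) \<partial>lborel) = kap * (\<integral>x. indicator D x * \<psi> (P x) \<partial>lborel)"
proof -
  note [measurable] = \<psi>
  have nU: "0 \<le> \<psi> (P x)" if "x \<in> U" for x
  proof -
    obtain y where "y \<in> D" "P y = P x" using \<open>x \<in> U\<close> by (rule UE)
    then show ?thesis using nonneg[of y] by simp
  qed
  have "(\<integral>x. indicator W x * (\<psi> (P x) * F x) \<partial>lborel) =
      enn2real (\<integral>\<^sup>+x. ennreal (indicator W x * (\<psi> (P x) * F x)) \<partial>lborel)"
    using nU F_nonneg by (intro integral_eq_nn_integral, measurable) (auto simp: indicator_def W_def)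
  also have "(\<integral>\<^sup>+x. ennreal (indicator W x * (\<psi> (P x) * F x)) \<partial>lborel) =
      (\<integral>\<^sup>+x. ennreal (\<psi> (P x)) * indicator {x. norm (x - P x) < 1} x * ennreal (F x) \<partial>lborel)"
    using F_nonneg F_zero by (intro nn_integral_cong) (auto simp: indicator_def W_def ennreal_mult'')
  also have "\<dots> = ennreal kap * (\<integral>\<^sup>+x. ennreal (\<psi> (P x)) * indicator D x \<partial>lborel)"
    by (rule nn_integral_F[of "\<lambda>y. ennreal (\<psi> y)"]) measurable
  also have "(\<integral>\<^sup>+x. ennreal (\<psi> (P x)) * indicator D x \<partial>lborel) = (\<integral>\<^sup>+x. ennreal (indicator D x * \<psi> (P x)) \<partial>lborel)"
    by (intro nn_integral_cong) (auto simp: indicator_def)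
  also have "enn2real (ennreal kap * (\<integral>\<^sup>+x. ennreal (indicator D x * \<psi> (P x)) \<partial>lborel)) =
      kap * enn2real (\<integral>\<^sup>+x. ennreal (indicator D x * \<psi> (P x)) \<partial>lborel)"
    using kap_pos by (simp add: enn2real_mult)
  also have "enn2real (\<integral>\<^sup>+x. ennreal (indicator D x * \<psi> (P x)) \<partial>lborel) = (\<integral>x. indicator D x * \<psi> (P x) \<partial>lborel)"
    using nonneg by (intro integral_eq_nn_integral[symmetric]) (auto simp: indicator_def)
  finally show ?thesis .
qed

lemma integral_F_linear: "(\<integral>x. indicator W x * ((v \<bullet> P x) * F x) \<partial>lborel) = 0"
proof -
  obtain R where R: "\<And>x. x \<in> D \<Longrightarrow> norm x \<le> R" using bounded_D unfolding bounded_iff by blast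
  \<comment> \<open>\<open>integral_F\<close> applies to nonnegative functions. The linear function
    is raised by its bound \<open>c\<close>, and the contribution of the constant is subtracted
    afterwards.\<close>
  define c where "c = norm v * R"
  have vP: "\<bar>v \<bullet> P x\<bar> \<le> c" if "x \<in> D" for x
  proof -
    have "\<bar>v \<bullet> P x\<bar> \<le> norm v * norm (P x)" by (rule Cauchy_Schwarz_ineq2)
    also have "\<dots> \<le> c" unfolding c_def using norm_P_le[of x] R[OF that] by (intro mult_left_mono) auto
    finally show ?thesis .
  qed
  have vPU: "\<bar>v \<bullet> P x\<bar> \<le> c" if "x \<in> W" for x
  proof -
    have "x \<in> U" using that by (simp add: W_def)
    then obtain y where "y \<in> D" "P y = P x" by (rule UE)
    then show ?thesis using vP[of y] by simp
  qed
  have c: "0 \<le> c" using vP[OF zero_D] by simp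
  obtain B where B: "\<And>x. F x \<le> B" by (rule F_bounded) auto
  have i1: "integrable lborel (\<lambda>x. indicator W x * ((v \<bullet> P x) * F x))"
  proof (rule integrable_indicator_bounded[OF W_borel bounded_W])
    fix x assume "x \<in> W"
    then show "\<bar>(v \<bullet> P x) * F x\<bar> \<le> c * B"
      unfolding abs_mult using vPU B F_nonneg c by (intro mult_mono) auto
  qed measurable
  have i2: "integrable lborel (\<lambda>x. indicator W x * (c * F x))"
  proof (rule integrable_indicator_bounded[OF W_borel bounded_W])
    fix x assume "x \<in> W"
    then show "\<bar>c * F x\<bar> \<le> c * B"
      unfolding abs_mult using B F_nonneg c by (intro mult_mono) auto
  qed measurable
  have j1: "integrable lborel (\<lambda>x. indicator D x * (v \<bullet> P x))"
    by (rule integrable_indicator_bounded[OF D_borel bounded_D _ vP]) measurable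
  have j2: "integrable lborel (\<lambda>x. indicator D x * c)"
    using c by (intro integrable_indicator_bounded[OF D_borel bounded_D, where B=c]) auto
  have "(\<integral>x. indicator W x * ((v \<bullet> P x + c) * F x) \<partial>lborel) = kap * (\<integral>x. indicator D x * (v \<bullet> P x + c) \<partial>lborel)"
    using vP by (intro integral_F[of "\<lambda>y. v \<bullet> y + c"]) (auto simp: abs_le_iff, fastforce)
  moreover have "(\<integral>x. indicator W x * ((v \<bullet> P x + c) * F x) \<partial>lborel) =
      (\<integral>x. indicator W x * ((v \<bullet> P x) * F x) \<partial>lborel) + (\<integral>x. indicator W x * (c * F x) \<partial>lborel)"
    by (subst Bochner_Integration.integral_add[OF i1 i2, symmetric]) (simp add: algebra_simps)
  moreover have "(\<integral>x. indicator D x * (v \<bullet> P x + c) \<partial>lborel) =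
      (\<integral>x. indicator D x * (v \<bullet> P x) \<partial>lborel) + (\<integral>x. indicator D x * c \<partial>lborel)"
    by (subst Bochner_Integration.integral_add[OF j1 j2, symmetric]) (simp add: algebra_simps)
  moreover have "(\<integral>x. indicator W x * (c * F x) \<partial>lborel) = kap * (\<integral>x. indicator D x * c \<partial>lborel)"
    using c by (intro integral_F[of "\<lambda>y. c"]) auto
  moreover have "(\<integral>x. indicator D x * (v \<bullet> P x) \<partial>lborel) = 0"
    using centred[of "P v"] by (simp add: selfadj)
  ultimately show ?thesis by (simp add: distrib_left)
qed

text \<open>Fubini expresses the left-hand side as an integral of \<open>F\<close> over the shrunk
  projection; rescaling the range by \<open>r\<close> returns to \<open>W\<close> and produces the
  power of \<open>r\<close>.\<close>

lemma integral_F_scaled: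
  assumes r: "0 < r"
  shows "kap * measure lborel {x \<in> D. \<exists>y\<in>D. P x = r *\<^sub>R P y} =
    r ^ dim (range P) * (\<integral>x. indicator W x * F (r *\<^sub>R x) \<partial>lborel)"
proof -
  let ?A = "{x. x /\<^sub>R r \<in> U}"
  have "open ?A"
  proof -
    have "open ((\<lambda>x. x /\<^sub>R r) -` U)" by (intro open_vimage open_U continuous_intros)
    then show ?thesis by (simp add: vimage_def)
  qed
  then have [measurable]: "?A \<in> sets borel" by (rule borel_open)
  have A: "x \<in> ?A \<longleftrightarrow> (\<exists>y\<in>D. P x = r *\<^sub>R P y)" for x
  proof -
    have "P y = P (x /\<^sub>R r) \<longleftrightarrow> P x = r *\<^sub>R P y" for y
      using r by (auto simp: P_simps)
    then show ?thesis by (simp add: U_def)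
  qed
  have "{x \<in> D. \<exists>y\<in>D. P x = r *\<^sub>R P y} = D \<inter> ?A" using A by auto
  then have S: "{x \<in> D. \<exists>y\<in>D. P x = r *\<^sub>R P y} \<in> sets borel" by simp
  have "ennreal kap * emeasure lborel {x \<in> D. \<exists>y\<in>D. P x = r *\<^sub>R P y} =
      ennreal kap * (\<integral>\<^sup>+x. indicator ?A (P x) * indicator D x \<partial>lborel)"
  proof -
    have "(\<integral>\<^sup>+x. indicator ?A (P x) * indicator D x \<partial>lborel) =
        (\<integral>\<^sup>+x. indicator {x \<in> D. \<exists>y\<in>D. P x = r *\<^sub>R P y} x \<partial>lborel)"
      by (intro nn_integral_cong) (simp add: indicator_def A[unfolded mem_Collect_eq] idem, blast)
    then show ?thesis using S by simp
  qed
  also have "\<dots> = (\<integral>\<^sup>+x. indicator ?A (P x) * indicator {x. norm (x - P x) < 1} x * ennreal (F x) \<partial>lborel)"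
    by (rule nn_integral_F[symmetric]) measurable
  also have "\<dots> = ennreal (r ^ dim (range P)) * (\<integral>\<^sup>+x. indicator ?A (P (r *\<^sub>R P x + (x - P x))) *
      indicator {x. norm (x - P x) < 1} (r *\<^sub>R P x + (x - P x)) * ennreal (F (r *\<^sub>R P x + (x - P x))) \<partial>lborel)"
    by (rule nn_integral_scale[OF r]) measurable
  also have "(\<integral>\<^sup>+x. indicator ?A (P (r *\<^sub>R P x + (x - P x))) *
      indicator {x. norm (x - P x) < 1} (r *\<^sub>R P x + (x - P x)) * ennreal (F (r *\<^sub>R P x + (x - P x))) \<partial>lborel)
      = (\<integral>\<^sup>+x. ennreal (indicator W x * F (r *\<^sub>R x)) \<partial>lborel)"
  proof (intro nn_integral_cong)
    fix x
    have "F (r *\<^sub>R P x + (x - P x)) = F (r *\<^sub>R x)" by (rule F_P) (simp add: P_simps)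
    moreover have "P (r *\<^sub>R P x + (x - P x)) \<in> ?A \<longleftrightarrow> x \<in> U"
      using r U_P[of "P x" x] by (simp add: P_simps)
    ultimately show "indicator ?A (P (r *\<^sub>R P x + (x - P x))) *
      indicator {x. norm (x - P x) < 1} (r *\<^sub>R P x + (x - P x)) * ennreal (F (r *\<^sub>R P x + (x - P x)))
      = ennreal (indicator W x * F (r *\<^sub>R x))"
      by (auto simp: indicator_def W_def P_simps)
  qed
  finally have "enn2real (ennreal kap * emeasure lborel {x \<in> D. \<exists>y\<in>D. P x = r *\<^sub>R P y}) =
      enn2real (ennreal (r ^ dim (range P)) * (\<integral>\<^sup>+x. ennreal (indicator W x * F (r *\<^sub>R x)) \<partial>lborel))" by simp
  moreover have "enn2real (\<integral>\<^sup>+x. ennreal (indicator W x * F (r *\<^sub>R x)) \<partial>lborel) =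
      (\<integral>x. indicator W x * F (r *\<^sub>R x) \<partial>lborel)"
    using F_nonneg by (intro integral_eq_nn_integral[symmetric]) auto
  ultimately show ?thesis
    using kap_pos r by (simp add: enn2real_mult measure_def)
qed

text \<open>On the segment from 0 to \<open>x\<close> concavity gives
  \<open>G (r *\<^sub>R x) - G x \<ge> (1 - r) * (G 0 - G x)\<close>, and the tangent of the
  \<open>m\<close>-th power turns this into
  \<open>F (r *\<^sub>R x) \<ge> F x + m * (1 - r) * E x\<close>. The excess \<open>e\<close> is the
  integral of \<open>E\<close>, up to the factor \<open>kap\<close>; centring makes it
  nonnegative.\<close>

lemma section_inequality:
  obtains e where "0 \<le> e"
    "\<And>r. 0 < r \<Longrightarrow> r < 1 \<Longrightarrow>
      r ^ dim (range P) * (measure lborel D + real m * (1 - r) * e) \<le> measure lborel {x \<in> D. \<exists>y\<in>D. P x = r *\<^sub>R P y}"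
    "e = 0 \<Longrightarrow> (\<forall>x\<in>U. F x = F 0)"
proof -
  obtain v where v: "\<And>x. x \<in> U \<Longrightarrow> G x \<le> G 0 + v \<bullet> (x - 0)"
    using supergradient_exists[OF open_U convex_U G_concave zero_U] by blast
  have G0: "0 < G 0" by (rule G_pos[OF zero_U])
  define y where "y x = (1 / G 0) * (v \<bullet> P x)" for x
  have Gle: "G x \<le> G 0 * (1 + y x)" if "x \<in> U" for x
  proof -
    have "P x \<in> U" using that U_P[of "P x" x] by (simp add: idem)
    then have "G (P x) \<le> G 0 + v \<bullet> P x" using v by fastforce
    then show ?thesis using G_P[of "P x" x] G0 by (simp add: idem y_def distrib_left)
  qed
  define E where "E x = G x ^ (m - 1) * (G 0 - G x)" for x
  have Fm: "F x = G x ^ (m - 1) * G x" for x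
    unfolding G_pow[symmetric] using dim_ker by (metis One_nat_def Suc_pred less_eq_Suc_le power_Suc2)
  \<comment> \<open>\<open>E\<close> may change sign. Adding the linear term leaves the integral
    unchanged, by centring, and makes the integrand nonnegative at every point of
    \<open>U\<close>.\<close>
  define H where "H x = E x + y x * F x" for x
  have H: "H x = G x ^ (m - 1) * (G 0 - G x * (1 - y x))" for x
    by (simp add: H_def E_def Fm algebra_simps)
  \<comment> \<open>Multiplying \<open>G x \<le> G 0 * (1 + y x)\<close> by \<open>1 - y x\<close>
    bounds the product by \<open>G 0 * (1 - (y x)\<^sup>2)\<close>, hence by \<open>G 0\<close>; if
    \<open>1 - y x\<close> is negative, the product is at most 0.\<close>
  have key: "0 \<le> G 0 - G x * (1 - y x)" if "x \<in> U" for x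
  proof (cases "1 - y x \<ge> 0")
    case True
    have "G x * (1 - y x) \<le> G 0 * (1 + y x) * (1 - y x)"
      using Gle[OF that] True by (intro mult_right_mono) auto
    also have "\<dots> = G 0 - G 0 * (y x)\<^sup>2" by (simp add: algebra_simps power2_eq_square)
    also have "\<dots> \<le> G 0" using G0 by simp
    finally show ?thesis by simp
  next
    case False
    then have "G x * (1 - y x) \<le> 0" using G_nonneg[of x] by (intro mult_nonneg_nonpos) auto
    then show ?thesis using G0 by linarith
  qed
  have H_nonneg: "0 \<le> H x" if "x \<in> U" for x
    unfolding H using key[OF that] G_nonneg by simp
  obtain B where B: "\<And>x. F x \<le> B" by (rule F_bounded) auto
  have GB: "G x \<le> root m B" for x unfolding G_def using dim_ker B by simp
  have "0 \<le> root m B" using GB[of 0] G0 by linarith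
  have iF: "integrable lborel (\<lambda>x. indicator W x * F x)"
    using B F_nonneg by (intro integrable_indicator_bounded[OF W_borel bounded_W, where B=B]) auto
  have iFr: "integrable lborel (\<lambda>x. indicator W x * F (r *\<^sub>R x))" for r
    using B F_nonneg by (intro integrable_indicator_bounded[OF W_borel bounded_W, where B=B]) auto
  have iE: "integrable lborel (\<lambda>x. indicator W x * E x)"
  proof (rule integrable_indicator_bounded[OF W_borel bounded_W])
    show "E \<in> borel_measurable borel" unfolding E_def by measurable
    fix x
    have "\<bar>G 0 - G x\<bar> \<le> root m B" using GB[of 0] GB[of x] G_nonneg[of 0] G_nonneg[of x] by linarith
    then show "\<bar>E x\<bar> \<le> root m B ^ (m - 1) * root m B"
      unfolding E_def abs_mult using G_nonneg GB by (intro mult_mono) (auto intro: power_mono)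
  qed
  have iY: "integrable lborel (\<lambda>x. indicator W x * (y x * F x))"
  proof -
    obtain R where R: "\<And>x. x \<in> W \<Longrightarrow> norm x \<le> R" using bounded_W unfolding bounded_iff by blast
    show ?thesis
    proof (rule integrable_indicator_bounded[OF W_borel bounded_W])
      show "(\<lambda>x. y x * F x) \<in> borel_measurable borel" unfolding y_def by measurable
      fix x assume x: "x \<in> W"
      have "\<bar>v \<bullet> P x\<bar> \<le> norm v * norm (P x)" by (rule Cauchy_Schwarz_ineq2)
      also have "\<dots> \<le> norm v * R" using norm_P_le[of x] R[OF x] by (intro mult_left_mono) auto
      finally have "\<bar>y x\<bar> \<le> 1 / G 0 * (norm v * R)" unfolding y_def using G0 by (simp add: abs_mult divide_right_mono)
      then show "\<bar>y x * F x\<bar> \<le> 1 / G 0 * (norm v * R) * B"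
        unfolding abs_mult using F_nonneg B by (intro mult_mono) (auto intro: order_trans[OF abs_ge_zero])
    qed
  qed
  have "(\<integral>x. indicator W x * (y x * F x) \<partial>lborel) = 0"
    using integral_F_linear[of "(1 / G 0) *\<^sub>R v"] by (simp add: y_def)
  then have EH: "(\<integral>x. indicator W x * E x \<partial>lborel) = (\<integral>x. indicator W x * H x \<partial>lborel)"
    using Bochner_Integration.integral_add[OF iE iY] by (simp add: H_def distrib_left)
  have iH: "integrable lborel (\<lambda>x. indicator W x * H x)"
    using Bochner_Integration.integrable_add[OF iE iY] by (simp add: H_def distrib_left)
  define e where "e = (\<integral>x. indicator W x * E x \<partial>lborel) / kap"
  show ?thesis
  proof (rule that[of e])
    have "0 \<le> (\<integral>x. indicator W x * H x \<partial>lborel)"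
      using H_nonneg by (intro Bochner_Integration.integral_nonneg) (auto simp: indicator_def W_def)
    then show "0 \<le> e" using kap_pos by (simp add: e_def EH)
  next
    fix r :: real assume r: "0 < r" "r < 1"
    have "(\<integral>x. indicator W x * F x + real m * (1 - r) * (indicator W x * E x) \<partial>lborel) \<le> (\<integral>x. indicator W x * F (r *\<^sub>R x) \<partial>lborel)"
    proof (rule integral_mono)
      show "integrable lborel (\<lambda>x. indicator W x * F x + real m * (1 - r) * (indicator W x * E x))"
        using iF iE by simp
      show "integrable lborel (\<lambda>x. indicator W x * F (r *\<^sub>R x))" by (rule iFr)
      fix x
      show "indicator W x * F x + real m * (1 - r) * (indicator W x * E x) \<le> indicator W x * F (r *\<^sub>R x)"
      proof (cases "x \<in> W")
        case True
        then have x: "x \<in> U" by (simp add: W_def)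
        have "(1 - r) * G 0 + r * G x \<le> G (r *\<^sub>R x)"
          using G_concave[OF zero_U x r] by simp
        then have "(1 - r) * (G 0 - G x) \<le> G (r *\<^sub>R x) - G x" by (simp add: algebra_simps)
        then have "real m * G x ^ (m - 1) * ((1 - r) * (G 0 - G x)) \<le> real m * G x ^ (m - 1) * (G (r *\<^sub>R x) - G x)"
          using G_nonneg by (intro mult_left_mono) auto
        also have "\<dots> \<le> G (r *\<^sub>R x) ^ m - G x ^ m"
          using G_nonneg G_pos[OF x] dim_ker by (rule power_diff_ge)
        finally have "F x + real m * (1 - r) * E x \<le> F (r *\<^sub>R x)"
          unfolding G_pow E_def by (simp add: mult_ac)
        then show ?thesis using True by simp
      qed simp
    qed
    also have "(\<integral>x. indicator W x * F x + real m * (1 - r) * (indicator W x * E x) \<partial>lborel) =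
        (\<integral>x. indicator W x * F x \<partial>lborel) + real m * (1 - r) * (\<integral>x. indicator W x * E x \<partial>lborel)"
      using iF iE by simp
    also have "(\<integral>x. indicator W x * F x \<partial>lborel) = kap * measure lborel D"
      using integral_F[of "\<lambda>_. 1"] by simp
    also have "(\<integral>x. indicator W x * E x \<partial>lborel) = kap * e" using kap_pos by (simp add: e_def)
    finally have "r ^ dim (range P) * (kap * measure lborel D + real m * (1 - r) * (kap * e))
        \<le> r ^ dim (range P) * (\<integral>x. indicator W x * F (r *\<^sub>R x) \<partial>lborel)"
      using r by (intro mult_left_mono) auto
    also have "\<dots> = kap * measure lborel {x \<in> D. \<exists>y\<in>D. P x = r *\<^sub>R P y}"
      using integral_F_scaled[OF r(1)] by simp
    finally have "kap * (r ^ dim (range P) * (measure lborel D + real m * (1 - r) * e)) \<le>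
        kap * measure lborel {x \<in> D. \<exists>y\<in>D. P x = r *\<^sub>R P y}"
      by (simp add: algebra_simps)
    then show "r ^ dim (range P) * (measure lborel D + real m * (1 - r) * e) \<le> measure lborel {x \<in> D. \<exists>y\<in>D. P x = r *\<^sub>R P y}"
      using kap_pos by simp
  next
    assume "e = 0"
    then have zero: "(\<integral>x. indicator W x * H x \<partial>lborel) = 0" using kap_pos by (simp add: e_def EH)
    have WU: "W \<subseteq> U" by (auto simp: W_def)
    have "continuous_on W H"
      unfolding H y_def by (intro continuous_intros continuous_on_subset[OF continuous_on_G WU])
    then have HW: "H x = 0" if "x \<in> W" for x
      by (rule continuous_integral_zero[OF open_W _ _ iH zero that]) (use H_nonneg WU in blast)
    show "\<forall>x\<in>U. F x = F 0"
    proof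
      fix x assume x: "x \<in> U"
      then have Px: "P x \<in> W" using U_P[of "P x" x] by (simp add: W_def idem)
      then have PU: "P x \<in> U" using WU by blast
      let ?y = "y (P x)" and ?g = "G (P x)"
      have "?g > 0" by (rule G_pos[OF PU])
      \<comment> \<open>Now \<open>G 0\<close> is itself bounded by
        \<open>G 0 * (1 - ?y\<^sup>2)\<close>, which forces \<open>?y = 0\<close> and thereby
        \<open>G (P x) = G 0\<close>.\<close>
      then have eq: "G 0 = ?g * (1 - ?y)" using HW[OF Px] unfolding H by simp
      then have "1 - ?y > 0" using G0 \<open>?g > 0\<close> by (simp add: zero_less_mult_iff)
      then have "?g * (1 - ?y) \<le> G 0 * (1 + ?y) * (1 - ?y)"
        using Gle[OF PU] by (intro mult_right_mono) auto
      then have "G 0 \<le> G 0 * (1 + ?y) * (1 - ?y)" by (simp only: eq[symmetric])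
      then have "G 0 * ?y\<^sup>2 \<le> 0" by (simp add: algebra_simps power2_eq_square)
      then have "?y = 0" using G0 by (simp add: mult_le_0_iff)
      then have "?g = G 0" using eq by simp
      then have "F (P x) = F 0" by (metis G_pow)
      then show "F x = F 0" using F_P[of "P x" x] by (simp add: idem)
    qed
  qed
qed

end

section \<open>Bodies with sections of equal volume\<close>

text \<open>Cut the interval into \<open>n\<close> equal steps. The bounds on the single steps
  telescope to \<open>(\<kappa> b - \<kappa> a) * (b - a)\<close> divided by \<open>n\<close>, which
  tends to 0.\<close>

lemma const_of_slope_bounds:
  fixes h \<kappa> :: "real \<Rightarrow> real"
  assumes le: "\<And>a b. l < a \<Longrightarrow> a < b \<Longrightarrow> b < r \<Longrightarrow> \<bar>h b - h a\<bar> \<le> (\<kappa> b - \<kappa> a) * (b - a)"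
    and ab: "l < a" "a < b" "b < r"
  shows "h a = h b"
proof -
  have bound: "\<bar>h b - h a\<bar> \<le> (\<kappa> b - \<kappa> a) * (b - a) * inverse (real (Suc n))" for n
  proof -
    let ?N = "Suc n"
    define M where "M = real ?N"
    have M: "M > 0" by (simp add: M_def)
    define p where "p i = a + (b - a) * (real i / M)" for i
    have p0: "p 0 = a" and pN: "p ?N = b" using M by (simp_all add: p_def M_def[symmetric] del: of_nat_Suc)
    have step: "p (Suc i) - p i = (b - a) * inverse M" for i
      by (simp add: p_def add_divide_distrib distrib_left inverse_eq_divide)
    have "\<bar>h (p (Suc i)) - h (p i)\<bar> \<le> (\<kappa> (p (Suc i)) - \<kappa> (p i)) * ((b - a) * inverse (M))" if "i < ?N" for i
    proof -
      have "l < p i"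
      proof -
        have "0 \<le> (b - a) * (real i / M)" using ab M by simp
        then show ?thesis using ab(1) by (simp add: p_def)
      qed
      moreover have "p i < p (Suc i)" 
      proof -
        have "0 < (b - a) * inverse M" using ab M by simp
        then show ?thesis using step[of i] by linarith
      qed
      moreover have "p (Suc i) \<le> b"
      proof -
        have "real (Suc i) / M \<le> 1" using that M by (simp add: M_def divide_le_eq_1)
        then have "(b - a) * (real (Suc i) / M) \<le> (b - a) * 1" using ab by (intro mult_left_mono) auto
        then show ?thesis by (simp add: p_def)
      qed
      ultimately show ?thesis using le[of "p i" "p (Suc i)"] ab(3) by (simp only: step)
    qed
    then have "(\<Sum>i<?N. \<bar>h (p (Suc i)) - h (p i)\<bar>) \<le>
        (\<Sum>i<?N. (\<kappa> (p (Suc i)) - \<kappa> (p i)) * ((b - a) * inverse (M)))"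
      by (intro sum_mono) blast
    also have "\<dots> = (\<kappa> b - \<kappa> a) * ((b - a) * inverse (M))"
      unfolding sum_distrib_right[symmetric] by (simp only: sum_lessThan_telescope[of "\<lambda>i. \<kappa> (p i)"] p0 pN)
    finally have "(\<Sum>i<?N. \<bar>h (p (Suc i)) - h (p i)\<bar>) \<le> (\<kappa> b - \<kappa> a) * (b - a) * inverse (M)"
      by (simp only: mult.assoc)
    moreover have "\<bar>h b - h a\<bar> \<le> (\<Sum>i<?N. \<bar>h (p (Suc i)) - h (p i)\<bar>)"
    proof -
      have "h b - h a = (\<Sum>i<?N. h (p (Suc i)) - h (p i))"
        by (simp only: sum_lessThan_telescope[of "\<lambda>i. h (p i)"] p0 pN)
      then show ?thesis by (simp only: sum_abs)
    qed
    ultimately show ?thesis unfolding M_def by linarith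
  qed
  have "(\<lambda>n. (\<kappa> b - \<kappa> a) * (b - a) * inverse (real (Suc n))) \<longlonglongrightarrow> (\<kappa> b - \<kappa> a) * (b - a) * 0"
    by (intro tendsto_mult tendsto_const LIMSEQ_inverse_real_of_nat)
  then have "\<bar>h b - h a\<bar> \<le> (\<kappa> b - \<kappa> a) * (b - a) * 0"
    by (rule LIMSEQ_le_const) (use bound in blast)
  then show ?thesis by simp
qed

lemma small_scaling_in_open:
  fixes U :: "'a::real_normed_vector set"
  assumes "open U" "0 \<in> U"
  obtains e where "e > 0" "e *\<^sub>R x \<in> U"
proof -
  obtain d where d: "d > 0" "ball 0 d \<subseteq> U" using assms open_contains_ball by blast
  have "norm ((d / (2 * (norm x + 1))) *\<^sub>R x) < d"
  proof -
    have "norm x + 1 > 0" by (simp add: add_nonneg_pos)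
    then have "d / (2 * (norm x + 1)) * norm x < d"
      using d by (simp add: pos_divide_less_eq mult_strict_left_mono)
    then show ?thesis using d \<open>norm x + 1 > 0\<close> by simp
  qed
  then show ?thesis using d \<open>d > 0\<close>
    by (intro that[of "d / (2 * (norm x + 1))"]) (auto intro!: divide_pos_pos add_nonneg_pos)
qed

lemma inner_maximal_in_open:
  fixes U :: "'a::real_inner set"
  assumes U: "open U" "z \<in> U" and le: "\<And>x. x \<in> U \<Longrightarrow> g \<bullet> x \<le> g \<bullet> z"
  shows "g = 0"
proof (rule ccontr)
  assume g: "g \<noteq> 0"
  obtain d where d: "d > 0" "ball z d \<subseteq> U" using U open_contains_ball by blast
  let ?x = "z + (d / (2 * norm g)) *\<^sub>R g"
  have "?x \<in> U" using d g by (intro subsetD[OF d(2)]) (simp add: dist_norm)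
  then have "(d / (2 * norm g)) * (g \<bullet> g) \<le> 0" using le[of ?x] by (simp add: inner_add_right)
  moreover have "(d / (2 * norm g)) * (g \<bullet> g) > 0" using d g by (intro mult_pos_pos) auto
  ultimately show False by linarith
qed

lemma (in orthogonal_projection) sec_pos:
  assumes A: "open A" "bounded A" and w: "w \<in> A" "P w = 0"
  shows "0 < sec A"
proof -
  have "sec_set A = {z. norm (P z) < 1} \<inter> (\<lambda>z. z - P z) -` A" by (auto simp: sec_set_def)
  moreover have "open ((\<lambda>z. z - P z) -` A)" by (intro open_vimage A(1) continuous_intros)
  moreover have "open {z. norm (P z) < 1}" by (intro open_Collect_less continuous_intros)
  ultimately have "open (sec_set A)" by auto
  moreover have "w \<in> sec_set A" using w by (simp add: sec_set_def)
  ultimately have "0 < emeasure lborel (sec_set A)" using emeasure_lborel_open_pos[of "sec_set A"] by blast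
  then show ?thesis using A by (simp add: emeasure_sec_set borel_open)
qed

locale equal_sections = projected_body +
  assumes const_F: "x \<in> U \<Longrightarrow> F x = F 0"

text \<open>The sections are compared through their one-dimensional marginals in a fixed direction
  \<open>u\<close> of the kernel; the results for all such directions are combined
  afterwards.\<close>

locale equal_sections_direction = equal_sections +
  fixes u
  assumes Pu: "P u = 0" and u_nz: "u \<noteq> 0"
begin

abbreviation (input) "f \<equiv> F 0"

lemma f_pos: "0 < f" by (rule F_pos[OF zero_U])

definition half :: "'a \<Rightarrow> real \<Rightarrow> 'a set" where "half x c = slice x \<inter> {w. w \<bullet> u \<le> c}"

definition upper :: "'a \<Rightarrow> real \<Rightarrow> 'a set" where "upper x c = slice x \<inter> {w. c < w \<bullet> u}"

definition N :: "'a \<Rightarrow> real \<Rightarrow> real" where "N x c = sec (half x c)"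

text \<open>The marginal of the thickened section in direction \<open>u\<close>. Its distribution
  function is \<open>N x\<close>, which provides limits, continuity and the uniqueness theorem for
  distribution functions.\<close>

definition \<mu> :: "'a \<Rightarrow> real measure" where
  "\<mu> x = distr (density lborel (indicator (sec_set (slice x)))) borel (\<lambda>z. z \<bullet> u)"

lemma compl_inner_u: "(z - P z) \<bullet> u = z \<bullet> u"
  using selfadj[of z u] by (simp add: inner_diff_left Pu)

lemma half_borel [measurable]: "half x c \<in> sets borel"
  unfolding half_def by (intro sets.Int slice_borel borel_closed closed_Collect_le continuous_intros)

lemma open_upper: "open (upper x c)"
  unfolding upper_def by (intro open_Int open_slice open_Collect_less continuous_intros)

lemma bounded_half: "bounded (half x c)" and bounded_upper: "bounded (upper x c)"
  unfolding half_def upper_def using bounded_slice by (auto intro: bounded_Int)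

lemma N_add_upper: "N x c + sec (upper x c) = F x"
proof -
  have "sec_set (slice x) = sec_set (half x c) \<union> sec_set (upper x c)"
    "sec_set (half x c) \<inter> sec_set (upper x c) = {}"
    by (auto simp: sec_set_def half_def upper_def)
  moreover have "sec_set (half x c) \<in> sets lborel" "sec_set (upper x c) \<in> sets lborel"
    using borel_open[OF open_upper] by auto
  ultimately have "emeasure lborel (sec_set (slice x)) =
      emeasure lborel (sec_set (half x c)) + emeasure lborel (sec_set (upper x c))"
    by (metis plus_emeasure)
  then have "ennreal (F x) = ennreal (N x c) + ennreal (sec (upper x c))"
    by (simp add: emeasure_sec_set bounded_half bounded_upper bounded_slice borel_open[OF open_upper] F_def N_def)
  then show ?thesis
    using F_nonneg sec_nonneg by (simp add: N_def ennreal_plus[symmetric] del: ennreal_plus)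
qed

lemma sets_\<mu> [simp, measurable_cong]: "sets (\<mu> x) = sets borel"
  by (simp add: \<mu>_def)

lemma emeasure_\<mu>:
  assumes "A \<in> sets borel"
  shows "emeasure (\<mu> x) A = emeasure lborel (sec_set (slice x) \<inter> (\<lambda>z. z \<bullet> u) -` A)"
proof -
  have A: "(\<lambda>z. z \<bullet> u) -` A \<in> sets borel"
    using measurable_sets_borel[of "\<lambda>z. z \<bullet> u" borel A] assms by simp
  have "emeasure (\<mu> x) A = emeasure (density lborel (indicator (sec_set (slice x)))) ((\<lambda>z. z \<bullet> u) -` A)"
    unfolding \<mu>_def using assms by (subst emeasure_distr) (simp_all add: space_density)
  also have "\<dots> = (\<integral>\<^sup>+z. indicator (sec_set (slice x)) z * indicator ((\<lambda>z. z \<bullet> u) -` A) z \<partial>lborel)"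
    using A by (intro emeasure_density) simp_all
  also have "\<dots> = (\<integral>\<^sup>+z. indicator (sec_set (slice x) \<inter> (\<lambda>z. z \<bullet> u) -` A) z \<partial>lborel)"
    by (simp only: indicator_inter_arith)
  also have "\<dots> = emeasure lborel (sec_set (slice x) \<inter> (\<lambda>z. z \<bullet> u) -` A)" using A by simp
  finally show ?thesis .
qed

lemma finite_borel_measure_\<mu>: "finite_borel_measure (\<mu> x)"
proof (intro finite_borel_measure.intro finite_measureI finite_borel_measure_axioms.intro)
  show "sets (\<mu> x) = sets borel" by simp
  have "space (\<mu> x) = UNIV" by (simp add: \<mu>_def)
  then show "emeasure (\<mu> x) (space (\<mu> x)) \<noteq> \<infinity>"
    by (simp add: emeasure_\<mu> emeasure_sec_set bounded_slice)
qed

lemma cdf_\<mu>: "cdf (\<mu> x) c = N x c"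
proof -
  have "sec_set (slice x) \<inter> (\<lambda>z. z \<bullet> u) -` {..c} = sec_set (half x c)"
    by (auto simp: sec_set_def half_def compl_inner_u)
  then show ?thesis
    unfolding cdf_def measure_def N_def sec_def by (simp add: emeasure_\<mu>)
qed

lemma measure_\<mu>_space: "measure (\<mu> x) (space (\<mu> x)) = F x"
proof -
  have "space (\<mu> x) = UNIV" by (simp add: \<mu>_def)
  then show ?thesis by (simp add: measure_def emeasure_\<mu> F_def sec_def)
qed

lemma isCont_N: "isCont (N x) c"
proof -
  interpret finite_borel_measure "\<mu> x" by (rule finite_borel_measure_\<mu>)
  have "negligible {z. u \<bullet> z = c}" by (rule negligible_hyperplane) (use u_nz in simp)
  moreover have "{z. u \<bullet> z = c} \<in> sets borel"
    by (intro borel_closed closed_Collect_eq continuous_intros)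
  ultimately have "emeasure lborel {z. u \<bullet> z = c} = 0"
    by (simp add: negligible_iff_null_sets null_sets_completion_iff null_sets_def)
  moreover have "emeasure lborel (sec_set (slice x) \<inter> (\<lambda>z. z \<bullet> u) -` {c}) \<le> emeasure lborel {z. u \<bullet> z = c}"
    using \<open>{z. u \<bullet> z = c} \<in> sets borel\<close> by (intro emeasure_mono) (auto simp: inner_commute)
  ultimately have "measure (\<mu> x) {c} = 0" by (simp add: measure_def emeasure_\<mu>)
  then have "isCont (cdf (\<mu> x)) c" by (simp add: isCont_cdf)
  moreover have "cdf (\<mu> x) = N x" by (rule ext) (rule cdf_\<mu>)
  ultimately show ?thesis by simp
qed

lemma N_mono: "c \<le> c' \<Longrightarrow> N x c \<le> N x c'"
  using finite_borel_measure.cdf_nondecreasing[OF finite_borel_measure_\<mu>, of c c' x] by (simp add: cdf_\<mu>)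

lemma N_nonneg: "0 \<le> N x c" by (simp add: N_def sec_nonneg)

lemma N_le: "x \<in> U \<Longrightarrow> N x c \<le> f"
  using N_add_upper[of x c] sec_nonneg[of "upper x c"] const_F by fastforce

lemma N_exceeds: assumes "x \<in> U" "s < f" obtains c where "c0 < c" "s < N x c"
proof -
  have "(cdf (\<mu> x) \<longlongrightarrow> F x) at_top"
    using finite_borel_measure.cdf_lim_at_top[OF finite_borel_measure_\<mu>, of x] by (simp add: measure_\<mu>_space)
  then have "\<forall>\<^sub>F c in at_top. s < cdf (\<mu> x) c"
    using assms const_F by (intro order_tendstoD(1)) auto
  then have "\<forall>\<^sub>F c in at_top. c0 < c \<and> s < cdf (\<mu> x) c"
    using eventually_gt_at_top[of c0] by (rule eventually_conj[rotated])
  then obtain c where "c0 < c \<and> s < cdf (\<mu> x) c" using eventually_happens'[OF trivial_limit_at_top_linorder] by blast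
  then show ?thesis using that[of c] unfolding cdf_\<mu> by blast
qed

lemma N_below: assumes "0 < s" obtains c where "N x c < s"
proof -
  have "(cdf (\<mu> x) \<longlongrightarrow> 0) at_bot"
    by (rule finite_borel_measure.cdf_lim_at_bot[OF finite_borel_measure_\<mu>])
  then have "\<forall>\<^sub>F c in at_bot. cdf (\<mu> x) c < s" using assms by (rule order_tendstoD(2))
  then obtain c where "cdf (\<mu> x) c < s" using eventually_happens'[OF trivial_limit_at_bot_linorder] by blast
  then show ?thesis using that by (simp add: cdf_\<mu>)
qed

section \<open>Quantiles of the marginals\<close>

lemma slice_comb:
  assumes "x \<in> U" "y \<in> U" "0 < t" "t < 1" "a \<in> slice x" "b \<in> slice y"
  shows "(1 - t) *\<^sub>R a + t *\<^sub>R b \<in> slice ((1 - t) *\<^sub>R x + t *\<^sub>R y)"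
proof -
  have "(1 - t) *\<^sub>R (P x + a) + t *\<^sub>R (P y + b) \<in> D"
    using assms by (intro convex_comb_D) (auto simp: slice_def)
  then show ?thesis by (simp add: slice_def P_simps algebra_simps)
qed

lemma N_concave:
  assumes xy: "x \<in> U" "y \<in> U" and t: "0 < t" "t < 1" and pos: "0 < N x c" "0 < N y d"
  shows "(1 - t) * root m (N x c) + t * root m (N y d) \<le> root m (N ((1 - t) *\<^sub>R x + t *\<^sub>R y) ((1 - t) * c + t * d))"
  unfolding N_def
proof (rule sec_root_concave[OF dim_ker t])
  fix a b assume ab: "a \<in> half x c" "b \<in> half y d"
  have "(1 - t) * (a \<bullet> u) + t * (b \<bullet> u) \<le> (1 - t) * c + t * d"
    using ab t by (intro add_mono mult_left_mono) (auto simp: half_def)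
  then show "(1 - t) *\<^sub>R a + t *\<^sub>R b \<in> half ((1 - t) *\<^sub>R x + t *\<^sub>R y) ((1 - t) * c + t * d)"
    using slice_comb[OF xy t, of a b] ab by (auto simp: half_def inner_add_left)
qed (use pos bounded_half in \<open>auto simp: N_def\<close>)

lemma upper_concave:
  assumes xy: "x \<in> U" "y \<in> U" and t: "0 < t" "t < 1" and pos: "0 < sec (upper x c)" "0 < sec (upper y d)"
  shows "(1 - t) * root m (sec (upper x c)) + t * root m (sec (upper y d)) \<le>
    root m (sec (upper ((1 - t) *\<^sub>R x + t *\<^sub>R y) ((1 - t) * c + t * d)))"
proof (rule sec_root_concave[OF dim_ker t])
  fix a b assume ab: "a \<in> upper x c" "b \<in> upper y d"
  have "(1 - t) * c + t * d < (1 - t) * (a \<bullet> u) + t * (b \<bullet> u)"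
    using ab t by (intro add_strict_mono mult_strict_left_mono) (auto simp: upper_def)
  then show "(1 - t) *\<^sub>R a + t *\<^sub>R b \<in> upper ((1 - t) *\<^sub>R x + t *\<^sub>R y) ((1 - t) * c + t * d)"
    using slice_comb[OF xy t, of a b] ab by (auto simp: upper_def inner_add_left)
qed (use pos bounded_upper open_upper in \<open>auto intro: borel_open\<close>)

lemma comb_U: "x \<in> U \<Longrightarrow> y \<in> U \<Longrightarrow> 0 < t \<Longrightarrow> t < 1 \<Longrightarrow> (1 - t) *\<^sub>R x + t *\<^sub>R y \<in> U"
  using convex_U by (simp add: convex_alt)

text \<open>Both the part below and the part above the cut are governed by concave functions, while their
  sum is constant; hence the quantiles are affine.\<close>

lemma N_level:
  assumes xy: "x \<in> U" "y \<in> U" and t: "0 < t" "t < 1" and s: "0 < s" "s < f" and c: "N x c = s" "N y d = s"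
  shows "N ((1 - t) *\<^sub>R x + t *\<^sub>R y) ((1 - t) * c + t * d) = s"
proof -
  let ?x = "(1 - t) *\<^sub>R x + t *\<^sub>R y" and ?c = "(1 - t) * c + t * d"
  have avg: "(1 - t) * r + t * r = r" for r :: real by (simp add: algebra_simps)
  have "root m s \<le> root m (N ?x ?c)" using N_concave[OF xy t, of c d] c s by (simp only: avg)
  then have 1: "s \<le> N ?x ?c" using dim_ker by simp
  have up: "sec (upper x c) = f - s" "sec (upper y d) = f - s"
    using N_add_upper[of x c] N_add_upper[of y d] c const_F[OF xy(1)] const_F[OF xy(2)] by simp_all
  have "root m (f - s) \<le> root m (sec (upper ?x ?c))"
    using upper_concave[OF xy t, of c d] s unfolding up by (simp only: avg)
  then have 2: "f - s \<le> sec (upper ?x ?c)" using dim_ker by simp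
  show ?thesis using 1 2 N_add_upper[of ?x ?c] const_F[OF comb_U[OF xy t]] by linarith
qed

text \<open>\<open>root m (N x c)\<close> is concave in \<open>c\<close> where it is positive. Two
  points at the same level \<open>s < f\<close> followed by a larger value further to the right
  would contradict this.\<close>

lemma N_unique:
  assumes x: "x \<in> U" and s: "0 < s" "s < f" and c: "N x c = s" "N x d = s"
  shows "c = d"
proof -
  have False if cd: "c < d" "N x c = s" "N x d = s" for c d
  proof -
    obtain e where e: "d < e" "s < N x e" using N_exceeds[OF x s(2)] .
    define t where "t = (d - c) / (e - c)"
    have t: "0 < t" "t < 1" using cd e by (auto simp: t_def)
    have "t * (e - c) = d - c" using cd e by (simp add: t_def)
    then have d: "(1 - t) * c + t * e = d" by (simp add: algebra_simps)
    have xx: "(1 - t) *\<^sub>R x + t *\<^sub>R x = x" by (simp add: algebra_simps)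
    have "(1 - t) * root m s + t * root m (N x e) \<le> root m s"
      using N_concave[OF x x t, of c e] s cd e unfolding d xx by simp
    then have "t * (root m (N x e) - root m s) \<le> 0" by (simp add: algebra_simps)
    moreover have "root m s < root m (N x e)" using e dim_ker by simp
    ultimately show False using t by (simp add: mult_le_0_iff)
  qed
  from this[of c d] this[of d c] c show ?thesis by (metis linorder_neqE_linordered_idom)
qed

text \<open>The quantile of the unnormalised marginal. It is determined for \<open>0 < s < f\<close>
  and \<open>x\<close> in \<open>U\<close>, by the intermediate value theorem and
  \<open>N_unique\<close>.\<close>

definition q :: "'a \<Rightarrow> real \<Rightarrow> real" where "q x s = (SOME c. N x c = s)"

lemma N_q: assumes x: "x \<in> U" and s: "0 < s" "s < f" shows "N x (q x s) = s"
proof -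
  obtain a where a: "N x a < s" using N_below[OF s(1)] .
  obtain b where b: "a < b" "s < N x b" using N_exceeds[OF x s(2)] .
  have "\<exists>c\<ge>a. c \<le> b \<and> N x c = s"
    using a b isCont_N by (intro IVT) auto
  then have "\<exists>c. N x c = s" by blast
  then show ?thesis unfolding q_def by (rule someI_ex)
qed

lemma q_eq: "x \<in> U \<Longrightarrow> 0 < s \<Longrightarrow> s < f \<Longrightarrow> N x c = s \<Longrightarrow> q x s = c"
  using N_unique N_q by blast

lemma q_affine:
  assumes "x \<in> U" "y \<in> U" "0 < t" "t < 1" "0 < s" "s < f"
  shows "q ((1 - t) *\<^sub>R x + t *\<^sub>R y) s = (1 - t) * q x s + t * q y s"
  using assms by (intro q_eq comb_U N_level N_q)

lemma q_strict_mono: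
  assumes x: "x \<in> U" and s: "0 < s" "s < s'" "s' < f" shows "q x s < q x s'"
proof (rule ccontr)
  assume "\<not> q x s < q x s'"
  then have "N x (q x s') \<le> N x (q x s)" by (intro N_mono) simp
  then show False using N_q[OF x, of s] N_q[OF x, of s'] s by simp
qed

text \<open>The domain on which \<open>root m\<close> of \<open>N\<close> is positive and jointly
  concave in the point and the cut. It is open and convex, so supergradients exist there.\<close>

definition R :: "('a \<times> real) set" where "R = {p. fst p \<in> U \<and> 0 < N (fst p) (snd p)}"

lemma open_R: "open R"
proof -
  have "R = (\<Union>w\<in>{w. P w = 0}. (\<lambda>p. P (fst p) + w) -` D \<inter> {p. w \<bullet> u < snd p})"
  proof (intro equalityI subsetI)
    fix p assume p: "p \<in> R"
    then have "sec_set (half (fst p) (snd p)) \<noteq> {}" by (auto simp: R_def N_def sec_def)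
    then obtain z where "z - P z \<in> half (fst p) (snd p)" by (auto simp: sec_set_def)
    then have w: "P (fst p) + (z - P z) \<in> D" "(z - P z) \<bullet> u \<le> snd p" by (auto simp: half_def slice_def)
    obtain d where d: "d > 0" "ball (P (fst p) + (z - P z)) d \<subseteq> D" using open_D w(1) open_contains_ball by blast
    \<comment> \<open>Pushing the witness a little against \<open>u\<close>, inside the open set
      \<open>D\<close>, replaces \<open>\<le>\<close> by the strict and hence open
      condition.\<close>
    let ?w = "(z - P z) - (d / (2 * norm u)) *\<^sub>R u"
    have "P (fst p) + ?w \<in> D" using d u_nz by (intro subsetD[OF d(2)]) (simp add: dist_norm)
    moreover have "P ?w = 0" by (simp add: P_simps Pu)
    moreover have "?w \<bullet> u < snd p"
    proof -
      have "(d / (2 * norm u)) * (u \<bullet> u) > 0" using d u_nz by (intro mult_pos_pos) auto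
      then show ?thesis using w(2) by (simp add: inner_diff_left)
    qed
    ultimately show "p \<in> (\<Union>w\<in>{w. P w = 0}. (\<lambda>p. P (fst p) + w) -` D \<inter> {p. w \<bullet> u < snd p})" by blast
  next
    fix p assume "p \<in> (\<Union>w\<in>{w. P w = 0}. (\<lambda>p. P (fst p) + w) -` D \<inter> {p. w \<bullet> u < snd p})"
    then obtain w where w: "P w = 0" "P (fst p) + w \<in> D" "w \<bullet> u < snd p" by auto
    have "P (P (fst p) + w) = P (fst p)" using w by (simp add: P_simps)
    with w(2) have xU: "fst p \<in> U" by (rule UI)
    let ?A = "slice (fst p) \<inter> {v. v \<bullet> u < snd p}"
    have oA: "open ?A" by (intro open_Int open_slice open_Collect_less continuous_intros)
    have "0 < sec ?A"
      using w by (intro sec_pos[OF oA, of w]) (auto simp: slice_def[symmetric] bounded_slice bounded_Int, simp_all add: slice_def)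
    also have "\<dots> \<le> N (fst p) (snd p)"
      unfolding N_def using oA by (intro sec_mono bounded_half) (auto simp: half_def[of "fst p"] intro: borel_open half_borel[of "fst p", unfolded half_def])
    finally show "p \<in> R" using xU by (simp add: R_def)
  qed
  moreover have "open (\<Union>w\<in>{w. P w = 0}. (\<lambda>p::'a \<times> real. P (fst p) + w) -` D \<inter> {p. w \<bullet> u < snd p})"
    by (intro open_UN ballI open_Int open_vimage open_D open_Collect_less continuous_intros)
  ultimately show ?thesis by simp
qed

lemma convex_R: "convex R"
  unfolding convex_alt
proof (intro ballI allI impI)
  fix p p' and t :: real assume p: "p \<in> R" "p' \<in> R" and t: "0 \<le> t \<and> t \<le> 1"
  show "(1 - t) *\<^sub>R p + t *\<^sub>R p' \<in> R"
  proof (cases "t = 0 \<or> t = 1")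
    case False
    then have t: "0 < t" "t < 1" using t by auto
    have pU: "fst p \<in> U" "fst p' \<in> U" and pos: "0 < N (fst p) (snd p)" "0 < N (fst p') (snd p')"
      using p by (auto simp: R_def)
    have "0 < (1 - t) * root m (N (fst p) (snd p)) + t * root m (N (fst p') (snd p'))"
      using pos t dim_ker by (intro add_pos_pos mult_pos_pos) auto
    also note N_concave[OF pU t pos]
    finally have "0 < N ((1 - t) *\<^sub>R fst p + t *\<^sub>R fst p') ((1 - t) * snd p + t * snd p')"
      using dim_ker by simp
    then show ?thesis using comb_U[OF pU t] by (simp add: R_def)
  qed (use p in auto)
qed

text \<open>A supporting hyperplane at one point of a level set supports along the whole level set, since the
  latter is affine. Its slope in the last variable therefore does not depend on the section.\<close>

lemma common_slope:
  assumes s: "0 < s" "s < f"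
  obtains a k where "k > 0" "\<And>x. x \<in> U \<Longrightarrow> k * (q x s - q 0 s) = a \<bullet> x"
    "\<And>x s'. x \<in> U \<Longrightarrow> 0 < s' \<Longrightarrow> s' < f \<Longrightarrow> root m s' - root m s \<le> k * (q x s' - q x s)"
proof -
  let ?\<Phi> = "\<lambda>p. root m (N (fst p) (snd p))"
  have qR: "(x, q x s') \<in> R" if "x \<in> U" "0 < s'" "s' < f" for x s'
    using that by (simp add: R_def N_q)
  obtain v where v: "\<And>p. p \<in> R \<Longrightarrow> ?\<Phi> p \<le> ?\<Phi> (0, q 0 s) + v \<bullet> (p - (0, q 0 s))"
  proof (rule supergradient_exists[OF open_R convex_R _ qR[OF zero_U s], of ?\<Phi>])
    fix p p' :: "'a \<times> real" and t :: real assume "p \<in> R" "p' \<in> R" "0 < t" "t < 1"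
    then show "(1 - t) * ?\<Phi> p + t * ?\<Phi> p' \<le> ?\<Phi> ((1 - t) *\<^sub>R p + t *\<^sub>R p')"
      using N_concave[of "fst p" "fst p'" t "snd p" "snd p'"] by (simp add: R_def)
  qed (rule that)
  obtain a k where ak: "v = (a, k)" by (cases v)
  have sup: "root m s' \<le> root m s + a \<bullet> x + k * (q x s' - q 0 s)" if "x \<in> U" "0 < s'" "s' < f" for x s'
    using v[OF qR[OF that]] N_q[OF that] N_q[OF zero_U s] by (simp add: ak)
  \<comment> \<open>The height of the supporting hyperplane over the level set. It is nonnegative by
    support, affine since the quantile is affine, and 0 at the origin. Writing 0 as a proper convex
    combination of \<open>x\<close> and a negative multiple of \<open>x\<close> in \<open>U\<close>
    shows that it vanishes.\<close>
  define \<eta> where "\<eta> x = a \<bullet> x + k * (q x s - q 0 s)" for x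
  have \<eta>0: "0 \<le> \<eta> x" if "x \<in> U" for x using sup[OF that s] by (simp add: \<eta>_def)
  have \<eta>: "\<eta> x = 0" if x: "x \<in> U" for x
  proof -
    obtain e where e: "e > 0" "e *\<^sub>R (- x) \<in> U" using small_scaling_in_open[OF open_U zero_U] .
    define t where "t = 1 / (1 + e)"
    have t: "0 < t" "t < 1" using e by (auto simp: t_def)
    have te: "1 - t = t * e" using e by (simp add: t_def field_simps)
    have comb0: "(1 - t) *\<^sub>R x + t *\<^sub>R (e *\<^sub>R (- x)) = 0" unfolding te by simp
    have "q 0 s = (1 - t) * q x s + t * q (e *\<^sub>R (- x)) s"
      using q_affine[OF x e(2) t s] unfolding comb0 .
    moreover have "(1 - t) * \<eta> x + t * \<eta> y = a \<bullet> ((1 - t) *\<^sub>R x + t *\<^sub>R y) +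
        k * (((1 - t) * q x s + t * q y s) - q 0 s)" for y
      by (simp add: \<eta>_def inner_add_right algebra_simps)
    ultimately have "(1 - t) * \<eta> x + t * \<eta> (e *\<^sub>R (- x)) = a \<bullet> ((1 - t) *\<^sub>R x + t *\<^sub>R (e *\<^sub>R (- x)))"
      by (metis add.right_neutral diff_self mult_zero_right)
    then have "(1 - t) * \<eta> x + t * \<eta> (e *\<^sub>R (- x)) = 0" by (simp only: comb0 inner_zero_right)
    moreover have "0 \<le> t * \<eta> (e *\<^sub>R (- x))" using t \<eta>0[OF e(2)] by simp
    ultimately have "(1 - t) * \<eta> x \<le> 0" by linarith
    then show ?thesis using t \<eta>0[OF x] by (simp add: mult_le_0_iff)
  qed
  have main: "root m s' - root m s \<le> k * (q x s' - q x s)" if "x \<in> U" "0 < s'" "s' < f" for x s'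
    using sup[OF that] \<eta>[OF that(1)] by (simp add: \<eta>_def algebra_simps)
  have "k > 0"
  proof -
    define s' where "s' = (s + f) / 2"
    have s': "0 < s'" "s < s'" "s' < f" using s by (auto simp: s'_def)
    have "0 < root m s' - root m s" using s'(2) dim_ker by simp
    also have "\<dots> \<le> k * (q 0 s' - q 0 s)" by (rule main[OF zero_U s'(1,3)])
    finally show ?thesis using q_strict_mono[OF zero_U s(1) s'(2,3)] by (simp add: zero_less_mult_iff)
  qed
  show ?thesis
  proof (rule that[of k "- a"])
    show "k * (q x s - q 0 s) = - a \<bullet> x" if "x \<in> U" for x
      using \<eta>[OF that] unfolding \<eta>_def inner_minus_left by linarith
  qed (rule \<open>k > 0\<close>, rule main)
qed

text \<open>The displacement of the median. \<open>q_shift\<close> shows that all other quantiles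
  move by the same amount.\<close>

definition shift :: "'a \<Rightarrow> real" where "shift x = q x (f / 2) - q 0 (f / 2)"

lemma shift_linear: obtains g where "\<And>x. x \<in> U \<Longrightarrow> shift x = g \<bullet> x"
proof -
  have s: "0 < f / 2" "f / 2 < f" using f_pos by auto
  obtain a k where "k > 0" "\<And>x. x \<in> U \<Longrightarrow> k * (q x (f / 2) - q 0 (f / 2)) = a \<bullet> x"
    using common_slope[OF s] by metis
  then show ?thesis by (intro that[of "(1 / k) *\<^sub>R a"]) (simp add: shift_def field_simps)
qed

text \<open>The slope \<open>k s\<close> bounds the quantiles of all sections at once. In the
  variable \<open>root m s\<close> it encloses every quantile increment between \<open>1 / k\<close>
  at the two end levels times the step. The quantile functions over \<open>x\<close> and over 0 thus
  differ by a function satisfying \<open>const_of_slope_bounds\<close>.\<close>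

lemma q_shift:
  assumes x: "x \<in> U" and s: "0 < s" "s < f"
  shows "q x s = q 0 s + shift x"
proof -
  define good where "good s k \<longleftrightarrow> 0 < k \<and> (\<forall>x\<in>U. \<forall>s'. 0 < s' \<longrightarrow> s' < f \<longrightarrow> root m s' - root m s \<le> k * (q x s' - q x s))" for s k
  define k where "k s = (SOME k. good s k)" for s
  have good: "good s (k s)" if s: "0 < s" "s < f" for s
  proof -
    obtain a k where "k > 0" "\<And>x. x \<in> U \<Longrightarrow> k * (q x s - q 0 s) = a \<bullet> x"
      "\<And>x s'. x \<in> U \<Longrightarrow> 0 < s' \<Longrightarrow> s' < f \<Longrightarrow> root m s' - root m s \<le> k * (q x s' - q x s)"
      by (rule common_slope[OF s]) (rule that)
    then have "good s k" by (simp add: good_def)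
    then show ?thesis unfolding k_def by (rule someI)
  qed
  have k: "k s > 0" "x \<in> U \<Longrightarrow> 0 < s' \<Longrightarrow> s' < f \<Longrightarrow> root m s' - root m s \<le> k s * (q x s' - q x s)"
    if "0 < s" "s < f" for s x s'
    using good[OF that] by (simp_all add: good_def)
  have m0: "0 < m" using dim_ker by simp
  define h where "h \<sigma> = q x (\<sigma> ^ m) - q 0 (\<sigma> ^ m)" for \<sigma>
  have const: "h a = h b" if ab: "0 < a" "a < b" "b < root m f" for a b
  proof (rule const_of_slope_bounds[OF _ ab, where \<kappa>="\<lambda>\<sigma>. 1 / k (\<sigma> ^ m)"])
    fix a b assume ab: "0 < a" "a < b" "b < root m f"
    have bf: "b ^ m < f"
    proof -
      have "b ^ m < root m f ^ m" using ab m0 by (intro power_strict_mono) auto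
      then show ?thesis using f_pos m0 by simp
    qed
    have abm: "a ^ m < b ^ m" using ab m0 by (intro power_strict_mono) auto
    have pos: "0 < a ^ m" "0 < b ^ m" "a ^ m < f" using ab abm bf by auto
    have rt: "root m (a ^ m) = a" "root m (b ^ m) = b" using ab m0 by (auto simp: real_root_power_cancel)
    have bounds: "1 / k (a ^ m) * (b - a) \<le> q y (b ^ m) - q y (a ^ m) \<and> q y (b ^ m) - q y (a ^ m) \<le> 1 / k (b ^ m) * (b - a)"
      if y: "y \<in> U" for y
    proof
      have "b - a \<le> k (a ^ m) * (q y (b ^ m) - q y (a ^ m))" using k(2)[OF pos(1,3) y pos(2) bf] by (simp only: rt)
      then show "1 / k (a ^ m) * (b - a) \<le> q y (b ^ m) - q y (a ^ m)"
        using k(1)[OF pos(1,3)] by (simp add: pos_divide_le_eq mult.commute)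
      have "a - b \<le> k (b ^ m) * (q y (a ^ m) - q y (b ^ m))" using k(2)[OF pos(2) bf y pos(1,3)] by (simp only: rt)
      then have "k (b ^ m) * (q y (b ^ m) - q y (a ^ m)) \<le> b - a" by (simp add: algebra_simps)
      then show "q y (b ^ m) - q y (a ^ m) \<le> 1 / k (b ^ m) * (b - a)"
        using k(1)[OF pos(2) bf] by (simp add: pos_le_divide_eq mult.commute)
    qed
    have "(1 / k (b ^ m) - 1 / k (a ^ m)) * (b - a) = 1 / k (b ^ m) * (b - a) - 1 / k (a ^ m) * (b - a)"
      by (rule left_diff_distrib)
    then show "\<bar>h b - h a\<bar> \<le> (1 / k (b ^ m) - 1 / k (a ^ m)) * (b - a)"
      using bounds[OF x] bounds[OF zero_U] unfolding h_def abs_le_iff by linarith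
  qed
  have in_range: "0 < root m r" "root m r < root m f" "root m r ^ m = r" if "0 < r" "r < f" for r
    using that m0 by auto
  have s2: "0 < f / 2" "f / 2 < f" using f_pos by auto
  have "h (root m s) = h (root m (f / 2))"
    using const[of "root m s" "root m (f / 2)"] const[of "root m (f / 2)" "root m s"]
      in_range[OF s] in_range[OF s2] by (metis linorder_neqE_linordered_idom)
  then show ?thesis
    unfolding h_def in_range(3)[OF s] in_range(3)[OF s2] shift_def by simp
qed

text \<open>At levels strictly between 0 and \<open>f\<close> this restates \<open>q_shift\<close>.
  At the two extreme levels, which have no unique quantile, monotonicity and a limit in
  \<open>s\<close> give it.\<close>

lemma N_shift:
  assumes x: "x \<in> U"
  shows "N x (c + shift x) = N 0 c"
proof -
  consider "N 0 c = 0" | "0 < N 0 c" "N 0 c < f" | "N 0 c = f"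
    using N_nonneg[of 0 c] N_le[OF zero_U, of c] by linarith
  then show ?thesis
  proof cases
    case 1
    have "N x (c + shift x) \<le> s" if s: "0 < s" "s < f" for s
    proof -
      have "c \<le> q 0 s"
        using N_mono[of "q 0 s" c 0] N_q[OF zero_U s] 1 s by (cases "c \<le> q 0 s") auto
      then have "N x (c + shift x) \<le> N x (q x s)" using q_shift[OF x s] by (intro N_mono) simp
      then show ?thesis using N_q[OF x s] by simp
    qed
    then have "N x (c + shift x) \<le> 0"
      using f_pos by (intro dense_ge_bounded[of 0 f]) auto
    then show ?thesis using N_nonneg[of x "c + shift x"] 1 by linarith
  next
    case 2
    then have "q 0 (N 0 c) = c" using q_eq[OF zero_U] by blast
    then show ?thesis using N_q[OF x 2] q_shift[OF x 2] by simp
  next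
    case 3
    have "s \<le> N x (c + shift x)" if s: "0 < s" "s < f" for s
    proof -
      have "q 0 s \<le> c"
        using N_mono[of c "q 0 s" 0] N_q[OF zero_U s] 3 s by (cases "q 0 s \<le> c") auto
      then have "N x (q x s) \<le> N x (c + shift x)" using q_shift[OF x s] by (intro N_mono) simp
      then show ?thesis using N_q[OF x s] by simp
    qed
    then have "f \<le> N x (c + shift x)"
      using f_pos by (intro dense_le_bounded[of 0 f]) auto
    then show ?thesis using N_le[OF x, of "c + shift x"] 3 by linarith
  qed
qed

lemma integral_\<mu>: "(\<integral>y. y \<partial>\<mu> x) = (\<integral>z. indicator (sec_set (slice x)) z * (z \<bullet> u) \<partial>lborel)"
  and integrable_\<mu>: "integrable (\<mu> x) (\<lambda>y. y)"
proof -
  let ?S = "sec_set (slice x)"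
  have S: "?S \<in> sets borel" by simp
  have d: "density lborel (indicator ?S) = density lborel (\<lambda>z. ennreal (indicator ?S z))"
    by (intro density_cong) (auto simp: indicator_def)
  obtain B where B: "\<And>z. z \<in> ?S \<Longrightarrow> norm z \<le> B"
    using sec_set_bounded[OF bounded_slice, of x] unfolding bounded_iff by blast
  have i: "integrable lborel (\<lambda>z. indicator ?S z * (z \<bullet> u))"
  proof (rule integrable_indicator_bounded[OF S sec_set_bounded[OF bounded_slice]])
    fix z assume "z \<in> ?S"
    then show "\<bar>z \<bullet> u\<bar> \<le> B * norm u"
      using Cauchy_Schwarz_ineq2[of z u] B[of z] mult_right_mono[of "norm z" B "norm u"] by fastforce
  qed measurable
  have "(\<integral>y. y \<partial>\<mu> x) = (\<integral>z. z \<bullet> u \<partial>density lborel (indicator ?S))"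
    unfolding \<mu>_def by (rule integral_distr) simp_all
  also have "\<dots> = (\<integral>z. indicator ?S z *\<^sub>R (z \<bullet> u) \<partial>lborel)"
    unfolding d using S by (intro integral_density) simp_all
  finally show "(\<integral>y. y \<partial>\<mu> x) = (\<integral>z. indicator ?S z * (z \<bullet> u) \<partial>lborel)" by simp
  have "integrable (density lborel (\<lambda>z. ennreal (indicator ?S z))) (\<lambda>z. z \<bullet> u)"
    using i S by (subst integrable_density) simp_all
  then show "integrable (\<mu> x) (\<lambda>y. y)"
    unfolding \<mu>_def d[symmetric] by (subst integrable_distr_eq) simp_all
qed

text \<open>After translation by \<open>shift x\<close> the marginals over \<open>x\<close> and over
  0 have the same distribution function, hence coincide. Comparing first moments shows that the
  shift depends linearly on the direction \<open>u\<close>, so that a single vector encodes all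
  shifts.\<close>

lemma shift_moment:
  assumes x: "x \<in> U"
  shows "shift x * f = (\<integral>z. indicator (sec_set (slice x)) z * (z \<bullet> u) \<partial>lborel) -
    (\<integral>z. indicator (sec_set (slice 0)) z * (z \<bullet> u) \<partial>lborel)"
proof -
  interpret M: finite_borel_measure "\<mu> x" by (rule finite_borel_measure_\<mu>)
  let ?M = "distr (\<mu> x) borel (\<lambda>y. y - shift x)"
  have fM: "finite_borel_measure ?M"
  proof (intro finite_borel_measure.intro finite_measureI finite_borel_measure_axioms.intro)
    show "emeasure ?M (space ?M) \<noteq> \<infinity>"
      using M.finite_emeasure_space by (simp add: emeasure_distr)
  qed simp
  have "cdf ?M = cdf (\<mu> 0)"
  proof
    fix c
    have "cdf ?M c = measure (\<mu> x) ((\<lambda>y. y - shift x) -` {..c} \<inter> space (\<mu> x))"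
      unfolding cdf_def by (rule measure_distr) simp_all
    also have "(\<lambda>y. y - shift x) -` {..c} \<inter> space (\<mu> x) = {..c + shift x}"
      using sets_eq_imp_space_eq[OF sets_\<mu>[of x]] by auto
    also have "measure (\<mu> x) {..c + shift x} = cdf (\<mu> x) (c + shift x)" by (simp add: cdf_def)
    finally show "cdf ?M c = cdf (\<mu> 0) c" using N_shift[OF x, of c] by (simp add: cdf_\<mu>)
  qed
  then have "?M = \<mu> 0" by (rule cdf_unique'[OF fM finite_borel_measure_\<mu>])
  then have "(\<integral>y. y \<partial>\<mu> 0) = (\<integral>y. y \<partial>?M)" by simp
  also have "\<dots> = (\<integral>y. y - shift x \<partial>\<mu> x)" by (rule integral_distr) simp_all
  also have "\<dots> = (\<integral>y. y \<partial>\<mu> x) - shift x * measure (\<mu> x) (space (\<mu> x))"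
    using integrable_\<mu>[of x] by (subst Bochner_Integration.integral_diff) auto
  also have "measure (\<mu> x) (space (\<mu> x)) = f" using const_F[OF x] by (simp only: measure_\<mu>_space)
  finally show ?thesis unfolding integral_\<mu> by simp
qed

text \<open>If \<open>\<nu>\<close> supports \<open>D\<close> at \<open>z\<close>, its kernel part
  \<open>u\<close> bounds the section over \<open>x\<close> by \<open>c\<close>, that is,
  \<open>N x c = f\<close>. Translating the marginals moves this bound to the section over
  \<open>z\<close>, where it applies to \<open>z\<close> itself.\<close>

lemma support_shift:
  assumes x: "x \<in> U" and z: "z \<in> U" "z \<in> closure D" and \<nu>: "u = \<nu> - P \<nu>"
    and sup: "\<And>y. y \<in> D \<Longrightarrow> (y - z) \<bullet> \<nu> \<le> 0"
  shows "P x \<bullet> \<nu> + shift x \<le> P z \<bullet> \<nu> + shift z"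
proof -
  have ker: "w \<bullet> \<nu> = w \<bullet> u" if "P w = 0" for w
    using that selfadj[of w \<nu>] by (simp add: \<nu> inner_diff_right)
  define c where "c = z \<bullet> \<nu> - P x \<bullet> \<nu>"
  have "w \<bullet> u \<le> c" if "w \<in> slice x" "P w = 0" for w
    using sup[of "P x + w"] that ker[OF that(2)] by (simp add: slice_def c_def inner_diff_left inner_add_left)
  then have "sec_set (half x c) = sec_set (slice x)"
    by (auto simp: sec_set_def half_def P_simps)
  then have "N x c = f" using const_F[OF x] by (simp add: N_def F_def sec_def)
  define c' where "c' = c - shift x + shift z"
  have "N z c' = N 0 (c - shift x)" using N_shift[OF z(1), of "c - shift x"] by (simp add: c'_def)
  also have "\<dots> = N x c" using N_shift[OF x, of "c - shift x"] by simp
  finally have Nz: "N z c' = f" using \<open>N x c = f\<close> by simp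
  have le: "w \<bullet> u \<le> c'" if w: "w \<in> slice z" "P w = 0" for w
  proof (rule ccontr)
    assume "\<not> w \<bullet> u \<le> c'"
    then have "w \<in> upper z c'" using w by (simp add: upper_def)
    then have "0 < sec (upper z c')" using sec_pos[OF open_upper bounded_upper] w by blast
    then show False using N_add_upper[of z c'] Nz const_F[OF z(1)] by simp
  qed
  obtain o' where o': "o' \<in> D" "P o' = P z" using z(1) by (rule UE)
  have "(z - P z) \<bullet> u \<le> c'"
  proof -
    \<comment> \<open>\<open>z\<close> lies in the closure only. The segment from \<open>o'\<close>,
      a point of \<open>D\<close> in the same fibre, approaches \<open>z\<close> through points of
      \<open>D\<close>, where the bound is available.\<close>
    let ?y = "\<lambda>n. z + (inverse (real (Suc n))) *\<^sub>R (o' - z)"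
    have yD: "?y n \<in> D" for n
    proof -
      let ?t = "inverse (real (Suc n))"
      have t: "0 < ?t" "?t \<le> 1" by (auto simp: inverse_le_1_iff)
      have "o' \<in> interior D" using o'(1) open_D by (simp add: interior_open)
      then have "z - ?t *\<^sub>R (z - o') \<in> interior D"
        by (rule mem_interior_closure_convex_shrink[OF convex_D _ z(2) t])
      also have "z - ?t *\<^sub>R (z - o') = ?y n" by (simp add: algebra_simps)
      finally show ?thesis using interior_subset by blast
    qed
    have "(?y n - P z) \<bullet> u \<le> c'" for n
      using yD[of n] o' by (intro le) (simp_all add: slice_def P_simps)
    moreover have "(\<lambda>n. (?y n - P z) \<bullet> u) \<longlonglongrightarrow> ((z + 0 *\<^sub>R (o' - z)) - P z) \<bullet> u"
      by (intro tendsto_intros LIMSEQ_inverse_real_of_nat)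
    ultimately have "((z + 0 *\<^sub>R (o' - z)) - P z) \<bullet> u \<le> c'"
      by (intro LIMSEQ_le_const2) auto
    then show ?thesis by simp
  qed
  moreover have "(z - P z) \<bullet> u = z \<bullet> \<nu> - P z \<bullet> \<nu>"
    using ker[of "z - P z"] by (simp add: P_simps inner_diff_left)
  ultimately show ?thesis by (simp add: c'_def c_def)
qed

end

section \<open>Subspace concentration\<close>

context equal_sections
begin

text \<open>The difference of the centroids of two sections, linear because the quantiles are.\<close>

definition trans :: "'a \<Rightarrow> 'a" where
  "trans x = (let c = (1 / F 0) *\<^sub>R ((\<integral>z. indicator (sec_set (slice x)) z *\<^sub>R z \<partial>lborel) -
      (\<integral>z. indicator (sec_set (slice 0)) z *\<^sub>R z \<partial>lborel)) in c - P c)"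

lemma P_trans: "P (trans x) = 0" by (simp add: trans_def Let_def P_simps)

lemma trans_P: "P x = P y \<Longrightarrow> trans x = trans y"
  using slice_P[of x y] by (simp add: trans_def)

lemma shift_eq_trans:
  assumes u: "P u = 0" "u \<noteq> 0" and x: "x \<in> U"
  shows "equal_sections_direction.shift P D u x = trans x \<bullet> u"
proof -
  interpret d: equal_sections_direction P D u
    by (intro equal_sections_direction.intro equal_sections_axioms equal_sections_direction_axioms.intro u)
  have i: "integrable lborel (\<lambda>z. indicator (sec_set (slice y)) z *\<^sub>R z)" for y
  proof -
    obtain B where "\<And>z. z \<in> sec_set (slice y) \<Longrightarrow> norm z \<le> B"
      using sec_set_bounded[OF bounded_slice, of y] unfolding bounded_iff by blast
    then show ?thesis
      using emeasure_bounded_finite[OF sec_set_bounded[OF bounded_slice, of y]]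
      by (intro integrableI_bounded_set_indicator[where B=B]) auto
  qed
  have inner: "(\<integral>z. indicator (sec_set (slice y)) z * (z \<bullet> u) \<partial>lborel) =
      (\<integral>z. indicator (sec_set (slice y)) z *\<^sub>R z \<partial>lborel) \<bullet> u" for y
    using integral_inner_left[of u, OF i[of y]] by simp
  have "d.shift x * F 0 = ((\<integral>z. indicator (sec_set (slice x)) z *\<^sub>R z \<partial>lborel) -
      (\<integral>z. indicator (sec_set (slice 0)) z *\<^sub>R z \<partial>lborel)) \<bullet> u" (is "_ = ?c \<bullet> u")
    using d.shift_moment[OF x] unfolding inner by (simp add: inner_diff_left)
  then have "d.shift x = (?c \<bullet> u) / F 0"
    using d.f_pos by (subst nonzero_eq_divide_eq) auto
  also have "\<dots> = ((1 / F 0) *\<^sub>R ?c) \<bullet> u" by (simp only: inner_scaleR_left) simp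
  also have "\<dots> = trans x \<bullet> u"
    using selfadj[of "(1 / F 0) *\<^sub>R ?c" u] u(1) unfolding trans_def Let_def by (simp only: inner_diff_left inner_zero_right diff_0_right)
  finally show ?thesis .
qed

text \<open>The component of \<open>trans\<close> along \<open>b\<close> sees only the kernel part
  of \<open>b\<close>. If that part is nonzero, the component is the shift in its direction, which
  is linear on \<open>U\<close>; otherwise it is 0.\<close>

lemma trans_linear: obtains T where "linear T" "\<And>x. x \<in> U \<Longrightarrow> T x = trans x"
proof -
  have "\<exists>g. \<forall>x\<in>U. trans x \<bullet> b = g \<bullet> x" for b
  proof (cases "b - P b = 0")
    case True
    have "trans x \<bullet> b = 0" for x
      using selfadj[of "trans x" b] P_trans[of x] True by simp
    then show ?thesis by (intro exI[of _ 0]) simp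
  next
    case False
    have Pu: "P (b - P b) = 0" by (simp add: P_simps)
    interpret d: equal_sections_direction P D "b - P b"
      by (intro equal_sections_direction.intro equal_sections_axioms equal_sections_direction_axioms.intro Pu False)
    obtain g where g: "\<And>x. x \<in> U \<Longrightarrow> d.shift x = g \<bullet> x" by (rule d.shift_linear) (rule that)
    have "trans x \<bullet> b = g \<bullet> x" if "x \<in> U" for x
    proof -
      have "trans x \<bullet> b = trans x \<bullet> (b - P b)"
        using selfadj[of "trans x" b] P_trans[of x] by (simp add: inner_diff_right)
      then show ?thesis using shift_eq_trans[OF Pu False that] g[OF that] by simp
    qed
    then show ?thesis by blast
  qed
  then obtain g where g: "\<And>b x. x \<in> U \<Longrightarrow> trans x \<bullet> b = g b \<bullet> x" by metis
  let ?T = "\<lambda>x. \<Sum>b\<in>Basis. (g b \<bullet> x) *\<^sub>R b"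
  have "linear ?T"
    by (rule linearI) (simp_all add: inner_add_right scaleR_add_left sum.distrib scaleR_sum_right)
  moreover have "?T x = trans x" if "x \<in> U" for x
    using g[OF that, symmetric] by (simp add: euclidean_representation)
  ultimately show ?thesis by (rule that)
qed

lemma support_translate:
  assumes x: "x \<in> U" and z: "z \<in> U" "z \<in> closure D" and sup: "\<And>y. y \<in> D \<Longrightarrow> (y - z) \<bullet> \<nu> \<le> 0"
  shows "P x \<bullet> \<nu> + trans x \<bullet> \<nu> \<le> P z \<bullet> \<nu> + trans z \<bullet> \<nu>"
proof (cases "\<nu> - P \<nu> = 0")
  case True
  have t: "trans y \<bullet> \<nu> = 0" for y
    using selfadj[of "trans y" \<nu>] P_trans[of y] True by simp
  obtain y where y: "y \<in> D" "P y = P x" using x by (rule UE)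
  have "y \<bullet> \<nu> = P y \<bullet> \<nu>" "z \<bullet> \<nu> = P z \<bullet> \<nu>" using True selfadj[of y \<nu>] selfadj[of z \<nu>] by simp_all
  then show ?thesis using sup[OF y(1)] y(2) by (simp add: t inner_diff_left)
next
  case False
  have Pu: "P (\<nu> - P \<nu>) = 0" by (simp add: P_simps)
  interpret d: equal_sections_direction P D "\<nu> - P \<nu>"
    by (intro equal_sections_direction.intro equal_sections_axioms equal_sections_direction_axioms.intro Pu False)
  have s: "d.shift y = trans y \<bullet> \<nu>" if "y \<in> U" for y
    using shift_eq_trans[OF Pu False that] selfadj[of "trans y" \<nu>] P_trans[of y] by (simp add: inner_diff_right)
  show ?thesis using d.support_shift[OF x z refl sup] s[OF x] s[OF z(1)] by simp
qed

lemma complementary_normals: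
  obtains L' where "subspace L'" "range P \<inter> L' = {0}" "range P + L' = UNIV"
    "\<forall>z\<in>U \<inter> closure D. \<forall>\<nu>. (\<forall>y\<in>D. (y - z) \<bullet> \<nu> \<le> 0) \<longrightarrow> \<nu> \<in> L'"
proof -
  obtain T where T: "linear T" "\<And>x. x \<in> U \<Longrightarrow> T x = trans x" by (rule trans_linear) (rule that)
  define A where "A x = P x + T (P x)" for x
  have linA: "linear A"
    unfolding A_def by (rule linearI) (simp_all add: P_simps linear_add[OF T(1)] linear_scale[OF T(1)] scaleR_add_right)
  define L' where "L' = {\<nu>. \<forall>x\<in>range A. orthogonal x \<nu>}"
  have L'_iff: "\<nu> \<in> L' \<longleftrightarrow> (\<forall>x. A x \<bullet> \<nu> = 0)" for \<nu> by (auto simp: L'_def orthogonal_def)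
  have PU: "P x \<in> U" if "x \<in> U" for x using that U_P[of "P x" x] by (simp add: idem)
  have AU: "A x = P x + trans x" if "x \<in> U" for x
    using T(2)[OF PU[OF that]] trans_P[of "P x" x] by (simp add: A_def idem)
  have zeroA: "\<nu> \<in> L'" if \<nu>: "\<And>x. x \<in> U \<Longrightarrow> A x \<bullet> \<nu> = 0" for \<nu>
  proof -
    have "A x \<bullet> \<nu> = 0" for x
    proof -
      obtain e where e: "e > 0" "e *\<^sub>R x \<in> U" using small_scaling_in_open[OF open_U zero_U] .
      then show ?thesis using \<nu>[OF e(2)] linear_scale[OF linA, of e x] by simp
    qed
    then show ?thesis by (simp add: L'_iff)
  qed
  have sub: "subspace L'" by (auto simp: subspace_def L'_iff inner_add_right)
  have disj: "range P \<inter> L' = {0}"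
  proof (intro equalityI subsetI)
    fix \<nu> assume "\<nu> \<in> range P \<inter> L'"
    then have \<nu>: "P \<nu> = \<nu>" "\<And>x. A x \<bullet> \<nu> = 0" using idem by (auto simp: L'_iff)
    obtain e where e: "e > 0" "e *\<^sub>R \<nu> \<in> U" using small_scaling_in_open[OF open_U zero_U] .
    have "trans (e *\<^sub>R \<nu>) \<bullet> \<nu> = 0" using selfadj[of "trans (e *\<^sub>R \<nu>)" \<nu>] P_trans[of "e *\<^sub>R \<nu>"] \<nu>(1) by simp
    then have "P (e *\<^sub>R \<nu>) \<bullet> \<nu> = 0" using \<nu>(2)[of "e *\<^sub>R \<nu>"] AU[OF e(2)] by (simp add: inner_add_left)
    then show "\<nu> \<in> {0}" using e(1) \<nu>(1) by (simp add: P_simps)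
  qed (use sub subspace_0 in \<open>auto intro: rev_image_eqI[of 0]\<close>)
  have "dim L' + dim (range A) = DIM('a)"
    using dim_subspace_orthogonal_to_vectors[OF linear_subspace_image[OF linA subspace_UNIV] subspace_UNIV]
    by (simp add: L'_def)
  \<comment> \<open>\<open>A\<close> factors through \<open>P\<close>, so its range is not larger
    than that of \<open>P\<close>. The complement \<open>L'\<close> is then large enough for the two
    subspaces, which meet in 0 only, to span the space.\<close>
  moreover have "dim (range A) \<le> dim (range P)"
  proof -
    have "range A = range (\<lambda>x. A (P x))"
      by (intro image_cong refl) (simp add: A_def idem)
    also have "\<dots> = A ` range P" by (simp add: image_image)
    finally show ?thesis using dim_image_le[OF linA, of "range P"] by simp
  qed
  moreover have "dim {x + y |x y. x \<in> range P \<and> y \<in> L'} + dim (range P \<inter> L') = dim (range P) + dim L'"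
    by (rule dim_sums_Int[OF subspace_range sub])
  moreover have "dim (range P \<inter> L') = 0" unfolding disj by simp
  ultimately have "DIM('a) \<le> dim {x + y |x y. x \<in> range P \<and> y \<in> L'}" by linarith
  then have "dim {x + y |x y. x \<in> range P \<and> y \<in> L'} = DIM('a)" using dim_subset_UNIV by (rule antisym[rotated])
  then have "span {x + y |x y. x \<in> range P \<and> y \<in> L'} = UNIV" by (simp only: dim_eq_full)
  then have "{x + y |x y. x \<in> range P \<and> y \<in> L'} = UNIV"
    using span_eq_iff[of "{x + y |x y. x \<in> range P \<and> y \<in> L'}"] subspace_sums[OF subspace_range sub] by simp
  moreover have "range P + L' = {x + y |x y. x \<in> range P \<and> y \<in> L'}" unfolding set_plus_def by blast
  ultimately have sum: "range P + L' = UNIV" by simp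
  \<comment> \<open>By \<open>support_translate\<close> the linear functional given by
    \<open>A x \<bullet> \<nu>\<close> attains its maximum over the open set \<open>U\<close> at
    \<open>z\<close>, hence vanishes.\<close>
  have normals: "\<nu> \<in> L'" if z: "z \<in> U" "z \<in> closure D" and sup: "\<And>y. y \<in> D \<Longrightarrow> (y - z) \<bullet> \<nu> \<le> 0" for z \<nu>
  proof (rule zeroA)
    have adj: "A x \<bullet> \<nu> = adjoint A \<nu> \<bullet> x" for x
      using adjoint_works[OF linA, of x \<nu>] by (simp add: inner_commute)
    have "adjoint A \<nu> \<bullet> x \<le> adjoint A \<nu> \<bullet> z" if "x \<in> U" for x
      using support_translate[OF that z sup] unfolding adj[symmetric] AU[OF that] AU[OF z(1)]
      by (simp add: inner_add_left)
    then have "adjoint A \<nu> = 0" by (rule inner_maximal_in_open[OF open_U z(1)])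
    then show "A x \<bullet> \<nu> = 0" for x unfolding adj by simp
  qed
  show ?thesis using sub disj sum by (rule that) (use normals in blast)
qed

end

section \<open>The inequality and its equality case for a convex body\<close>

context convex_body
begin

definition cone_vol :: "'a set \<Rightarrow> real" where
  "cone_vol \<omega> = measure lborel (cone {x \<in> regular_boundary K. normal_at K x \<in> \<omega>})"

lemma emeasure_cone_vol:
  assumes "\<omega> \<in> sets borel"
  shows "emeasure lborel (cone {x \<in> regular_boundary K. normal_at K x \<in> \<omega>}) = ennreal (cone_vol \<omega>)"
proof -
  have "emeasure lborel (cone {x \<in> regular_boundary K. normal_at K x \<in> \<omega>}) < \<infinity>"
    using emeasure_cone_measure_finite emeasure_cone_measure[OF normal_preimage_borel[OF assms]] by metis
  then show ?thesis unfolding cone_vol_def by (intro emeasure_eq_ennreal_measure) auto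
qed

lemma null_frontier: "frontier K \<in> null_sets lborel"
proof -
  have "frontier K \<in> sets borel" by (rule borel_closed) (rule frontier_closed)
  then show ?thesis
    using negligible_convex_frontier[OF convex_K] by (simp add: negligible_iff_null_sets null_sets_completion_iff)
qed

lemma measure_interior: "measure lborel (interior K) = measure lborel K"
proof -
  have "emeasure lborel (interior K) = emeasure lborel K"
  proof (rule emeasure_eq_AE)
    show "AE x in lborel. (x \<in> interior K) = (x \<in> K)"
      using AE_not_in[OF null_frontier]
    proof eventually_elim
      case (elim x)
      then show ?case using interior_subset[of K] closure_subset[of K] by (auto simp: frontier_def)
    qed
  qed (use compact_K in \<open>auto intro: borel_compact\<close>)
  then show ?thesis by (simp add: measure_def)
qed

lemma cone_vol_UNIV: "cone_vol UNIV = measure lborel K"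
  using emeasure_cone_regular by (simp add: cone_vol_def measure_def)

lemma closure_interior_K: "closure (interior K) = K"
  using convex_closure_interior[OF convex_K] zero_interior compact_imp_closed[OF compact_K] by auto

text \<open>The part of the body over \<open>r\<close> times its projection to the range of \<open>P\<close> misses the outer shell of every
  cone whose normals lie in that range.\<close>

lemma shell_slab_inequality:
  assumes P: "orthogonal_projection P" and r: "0 < r" "r < 1"
  shows "(1 - r ^ DIM('a)) * cone_vol (range P) +
    measure lborel {x \<in> interior K. \<exists>y\<in>interior K. P x = r *\<^sub>R P y} \<le> measure lborel K"
proof -
  interpret orthogonal_projection P by (rule P)
  let ?Z = "{x \<in> regular_boundary K. normal_at K x \<in> range P}"
  let ?S = "{z. r < gauge_fun z \<and> gauge_fun z \<le> 1 \<and> radial z \<in> ?Z}"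
  let ?D = "{x \<in> interior K. \<exists>y\<in>interior K. P x = r *\<^sub>R P y}"
  have bL: "range P \<in> sets borel" by (intro borel_closed closed_subspace subspace_range)
  have Z: "?Z \<in> sets borel" by (rule normal_preimage_borel[OF bL])
  have S: "?S \<in> sets borel" using Z by measurable
  have finK: "emeasure lborel K \<noteq> \<infinity>" using emeasure_K_finite by simp
  have KL: "K \<in> sets lborel" using compact_K by (simp add: borel_compact)
  have "?S \<subseteq> K" by (auto simp: mem_K_iff)
  have mS: "measure lborel ?S = (1 - r ^ DIM('a)) * cone_vol (range P)"
  proof -
    have "emeasure lborel ?S = ennreal (1 - r ^ DIM('a)) * ennreal (cone_vol (range P))"
      using emeasure_shell[OF Z r(1)] r emeasure_cone_vol[OF bL] by simp
    moreover have "r ^ DIM('a) \<le> 1" using r by (simp add: power_le_one)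
    moreover have "0 \<le> cone_vol (range P)" by (simp add: cone_vol_def)
    ultimately show ?thesis by (simp add: measure_def enn2real_mult)
  qed
  have "?D \<subseteq> K - ?S"
  proof
    fix z assume z: "z \<in> ?D"
    then obtain y where y: "y \<in> interior K" "P z = r *\<^sub>R P y" "z \<in> K" using interior_subset by blast
    have False if "z \<in> ?S"
    proof -
      let ?x = "radial z" and ?\<nu> = "normal_at K (radial z)"
      have x: "?x \<in> regular_boundary K" "?\<nu> \<in> range P" "r < gauge_fun z" using that by auto
      have nu: "outer_unit_normal K ?x ?\<nu>" by (rule outer_unit_normal_at[OF x(1)])
      have P\<nu>: "P ?\<nu> = ?\<nu>" using x(2) idem by auto
      have pos: "?x \<bullet> ?\<nu> > 0" by (rule outer_unit_normal_inner_pos[OF nu])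
      have "y \<in> K" using y(1) interior_subset by blast
      then have yx: "y \<bullet> ?\<nu> \<le> ?x \<bullet> ?\<nu>" using nu by (simp add: outer_unit_normal_def inner_diff_left)
      \<comment> \<open>A normal in the range of \<open>P\<close> sees projections only, so
        \<open>P z = r *\<^sub>R P y\<close> bounds the gauge of \<open>z\<close> by
        \<open>r\<close>, contrary to its lying in the shell.\<close>
      have "gauge_fun z * (?x \<bullet> ?\<nu>) = z \<bullet> ?\<nu>"
        using gauge_scaleR_radial[of z] by (metis inner_scaleR_left)
      also have "\<dots> = P z \<bullet> ?\<nu>" using selfadj[of z ?\<nu>] P\<nu> by simp
      also have "\<dots> = r * (y \<bullet> ?\<nu>)" using y(2) selfadj[of y ?\<nu>] P\<nu> by simp
      also have "\<dots> \<le> r * (?x \<bullet> ?\<nu>)" using yx r by (intro mult_left_mono) auto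
      finally show False using x(3) pos by (simp add: mult_le_cancel_right)
    qed
    then show "z \<in> K - ?S" using y(3) by blast
  qed
  have "measure lborel ?D \<le> measure lborel (K - ?S)"
  proof (cases "?D \<in> sets lborel")
    case True
    then show ?thesis
      using S KL finK emeasure_mono[of "K - ?S" K lborel] \<open>?D \<subseteq> K - ?S\<close>
      by (intro measure_mono_fmeasurable) (auto simp: fmeasurable_def less_top[symmetric] top_unique)
  next
    case False
    then show ?thesis by (simp add: measure_notin_sets)
  qed
  also have "\<dots> = measure lborel K - measure lborel ?S"
    using S KL finK \<open>?S \<subseteq> K\<close> by (intro measure_Diff) auto
  finally show ?thesis unfolding mS by linarith
qed

lemma cone_vol_subspace:
  assumes centred: "\<And>v. (\<integral>x. indicator K x * (v \<bullet> x) \<partial>lborel) = 0"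
    and L: "subspace L" "0 < dim L" "dim L < DIM('a)"
  shows "real DIM('a) * cone_vol L \<le> real (dim L) * measure lborel K"
    and "real DIM('a) * cone_vol L = real (dim L) * measure lborel K \<Longrightarrow>
      \<exists>L'. subspace L' \<and> L \<inter> L' = {0} \<and> L + L' = UNIV \<and> (\<forall>x\<in>regular_boundary K. normal_at K x \<in> L \<union> L')"
proof -
  let ?n = "DIM('a)" and ?d = "dim L" and ?V = "measure lborel K"
  obtain P where P: "orthogonal_projection P" and PL: "range P = L"
    using orthogonal_projection_exists[OF L(1)] .
  have centred': "(\<integral>x. indicator (interior K) x * (v \<bullet> x) \<partial>lborel) = 0" for v
  proof -
    have "(\<integral>x. indicator (interior K) x * (v \<bullet> x) \<partial>lborel) = (\<integral>x. indicator K x * (v \<bullet> x) \<partial>lborel)"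
    proof (rule integral_cong_AE)
      show "AE x in lborel. indicator (interior K) x * (v \<bullet> x) = indicator K x * (v \<bullet> x)"
        using AE_not_in[OF null_frontier]
      proof eventually_elim
        case (elim x)
        then have "x \<in> interior K \<longleftrightarrow> x \<in> K"
          using interior_subset[of K] closure_subset[of K] by (auto simp: frontier_def)
        then show ?case by (simp add: indicator_def)
      qed
    qed (use compact_K in \<open>auto intro!: borel_measurable_times borel_measurable_indicator borel_compact\<close>)
    then show ?thesis using centred by simp
  qed
  interpret orthogonal_projection P by (rule P)
  have dims: "?d + dim (range (\<lambda>x. x - P x)) = ?n" using dim_range unfolding PL .
  interpret projected_body P "interior K"
  proof
    show "bounded (interior K)" using compact_imp_bounded[OF compact_K] interior_subset bounded_subset by blast
    show "convex (interior K)" using convex_K by (rule convex_interior)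
    show "1 \<le> dim (range (\<lambda>x. x - P x))" using dims L(3) by linarith
  qed (use centred' zero_interior in auto)
  let ?m = "dim (range (\<lambda>x. x - P x))"
  obtain e where e: "0 \<le> e"
    "\<And>r. 0 < r \<Longrightarrow> r < 1 \<Longrightarrow> r ^ dim (range P) * (measure lborel (interior K) + real ?m * (1 - r) * e)
      \<le> measure lborel {x \<in> interior K. \<exists>y\<in>interior K. P x = r *\<^sub>R P y}"
    "e = 0 \<Longrightarrow> (\<forall>x\<in>U. F x = F 0)"
    by (rule section_inequality) (rule that)
  let ?s = "cone_vol L"
  have bound: "(\<Sum>i<?n. r ^ i) * ?s + r ^ ?d * (real ?m * e) \<le> (\<Sum>i<?d. r ^ i) * ?V" if r: "0 < r" "r < 1" for r
  proof -
    have "(1 - r ^ ?n) * ?s + r ^ ?d * (?V + real ?m * (1 - r) * e) \<le> ?V"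
      using shell_slab_inequality[OF P r] e(2)[OF r] unfolding PL measure_interior by linarith
    then have "(1 - r ^ ?n) * ?s + (1 - r) * (r ^ ?d * (real ?m * e)) \<le> (1 - r ^ ?d) * ?V"
      by (simp add: algebra_simps)
    \<comment> \<open>Every term carries a factor \<open>1 - r\<close>. Cancelling it through
      geometric sums keeps the excess \<open>e\<close> alive in the limit \<open>r\<close> to 1,
      where the sums become \<open>?n\<close> and \<open>?d\<close>.\<close>
    then have "(1 - r) * ((\<Sum>i<?n. r ^ i) * ?s + r ^ ?d * (real ?m * e)) \<le> (1 - r) * ((\<Sum>i<?d. r ^ i) * ?V)"
      unfolding one_diff_power_eq by (simp only: distrib_left mult.assoc)
    then show ?thesis using r by (simp only: mult_le_cancel_left_pos)
  qed
  define \<rho> where "\<rho> j = 1 - inverse (real (Suc (Suc j)))" for j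
  have \<rho>: "0 < \<rho> j" "\<rho> j < 1" for j
    by (auto simp: \<rho>_def inverse_less_1_iff)
  have lim: "\<rho> \<longlonglongrightarrow> 1"
    unfolding \<rho>_def using tendsto_diff[OF tendsto_const LIMSEQ_Suc[OF LIMSEQ_inverse_real_of_nat], of 1] by simp
  have "(\<lambda>j. (\<Sum>i<?n. \<rho> j ^ i) * ?s + \<rho> j ^ ?d * (real ?m * e)) \<longlonglongrightarrow>
      (\<Sum>i<?n. 1 ^ i) * ?s + 1 ^ ?d * (real ?m * e)"
    by (intro tendsto_intros lim)
  moreover have "(\<lambda>j. (\<Sum>i<?d. \<rho> j ^ i) * ?V) \<longlonglongrightarrow> (\<Sum>i<?d. 1 ^ i) * ?V"
    by (intro tendsto_intros lim)
  ultimately have "(\<Sum>i<?n. 1 ^ i) * ?s + 1 ^ ?d * (real ?m * e) \<le> (\<Sum>i<?d. 1 ^ i) * ?V"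
    by (rule LIMSEQ_le) (use bound \<rho> in blast)
  then have main: "real ?n * ?s + real ?m * e \<le> real ?d * ?V" by simp
  have me: "0 \<le> real ?m * e" using e(1) by simp
  show "real ?n * ?s \<le> real ?d * ?V" using main me by linarith
  assume "real ?n * ?s = real ?d * ?V"
  then have "real ?m * e \<le> 0" using main by linarith
  moreover have "0 < real ?m" using dim_ker by simp
  ultimately have "e = 0" using e(1) by (simp only: mult_le_0_iff) linarith
  then have const: "F x = F 0" if "x \<in> U" for x using e(3) that by blast
  interpret equal_sections P "interior K"
    by (intro equal_sections.intro projected_body_axioms equal_sections_axioms.intro const)
  obtain L' where L': "subspace L'" "range P \<inter> L' = {0}" "range P + L' = UNIV"
    "\<forall>z\<in>U \<inter> closure (interior K). \<forall>\<nu>. (\<forall>y\<in>interior K. (y - z) \<bullet> \<nu> \<le> 0) \<longrightarrow> \<nu> \<in> L'"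
    using complementary_normals .
  have "normal_at K x \<in> L \<union> L'" if x: "x \<in> regular_boundary K" for x
  proof -
    have nu: "outer_unit_normal K x (normal_at K x)" by (rule outer_unit_normal_at[OF x])
    have xK: "x \<in> K" using x frontier_subset_compact[OF compact_K] by (auto simp: regular_boundary_def)
    show ?thesis
    proof (cases "x \<in> U")
      case True
      have "normal_at K x \<in> L'"
      proof (rule L'(4)[rule_format])
        show "x \<in> U \<inter> closure (interior K)" using True xK unfolding closure_interior_K by blast
        show "(y - x) \<bullet> normal_at K x \<le> 0" if "y \<in> interior K" for y
          using nu that interior_subset by (auto simp: outer_unit_normal_def)
      qed
      then show ?thesis by blast
    next
      case False
      \<comment> \<open>Over points outside \<open>U\<close> the normal is found by separating
        \<open>x\<close> from the cylinder \<open>U\<close>; the result is a normal of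
        \<open>K\<close> at \<open>x\<close>, and the normal there is unique.\<close>
      have "convex ((\<lambda>y. x - y) ` U)" "0 \<notin> (\<lambda>y. x - y) ` U"
        using False convex_U by (auto intro: convex_affinity[of U x "-1", simplified])
      then obtain a where a: "a \<noteq> 0" "\<And>w. w \<in> (\<lambda>y. x - y) ` U \<Longrightarrow> 0 \<le> a \<bullet> w"
        using separating_hyperplane_set_0[of "(\<lambda>y. x - y) ` U"] by blast
      have aU: "a \<bullet> y \<le> a \<bullet> x" if "y \<in> U" for y
        using a(2)[of "x - y"] that by (auto simp: inner_diff_right)
      \<comment> \<open>\<open>U\<close> contains the whole kernel of \<open>P\<close>. A functional
        bounded above on \<open>U\<close> must vanish there, so \<open>a\<close> lies in the range
        of \<open>P\<close>.\<close>
      have "a \<bullet> (a - P a) \<le> 0"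
      proof (rule ccontr)
        assume "\<not> a \<bullet> (a - P a) \<le> 0"
        then have pos: "0 < a \<bullet> (a - P a)" by simp
        let ?t = "(a \<bullet> x + 1) / (a \<bullet> (a - P a))"
        have "?t *\<^sub>R (a - P a) \<in> U" using U_P[of "?t *\<^sub>R (a - P a)" 0] zero_U by (simp add: P_simps)
        then have "a \<bullet> (?t *\<^sub>R (a - P a)) \<le> a \<bullet> x" by (rule aU)
        moreover have "a \<bullet> (?t *\<^sub>R (a - P a)) = a \<bullet> x + 1" using pos by simp
        ultimately show False by linarith
      qed
      moreover have "a \<bullet> (a - P a) = (a - P a) \<bullet> (a - P a)"
        using P_orthogonal[of a a] by (simp add: inner_diff_left)
      ultimately have Pa: "P a = a" by (metis eq_iff_diff_eq_0 inner_eq_zero_iff inner_ge_zero order_antisym)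
      have "a \<bullet> y \<le> a \<bullet> x" if "y \<in> K" for y
      proof -
        have "closure (interior K) \<subseteq> {y. a \<bullet> y \<le> a \<bullet> x}"
          using D_subset_U aU by (intro closure_minimal closed_halfspace_le) auto
        then show ?thesis using that unfolding closure_interior_K by auto
      qed
      then have "outer_unit_normal K x ((1 / norm a) *\<^sub>R a)"
        using a(1) by (auto simp: outer_unit_normal_def inner_commute[of _ a] inner_diff_right intro!: divide_nonpos_pos)
      then have "normal_at K x = (1 / norm a) *\<^sub>R a" using normal_at_eq[OF x] by blast
      then have "normal_at K x = P ((1 / norm a) *\<^sub>R a)" by (simp add: P_scale Pa)
      then show ?thesis unfolding PL[symmetric] by blast
    qed
  qed
  then show "\<exists>L'. subspace L' \<and> L \<inter> L' = {0} \<and> L + L' = UNIV \<and> (\<forall>x\<in>regular_boundary K. normal_at K x \<in> L \<union> L')"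
    using L'(1,2,3) unfolding PL by blast
qed

end

lemma centroid_zero_imp_centred:
  fixes K :: "(real^'n) set"
  assumes K: "compact K" "convex K" "interior K \<noteq> {}" and c0: "centroid K = 0"
  shows "(\<integral>x. indicator K x * (v \<bullet> x) \<partial>lborel) = 0"
proof -
  obtain c where c: "0 < c" "hausdorff_measure CARD('n) = density lborel (\<lambda>x::real^'n. ennreal c)"
    using hausdorff_measure_eq_lborel[where 'a="real^'n"] by auto
  have bK: "K \<in> sets borel" using K(1) by (rule borel_compact)
  have fin: "emeasure lborel K < \<infinity>" by (rule emeasure_compact_finite[OF K(1)])
  have "emeasure lborel K > 0"
  proof -
    have "0 < emeasure lborel (interior K)" by (rule emeasure_lborel_open_pos[OF open_interior K(3)])
    also have "\<dots> \<le> emeasure lborel K" using bK by (intro emeasure_mono interior_subset) simp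
    finally show ?thesis .
  qed
  moreover have "emeasure (hausdorff_measure CARD('n)) K = ennreal c * emeasure lborel K"
    unfolding c(2) using bK by (subst emeasure_density_const) simp_all
  \<comment> \<open>Positive finite volume excludes the degenerate case in which
    \<open>inverse 0 = 0\<close> makes the centroid vanish regardless of the integral.\<close>
  ultimately have "measure (hausdorff_measure CARD('n)) K > 0"
    using c(1) fin by (auto simp: measure_def enn2real_mult enn2real_positive_iff)
  then have zero: "(LINT x:K|hausdorff_measure CARD('n). x) = 0"
    using c0 by (auto simp: centroid_def)
  have "(LINT x:K|hausdorff_measure CARD('n). x) = (\<integral>x. c *\<^sub>R (indicator K x *\<^sub>R x) \<partial>lborel)"
    unfolding set_lebesgue_integral_def c(2)
    using bK c(1) by (intro integral_density) auto
  then have "c *\<^sub>R (\<integral>x. indicator K x *\<^sub>R x \<partial>lborel) = 0"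
    unfolding zero by (simp only: integral_scaleR_right)
  then have z: "(\<integral>x. indicator K x *\<^sub>R x \<partial>lborel) = 0" using c(1) by (simp only: scaleR_eq_0_iff) simp
  have i: "integrable lborel (\<lambda>x. indicator K x *\<^sub>R x)"
    by (rule borel_integrable_compact[OF K(1)]) (rule continuous_on_id)
  have "(\<integral>x. indicator K x * (v \<bullet> x) \<partial>lborel) = (\<integral>x. (indicator K x *\<^sub>R x) \<bullet> v \<partial>lborel)"
    by (simp add: inner_commute)
  also have "\<dots> = (\<integral>x. indicator K x *\<^sub>R x \<partial>lborel) \<bullet> v"
    using i by (intro integral_inner_left)
  finally show ?thesis using z by simp
qed

text \<open>Otherwise a hyperplane through 0 has \<open>K\<close> on one side. The moment of
  \<open>K\<close> in the normal direction is then the vanishing integral of a nonnegative function,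
  which forces the interior of \<open>K\<close> into the hyperplane.\<close>

lemma centred_imp_zero_interior:
  fixes K :: "'a::euclidean_space set"
  assumes K: "compact K" "convex K" "interior K \<noteq> {}"
    and centred: "\<And>v. (\<integral>x. indicator K x * (v \<bullet> x) \<partial>lborel) = 0"
  shows "0 \<in> interior K"
proof (rule ccontr)
  assume "0 \<notin> interior K"
  then obtain a where a: "a \<noteq> 0" "\<And>x. x \<in> interior K \<Longrightarrow> 0 \<le> a \<bullet> x"
    using separating_hyperplane_set_0[OF convex_interior[OF K(2)]] by blast
  have aK: "0 \<le> a \<bullet> x" if "x \<in> K" for x
  proof -
    have "closure (interior K) \<subseteq> {x. 0 \<le> a \<bullet> x}"
      using a(2) by (intro closure_minimal) (auto intro: closed_halfspace_ge[of 0 a])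
    moreover have "x \<in> closure (interior K)"
      using that convex_closure_interior[OF K(2,3)] closure_subset by blast
    ultimately show ?thesis by blast
  qed
  have bK: "K \<in> sets borel" using K(1) by (rule borel_compact)
  have i: "integrable lborel (\<lambda>x. indicator K x * (a \<bullet> x))"
    using borel_integrable_compact[OF K(1), of "\<lambda>x. a \<bullet> x"] by (simp add: continuous_intros)
  have "AE x in lborel. indicator K x * (a \<bullet> x) = 0"
    using integral_nonneg_eq_0_iff_AE[OF i] centred[of a] aK by (auto simp: indicator_def)
  then have AE: "AE x in lborel. indicator (interior K) x * (a \<bullet> x) = 0"
    by eventually_elim (use interior_subset in \<open>auto simp: indicator_def split: if_splits\<close>)
  have iI: "integrable lborel (\<lambda>x. indicator (interior K) x * (a \<bullet> x))"
    by (rule integrable_cong_AE[THEN iffD2, OF _ _ _ integrable_zero]) (use AE in auto)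
  have zI: "(\<integral>x. indicator (interior K) x * (a \<bullet> x) \<partial>lborel) = 0"
    by (rule integral_eq_zero_AE[OF AE])
  have zero: "a \<bullet> x = 0" if "x \<in> interior K" for x
    by (rule continuous_integral_zero[OF open_interior _ a(2) iI zI that]) (intro continuous_intros)
  obtain z where z: "z \<in> interior K" using K(3) by blast
  have "a = 0" by (rule inner_maximal_in_open[OF open_interior z]) (simp add: zero z)
  then show False using a(1) by simp
qed

theorem theorem1p3:
  fixes K :: "(real^'n) set"
  assumes "compact K" and "convex K" and "interior K \<noteq> {}"
    and "centroid K = 0"
  shows "subspace_concentration_condition (cone_volume_measure K)"
proof -
  have centred: "(\<integral>x. indicator K x * (v \<bullet> x) \<partial>lborel) = 0" for v
    by (rule centroid_zero_imp_centred[OF assms])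
  interpret convex_body K
    by (rule convex_body.intro[OF assms(1,2) centred_imp_zero_interior[OF assms(1-3) centred]])
  let ?M = "cone_volume_measure K" and ?S = "sphere 0 1 :: (real^'n) set" and ?n = "CARD('n)"
  obtain c :: real where c: "0 \<le> c" and cone: "\<And>K \<omega>. convex_body K \<Longrightarrow> \<omega> \<in> sets borel \<Longrightarrow>
      cone_volume (K :: (real^'n) set) \<omega> =
      ennreal c * emeasure lborel (convex_body.cone K {x \<in> regular_boundary K. normal_at K x \<in> \<omega>})"
    using cone_volume_eq_emeasure_cone[where 'n='n] by blast
  have nn: "0 \<le> cone_vol \<omega>" for \<omega> by (simp add: cone_vol_def)
  have bL: "L \<in> sets borel" if "subspace L" for L :: "(real^'n) set"
    using that by (intro borel_closed closed_subspace)
  have unit: "normal_at K x \<in> ?S" if "x \<in> regular_boundary K" for x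
    using outer_unit_normal_at[OF that] by (simp add: outer_unit_normal_def)
  have M: "emeasure ?M (L \<inter> ?S) = ennreal (c * cone_vol L)" if "subspace L" for L
  proof -
    have "emeasure ?M (L \<inter> ?S) = cone_volume K (L \<inter> ?S)"
      using bL[OF that] by (intro emeasure_cone_volume_measure[OF assms(1)]) auto
    also have "\<dots> = ennreal c * emeasure lborel (convex_body.cone K {x \<in> regular_boundary K. normal_at K x \<in> L \<inter> ?S})"
      using bL[OF that] by (intro cone convex_body_axioms) auto
    also have "{x \<in> regular_boundary K. normal_at K x \<in> L \<inter> ?S} = {x \<in> regular_boundary K. normal_at K x \<in> L}"
      using unit by auto
    also have "ennreal c * emeasure lborel (convex_body.cone K \<dots>) = ennreal (c * cone_vol L)"
      using c nn emeasure_cone_vol[OF bL[OF that]] by (simp add: ennreal_mult)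
    finally show ?thesis .
  qed
  let ?V = "measure lborel K"
  have MS: "emeasure ?M ?S = ennreal (c * ?V)"
    using M[OF subspace_UNIV] cone_vol_UNIV by simp
  have n: "real ?n > 0" by simp
  have frac: "ennreal (real d / real ?n) * emeasure ?M ?S = ennreal (c * (real d / real ?n * ?V))" for d :: nat
    unfolding MS using c by (subst ennreal_mult[symmetric]) (auto simp: mult_ac)
  \<comment> \<open>The subspaces of dimension 0 and \<open>?n\<close> are settled directly: no unit
    normal is 0, and all normals lie in the whole space. They are complementary to each other in the
    equality case.\<close>
  have cv_zero: "cone_vol {0} = 0"
  proof -
    have "{x \<in> regular_boundary K. normal_at K x \<in> {0}} = {}" using unit by force
    then show ?thesis unfolding cone_vol_def by (simp only:) (simp add: cone_def)
  qed
  have zero_dim: "L = {0}" if "subspace L" "dim L = 0" for L :: "(real^'n) set"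
    using that subspace_0 by (auto simp: dim_eq_0)
  have full_dim: "L = UNIV" if "subspace L" "dim L = ?n" for L :: "(real^'n) set"
    using that dim_eq_full[of L] span_eq_iff[of L] by simp
  have le: "real ?n * cone_vol L \<le> real (dim L) * ?V" if L: "subspace L" for L
  proof -
    have "dim L \<le> ?n" using dim_subset_UNIV[of L] by simp
    then consider "dim L = 0" | "0 < dim L" "dim L < ?n" | "dim L = ?n" by linarith
    then show ?thesis
    proof cases
      case 1
      then show ?thesis using zero_dim[OF L] cv_zero by simp
    next
      case 2
      then show ?thesis using cone_vol_subspace(1)[OF centred L] by simp
    next
      case 3
      then show ?thesis using full_dim[OF L] cone_vol_UNIV by simp
    qed
  qed
  have eq: "\<exists>L'. subspace L' \<and> L \<inter> L' = {0} \<and> L + L' = UNIV \<and> real ?n * cone_vol L' = real (dim L') * ?V"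
    if L: "subspace L" and e: "real ?n * cone_vol L = real (dim L) * ?V" for L
  proof -
    have "dim L \<le> ?n" using dim_subset_UNIV[of L] by simp
    then consider "dim L = 0" | "0 < dim L" "dim L < ?n" | "dim L = ?n" by linarith
    then show ?thesis
    proof cases
      case 1
      have "{0} + UNIV = (UNIV :: (real^'n) set)" by (auto simp: set_plus_def)
      then show ?thesis
        using zero_dim[OF L 1] cone_vol_UNIV by (intro exI[of _ UNIV]) simp
    next
      case 3
      have "UNIV + {0} = (UNIV :: (real^'n) set)" by (auto simp: set_plus_def)
      then show ?thesis
        using full_dim[OF L 3] cv_zero by (intro exI[of _ "{0}"]) simp
    next
      case 2
      have "\<exists>L'. subspace L' \<and> L \<inter> L' = {0} \<and> L + L' = UNIV \<and> (\<forall>x\<in>regular_boundary K. normal_at K x \<in> L \<union> L')"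
        using cone_vol_subspace(2)[OF centred L] 2 e by simp
      then obtain L' where L': "subspace L'" "L \<inter> L' = {0}" "L + L' = UNIV"
        "\<And>x. x \<in> regular_boundary K \<Longrightarrow> normal_at K x \<in> L \<union> L'" by blast
      have "{x + y |x y. x \<in> L \<and> y \<in> L'} = UNIV"
        unfolding L'(3)[symmetric] set_plus_def by blast
      then have dims: "dim L + dim L' = ?n"
        using dim_sums_Int[OF L L'(1)] L'(2) by simp
      \<comment> \<open>All normals lie in \<open>L\<close> or \<open>L'\<close>, so the two cones
        cover almost all of \<open>K\<close>. With equality for \<open>L\<close> this bounds
        \<open>cone_vol L'\<close> from below, and the inequality for \<open>L'\<close> gives
        equality there.\<close>
      have "ennreal ?V = emeasure lborel (cone (regular_boundary K))"
        using emeasure_cone_regular emeasure_K_finite by (simp add: emeasure_eq_ennreal_measure less_top)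
      also have "\<dots> \<le> emeasure lborel (cone {x \<in> regular_boundary K. normal_at K x \<in> L} \<union>
          cone {x \<in> regular_boundary K. normal_at K x \<in> L'})"
      proof (rule emeasure_mono)
        show "cone (regular_boundary K) \<subseteq> cone {x \<in> regular_boundary K. normal_at K x \<in> L} \<union>
          cone {x \<in> regular_boundary K. normal_at K x \<in> L'}"
          using L'(4) by (auto simp: cone_def)
      qed (use cone_borel normal_preimage_borel bL L L'(1) in auto)
      also have "\<dots> \<le> ennreal (cone_vol L) + ennreal (cone_vol L')"
        unfolding emeasure_cone_vol[OF bL[OF L], symmetric] emeasure_cone_vol[OF bL[OF L'(1)], symmetric]
        using cone_borel normal_preimage_borel bL L L'(1) by (intro emeasure_subadditive) auto
      finally have "?V \<le> cone_vol L + cone_vol L'"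
        using nn by (simp add: ennreal_plus[symmetric] del: ennreal_plus)
      then have "real ?n * ?V \<le> real ?n * cone_vol L + real ?n * cone_vol L'"
        unfolding distrib_left[symmetric] by (intro mult_left_mono) auto
      moreover have "real ?n = real (dim L) + real (dim L')" using dims by linarith
      then have "real ?n * ?V = real (dim L) * ?V + real (dim L') * ?V" by (simp only: distrib_right)
      ultimately have "real (dim L') * ?V \<le> real ?n * cone_vol L'" using e by linarith
      then have "real ?n * cone_vol L' = real (dim L') * ?V" using le[OF L'(1)] by linarith
      then show ?thesis using L'(1-3) by blast
    qed
  qed
  have le': "cone_vol L \<le> real (dim L) / real ?n * ?V" if "subspace L" for L
    using le[OF that] n by (simp add: pos_le_divide_eq mult.commute)
  show ?thesis
    unfolding subspace_concentration_condition_def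
  proof (intro allI impI conjI)
    fix L :: "(real^'n) set" assume L: "subspace L"
    show "emeasure ?M (L \<inter> ?S) \<le> ennreal (real (dim L) / real ?n) * emeasure ?M ?S"
      unfolding M[OF L] frac using c le'[OF L] by (intro ennreal_leI mult_left_mono)
    assume E: "emeasure ?M (L \<inter> ?S) = ennreal (real (dim L) / real ?n) * emeasure ?M ?S"
    have V: "0 \<le> ?V" by simp
    show "\<exists>L'. subspace L' \<and> L \<inter> L' = {0} \<and> L + L' = UNIV \<and>
        emeasure ?M (L' \<inter> ?S) = ennreal (real (dim L') / real ?n) * emeasure ?M ?S"
    \<comment> \<open>If the factor is 0, the measure gives mass 0 to every subspace, and the
      orthogonal complement of \<open>L\<close> serves as the complementary subspace.\<close>
    proof (cases "c = 0")
      case True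
      obtain P where P: "orthogonal_projection P" "range P = L" using orthogonal_projection_exists[OF L] .
      interpret orthogonal_projection P by (rule P)
      interpret Q: orthogonal_projection "\<lambda>x. x - P x" by (rule compl_projection)
      let ?L = "range (\<lambda>x. x - P x)"
      have "L \<inter> ?L = {0}" "L + ?L = UNIV" using range_Int_range_compl range_plus_range_compl unfolding P(2) .
      moreover have "emeasure ?M (?L \<inter> ?S) = ennreal (real (dim ?L) / real ?n) * emeasure ?M ?S"
        unfolding M[OF Q.subspace_range] frac True by simp
      ultimately show ?thesis using Q.subspace_range by blast
    next
      case False
      have "c * cone_vol L = c * (real (dim L) / real ?n * ?V)"
        using E c nn V unfolding M[OF L] frac by simp
      then have "cone_vol L = real (dim L) / real ?n * ?V" using False by (simp only: mult_cancel_left) simp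
      then have "real ?n * cone_vol L = real (dim L) * ?V" using n by (simp add: field_simps)
      then obtain L' where L': "subspace L'" "L \<inter> L' = {0}" "L + L' = UNIV" "real ?n * cone_vol L' = real (dim L') * ?V"
        using eq[OF L] by blast
      have "cone_vol L' = real (dim L') / real ?n * ?V" using L'(4) n by (simp add: field_simps)
      then have "emeasure ?M (L' \<inter> ?S) = ennreal (real (dim L') / real ?n) * emeasure ?M ?S"
        unfolding M[OF L'(1)] frac by simp
      then show ?thesis using L'(1-3) by blast
    qed
  qed
qed

end
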